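(* Let $d\ge 3$, $\mu>0$, $1<p\le\infty$ and let $s\in\mathbb{R}$ satisfy: $s>-\min\{\frac{d}{p'},\,1+\frac{d}{p}\}$ if $1<p<\infty$; $s\ge -1$ if $p=\infty$. Let $u_0\in\widehat{\dot B}{}^{-1}_{\infty,2}(\mathbb{R}^d)\cap\widehat{\dot B}{}^{0}_{1,\infty}(\mathbb{R}^d)$ be an $\mathbb{R}^d$-valued initial velocity with $\operatorname{div}u_0=0$ in $\mathcal{S}'$ and with $\|u_0\|_{\widehat{\dot B}{}^{-1}_{\infty,2}}$ sufficiently small. Suppose moreover that there exist a non-zero vector $M_0\in\mathbb{R}^d$ and $\alpha>1$ such that $$\left|\widehat{u}_0(\xi)-P(\xi)M_0\right|=O(|\xi|^\alpha)\quad\text{as }|\xi|\to0 .$$ Then the global mild solution $u$ of the incompressible Navier--Stokes equations with initial velocity $u_0$ satisfies $$\lim_{t\to\infty}t^{\frac d2\left(1-\frac1p\right)+\frac{s+1}2}\left\||\nabla|^s\left(u(t)-S_\mu(t)M_0+\partial_kS_\mu(t)\int_0^\infty\!\!\int_{\mathbb{R}^d}(u_ku)(x,\tau)\,dx\,d\tau\right)\right\|_{\widehat{L}^p}=0 ,$$ with summation over $k=1,\dots,d$.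
   Context: Fourier transform: $\widehat f(\xi)=\mathcal{F}[f](\xi)=(2\pi)^{-d/2}\int_{\mathbb{R}^d}e^{-ix\cdot\xi}f(x)\,dx$, $\mathcal{F}^{-1}[g](x)=(2\pi)^{-d/2}\int_{\mathbb{R}^d}e^{ix\cdot\xi}g(\xi)\,d\xi$. $p'$ is the Hölder conjugate of $p$. $|\nabla|^sf=\mathcal{F}^{-1}[|\xi|^s\widehat f]$, $e^{\mu t\Delta}f=\mathcal{F}^{-1}[e^{-\mu t|\xi|^2}\widehat f]$. Repeated indices are summed from $1$ to $d$; $u_ku$ is the vector field $u$ multiplied by its $k$-th component. Fourier--Lebesgue norm: $\|f\|_{\widehat L^p}=\|\widehat f\|_{L^{p'}}$ (for $f\in\mathcal{S}'$ with $\widehat f\in L^1_{loc}$). Thus $\||\nabla|^sf\|_{\widehat L^p}=\||\xi|^s\widehat f\|_{L^{p'}_\xi}$. Homogeneous Fourier--Herz space $\widehat{\dot B}{}^{s}_{p,\sigma}(\mathbb{R}^d)$: the $f\in\mathcal{S}'$ with $\widehat f\in L^1_{loc}$ and $\|f\|_{\widehat{\dot B}{}^{s}_{p,\sigma}}=\big\|\{2^{sj}\|\dot\Delta_jf\|_{\widehat L^p}\}_{j\in\mathbb{Z}}\big\|_{\ell^\sigma}<\infty$, where $\dot\Delta_jf=\mathcal{F}^{-1}[\widehat\phi(2^{-j}\xi)\widehat f]$ and $\widehat\phi\ge0$ is smooth, radial, supported in $\{1/2\le|\xi|\le2\}$ with $\sum_{j\in\mathbb{Z}}\widehat\phi(2^{-j}\xi)=1$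 for $\xi\ne0$. One has $\widehat{\dot B}{}^0_{1,\infty}\simeq\widehat L^1$ (i.e. $\widehat u_0\in L^\infty$); pointwise statements on $\widehat u_0$ are understood up to null sets. $P(\xi)=\left(\delta_{lm}-\xi_l\xi_m/|\xi|^2\right)_{1\le l,m\le d}$ for $\xi\neq0$; the (matrix-valued) Oseen kernel is $S_\mu(x,t)=\mathcal{F}^{-1}[e^{-\mu t|\xi|^2}P(\xi)](x)$. Navier--Stokes: $\partial_tu-\mu\Delta u+\operatorname{div}(u\otimes u)+\nabla p=0$, $\operatorname{div}u=0$, $u|_{t=0}=u_0$ on $\mathbb{R}^d\times(0,\infty)$ (in this equation $p$ is the pressure). A global mild solution is $u\in L^2(\mathbb{R}_+;\widehat L^\infty)$ with $$u(t)=e^{\mu t\Delta}u_0-\int_0^te^{\mu(t-\tau)\Delta}\mathcal{P}_\sigma\operatorname{div}(u\otimes u)(\tau)\,d\tau,$$ where $\mathcal{P}_\sigma=Id+(-\Delta)^{-1}\nabla\operatorname{div}$ is the Fourier multiplier with symbol $P(\xi)$. It is known that if $u_0\in\widehat{\dot B}{}^{-1}_{\infty,2}$, $\operatorname{div}u_0=0$, and $\|u_0\|_{\widehat{\dot B}{}^{-1}_{\infty,2}}$ is sufficiently small, there is a unique global mild solution; "the global mild solution" refers to it.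
   Formalization: The space-time integral of u_k u is multiplied by (2π)^{-d/2}; with the symmetric Fourier normalization stated, the formula without this factor is false unless the matrix ∫∫u_k u_l is a multiple of the identity. *)

theory Defs
  imports "HOL-Analysis.Analysis" "HOL-Probability.Essential_Supremum"
begin

section \<open>Test functions and tempered distributions\<close>

definition pd :: "'n::finite \<Rightarrow> (real^'n \<Rightarrow> 'a::real_normed_vector) \<Rightarrow> real^'n \<Rightarrow> 'a" where
  "pd k f x = vector_derivative (\<lambda>h. f (x + h *\<^sub>R axis k 1)) (at 0)"

definition smooth :: "(real^'n::finite \<Rightarrow> 'a::real_normed_vector) \<Rightarrow> bool" where
  "smooth f \<longleftrightarrow> (\<forall>ks x. foldr pd ks f differentiable (at x))"

definition schwartz :: "(real^'n::finite \<Rightarrow> complex) set" where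
  "schwartz = {\<phi>. smooth \<phi> \<and>
     (\<forall>ks (N::nat). bounded (range (\<lambda>x. (1 + norm x) ^ N *\<^sub>R foldr pd ks \<phi> x)))}"

definition schwartz_seminorm :: "nat \<Rightarrow> (real^'n::finite \<Rightarrow> complex) \<Rightarrow> real" where
  "schwartz_seminorm N \<phi> =
     (\<Sum>ks | length ks \<le> N. SUP x. (1 + norm x) ^ N * norm (foldr pd ks \<phi> x))"

text \<open>Distributions with values in \<open>\<complex>\<^sup>d\<close> on \<open>\<real>\<^sup>d\<close>, where \<open>d = CARD('n)\<close>.
  Only their values on Schwartz functions are meaningful.\<close>

type_synonym 'n dist = "(real^'n \<Rightarrow> complex) \<Rightarrow> complex^'n"

definition tempered :: "'n::finite dist \<Rightarrow> bool" where
  "tempered T \<longleftrightarrow>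
     (\<forall>\<phi>\<in>schwartz. \<forall>\<psi>\<in>schwartz. T (\<lambda>x. \<phi> x + \<psi> x) = T \<phi> + T \<psi>) \<and>
     (\<forall>c. \<forall>\<phi>\<in>schwartz. T (\<lambda>x. c * \<phi> x) = c *s T \<phi>) \<and>
     (\<exists>C N. \<forall>\<phi>\<in>schwartz. norm (T \<phi>) \<le> C * schwartz_seminorm N \<phi>)"

definition dist_of :: "(real^'n::finite \<Rightarrow> complex^'n) \<Rightarrow> 'n dist" where
  "dist_of w = (\<lambda>\<phi>. \<chi> i. LINT x|lborel. w x $ i * \<phi> x)"

definition real_dist :: "'n::finite dist \<Rightarrow> bool" where
  "real_dist T \<longleftrightarrow> (\<forall>\<phi>\<in>schwartz. (\<forall>x. \<phi> x \<in> \<real>) \<longrightarrow> (\<forall>i. T \<phi> $ i \<in> \<real>))"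

definition div_free :: "'n::finite dist \<Rightarrow> bool" where
  "div_free T \<longleftrightarrow> (\<forall>\<phi>\<in>schwartz. - (\<Sum>k\<in>UNIV. T (pd k \<phi>) $ k) = 0)"

section \<open>Fourier transform\<close>

definition fourier :: "(real^'n::finite \<Rightarrow> complex) \<Rightarrow> real^'n \<Rightarrow> complex" where
  "fourier f \<xi> = of_real ((2 * pi) powr (- real CARD('n) / 2)) *
     (LINT x|lborel. cis (- (x \<bullet> \<xi>)) * f x)"

definition inv_fourier :: "(real^'n::finite \<Rightarrow> complex) \<Rightarrow> real^'n \<Rightarrow> complex" where
  "inv_fourier g x = of_real ((2 * pi) powr (- real CARD('n) / 2)) *
     (LINT \<xi>|lborel. cis (x \<bullet> \<xi>) * g \<xi>)"

definition dist_fourier :: "'n::finite dist \<Rightarrow> 'n dist" where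
  "dist_fourier T = (\<lambda>\<phi>. T (fourier \<phi>))"

definition dist_inv_fourier :: "'n::finite dist \<Rightarrow> 'n dist" where
  "dist_inv_fourier T = (\<lambda>\<phi>. T (inv_fourier \<phi>))"

text \<open>\<open>has_hat T g\<close>: the Fourier transform of \<open>T\<close> is the locally integrable function \<open>g\<close>.
  The two are compared on compactly supported test functions only, since a locally integrable
  function need not be integrable against every Schwartz function.\<close>

definition has_hat :: "'n::finite dist \<Rightarrow> (real^'n \<Rightarrow> complex^'n) \<Rightarrow> bool" where
  "has_hat T g \<longleftrightarrow> (\<forall>K. compact K \<longrightarrow> set_integrable lborel K g) \<and>
     (\<forall>\<phi>\<in>schwartz. bounded {x. \<phi> x \<noteq> 0} \<longrightarrow> dist_fourier T \<phi> = dist_of g \<phi>)"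

definition locint_hat :: "'n::finite dist \<Rightarrow> bool" where
  "locint_hat T \<longleftrightarrow> tempered T \<and> (\<exists>g. has_hat T g)"

text \<open>The function \<open>g\<close> is determined up to a null set; \<open>fhat\<close> picks a representative.\<close>

definition fhat :: "'n::finite dist \<Rightarrow> real^'n \<Rightarrow> complex^'n" where
  "fhat T = (SOME g. has_hat T g)"

text \<open>If \<open>fhat T\<close> is integrable, then \<open>T\<close> is the bounded continuous function \<open>fval T\<close>.\<close>

definition fval :: "'n::finite dist \<Rightarrow> real^'n \<Rightarrow> complex^'n" where
  "fval T x = (\<chi> i. inv_fourier (\<lambda>\<xi>. fhat T \<xi> $ i) x)"

definition fourier_mult :: "(real^'n::finite \<Rightarrow> complex^'n^'n) \<Rightarrow> 'n dist \<Rightarrow> 'n dist" where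
  "fourier_mult m T = dist_inv_fourier (dist_of (\<lambda>\<xi>. m \<xi> *v fhat T \<xi>))"

definition scalar_mult :: "(real^'n::finite \<Rightarrow> real) \<Rightarrow> 'n dist \<Rightarrow> 'n dist" where
  "scalar_mult m = fourier_mult (\<lambda>\<xi>. mat (of_real (m \<xi>)))"

definition riesz :: "real \<Rightarrow> 'n::finite dist \<Rightarrow> 'n dist" where
  "riesz s = scalar_mult (\<lambda>\<xi>. norm \<xi> powr s)"

definition heat :: "real \<Rightarrow> real \<Rightarrow> 'n::finite dist \<Rightarrow> 'n dist" where
  "heat \<mu> t = scalar_mult (\<lambda>\<xi>. exp (- \<mu> * t * (norm \<xi>)\<^sup>2))"

definition leray_symbol :: "real^'n::finite \<Rightarrow> complex^'n^'n" where
  "leray_symbol \<xi> =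
     (\<chi> l m. of_real ((if l = m then 1 else 0) - \<xi> $ l * \<xi> $ m / (norm \<xi>)\<^sup>2))"

definition leray :: "'n::finite dist \<Rightarrow> 'n dist" where
  "leray = fourier_mult leray_symbol"

section \<open>Norms\<close>

definition epowr :: "ennreal \<Rightarrow> real \<Rightarrow> ennreal" where
  "epowr x r = (if x = \<infinity> then \<infinity> else ennreal (enn2real x powr r))"

text \<open>The \<open>L\<^sup>q\<close> norm of a non-negative function. With a counting measure this is the
  \<open>\<ell>\<^sup>q\<close> norm.\<close>

definition Lq_norm :: "'a measure \<Rightarrow> ennreal \<Rightarrow> ('a \<Rightarrow> ennreal) \<Rightarrow> ennreal" where
  "Lq_norm M q f = (if q = \<infinity> then esssup M f
     else epowr (\<integral>\<^sup>+ x. epowr (f x) (enn2real q) \<partial>M) (1 / enn2real q))"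

text \<open>For \<open>p = \<infinity>\<close> and \<open>p = 1\<close> this evaluates to \<open>1\<close> and \<open>\<infinity>\<close>, respectively.\<close>

definition conj_exp :: "ennreal \<Rightarrow> ennreal" where
  "conj_exp p = 1 / (1 - 1 / p)"

definition hatL_norm :: "ennreal \<Rightarrow> 'n::finite dist \<Rightarrow> ennreal" where
  "hatL_norm p T = (if locint_hat T
     then Lq_norm lborel (conj_exp p) (\<lambda>\<xi>. ennreal (norm (fhat T \<xi>))) else \<infinity>)"

text \<open>The argument \<open>\<theta>\<close> of the following definitions is the Fourier-side function
  \<open>\<phi>\<close>-hat of the dyadic decomposition.\<close>

definition dyadic_cutoff :: "(real^'n::finite \<Rightarrow> real) \<Rightarrow> bool" where
  "dyadic_cutoff \<theta> \<longleftrightarrow> smooth \<theta> \<and> (\<forall>\<xi>. 0 \<le> \<theta> \<xi>) \<and>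
     (\<forall>\<xi> \<eta>. norm \<xi> = norm \<eta> \<longrightarrow> \<theta> \<xi> = \<theta> \<eta>) \<and>
     (\<forall>\<xi>. \<theta> \<xi> \<noteq> 0 \<longrightarrow> 1/2 \<le> norm \<xi> \<and> norm \<xi> \<le> 2) \<and>
     (\<forall>\<xi>. \<xi> \<noteq> 0 \<longrightarrow> ((\<lambda>j::int. \<theta> ((2 powi (- j)) *\<^sub>R \<xi>)) has_sum 1) UNIV)"

definition dyadic_block :: "(real^'n::finite \<Rightarrow> real) \<Rightarrow> int \<Rightarrow> 'n dist \<Rightarrow> 'n dist" where
  "dyadic_block \<theta> j = scalar_mult (\<lambda>\<xi>. \<theta> ((2 powi (- j)) *\<^sub>R \<xi>))"

definition herz_norm ::
    "(real^'n::finite \<Rightarrow> real) \<Rightarrow> real \<Rightarrow> ennreal \<Rightarrow> ennreal \<Rightarrow> 'n dist \<Rightarrow> ennreal" where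
  "herz_norm \<theta> s p \<sigma> f = Lq_norm (count_space (UNIV :: int set)) \<sigma>
     (\<lambda>j. ennreal (2 powr (s * of_int j)) * hatL_norm p (dyadic_block \<theta> j f))"

definition herz ::
    "(real^'n::finite \<Rightarrow> real) \<Rightarrow> real \<Rightarrow> ennreal \<Rightarrow> ennreal \<Rightarrow> 'n dist set" where
  "herz \<theta> s p \<sigma> = {f. locint_hat f \<and> herz_norm \<theta> s p \<sigma> f < \<infinity>}"

section \<open>Navier--Stokes equations\<close>

definition oseen :: "real \<Rightarrow> real \<Rightarrow> real^'n::finite \<Rightarrow> complex^'n^'n" where
  "oseen \<mu> t x = (\<chi> l m. inv_fourier
     (\<lambda>\<xi>. of_real (exp (- \<mu> * t * (norm \<xi>)\<^sup>2)) * leray_symbol \<xi> $ l $ m) x)"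

definition cvec :: "real^'n::finite \<Rightarrow> complex^'n" where
  "cvec v = (\<chi> i. of_real (v $ i))"

text \<open>\<open>div (u \<otimes> u) = \<partial>\<^sub>k (u\<^sub>k u)\<close>, for \<open>u\<close> with integrable Fourier transform.\<close>

definition div_tensor :: "'n::finite dist \<Rightarrow> 'n dist" where
  "div_tensor u = (\<lambda>\<phi>. - (\<Sum>k\<in>UNIV. dist_of (\<lambda>x. fval u x $ k *s fval u x) (pd k \<phi>)))"

text \<open>\<open>L\<^sup>2\<close> in time with values in the space of \<open>f\<close> with integrable Fourier transform.
  As \<open>L\<^sup>1\<close> is separable, strong measurability amounts to a jointly measurable representative
  \<open>v\<close> of the Fourier transform. Integrals in time use the completed measure because \<open>u t\<close> is
  unconstrained for \<open>t\<close> in a null set, which may spoil Borel measurability.\<close>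

definition L2_hatLinf :: "(real \<Rightarrow> 'n::finite dist) \<Rightarrow> bool" where
  "L2_hatLinf u \<longleftrightarrow>
     (\<exists>v :: real \<times> (real^'n) \<Rightarrow> complex^'n. v \<in> borel_measurable borel \<and>
        (AE t in lebesgue. 0 < t \<longrightarrow>
           locint_hat (u t) \<and> (AE \<xi> in lborel. v (t, \<xi>) = fhat (u t) \<xi>))) \<and>
     Lq_norm (restrict_space lebesgue {0<..}) 2 (\<lambda>t. hatL_norm \<infinity> (u t)) < \<infinity>"

text \<open>The time integral in the Duhamel formula is understood weakly, that is, after testing with
  each Schwartz function. The formula is imposed for every \<open>t > 0\<close>, which fixes \<open>u t\<close> for all
  \<open>t > 0\<close>.\<close>

definition global_mild_solution ::
    "real \<Rightarrow> 'n::finite dist \<Rightarrow> (real \<Rightarrow> 'n dist) \<Rightarrow> bool" where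
  "global_mild_solution \<mu> u0 u \<longleftrightarrow> L2_hatLinf u \<and>
     (\<forall>t>0. \<forall>\<phi>\<in>schwartz. u t \<phi> = heat \<mu> t u0 \<phi> -
        (LINT \<tau>:{0<..<t}|lebesgue. heat \<mu> (t - \<tau>) (leray (div_tensor (u \<tau>))) \<phi>))"

definition momentum_integral :: "(real \<Rightarrow> 'n::finite dist) \<Rightarrow> 'n \<Rightarrow> complex^'n" where
  "momentum_integral u k =
     (LINT \<tau>:{0<..}|lebesgue. LINT x|lborel. fval (u \<tau>) x $ k *s fval (u \<tau>) x)"

text \<open>\<open>u(t) - S(t) M\<^sub>0 + \<partial>\<^sub>k S(t) c\<^sub>k\<close>, where \<open>c\<^sub>k\<close> is \<open>(2\<pi>)\<close> to the power \<open>-d/2\<close> times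
  the space-time integral of \<open>u\<^sub>k u\<close>. The factor comes from the symmetric normalisation of the
  Fourier transform: the transform of \<open>u\<^sub>k u\<close> at the origin is \<open>(2\<pi>)\<close> to the power \<open>-d/2\<close> times
  the integral of \<open>u\<^sub>k u\<close>. With a Fourier transform without prefactor it would be absent.\<close>

definition asymptotic_remainder ::
    "real \<Rightarrow> real^'n::finite \<Rightarrow> (real \<Rightarrow> 'n dist) \<Rightarrow> real \<Rightarrow> 'n dist" where
  "asymptotic_remainder \<mu> M0 u t = (\<lambda>\<phi>. u t \<phi>
     - dist_of (\<lambda>x. oseen \<mu> t x *v cvec M0) \<phi>
     + dist_of (\<lambda>x. \<Sum>k\<in>UNIV. pd k (oseen \<mu> t) x *v
         ((2 * pi) powr (- real CARD('n) / 2) *\<^sub>R momentum_integral u k)) \<phi>)"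

end

theory Submission
  imports Defs "HOL-Probability.Sinc_Integral" "HOL-Probability.Characteristic_Functions" "HOL-Real_Asymp.Real_Asymp"
begin

text \<open>On the Fourier side, a mild solution is \<open>exp (- \<mu> t |\<xi>|\<^sup>2)\<close> times the
  transform of \<open>u\<^sub>0\<close>, minus the integral over \<open>0 < \<tau> < t\<close> of \<open>exp (-
  \<mu> (t - \<tau>) |\<xi>|\<^sup>2)\<close> (the heat factor) times \<open>P(\<xi>)\<close> times the sum over
  \<open>k\<close> of \<open>\<i> \<xi>\<^sub>k\<close> times the transform of \<open>u\<^sub>k u\<close> at
  \<open>(\<tau>, \<xi>)\<close> (\<open>mild_solution_hat\<close>). The two leading terms of the theorem arise
  when the transform of \<open>u\<^sub>0\<close> is replaced by \<open>P(\<xi>) M\<^sub>0\<close>, the heat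
  factor by its value at \<open>\<tau> = 0\<close>, the transform of \<open>u\<^sub>k u\<close> by its value at
  \<open>\<xi> = 0\<close>, and the upper limit \<open>t\<close> of the integral by infinity. Put \<open>\<xi> =
  \<eta> / sqrt t\<close>. The error of the first replacement is of order \<open>t\<close> to the power
  \<open>-\<alpha>/2\<close> with \<open>\<alpha> > 1\<close>. The error of the others has the factor
  \<open>\<xi>\<close>, of order \<open>t\<close> to the power \<open>-1/2\<close>, and an integral over
  \<open>\<tau>\<close> that tends to zero, because for fixed \<open>\<tau>\<close> the heat factors agree in
  the limit and the transform of \<open>u\<^sub>k u\<close> is continuous (\<open>defect_tendsto_0\<close>). So
  \<open>sqrt t\<close> times the transform of the remainder tends to zero for each \<open>\<eta>\<close>, and
  the powers of \<open>t\<close> in the theorem are those that the substitution produces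
  (\<open>self_similar_decay\<close>).

  What has to be shown is domination, first in \<open>\<tau>\<close> and then in \<open>\<eta>\<close>. It comes
  from the analyticity of small solutions in the form that the transform of \<open>u(t)\<close> is at most
  \<open>K exp (- 2 sqrt t |\<xi>|)\<close>. The modulus of the transform satisfies a quadratic integral
  inequality (\<open>mild_quadratic_inequality\<close>). Multiplication by \<open>exp (2 sqrt t |\<xi>|)\<close>
  preserves its form, since \<open>sqrt t - sqrt \<tau> \<le> sqrt (t - \<tau>)\<close> and half of the Gaussian
  absorbs the weight \<open>exp (2 sqrt (t - \<tau>) |\<xi>|)\<close> (\<open>weight_submultiplicative\<close>).
  The bilinear estimate \<open>duhamel_estimate\<close> in \<open>L\<^sup>2\<close> in time with values in
  \<open>L\<^sup>1\<close> in frequency and a continuity argument bound the weighted energy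
  (\<open>weighted_energy_bound\<close>); the smallness that this needs is that of the norm of
  \<open>u\<^sub>0\<close> with \<open>s = -1\<close> (\<open>herz_heat_bound\<close>). A linear contraction
  argument then carries the boundedness of the transform of \<open>u\<^sub>0\<close>
  (\<open>hat_bounded\<close>) over to the weighted solution (\<open>weighted_pointwise_bound\<close>).

  Hence the integral of \<open>exp (sqrt \<tau> |\<xi>|)\<close> times the modulus of the transform of
  \<open>u(\<tau>)\<close> is integrable in time: near zero by the energy, and at infinity because it is of
  order \<open>\<tau>\<close> to the power \<open>-d/2\<close> with \<open>d \<ge> 3\<close>
  (\<open>moment_integral\<close>). The transform of \<open>u\<^sub>k u\<close> is then at most an integrable
  function of \<open>\<tau>\<close> times \<open>exp (- sqrt \<tau> |\<xi>|)\<close>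
  (\<open>prod_hat_bound\<close>). After rescaling, either the heat factor or this exponential supplies
  \<open>exp (- |\<eta>| / 2)\<close>, uniformly in \<open>t\<close> (\<open>heat_weight_le\<close>).

  The first sections build what these arguments rest on: Fourier inversion for integrable functions, the
  uniqueness of a locally integrable Fourier transform, and the rules for Fourier multipliers and products that
  turn the weak formulation into pointwise identities.\<close>

section \<open>Smooth functions and test functions\<close>

text \<open>Smoothness speaks about all iterated partial derivatives, so it suffices to find a class of
  differentiable functions that is closed under partial derivatives. Each smoothness proof below names
  such a class.\<close>

lemma smooth_coinduct:
  fixes f :: "real^'n::finite \<Rightarrow> 'a::real_normed_vector"
  assumes "f \<in> S"
    and "\<And>g x. g \<in> S \<Longrightarrow> g differentiable (at x)"
    and "\<And>g k. g \<in> S \<Longrightarrow> pd k g \<in> S"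
  shows "smooth f"
proof -
  have "foldr pd ks f \<in> S" for ks
    by (induction ks) (use assms in auto)
  then show ?thesis
    using assms(2) by (auto simp: smooth_def)
qed

lemma smooth_differentiable: "smooth f \<Longrightarrow> f differentiable (at x)"
  unfolding smooth_def by (metis foldr_Nil id_apply)

lemma smooth_foldr_pd: "smooth f \<Longrightarrow> smooth (foldr pd ks f)"
  unfolding smooth_def by (metis foldr_append)

lemma smooth_pd: "smooth f \<Longrightarrow> smooth (pd k f)"
  using smooth_foldr_pd[of f "[k]"] by simp

lemma smooth_continuous: "smooth f \<Longrightarrow> continuous_on UNIV f"
  by (meson continuous_at_imp_continuous_on differentiable_imp_continuous_within smooth_differentiable)

lemma has_derivative_pd:
  assumes "(f has_derivative D) (at x)"
  shows "pd k f x = D (axis k 1)"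
proof -
  have "((\<lambda>h. f (x + h *\<^sub>R axis k 1)) has_derivative (\<lambda>h. D (h *\<^sub>R axis k 1))) (at 0)"
    by (rule has_derivative_compose[where g=f]) (use assms in \<open>auto intro!: derivative_eq_intros\<close>)
  moreover have "D (h *\<^sub>R axis k 1) = h *\<^sub>R D (axis k 1)" for h
    using assms has_derivative_linear linear_cmul by blast
  ultimately show ?thesis
    unfolding pd_def by (intro vector_derivative_at) (simp add: has_vector_derivative_def)
qed

lemma differentiable_pd:
  assumes "f differentiable (at x)"
  shows "((\<lambda>h. f (x + h *\<^sub>R axis k 1)) has_vector_derivative pd k f x) (at 0)"
proof -
  obtain D where D: "(f has_derivative D) (at x)"
    using assms by (auto simp: differentiable_def)
  have "((\<lambda>h. f (x + h *\<^sub>R axis k 1)) has_derivative (\<lambda>h. D (h *\<^sub>R axis k 1))) (at 0)"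
    by (rule has_derivative_compose[where g=f]) (use D in \<open>auto intro!: derivative_eq_intros\<close>)
  moreover have "D (h *\<^sub>R axis k 1) = h *\<^sub>R D (axis k 1)" for h
    using D has_derivative_linear linear_cmul by blast
  ultimately show ?thesis
    using has_derivative_pd[OF D] by (simp add: has_vector_derivative_def)
qed

text \<open>The class for \<open>smooth_mult\<close>: the product rule leads out of the set of products, but not out of the
  set of finite sums of products.\<close>

inductive_set products :: "(real^'n::finite \<Rightarrow> 'a::real_normed_algebra) set" where
  prod: "smooth f \<Longrightarrow> smooth g \<Longrightarrow> (\<lambda>x. f x * g x) \<in> products"
| add: "f \<in> products \<Longrightarrow> g \<in> products \<Longrightarrow> (\<lambda>x. f x + g x) \<in> products"

lemma smooth_mult:
  fixes f g :: "real^'n::finite \<Rightarrow> 'a::real_normed_algebra"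
  assumes "smooth f" "smooth g"
  shows "smooth (\<lambda>x. f x * g x)"
proof (rule smooth_coinduct)
  show "(\<lambda>x. f x * g x) \<in> products" using assms by (rule products.prod)
  show dif: "h differentiable (at x)" if "h \<in> products" for h :: "real^'n \<Rightarrow> 'a" and x
    using that by induction (simp_all add: differentiable_add differentiable_mult smooth_differentiable)
  show "pd k h \<in> products" if "h \<in> products" for h :: "real^'n \<Rightarrow> 'a" and k
    using that
  proof induction
    case (prod f g)
    have "pd k (\<lambda>x. f x * g x) = (\<lambda>x. f x * pd k g x + pd k f x * g x)"
    proof
      fix x
      obtain F G where F: "(f has_derivative F) (at x)" and G: "(g has_derivative G) (at x)"
        using prod smooth_differentiable unfolding differentiable_def by blast
      show "pd k (\<lambda>x. f x * g x) x = f x * pd k g x + pd k f x * g x"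
        using has_derivative_pd[OF has_derivative_mult[OF F G], of k]
          has_derivative_pd[OF F] has_derivative_pd[OF G] by simp
    qed
    then show ?case
      using products.add[OF products.prod[OF prod(1) smooth_pd[OF prod(2)]]
          products.prod[OF smooth_pd[OF prod(1)] prod(2)]] by simp
  next
    case (add f g)
    have "pd k (\<lambda>x. f x + g x) = (\<lambda>x. pd k f x + pd k g x)"
    proof
      fix x
      obtain F G where F: "(f has_derivative F) (at x)" and G: "(g has_derivative G) (at x)"
        using add dif unfolding differentiable_def by blast
      show "pd k (\<lambda>x. f x + g x) x = pd k f x + pd k g x"
        using has_derivative_pd[OF has_derivative_add[OF F G], of k]
          has_derivative_pd[OF F] has_derivative_pd[OF G] by simp
    qed
    then show ?case
      using products.add[OF add.IH] by simp
  qed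
qed

lemma smooth_affine:
  fixes c b :: "'a::real_normed_vector"
  shows "smooth (\<lambda>x::real^'n::finite. (x $ j) *\<^sub>R c + b)"
proof -
  define S where "S = {f. \<exists>c b::'a. f = (\<lambda>x::real^'n. (x $ j) *\<^sub>R c + b)}"
  have D: "((\<lambda>x. (x $ j) *\<^sub>R c + b) has_derivative (\<lambda>h. (h $ j) *\<^sub>R c)) (at x)"
    for c b :: 'a and x :: "real^'n"
    by (auto intro!: derivative_eq_intros bounded_linear.has_derivative[OF bounded_linear_vec_nth])
  show ?thesis
  proof (rule smooth_coinduct[of _ S])
    show "(\<lambda>x::real^'n. (x $ j) *\<^sub>R c + b) \<in> S" by (auto simp: S_def)
    show "g differentiable (at x)" if "g \<in> S" for g x
      using that D unfolding S_def differentiable_def by blast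
    show "pd k g \<in> S" if g: "g \<in> S" for g k
    proof -
      obtain c b where "g = (\<lambda>x. (x $ j) *\<^sub>R c + b)" using g by (auto simp: S_def)
      then have "pd k g = (\<lambda>x. (x $ j) *\<^sub>R 0 + (axis k 1 $ j) *\<^sub>R c)"
        using has_derivative_pd[OF D] by auto
      then show ?thesis unfolding S_def by blast
    qed
  qed
qed

definition test_functions :: "(real^'n::finite \<Rightarrow> complex) set" where
  "test_functions = {\<phi>. smooth \<phi> \<and> bounded {x. \<phi> x \<noteq> 0}}"

lemma test_cont: "\<phi> \<in> test_functions \<Longrightarrow> continuous_on UNIV \<phi>"
  by (auto simp: test_functions_def smooth_continuous)

lemma test_support:
  assumes "\<phi> \<in> test_functions"
  obtains R where "R > 0" "\<And>x. norm x > R \<Longrightarrow> \<phi> x = 0"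
proof -
  obtain R where "R > 0" "\<And>x. \<phi> x \<noteq> 0 \<Longrightarrow> norm x \<le> R"
    using assms unfolding test_functions_def bounded_pos by blast
  then show ?thesis using that[of R] by fastforce
qed

lemma pd_zero_outside:
  assumes "\<And>x. norm x > R \<Longrightarrow> \<phi> x = 0" "norm x > R"
  shows "pd k \<phi> x = 0"
proof -
  have "(\<phi> has_derivative (\<lambda>_. 0)) (at x)"
  proof (rule has_derivative_transform_within_open[of "\<lambda>_. 0"])
    show "open {x. norm x > R}" by (intro open_Collect_less continuous_intros)
  qed (use assms in auto)
  then show ?thesis by (simp add: has_derivative_pd)
qed

lemma test_pd: "\<phi> \<in> test_functions \<Longrightarrow> pd k \<phi> \<in> test_functions"
proof -
  assume \<phi>: "\<phi> \<in> test_functions"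
  obtain R where R: "\<And>x. norm x > R \<Longrightarrow> \<phi> x = 0" by (rule test_support[OF \<phi>]) auto
  have "pd k \<phi> x = 0" if "norm x > R" for x using pd_zero_outside R that by blast
  then have "bounded {x. pd k \<phi> x \<noteq> 0}"
    by (intro boundedI[of _ R]) (metis (mono_tags, lifting) linorder_not_less mem_Collect_eq)
  then show ?thesis using \<phi> by (auto simp: test_functions_def smooth_pd)
qed

lemma test_mult_left:
  assumes "smooth f" "\<phi> \<in> test_functions"
  shows "(\<lambda>x. f x * \<phi> x) \<in> test_functions"
proof -
  have "{x. f x * \<phi> x \<noteq> 0} \<subseteq> {x. \<phi> x \<noteq> 0}" by auto
  then show ?thesis using assms bounded_subset
    by (auto simp: test_functions_def intro!: smooth_mult)
qed

lemma test_mult_coord: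
  assumes "\<phi> \<in> test_functions"
  shows "(\<lambda>x. c * complex_of_real (x $ k) * \<phi> x) \<in> test_functions"
proof -
  have "smooth (\<lambda>x::real^'a. c * complex_of_real (x $ k))"
    using smooth_affine[of k c 0] by (simp add: scaleR_conv_of_real mult.commute)
  then show ?thesis using assms by (rule test_mult_left)
qed

lemma compact_support_bounded:
  fixes f :: "real^'n::finite \<Rightarrow> 'a::real_normed_vector"
  assumes "continuous_on UNIV f" "\<And>x. norm x > R \<Longrightarrow> f x = 0"
  shows "bounded (range f)"
proof -
  have "compact (f ` cball 0 R)"
    by (intro compact_continuous_image continuous_on_subset[OF assms(1)]) auto
  then have "bounded (insert 0 (f ` cball 0 R))" by (simp add: compact_imp_bounded)
  moreover have "range f \<subseteq> insert 0 (f ` cball 0 R)" using assms(2) by force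
  ultimately show ?thesis using bounded_subset by blast
qed

lemma test_foldr_pd: "\<phi> \<in> test_functions \<Longrightarrow> foldr pd ks \<phi> \<in> test_functions"
  by (induction ks) (auto intro: test_pd)

lemma test_schwartz: "\<phi> \<in> test_functions \<Longrightarrow> \<phi> \<in> schwartz"
proof -
  assume \<phi>: "\<phi> \<in> test_functions"
  have "bounded (range (\<lambda>x. (1 + norm x) ^ N *\<^sub>R foldr pd ks \<phi> x))" for ks N
  proof -
    let ?g = "foldr pd ks \<phi>"
    have g: "?g \<in> test_functions" using \<phi> by (rule test_foldr_pd)
    obtain R where R: "\<And>x. norm x > R \<Longrightarrow> ?g x = 0" by (rule test_support[OF g]) auto
    show ?thesis
      by (rule compact_support_bounded[where R=R]) (auto intro!: continuous_intros test_cont[OF g] simp: R)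
  qed
  then show ?thesis using \<phi> by (auto simp: schwartz_def test_functions_def)
qed

lemma test_iff: "\<phi> \<in> test_functions \<longleftrightarrow> \<phi> \<in> schwartz \<and> bounded {x. \<phi> x \<noteq> 0}"
  using test_schwartz by (auto simp: test_functions_def schwartz_def)

lemma test_bounded:
  assumes "\<phi> \<in> test_functions"
  obtains B where "B > 0" "\<And>x. norm (\<phi> x) \<le> B"
proof -
  obtain R where R: "\<And>x. norm x > R \<Longrightarrow> \<phi> x = 0" by (rule test_support[OF assms]) auto
  have "bounded (range \<phi>)"
    by (rule compact_support_bounded[OF test_cont[OF assms]]) (use R in auto)
  then show ?thesis using that by (auto simp: bounded_pos)
qed

lemma compact_support_integrable:
  fixes f :: "real^'n::finite \<Rightarrow> 'a::euclidean_space"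
  assumes "continuous_on UNIV f" "\<And>x. norm x > R \<Longrightarrow> f x = 0"
  shows "integrable lborel f"
proof -
  have "integrable lborel (\<lambda>x. indicator (cball 0 R) x *\<^sub>R f x)"
    by (intro borel_integrable_compact continuous_on_subset[OF assms(1)]) auto
  then show ?thesis
    by (rule Bochner_Integration.integrable_cong[THEN iffD1, rotated -1])
      (use assms in \<open>auto simp: indicator_def\<close>)
qed

lemma test_integrable: "\<phi> \<in> test_functions \<Longrightarrow> integrable lborel \<phi>"
  by (metis compact_support_integrable test_cont test_support)

lemma test_measurable: "\<phi> \<in> test_functions \<Longrightarrow> \<phi> \<in> borel_measurable borel"
  by (intro borel_measurable_continuous_onI test_cont)

lemma smooth_rescale:
  fixes f :: "real^'n::finite \<Rightarrow> real"
  assumes "smooth f"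
  shows "smooth (\<lambda>x. complex_of_real (f (a *\<^sub>R x + b)))"
proof -
  define S where "S = {g. \<exists>c. \<exists>f::real^'n \<Rightarrow> real. smooth f \<and> g = (\<lambda>x. complex_of_real (c * f (a *\<^sub>R x + b)))}"
  have D: "((\<lambda>x. complex_of_real (c * f (a *\<^sub>R x + b))) has_derivative
      (\<lambda>h. complex_of_real (c * F (a *\<^sub>R h)))) (at x)"
    if "(f has_derivative F) (at (a *\<^sub>R x + b))" for c and f :: "real^'n \<Rightarrow> real" and F x
  proof -
    have "((\<lambda>x. f (a *\<^sub>R x + b)) has_derivative (\<lambda>h. F (a *\<^sub>R h))) (at x)"
      by (rule has_derivative_compose[where g=f]) (use that in \<open>auto intro!: derivative_eq_intros\<close>)
    then show ?thesis
      by (intro bounded_linear.has_derivative[OF bounded_linear_of_real] has_derivative_mult_right)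
  qed
  show ?thesis
  proof (rule smooth_coinduct[of _ S])
    show "(\<lambda>x. complex_of_real (f (a *\<^sub>R x + b))) \<in> S" unfolding S_def using assms
      by (auto intro!: exI[of _ 1] exI[of _ f])
    show "g differentiable (at x)" if "g \<in> S" for g x
      using that D smooth_differentiable unfolding S_def differentiable_def by blast
    show "pd k g \<in> S" if g: "g \<in> S" for g k
    proof -
      obtain c f where f: "smooth f" "g = (\<lambda>x. complex_of_real (c * f (a *\<^sub>R x + b)))"
        using g by (auto simp: S_def)
      have "pd k g x = complex_of_real (c * a * pd k f (a *\<^sub>R x + b))" for x
      proof -
        obtain F where F: "(f has_derivative F) (at (a *\<^sub>R x + b))"
          using smooth_differentiable[OF f(1)] unfolding differentiable_def by blast
        have "F (a *\<^sub>R axis k 1) = a *\<^sub>R F (axis k 1)"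
          using F has_derivative_linear linear_cmul by blast
        then show ?thesis using has_derivative_pd[OF D[OF F], of k c] has_derivative_pd[OF F, of k]
          by (simp add: f(2))
      qed
      then show ?thesis using f smooth_pd unfolding S_def by blast
    qed
  qed
qed

section \<open>Integration on Euclidean space\<close>

lemma cis_measurable[measurable]: "cis \<in> borel_measurable borel"
  by (intro borel_measurable_continuous_onI) (simp add: cis_conv_exp continuous_intros)

lemma nn_integral_affine:
  fixes f :: "'a::euclidean_space \<Rightarrow> ennreal"
  assumes [measurable]: "f \<in> borel_measurable borel" and c: "c \<noteq> 0"
  shows "(\<integral>\<^sup>+x. f x \<partial>lborel) = \<bar>c\<bar> ^ DIM('a) * (\<integral>\<^sup>+x. f (t + c *\<^sub>R x) \<partial>lborel)"
  by (subst lborel_affine[OF c, of t])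
     (simp add: nn_integral_density nn_integral_distr nn_integral_cmult ennreal_power)

lemma integrable_affine:
  fixes f :: "'a::euclidean_space \<Rightarrow> 'b :: {banach, second_countable_topology}"
  assumes f: "integrable lborel f" and c: "c \<noteq> 0"
  shows "integrable lborel (\<lambda>x. f (t + c *\<^sub>R x))"
proof -
  have [measurable]: "f \<in> borel_measurable borel" using f by auto
  have "(\<integral>\<^sup>+x. norm (f x) \<partial>lborel) < \<infinity>" using f integrable_iff_bounded by blast
  then have "(\<integral>\<^sup>+x. norm (f (t + c *\<^sub>R x)) \<partial>lborel) < \<infinity>"
    using c by (subst (asm) nn_integral_affine[OF _ c, of _ t]) (auto simp: ennreal_mult_less_top)
  then show ?thesis by (simp add: integrable_iff_bounded)
qed

lemma integral_affine:
  fixes f :: "'a::euclidean_space \<Rightarrow> 'b :: {banach, second_countable_topology}"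
  assumes f[measurable]: "f \<in> borel_measurable borel" and c: "c \<noteq> 0"
  shows "(\<integral>x. f x \<partial>lborel) = \<bar>c\<bar> ^ DIM('a) *\<^sub>R (\<integral>x. f (t + c *\<^sub>R x) \<partial>lborel)"
  by (subst lborel_affine[OF c, of t]) (simp add: integral_density integral_distr)

lemma nn_integral_translate:
  fixes f :: "'a::euclidean_space \<Rightarrow> ennreal"
  assumes [measurable]: "f \<in> borel_measurable borel"
  shows "(\<integral>\<^sup>+x. f (t + x) \<partial>lborel) = (\<integral>\<^sup>+x. f x \<partial>lborel)"
  using nn_integral_affine[of f 1 t] by simp

lemma nn_integral_reflect:
  fixes f :: "'a::euclidean_space \<Rightarrow> ennreal"
  assumes [measurable]: "f \<in> borel_measurable borel"
  shows "(\<integral>\<^sup>+x. f (t - x) \<partial>lborel) = (\<integral>\<^sup>+x. f x \<partial>lborel)"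
  using nn_integral_affine[of f "-1" t] by simp

lemma integral_translate:
  fixes f :: "'a::euclidean_space \<Rightarrow> 'b :: {banach, second_countable_topology}"
  assumes [measurable]: "f \<in> borel_measurable borel"
  shows "(\<integral>x. f (t + x) \<partial>lborel) = (\<integral>x. f x \<partial>lborel)"
  using integral_affine[of f 1 t] by simp

lemma AE_affine:
  fixes P :: "'a::euclidean_space \<Rightarrow> bool"
  assumes "AE x in lborel. P x" and c: "c \<noteq> 0"
  shows "AE x in lborel. P (t + c *\<^sub>R x)"
proof -
  obtain N where N: "N \<in> null_sets lborel" "{x. \<not> P x} \<subseteq> N"
    using assms(1) unfolding eventually_ae_filter by (auto simp: null_sets_def)
  have [measurable]: "N \<in> sets borel" using N(1) by auto
  have "(\<integral>\<^sup>+x. indicator N x \<partial>lborel) = (0::ennreal)" using N(1) by auto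
  then have "(\<integral>\<^sup>+x. indicator N (t + c *\<^sub>R x) \<partial>lborel) = (0::ennreal)"
    using c by (subst (asm) nn_integral_affine[OF _ c, of _ t]) (auto simp: ennreal_eq_0_iff)
  then have "AE x in lborel. indicator N (t + c *\<^sub>R x) = (0::ennreal)"
    by (subst (asm) nn_integral_0_iff_AE) auto
  then show ?thesis
    by eventually_elim (use N(2) in \<open>auto simp: indicator_def split: if_splits\<close>)
qed

lemma integrable_product:
  fixes f :: "'a::euclidean_space \<Rightarrow> complex" and g :: "'b::euclidean_space \<Rightarrow> complex"
  assumes f: "integrable lborel f" and g: "integrable lborel g"
    and k[measurable]: "(\<lambda>p. k (fst p) (snd p)) \<in> borel_measurable (lborel \<Otimes>\<^sub>M lborel)"
    and kb: "\<And>x y. norm (k x y) \<le> B"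
  shows "integrable (lborel \<Otimes>\<^sub>M lborel) (\<lambda>(x,y). k x y * f x * g y)"
proof (rule Bochner_Integration.integrable_bound)
  have [measurable]: "f \<in> borel_measurable borel" "g \<in> borel_measurable borel" using f g by auto
  have "integrable lborel (\<lambda>x. norm (f x) * (\<integral>y. norm (g y) \<partial>lborel))"
    using f by auto
  then have "integrable (lborel \<Otimes>\<^sub>M lborel) (\<lambda>(x,y). f x * g y)"
    using g by (intro lborel_pair.Fubini_integrable) (auto simp: norm_mult)
  then show "integrable (lborel \<Otimes>\<^sub>M lborel) (\<lambda>p. B * norm (f (fst p) * g (snd p)))"
    by (simp add: case_prod_unfold)
  show "(\<lambda>(x, y). k x y * f x * g y) \<in> borel_measurable (lborel \<Otimes>\<^sub>M lborel)"
    unfolding case_prod_unfold by measurable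
  have "0 \<le> B" using kb[of undefined undefined] norm_ge_zero order_trans by blast
  then show "AE x in lborel \<Otimes>\<^sub>M lborel.
     norm (case x of (x, y) \<Rightarrow> k x y * f x * g y) \<le> norm (B * norm (f (fst x) * g (snd x)))"
    using kb by (auto simp: norm_mult mult.assoc split_beta intro!: AE_I2 mult_right_mono)
qed

lemma fubini_product:
  fixes f :: "'a::euclidean_space \<Rightarrow> complex" and g :: "'b::euclidean_space \<Rightarrow> complex"
  assumes f: "integrable lborel f" and g: "integrable lborel g"
    and k: "(\<lambda>p. k (fst p) (snd p)) \<in> borel_measurable (lborel \<Otimes>\<^sub>M lborel)"
    and kb: "\<And>x y. norm (k x y) \<le> B"
  shows "(LINT x|lborel. f x * (LINT y|lborel. k x y * g y)) =
    (LINT y|lborel. g y * (LINT x|lborel. k x y * f x))"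
proof -
  have "(LINT y|lborel. LINT x|lborel. k x y * f x * g y) = (LINT x|lborel. LINT y|lborel. k x y * f x * g y)"
    by (rule lborel_pair.Fubini_integral[OF integrable_product[OF assms]])
  moreover have "(LINT y|lborel. g y * (LINT x|lborel. k x y * f x)) = (LINT y|lborel. LINT x|lborel. k x y * f x * g y)"
    by (intro Bochner_Integration.integral_cong refl) (simp add: mult.commute)
  moreover have "(LINT x|lborel. f x * (LINT y|lborel. k x y * g y)) = (LINT x|lborel. LINT y|lborel. k x y * f x * g y)"
    by (intro Bochner_Integration.integral_cong refl, subst integral_mult_right_zero[symmetric]) (simp add: mult_ac)
  ultimately show ?thesis by simp
qed

lemma integrable_prod_Basis:
  fixes f :: "real \<Rightarrow> real"
  assumes f: "integrable lborel f" and nn: "\<And>x. 0 \<le> f x"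
  shows "integrable lborel (\<lambda>x::'a::euclidean_space. \<Prod>b\<in>Basis. f (x \<bullet> b))"
proof -
  have [measurable]: "f \<in> borel_measurable borel" using f by auto
  have "(\<integral>\<^sup>+x. ennreal (\<Prod>b\<in>Basis. f (x \<bullet> b)) \<partial>(lborel::'a measure)) = (\<integral>\<^sup>+x. (\<Prod>b\<in>Basis. ennreal (f (x \<bullet> b))) \<partial>(lborel::'a measure))"
    using nn by (simp add: prod_ennreal)
  also have "\<dots> = (\<Prod>b\<in>(Basis::'a set). \<integral>\<^sup>+x. f x \<partial>lborel)"
    by (subst nn_integral_lborel_prod) auto
  also have "\<dots> < \<infinity>"
  proof -
    have "(\<integral>\<^sup>+x. f x \<partial>lborel) < \<infinity>" using f nn by (simp add: integrable_iff_bounded)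
    then show ?thesis by (simp add: power_less_top_ennreal)
  qed
  finally show ?thesis using nn by (simp add: integrable_iff_bounded prod_nonneg)
qed

lemma integral_lborel_prod:
  fixes f :: "'a::euclidean_space \<Rightarrow> real \<Rightarrow> complex"
  assumes "\<And>b. b \<in> Basis \<Longrightarrow> integrable lborel (f b)"
  shows "(LINT x|lborel. (\<Prod>b\<in>Basis. f b (x \<bullet> b))) = (\<Prod>b\<in>Basis. LINT x|lborel. f b x)"
proof -
  interpret product_sigma_finite "\<lambda>_::'a. lborel::real measure" ..
  have [measurable]: "\<And>b. b \<in> Basis \<Longrightarrow> f b \<in> borel_measurable borel" using assms by auto
  show ?thesis
    by (simp add: lborel_eq[where 'a='a] integral_distr product_integral_prod[OF finite_Basis assms]
        cong: prod.cong)
qed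

text \<open>Each factor \<open>1 + (x \<bullet> b)\<^sup>2\<close> is at most \<open>(1 + norm x)\<^sup>2\<close>, so the function is dominated by a product of
  one-dimensional Cauchy densities.\<close>

lemma integrable_poly_decay:
  "integrable lborel (\<lambda>x::'a::euclidean_space. 1 / (1 + norm x) ^ (2 * DIM('a)))"
proof (rule Bochner_Integration.integrable_bound)
  have "set_integrable lborel (einterval (-\<infinity>) \<infinity>) (\<lambda>x::real. inverse (1 + x\<^sup>2))"
    by (rule integrable_inverse_1_plus_square)
  then have "integrable lborel (\<lambda>x::real. inverse (1 + x\<^sup>2))"
    by (simp add: set_integrable_def)
  then show "integrable lborel (\<lambda>x::'a. \<Prod>b\<in>Basis. inverse (1 + (x \<bullet> b)\<^sup>2))"
    by (rule integrable_prod_Basis) (simp add: add_nonneg_nonneg)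
  show "AE x::'a in lborel. norm (1 / (1 + norm x) ^ (2 * DIM('a))) \<le> norm (\<Prod>b\<in>Basis. inverse (1 + (x \<bullet> b)\<^sup>2))"
  proof (rule AE_I2)
    fix x :: 'a
    have 1: "1 + (x \<bullet> b)\<^sup>2 \<le> (1 + norm x)\<^sup>2" if "b \<in> Basis" for b
    proof -
      have "(x \<bullet> b)\<^sup>2 \<le> (norm x)\<^sup>2"
        using Basis_le_norm[OF that, of x] by (simp add: abs_le_square_iff[symmetric])
      then show ?thesis using norm_ge_zero[of x] unfolding power2_sum by (simp add: add_increasing2)
    qed
    have "1 / (1 + norm x)\<^sup>2 \<le> inverse (1 + (x \<bullet> b)\<^sup>2)" if "b \<in> Basis" for b
      using frac_le[of 1 1 "1 + (x \<bullet> b)\<^sup>2" "(1 + norm x)\<^sup>2"] 1[OF that]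
      by (simp add: inverse_eq_divide add_pos_nonneg)
    then have "(\<Prod>b\<in>(Basis::'a set). 1 / (1 + norm x)\<^sup>2) \<le> (\<Prod>b\<in>Basis. inverse (1 + (x \<bullet> b)\<^sup>2))"
      by (intro prod_mono) auto
    then show "norm (1 / (1 + norm x) ^ (2 * DIM('a))) \<le> norm (\<Prod>b\<in>Basis. inverse (1 + (x \<bullet> b)\<^sup>2))"
      by (simp add: power_mult power_divide abs_prod power_one_over)
  qed
qed simp

lemma norm_square_sum: "(norm x)\<^sup>2 = (\<Sum>b\<in>Basis. (x \<bullet> b)\<^sup>2)"
  unfolding power2_norm_eq_inner by (subst euclidean_inner) (simp add: power2_eq_square)

lemma integrable_gauss: "integrable lborel (\<lambda>x::'a::euclidean_space. exp (- (norm x)\<^sup>2 / 2))"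
proof -
  have "integrable lborel (\<lambda>x::real. exp (- x\<^sup>2 / 2))"
  proof -
    have "integrable lborel (\<lambda>x. sqrt (2*pi) * std_normal_density x)"
      using integrable_normal_moment[of 1 0 0] by (auto intro!: integrable_mult_right)
    then show ?thesis by (simp add: std_normal_density_def)
  qed
  then have "integrable lborel (\<lambda>x::'a. \<Prod>b\<in>Basis. exp (- (x \<bullet> b)\<^sup>2 / 2))"
    by (rule integrable_prod_Basis) simp
  moreover have "(\<Prod>b\<in>Basis. exp (- (x \<bullet> b)\<^sup>2 / 2)) = exp (- (norm x)\<^sup>2 / 2)" for x :: 'a
    by (simp add: exp_sum[symmetric] sum_negf sum_divide_distrib[symmetric] norm_square_sum)
  ultimately show ?thesis by simp
qed

text \<open>This is the characteristic function of the standard normal distribution.\<close>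

lemma gauss_transform_1d: "(LINT x|lborel. cis (- (x * t)) * of_real (exp (- x\<^sup>2 / 2))) = of_real (sqrt (2 * pi) * exp (- t\<^sup>2 / 2))"
proof -
  have "char std_normal_distribution (- t) = complex_of_real (exp (- t\<^sup>2 / 2))"
    using fun_cong[OF char_std_normal_distribution, of "-t"] by simp
  moreover have "char std_normal_distribution (- t) = (LINT x|lborel. std_normal_density x *\<^sub>R cis (- (x * t)))"
    unfolding char_def by (subst integral_density) (auto simp: cis_conv_exp mult.commute)
  moreover have "(LINT x|lborel. std_normal_density x *\<^sub>R cis (- (x * t))) =
     (1 / sqrt (2 * pi)) *\<^sub>R (LINT x|lborel. cis (- (x * t)) * of_real (exp (- x\<^sup>2 / 2)))"
    by (subst integral_scaleR_right[symmetric])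
      (auto simp: std_normal_density_def scaleR_conv_of_real mult_ac intro!: Bochner_Integration.integral_cong)
  ultimately have "(1 / sqrt (2 * pi)) *\<^sub>R (LINT x|lborel. cis (- (x * t)) * of_real (exp (- x\<^sup>2 / 2))) = complex_of_real (exp (- t\<^sup>2 / 2))"
    by simp
  then have "sqrt (2*pi) *\<^sub>R (1 / sqrt (2 * pi)) *\<^sub>R (LINT x|lborel. cis (- (x * t)) * of_real (exp (- x\<^sup>2 / 2))) = sqrt (2*pi) *\<^sub>R complex_of_real (exp (- t\<^sup>2 / 2))"
    by simp
  then show ?thesis by (simp add: scaleR_conv_of_real)
qed

lemma gauss_transform:
  fixes t :: "'a::euclidean_space"
  shows "(LINT x|lborel. cis (- (x \<bullet> t)) * of_real (exp (- (norm x)\<^sup>2 / 2))) =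
    of_real ((2 * pi) powr (DIM('a) / 2) * exp (- (norm t)\<^sup>2 / 2))"
proof -
  let ?f = "\<lambda>b x. cis (- (x * (t \<bullet> b))) * of_real (exp (- x\<^sup>2 / 2))"
  note sq = norm_square_sum
  have cissum: "cis (- (\<Sum>b\<in>B. g b)) = (\<Prod>b\<in>B. cis (- g b))" if "finite B" for B :: "'a set" and g
    using that
  proof (induction B rule: finite_induct)
    case (insert b B)
    have "cis (- g b + - (\<Sum>b\<in>B. g b)) = cis (- g b) * cis (- (\<Sum>b\<in>B. g b))"
      by (rule cis_mult[symmetric])
    then show ?case using insert by simp
  qed simp
  have "(\<Prod>b\<in>Basis. ?f b (x \<bullet> b)) = cis (- (x \<bullet> t)) * of_real (exp (- (norm x)\<^sup>2 / 2))" for x :: 'a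
    by (simp add: prod.distrib cissum[symmetric] euclidean_inner[of x t] sq sum_negf[symmetric]
        sum_divide_distrib exp_sum of_real_prod)
  moreover have "integrable lborel (?f b)" for b
    using integrable_gauss[where 'a=real]
    by (rule Bochner_Integration.integrable_bound) (auto simp: norm_mult)
  ultimately have "(LINT x|lborel. cis (- (x \<bullet> t)) * of_real (exp (- (norm x)\<^sup>2 / 2))) =
      (\<Prod>b\<in>Basis. LINT x|lborel. ?f b x)"
    using integral_lborel_prod[of ?f] by simp
  also have "\<dots> = (\<Prod>b\<in>(Basis::'a set). of_real (sqrt (2 * pi) * exp (- (t \<bullet> b)\<^sup>2 / 2)))"
    by (rule prod.cong[OF refl gauss_transform_1d])
  also have "\<dots> = of_real (sqrt (2 * pi) ^ DIM('a) * exp (- (norm t)\<^sup>2 / 2))"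
    unfolding of_real_prod[symmetric] by (simp add: prod.distrib sq sum_negf[symmetric] sum_divide_distrib exp_sum)
  also have "sqrt (2 * pi) ^ DIM('a) = (2 * pi) powr (DIM('a) / 2)"
    by (simp add: powr_half_sqrt[symmetric] powr_powr powr_realpow[symmetric])
  finally show ?thesis .
qed

section \<open>The Fourier transform of integrable functions\<close>

definition fconst :: "'n::finite itself \<Rightarrow> real" where
  "fconst _ = (2 * pi) powr (- real CARD('n) / 2)"

lemma fconst_pos[simp]: "0 < fconst TYPE('n::finite)"
  by (simp add: fconst_def)

lemma fourier_eq: "fourier (f :: real^'n::finite \<Rightarrow> complex) \<xi> =
    of_real (fconst TYPE('n)) * (LINT x|lborel. cis (- (x \<bullet> \<xi>)) * f x)"
  by (simp add: fourier_def fconst_def)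

lemma inv_fourier_eq_fourier: "inv_fourier f x = fourier f (- x)"
  by (simp add: inv_fourier_def fourier_def inner_commute)

lemma inv_fourier_eq: "inv_fourier (f :: real^'n::finite \<Rightarrow> complex) x =
    of_real (fconst TYPE('n)) * (LINT \<xi>|lborel. cis (x \<bullet> \<xi>) * f \<xi>)"
  by (simp add: inv_fourier_def fconst_def)

lemma integrable_cis:
  assumes "integrable M f" "h \<in> borel_measurable M"
  shows "integrable M (\<lambda>x. cis (h x) * f x)"
  using assms(1)
  by (rule Bochner_Integration.integrable_bound) (use assms in \<open>auto simp: norm_mult\<close>)

lemma fourier_measurable[measurable]:
  assumes [measurable]: "f \<in> borel_measurable borel"
  shows "fourier f \<in> borel_measurable borel"
  unfolding fourier_eq[abs_def] by measurable

lemma inv_fourier_measurable[measurable]: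
  assumes [measurable]: "f \<in> borel_measurable borel"
  shows "inv_fourier f \<in> borel_measurable borel"
  unfolding inv_fourier_eq[abs_def] by measurable

lemma norm_fourier_le:
  fixes f :: "real^'n::finite \<Rightarrow> complex"
  shows "norm (fourier f \<xi>) \<le> fconst TYPE('n) * (LINT x|lborel. norm (f x))"
proof -
  have "norm (LINT x|lborel. cis (- (x \<bullet> \<xi>)) * f x) \<le> (LINT x|lborel. norm (cis (- (x \<bullet> \<xi>)) * f x))"
    by (rule integral_norm_bound)
  then have "norm (LINT x|lborel. cis (- (x \<bullet> \<xi>)) * f x) \<le> (LINT x|lborel. norm (f x))"
    by (simp add: norm_mult)
  then show ?thesis using fconst_pos[where 'n='n]
    by (simp add: fourier_eq norm_mult abs_of_pos mult_left_mono del: fconst_pos)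
qed

lemma norm_inv_fourier_le:
  fixes f :: "real^'n::finite \<Rightarrow> complex"
  shows "norm (inv_fourier f \<xi>) \<le> fconst TYPE('n) * (LINT x|lborel. norm (f x))"
  by (simp add: inv_fourier_eq_fourier norm_fourier_le)

lemma fourier_cmult: "fourier (\<lambda>x. c * f x) \<xi> = c * fourier f \<xi>"
proof -
  have "(LINT x|lborel. cis (- (x \<bullet> \<xi>)) * (c * f x)) = c * (LINT x|lborel. cis (- (x \<bullet> \<xi>)) * f x)"
    by (subst integral_mult_right_zero[symmetric]) (simp add: mult_ac)
  then show ?thesis by (simp add: fourier_eq)
qed

lemma fourier_add:
  assumes "integrable lborel f" "integrable lborel g"
  shows "fourier (\<lambda>x. f x + g x) \<xi> = fourier f \<xi> + fourier g \<xi>"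
  using assms by (simp add: fourier_eq distrib_left integrable_cis)

lemma fourier_cong_AE:
  assumes "AE x in lborel. f x = g x" "f \<in> borel_measurable borel" "g \<in> borel_measurable borel"
  shows "fourier f = fourier g"
proof
  fix \<xi>
  have "(LINT x|lborel. cis (- (x \<bullet> \<xi>)) * f x) = (LINT x|lborel. cis (- (x \<bullet> \<xi>)) * g x)"
    by (rule integral_cong_AE) (use assms in auto)
  then show "fourier f \<xi> = fourier g \<xi>" by (simp add: fourier_eq)
qed

lemma continuous_fourier:
  assumes f: "integrable lborel f"
  shows "continuous_on UNIV (fourier f)"
proof -
  have [measurable]: "f \<in> borel_measurable borel" using f by auto
  have "(\<lambda>n. LINT x|lborel. cis (- (x \<bullet> X n)) * f x) \<longlonglongrightarrow> (LINT x|lborel. cis (- (x \<bullet> \<xi>)) * f x)"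
    if "X \<longlonglongrightarrow> \<xi>" for X \<xi>
  proof (rule integral_dominated_convergence)
    show "integrable lborel (\<lambda>x. norm (f x))" using f by auto
    show "AE x in lborel. (\<lambda>n. cis (- (x \<bullet> X n)) * f x) \<longlonglongrightarrow> cis (- (x \<bullet> \<xi>)) * f x"
      using that unfolding cis_conv_exp by (intro AE_I2 tendsto_intros)
  qed (auto simp: norm_mult)
  then show ?thesis
    unfolding fourier_eq[abs_def]
    by (intro continuous_on_mult continuous_on_const) (auto simp: continuous_on_sequentially comp_def)
qed

lemma cis_linearization: "norm (cis (a + b) - cis a - \<i> * b * cis a) \<le> b\<^sup>2 / 2"
proof -
  have "cis (a + b) - cis a - \<i> * b * cis a = cis a * (cis b - 1 - \<i> * b)"
    by (simp add: cis_mult[symmetric] algebra_simps)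
  moreover have "norm (cis b - 1 - \<i> * b) \<le> b\<^sup>2 / 2"
    using iexp_approx1[of b 1] by (simp add: cis_conv_exp algebra_simps power2_eq_square)
  ultimately show ?thesis by (simp add: norm_mult)
qed

text \<open>Differentiation under the integral sign: the second-order remainder of \<open>cis\<close> costs a factor
  \<open>(norm x)\<^sup>2\<close>, which the second moment pays for.\<close>

lemma has_derivative_fourier:
  fixes f :: "real^'n::finite \<Rightarrow> complex"
  assumes f: "integrable lborel (\<lambda>x. (1 + (norm x)\<^sup>2) *\<^sub>R f x)"
  shows "(fourier f has_derivative
    (\<lambda>h. of_real (fconst TYPE('n)) * (LINT x|lborel. - \<i> * of_real (x \<bullet> h) * cis (- (x \<bullet> \<xi>)) * f x))) (at \<xi>)"
proof -
  have [measurable]: "(\<lambda>x. (1 + (norm x)\<^sup>2) *\<^sub>R f x) \<in> borel_measurable borel"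
    using borel_measurable_integrable[OF f] by simp
  have "(\<lambda>x. (1 / (1 + (norm x)\<^sup>2)) *\<^sub>R ((1 + (norm x)\<^sup>2) *\<^sub>R f x)) \<in> borel_measurable borel"
    by measurable
  moreover have "1 + (norm x)\<^sup>2 \<noteq> 0" for x :: "real^'n"
    by (metis add_pos_nonneg less_irrefl zero_le_power2 zero_less_one)
  ultimately have [measurable]: "f \<in> borel_measurable borel" by (simp cong: measurable_cong)
  have n2: "integrable lborel (\<lambda>x. (1 + (norm x)\<^sup>2) * norm (f x))"
    using integrable_norm[OF f] by simp
  have le: "norm x \<le> 1 + (norm x)\<^sup>2" for x :: "real^'n"
    using sum_squares_bound[of "norm x" 1] by (smt (verit) norm_ge_zero one_power2 mult_1_right zero_le_power2)
  have n1: "integrable lborel (\<lambda>x. norm x * norm (f x))"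
    using n2 by (rule Bochner_Integration.integrable_bound) (auto simp: mult_right_mono le)
  have n0: "integrable lborel f"
    using f by (rule Bochner_Integration.integrable_bound) (simp_all add: distrib_right)
  have nsq: "integrable lborel (\<lambda>x. (norm x)\<^sup>2 * norm (f x))"
    using n2 by (rule Bochner_Integration.integrable_bound) (auto simp: mult_right_mono)
  let ?D = "\<lambda>h x. - \<i> * of_real (x \<bullet> h) * cis (- (x \<bullet> \<xi>)) * f x"
  have D: "integrable lborel (?D h)" for h
  proof -
    have "integrable lborel (\<lambda>x. norm h * (norm x * norm (f x)))" using n1 by auto
    then show ?thesis
      by (rule Bochner_Integration.integrable_bound)
        (auto simp: norm_mult mult.assoc[symmetric] mult.commute[of "norm h"] Cauchy_Schwarz_ineq2 mult_right_mono)
  qed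
  have nD: "norm (LINT x|lborel. ?D h x) \<le> norm h * (LINT x|lborel. norm x * norm (f x))" for h
  proof -
    have "norm (LINT x|lborel. ?D h x) \<le> (LINT x|lborel. norm h * (norm x * norm (f x)))"
    proof (rule Bochner_Integration.integral_norm_bound_integral[OF D])
      show "integrable lborel (\<lambda>x. norm h * (norm x * norm (f x)))" using n1 by (rule integrable_mult_right)
      show "norm (?D h x) \<le> norm h * (norm x * norm (f x))" for x
        by (auto simp: norm_mult mult.assoc[symmetric] mult.commute[of "norm h"] Cauchy_Schwarz_ineq2 mult_right_mono)
    qed
    then show ?thesis by simp
  qed
  have "((\<lambda>\<xi>. LINT x|lborel. cis (- (x \<bullet> \<xi>)) * f x) has_derivative (\<lambda>h. LINT x|lborel. ?D h x)) (at \<xi>)"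
  proof (rule has_derivativeI_sandwich[where e=1])
    show "bounded_linear (\<lambda>h. LINT x|lborel. ?D h x)"
    proof (rule bounded_linear_intro)
      show "(LINT x|lborel. ?D (h + k) x) = (LINT x|lborel. ?D h x) + (LINT x|lborel. ?D k x)" for h k
        using D by (subst Bochner_Integration.integral_add[symmetric]) (auto simp: inner_add_right algebra_simps)
      show "(LINT x|lborel. ?D (r *\<^sub>R h) x) = r *\<^sub>R (LINT x|lborel. ?D h x)" for h r
        by (subst integral_scaleR_right[symmetric]) (simp add: inner_scaleR_right scaleR_conv_of_real[where 'a=complex] mult_ac)
      show "norm (LINT x|lborel. ?D h x) \<le> norm h * (LINT x|lborel. norm x * norm (f x))" for h by (rule nD)
    qed
    let ?C = "(LINT x|lborel. (norm x)\<^sup>2 * norm (f x)) / 2"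
    show "norm ((LINT x|lborel. cis (- (x \<bullet> \<eta>)) * f x) - (LINT x|lborel. cis (- (x \<bullet> \<xi>)) * f x)
        - (LINT x|lborel. ?D (\<eta> - \<xi>) x)) / norm (\<eta> - \<xi>) \<le> ?C * norm (\<eta> - \<xi>)"
      if "\<eta> \<noteq> \<xi>" for \<eta>
    proof -
      have "norm ((LINT x|lborel. cis (- (x \<bullet> \<eta>)) * f x) - (LINT x|lborel. cis (- (x \<bullet> \<xi>)) * f x)
        - (LINT x|lborel. ?D (\<eta> - \<xi>) x)) = norm (LINT x|lborel. cis (- (x \<bullet> \<eta>)) * f x - cis (- (x \<bullet> \<xi>)) * f x
        - ?D (\<eta> - \<xi>) x)"
        using D integrable_cis[OF n0] by (simp add: Bochner_Integration.integral_diff)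
      also have "\<dots> \<le> (LINT x|lborel. (norm (\<eta> - \<xi>))\<^sup>2 / 2 * ((norm x)\<^sup>2 * norm (f x)))"
      proof (rule Bochner_Integration.integral_norm_bound_integral)
        show "norm (cis (- (x \<bullet> \<eta>)) * f x - cis (- (x \<bullet> \<xi>)) * f x - ?D (\<eta> - \<xi>) x)
          \<le> (norm (\<eta> - \<xi>))\<^sup>2 / 2 * ((norm x)\<^sup>2 * norm (f x))" for x
        proof -
          have "norm (cis (- (x \<bullet> \<eta>)) * f x - cis (- (x \<bullet> \<xi>)) * f x - ?D (\<eta> - \<xi>) x) =
            norm (cis (- (x \<bullet> \<xi>) + - (x \<bullet> (\<eta> - \<xi>))) - cis (- (x \<bullet> \<xi>)) - \<i> * of_real (- (x \<bullet> (\<eta> - \<xi>))) * cis (- (x \<bullet> \<xi>))) * norm (f x)"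
            by (simp add: norm_mult[symmetric] inner_diff_right algebra_simps)
          also have "\<dots> \<le> (- (x \<bullet> (\<eta> - \<xi>)))\<^sup>2 / 2 * norm (f x)"
            by (intro mult_right_mono cis_linearization) auto
          also have "(- (x \<bullet> (\<eta> - \<xi>)))\<^sup>2 \<le> (norm x * norm (\<eta> - \<xi>))\<^sup>2"
            unfolding power2_minus by (metis Cauchy_Schwarz_ineq2 abs_le_square_iff abs_mult abs_norm_cancel)
          finally show ?thesis by (simp add: power_mult_distrib mult_ac mult_right_mono divide_right_mono)
        qed
      qed (use D integrable_cis[OF n0] nsq in auto)
      also have "\<dots> = ?C * norm (\<eta> - \<xi>) * norm (\<eta> - \<xi>)" by (simp add: power2_eq_square)
      finally show ?thesis using that by (simp add: divide_le_eq)
    qed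
    show "((\<lambda>\<eta>. ?C * norm (\<eta> - \<xi>)) \<longlongrightarrow> 0) (at \<xi>)"
      by (auto intro!: tendsto_eq_intros)
  qed simp
  then show ?thesis unfolding fourier_eq[abs_def] by (rule has_derivative_mult_right)
qed

lemma fourier_pd:
  fixes f :: "real^'n::finite \<Rightarrow> complex"
  assumes f: "integrable lborel (\<lambda>x. (1 + (norm x)\<^sup>2) *\<^sub>R f x)"
  shows "pd k (fourier f) = fourier (\<lambda>x. - \<i> * of_real (x $ k) * f x)"
proof
  fix \<xi>
  show "pd k (fourier f) \<xi> = fourier (\<lambda>x. - \<i> * of_real (x $ k) * f x) \<xi>"
    unfolding has_derivative_pd[OF has_derivative_fourier[OF f]]
    by (simp add: fourier_eq inner_axis mult_ac)
qed

lemma has_vector_derivative_inv_fourier: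
  fixes f :: "real^'n::finite \<Rightarrow> complex"
  assumes f: "integrable lborel (\<lambda>x. (1 + (norm x)\<^sup>2) *\<^sub>R f x)"
  shows "((\<lambda>h. inv_fourier f (x + h *\<^sub>R axis k 1)) has_vector_derivative
    inv_fourier (\<lambda>\<xi>. \<i> * of_real (\<xi> $ k) * f \<xi>) x) (at 0)"
proof -
  have d: "fourier f differentiable (at y)" for y
    using has_derivative_fourier[OF f] unfolding differentiable_def by blast
  have "((\<lambda>h. fourier f (- x + h *\<^sub>R axis k 1)) has_vector_derivative
      fourier (\<lambda>x. - \<i> * of_real (x $ k) * f x) (- x)) (at (- 0))"
    using differentiable_pd[OF d, of "-x" k] by (simp add: fourier_pd[OF f])
  then have "((\<lambda>h. fourier f (- x + h *\<^sub>R axis k 1)) \<circ> uminus has_vector_derivative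
      (- 1) *\<^sub>R fourier (\<lambda>x. - \<i> * of_real (x $ k) * f x) (- x)) (at 0)"
    by (intro vector_diff_chain_at) (auto intro!: derivative_eq_intros)
  moreover have "(- 1) *\<^sub>R fourier (\<lambda>x. - \<i> * of_real (x $ k) * f x) (- x) =
      inv_fourier (\<lambda>\<xi>. \<i> * of_real (\<xi> $ k) * f \<xi>) x"
    using fourier_cmult[of "-1" "\<lambda>x. - \<i> * of_real (x $ k) * f x" "-x"]
    by (simp add: inv_fourier_eq_fourier)
  moreover have "(\<lambda>h. fourier f (- x + h *\<^sub>R axis k 1)) \<circ> uminus = (\<lambda>h. inv_fourier f (x + h *\<^sub>R axis k 1))"
    by (auto simp: fun_eq_iff inv_fourier_eq_fourier intro!: arg_cong[where f="fourier f"])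
  ultimately show ?thesis by simp
qed

subsection \<open>Transforms of test functions\<close>

lemma has_derivative_cis_inner:
  "((\<lambda>x::real^'n::finite. cis (- (x \<bullet> \<xi>))) has_derivative (\<lambda>h. - \<i> * of_real (h \<bullet> \<xi>) * cis (- (x \<bullet> \<xi>)))) (at x)"
proof -
  have "((\<lambda>x. \<i> * of_real (- (x \<bullet> \<xi>))) has_derivative (\<lambda>h. \<i> * of_real (- (h \<bullet> \<xi>)))) (at x)"
    by (auto intro!: derivative_eq_intros)
  from has_derivative_compose[OF this, of exp "(*) (exp (\<i> * of_real (- (x \<bullet> \<xi>))))"]
  show ?thesis
    using DERIV_exp[of "\<i> * of_real (- (x \<bullet> \<xi>))"]
    by (simp add: cis_conv_exp has_field_derivative_def mult_ac)
qed

lemma smooth_cis: "smooth (\<lambda>x::real^'n::finite. cis (- (x \<bullet> \<xi>)))"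
proof -
  define S where "S = {f. \<exists>c. f = (\<lambda>x::real^'n. c * cis (- (x \<bullet> \<xi>)))}"
  have D: "((\<lambda>x. c * cis (- (x \<bullet> \<xi>))) has_derivative (\<lambda>h. c * (- \<i> * of_real (h \<bullet> \<xi>)) * cis (- (x \<bullet> \<xi>)))) (at x)"
    for c and x :: "real^'n"
    using has_derivative_mult_right[OF has_derivative_cis_inner, of c] by (simp add: mult.assoc)
  show ?thesis
  proof (rule smooth_coinduct[of _ S])
    show "(\<lambda>x. cis (- (x \<bullet> \<xi>))) \<in> S" unfolding S_def by (auto intro!: exI[of _ 1])
    show "g differentiable (at x)" if "g \<in> S" for g x
      using that D unfolding S_def differentiable_def by blast
    show "pd k g \<in> S" if g: "g \<in> S" for g k
    proof -
      obtain c where "g = (\<lambda>x. c * cis (- (x \<bullet> \<xi>)))" using g by (auto simp: S_def)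
      then have "pd k g = (\<lambda>x. (c * (- \<i> * of_real (axis k 1 \<bullet> \<xi>))) * cis (- (x \<bullet> \<xi>)))"
        using has_derivative_pd[OF D] by auto
      then show ?thesis unfolding S_def by blast
    qed
  qed
qed

text \<open>The integral of a difference quotient vanishes by translation invariance, and the difference quotients
  converge boundedly on a fixed ball.\<close>

lemma integral_pd_test:
  assumes \<phi>: "\<phi> \<in> test_functions"
  shows "(LINT x|lborel. pd k \<phi> x) = 0"
proof -
  let ?e = "axis k 1 :: real^'a"
  have dif: "\<phi> differentiable (at x)" for x
    using \<phi> by (auto simp: test_functions_def smooth_differentiable)
  obtain R where R: "R > 0" "\<And>x. norm x > R \<Longrightarrow> \<phi> x = 0" by (rule test_support[OF \<phi>]) auto
  obtain B where B: "B > 0" "\<And>x. norm (pd k \<phi> x) \<le> B" by (rule test_bounded[OF test_pd[OF \<phi>]]) auto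
  have [measurable]: "\<phi> \<in> borel_measurable borel" "pd k \<phi> \<in> borel_measurable borel"
    using \<phi> test_pd test_measurable by blast+
  define h where "h n = 1 / (real n + 1)" for n
  have h: "h n > 0" "h n \<le> 1" for n by (auto simp: h_def)
  have h0: "h \<longlonglongrightarrow> 0" unfolding h_def using LIMSEQ_inverse_real_of_nat by (simp add: inverse_eq_divide add.commute)
  have vd: "((\<lambda>t. \<phi> (x + t *\<^sub>R ?e)) has_vector_derivative pd k \<phi> (x + s *\<^sub>R ?e)) (at s)" for x s
  proof -
    have "((\<lambda>t. \<phi> ((x + s *\<^sub>R ?e) + t *\<^sub>R ?e)) \<circ> (\<lambda>t. t - s) has_vector_derivative 1 *\<^sub>R pd k \<phi> (x + s *\<^sub>R ?e)) (at s)"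
      by (intro vector_diff_chain_at) (auto intro!: derivative_eq_intros differentiable_pd[OF dif])
    then show ?thesis by (simp add: comp_def algebra_simps)
  qed
  let ?q = "\<lambda>n x. (\<phi> (x + h n *\<^sub>R ?e) - \<phi> x) /\<^sub>R h n"
  have "(\<lambda>n. LINT x|lborel. ?q n x) \<longlonglongrightarrow> (LINT x|lborel. pd k \<phi> x)"
  proof (rule integral_dominated_convergence)
    show "integrable lborel (\<lambda>x. indicator (cball 0 (R + 1)) x *\<^sub>R B)"
      using emeasure_lborel_cball_finite by (intro integrable_real_indicator integrable_scaleR_left) auto
    show "AE x in lborel. (\<lambda>n. ?q n x) \<longlonglongrightarrow> pd k \<phi> x"
    proof (rule AE_I2)
      fix x
      let ?a = "\<lambda>t. \<phi> (x + t *\<^sub>R ?e) - \<phi> x"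
      have L: "((\<lambda>t. (?a t - t *\<^sub>R pd k \<phi> x) /\<^sub>R \<bar>t\<bar>) \<longlongrightarrow> 0) (at 0)"
        using differentiable_pd[OF dif, of x k]
        unfolding has_vector_derivative_def has_derivative_at_within by simp
      have eq: "norm ((?a t - t *\<^sub>R pd k \<phi> x) /\<^sub>R \<bar>t\<bar>) = norm (?a t /\<^sub>R t - pd k \<phi> x)" if "t \<noteq> 0" for t
      proof -
        have "?a t /\<^sub>R t - pd k \<phi> x = (?a t - t *\<^sub>R pd k \<phi> x) /\<^sub>R t"
          using that by (simp add: scaleR_diff_right)
        then show ?thesis by simp
      qed
      have "((\<lambda>t. norm (?a t /\<^sub>R t - pd k \<phi> x)) \<longlongrightarrow> 0) (at 0)"
      proof (rule Lim_transform_eventually[OF tendsto_norm_zero[OF L]])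
        show "\<forall>\<^sub>F t in at 0. norm ((?a t - t *\<^sub>R pd k \<phi> x) /\<^sub>R \<bar>t\<bar>) = norm (?a t /\<^sub>R t - pd k \<phi> x)"
          unfolding eventually_at_filter by (intro always_eventually allI impI eq)
      qed
      then have "((\<lambda>t. ?a t /\<^sub>R t) \<longlongrightarrow> pd k \<phi> x) (at 0)"
        by (simp only: tendsto_norm_zero_iff LIM_zero_iff)
      moreover have "filterlim h (at 0) sequentially"
        using h0 h by (auto simp: filterlim_at intro!: eventuallyI less_imp_neq[symmetric])
      ultimately show "(\<lambda>n. ?q n x) \<longlonglongrightarrow> pd k \<phi> x" by (rule filterlim_compose)
    qed
    show "AE x in lborel. norm (?q n x) \<le> indicator (cball 0 (R + 1)) x *\<^sub>R B" for n
    proof (rule AE_I2)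
      fix x
      show "norm (?q n x) \<le> indicator (cball 0 (R + 1)) x *\<^sub>R B"
      proof (cases "norm x \<le> R + 1")
        case True
        have "norm (\<phi> (x + h n *\<^sub>R ?e) - \<phi> (x + 0 *\<^sub>R ?e)) \<le> B * norm (h n - 0)"
        proof (rule differentiable_bound[where S=UNIV])
          show "((\<lambda>t. \<phi> (x + t *\<^sub>R ?e)) has_derivative (\<lambda>t. t *\<^sub>R pd k \<phi> (x + s *\<^sub>R ?e))) (at s within UNIV)" for s
            using vd[of x s] by (simp add: has_vector_derivative_def)
          show "onorm (\<lambda>t. t *\<^sub>R pd k \<phi> (x + s *\<^sub>R ?e)) \<le> B" for s
            by (rule onorm_le) (use B(2)[of "x + s *\<^sub>R ?e"] in \<open>simp add: mult.commute[of B] mult_left_mono\<close>)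
        qed auto
        then show ?thesis using True h[of n] by (simp add: divide_simps mult.commute)
      next
        case False
        have "norm x \<le> norm (x + h n *\<^sub>R ?e) + norm (h n *\<^sub>R ?e)"
          using norm_triangle_ineq4[of "x + h n *\<^sub>R ?e" "h n *\<^sub>R ?e"] by simp
        also have "norm (h n *\<^sub>R ?e) \<le> 1" using h[of n] by simp
        finally have "norm (x + h n *\<^sub>R ?e) > R" using False by simp
        then show ?thesis using False R by simp
      qed
    qed
  qed auto
  moreover have "(LINT x|lborel. ?q n x) = 0" for n
  proof -
    have "integrable lborel \<phi>" using \<phi> by (rule test_integrable)
    moreover from integrable_affine[OF this, of 1 "h n *\<^sub>R ?e"]
    have "integrable lborel (\<lambda>x. \<phi> (x + h n *\<^sub>R ?e))" by (simp add: add.commute)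
    moreover have "(LINT x|lborel. \<phi> (x + h n *\<^sub>R ?e)) = (LINT x|lborel. \<phi> x)"
      using integral_translate[of \<phi> "h n *\<^sub>R ?e"] by (simp add: add.commute)
    ultimately show ?thesis by (simp add: Bochner_Integration.integral_diff)
  qed
  ultimately have "(\<lambda>n. 0) \<longlonglongrightarrow> (LINT x|lborel. pd k \<phi> x)" by (simp only:)
  then show ?thesis by (simp add: LIMSEQ_const_iff)
qed

text \<open>Integration by parts, in the form that the partial derivative of the test function
  \<open>cis (- (x \<bullet> \<xi>)) * \<phi> x\<close> has integral zero.\<close>

lemma fourier_pd_test:
  assumes \<phi>: "\<phi> \<in> test_functions"
  shows "fourier (pd k \<phi>) \<xi> = \<i> * of_real (\<xi> $ k) * fourier \<phi> \<xi>"
proof -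
  let ?e = "\<lambda>x. cis (- (x \<bullet> \<xi>))"
  have t: "(\<lambda>x. ?e x * \<phi> x) \<in> test_functions" using smooth_cis \<phi> by (rule test_mult_left)
  have "pd k (\<lambda>x. ?e x * \<phi> x) x = ?e x * pd k \<phi> x - \<i> * of_real (\<xi> $ k) * (?e x * \<phi> x)" for x
  proof -
    obtain F where F: "(\<phi> has_derivative F) (at x)"
      using \<phi> smooth_differentiable unfolding differentiable_def test_functions_def by blast
    have G: "(?e has_derivative (\<lambda>h. (- \<i> * of_real (h \<bullet> \<xi>)) * ?e x)) (at x)"
      using has_derivative_cis_inner by simp
    show ?thesis
      unfolding has_derivative_pd[OF has_derivative_mult[OF G F]] has_derivative_pd[OF F]
      by (simp add: inner_axis' algebra_simps)
  qed
  then have "0 = (LINT x|lborel. ?e x * pd k \<phi> x - \<i> * of_real (\<xi> $ k) * (?e x * \<phi> x))"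
    using integral_pd_test[OF t, of k] by simp
  also have "\<dots> = (LINT x|lborel. ?e x * pd k \<phi> x) - \<i> * of_real (\<xi> $ k) * (LINT x|lborel. ?e x * \<phi> x)"
    using test_integrable[OF \<phi>] test_integrable[OF test_pd[OF \<phi>]] by (simp add: integrable_cis)
  finally show ?thesis by (simp add: fourier_eq)
qed

text \<open>Derivatives of \<open>\<phi>\<close> become factors \<open>\<xi> $ k\<close>, and all derivatives of \<open>\<phi>\<close> have bounded transforms.\<close>

lemma fourier_test_decay:
  assumes "\<phi> \<in> test_functions"
  shows "\<exists>B. \<forall>\<xi>. (1 + norm \<xi>) ^ N * norm (fourier \<phi> \<xi>) \<le> B"
  using assms
proof (induction N arbitrary: \<phi>)
  case 0
  then show ?case using norm_fourier_le by auto
next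
  case (Suc N)
  obtain B where B: "\<And>\<xi>. (1 + norm \<xi>) ^ N * norm (fourier \<phi> \<xi>) \<le> B" using Suc by blast
  have "\<forall>k. \<exists>B. \<forall>\<xi>. (1 + norm \<xi>) ^ N * norm (fourier (pd k \<phi>) \<xi>) \<le> B" using Suc test_pd by blast
  then obtain C where C: "\<And>k \<xi>. (1 + norm \<xi>) ^ N * norm (fourier (pd k \<phi>) \<xi>) \<le> C k" by metis
  have "(1 + norm \<xi>) ^ Suc N * norm (fourier \<phi> \<xi>) \<le> B + (\<Sum>k\<in>UNIV. C k)" for \<xi>
  proof -
    have "(1 + norm \<xi>) ^ Suc N * norm (fourier \<phi> \<xi>) =
        (1 + norm \<xi>) ^ N * norm (fourier \<phi> \<xi>) + norm \<xi> * ((1 + norm \<xi>) ^ N * norm (fourier \<phi> \<xi>))"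
      by (simp add: algebra_simps)
    also have "\<dots> \<le> B + (\<Sum>k\<in>UNIV. \<bar>\<xi> $ k\<bar>) * ((1 + norm \<xi>) ^ N * norm (fourier \<phi> \<xi>))"
      by (intro add_mono B mult_right_mono norm_le_l1_cart) auto
    also have "\<dots> = B + (\<Sum>k\<in>UNIV. (1 + norm \<xi>) ^ N * norm (fourier (pd k \<phi>) \<xi>))"
      unfolding sum_distrib_right fourier_pd_test[OF Suc.prems] norm_mult
      by (intro arg_cong2[where f=plus] sum.cong refl) simp
    also have "\<dots> \<le> B + (\<Sum>k\<in>UNIV. C k)" by (intro add_left_mono sum_mono C)
    finally show ?thesis .
  qed
  then show ?case by blast
qed

lemma test_second_moment:
  assumes "\<phi> \<in> test_functions"
  shows "integrable lborel (\<lambda>x. (1 + (norm x)\<^sup>2) *\<^sub>R \<phi> x)"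
proof -
  obtain R where R: "\<And>x. norm x > R \<Longrightarrow> \<phi> x = 0" by (rule test_support[OF assms]) auto
  show ?thesis
    by (rule compact_support_integrable[where R=R]) (auto intro!: continuous_on_scaleR continuous_intros test_cont[OF assms] simp: R)
qed

text \<open>A partial derivative of the transform of a test function is again the transform of a test function, so
  the image of the test functions serves as the class in \<open>smooth_coinduct\<close>.\<close>

lemma fourier_test_schwartz:
  fixes \<phi> :: "real^'n::finite \<Rightarrow> complex"
  assumes "\<phi> \<in> test_functions"
  shows "fourier \<phi> \<in> schwartz"
proof -
  let ?S = "fourier ` (test_functions :: (real^'n \<Rightarrow> complex) set)"
  have pd: "pd k g \<in> ?S" if g: "g \<in> ?S" for g k
  proof -
    obtain f where "f \<in> test_functions" "g = fourier f" using g by blast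
    then have "pd k g = fourier (\<lambda>x. - \<i> * of_real (x $ k) * f x)"
      using fourier_pd[OF test_second_moment] by blast
    then show ?thesis using test_mult_coord[OF \<open>f \<in> test_functions\<close>, of "- \<i>" k] by blast
  qed
  have "smooth (fourier \<phi>)"
  proof (rule smooth_coinduct[of _ ?S])
    show "g differentiable (at x)" if "g \<in> ?S" for g x
      using that has_derivative_fourier[OF test_second_moment] unfolding differentiable_def by blast
  qed (use assms pd in auto)
  moreover have "bounded (range (\<lambda>x. (1 + norm x) ^ N *\<^sub>R foldr pd ks (fourier \<phi>) x))" for ks N
  proof -
    have "foldr pd ks (fourier \<phi>) \<in> ?S" by (induction ks) (use assms pd in auto)
    then obtain f where f: "f \<in> test_functions" "foldr pd ks (fourier \<phi>) = fourier f" by blast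
    obtain B where "\<And>\<xi>. (1 + norm \<xi>) ^ N * norm (fourier f \<xi>) \<le> B"
      using fourier_test_decay[OF f(1)] by blast
    then show ?thesis by (intro boundedI[of _ B]) (auto simp: f(2))
  qed
  ultimately show ?thesis by (simp add: schwartz_def)
qed

lemma schwartz_decay:
  assumes "\<phi> \<in> schwartz"
  obtains B where "B \<ge> 0" "\<And>x. (1 + norm x) ^ N * norm (\<phi> x) \<le> B"
proof -
  have "bounded (range (\<lambda>x. (1 + norm x) ^ N *\<^sub>R foldr pd [] \<phi> x))"
    using assms unfolding schwartz_def by blast
  then obtain B where "\<And>x. norm ((1 + norm x) ^ N *\<^sub>R \<phi> x) \<le> B" by (auto simp: bounded_iff)
  then have *: "\<And>x. (1 + norm x) ^ N * norm (\<phi> x) \<le> B" by simp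
  have "0 \<le> (1 + norm 0) ^ N * norm (\<phi> 0)" by simp
  then have "B \<ge> 0" using * order_trans by blast
  then show thesis using that * by blast
qed

lemma schwartz_measurable: "\<phi> \<in> schwartz \<Longrightarrow> \<phi> \<in> borel_measurable borel"
  by (intro borel_measurable_continuous_onI smooth_continuous) (simp add: schwartz_def)

lemma schwartz_integrable:
  fixes \<phi> :: "real^'n::finite \<Rightarrow> complex"
  assumes "\<phi> \<in> schwartz"
  shows "integrable lborel \<phi>"
proof -
  obtain B where B: "B \<ge> 0" "\<And>x. (1 + norm x) ^ (2 * DIM(real^'n)) * norm (\<phi> x) \<le> B"
    by (rule schwartz_decay[OF assms, where N="2 * DIM(real^'n)"]) auto
  have "integrable lborel (\<lambda>x::real^'n. B * (1 / (1 + norm x) ^ (2 * DIM(real^'n))))"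
    by (intro integrable_mult_right integrable_poly_decay)
  then show ?thesis
  proof (rule Bochner_Integration.integrable_bound)
    have "norm (\<phi> x) \<le> B * (1 / (1 + norm x) ^ (2 * DIM(real^'n)))" for x
      using B(2)[of x] by (simp add: pos_le_divide_eq mult.commute add_pos_nonneg)
    then show "AE x in lborel. norm (\<phi> x) \<le> norm (B * (1 / (1 + norm x) ^ (2 * DIM(real^'n))))"
      using B(1) by (simp add: add_pos_nonneg)
  qed (use assms schwartz_measurable in auto)
qed

section \<open>Fourier inversion and a Plancherel bound\<close>

lemma fconst_gauss: "fconst TYPE('n::finite) * (2 * pi) powr (real CARD('n) / 2) = 1"
  by (simp add: fconst_def powr_add[symmetric])

lemma integral_gauss: "fconst TYPE('n::finite) * (LINT x|lborel. exp (- (norm (x::real^'n))\<^sup>2 / 2)) = 1"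
proof -
  have "complex_of_real (LINT x|lborel. exp (- (norm (x::real^'n))\<^sup>2 / 2)) =
      of_real ((2 * pi) powr (real CARD('n) / 2))"
    using gauss_transform[of "0::real^'n"] by simp
  then have "(LINT x|lborel. exp (- (norm (x::real^'n))\<^sup>2 / 2)) = (2 * pi) powr (real CARD('n) / 2)"
    by (simp only: of_real_eq_iff)
  then show ?thesis by (simp add: fconst_gauss)
qed

definition gauss_cutoff :: "real \<Rightarrow> real^'n::finite \<Rightarrow> real" where
  "gauss_cutoff \<epsilon> \<xi> = exp (- (norm (\<epsilon> *\<^sub>R \<xi>))\<^sup>2 / 2)"

lemma gauss_cutoff_bounds: "0 \<le> gauss_cutoff \<epsilon> \<xi>" "gauss_cutoff \<epsilon> \<xi> \<le> 1"
  by (auto simp: gauss_cutoff_def)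

lemma gauss_cutoff_abs[simp]: "\<bar>gauss_cutoff \<epsilon> \<xi>\<bar> = gauss_cutoff \<epsilon> \<xi>"
  by (simp add: gauss_cutoff_def)

lemma gauss_cutoff_mult_le: "0 \<le> a \<Longrightarrow> gauss_cutoff \<epsilon> \<xi> * a \<le> a"
  using gauss_cutoff_bounds by (rule mult_left_le_one_le[rotated])

lemma gauss_cutoff_measurable[measurable]: "gauss_cutoff \<epsilon> \<in> borel_measurable borel"
  unfolding gauss_cutoff_def[abs_def] by measurable

lemma gauss_cutoff_integrable: "\<epsilon> \<noteq> 0 \<Longrightarrow> integrable lborel (gauss_cutoff \<epsilon>)"
  using integrable_affine[OF integrable_gauss, of \<epsilon> 0] by (simp add: gauss_cutoff_def[abs_def])

lemma gauss_cutoff_tendsto: "\<epsilon> \<longlonglongrightarrow> 0 \<Longrightarrow> (\<lambda>n. gauss_cutoff (\<epsilon> n) \<xi>) \<longlonglongrightarrow> 1"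
proof -
  assume "\<epsilon> \<longlonglongrightarrow> 0"
  then have "(\<lambda>n. exp (- (norm (\<epsilon> n *\<^sub>R \<xi>))\<^sup>2 / 2)) \<longlonglongrightarrow> exp (- (norm (0 *\<^sub>R \<xi>))\<^sup>2 / 2)"
    by (intro tendsto_intros) auto
  then show ?thesis by (simp add: gauss_cutoff_def)
qed

text \<open>By Fubini, damping the inversion integral with a Gaussian of width \<open>1 / \<epsilon>\<close> amounts to averaging \<open>f\<close>
  against a Gaussian of width \<open>\<epsilon>\<close>. This identity yields both the inversion formula and the Plancherel
  bound.\<close>

lemma gauss_smoothing:
  fixes f :: "real^'n::finite \<Rightarrow> complex"
  assumes f: "integrable lborel f" and e: "\<epsilon> > 0"
  shows "inv_fourier (\<lambda>\<xi>. of_real (gauss_cutoff \<epsilon> \<xi>) * fourier f \<xi>) x =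
    of_real (fconst TYPE('n)) * (LINT z|lborel. of_real (exp (- (norm z)\<^sup>2 / 2)) * f (x - \<epsilon> *\<^sub>R z))"
proof -
  let ?c = "of_real (fconst TYPE('n)) :: complex"
  have [measurable]: "f \<in> borel_measurable borel" using f by auto
  have G: "integrable lborel (\<lambda>\<xi>. complex_of_real (gauss_cutoff \<epsilon> \<xi>))"
    using gauss_cutoff_integrable[of \<epsilon>] e by (intro integrable_of_real) auto
  let ?k = "\<lambda>\<xi> y. cis (\<xi> \<bullet> (x - y))"
  have inner: "(LINT \<xi>|lborel. ?k \<xi> y * of_real (gauss_cutoff \<epsilon> \<xi>)) =
      of_real ((1 / \<epsilon>) ^ CARD('n) * ((2 * pi) powr (real CARD('n) / 2) * exp (- (norm ((x - y) /\<^sub>R \<epsilon>))\<^sup>2 / 2)))" for y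
  proof -
    have "(LINT \<xi>|lborel. ?k \<xi> y * of_real (gauss_cutoff \<epsilon> \<xi>)) =
        \<bar>1 / \<epsilon>\<bar> ^ DIM(real^'n) *\<^sub>R (LINT \<xi>|lborel. ?k (0 + (1 / \<epsilon>) *\<^sub>R \<xi>) y * of_real (gauss_cutoff \<epsilon> (0 + (1 / \<epsilon>) *\<^sub>R \<xi>)))"
      by (rule integral_affine) (use e in auto)
    also have "(LINT \<xi>|lborel. ?k (0 + (1 / \<epsilon>) *\<^sub>R \<xi>) y * of_real (gauss_cutoff \<epsilon> (0 + (1 / \<epsilon>) *\<^sub>R \<xi>))) =
        (LINT \<xi>|lborel. cis (- (\<xi> \<bullet> (- ((x - y) /\<^sub>R \<epsilon>)))) * of_real (exp (- (norm \<xi>)\<^sup>2 / 2)))"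
    proof (intro Bochner_Integration.integral_cong refl)
      fix \<xi> :: "real^'n"
      have "?k (0 + (1 / \<epsilon>) *\<^sub>R \<xi>) y = cis (- (\<xi> \<bullet> (- ((x - y) /\<^sub>R \<epsilon>))))"
        by (simp add: divide_inverse)
      moreover have "gauss_cutoff \<epsilon> (0 + (1 / \<epsilon>) *\<^sub>R \<xi>) = exp (- (norm \<xi>)\<^sup>2 / 2)"
        using e by (simp add: gauss_cutoff_def)
      ultimately show "?k (0 + (1 / \<epsilon>) *\<^sub>R \<xi>) y * of_real (gauss_cutoff \<epsilon> (0 + (1 / \<epsilon>) *\<^sub>R \<xi>)) =
        cis (- (\<xi> \<bullet> (- ((x - y) /\<^sub>R \<epsilon>)))) * of_real (exp (- (norm \<xi>)\<^sup>2 / 2))"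
        by (simp only:)
    qed
    finally show ?thesis using e unfolding gauss_transform by (simp add: scaleR_conv_of_real[where 'a=complex])
  qed
  have "inv_fourier (\<lambda>\<xi>. of_real (gauss_cutoff \<epsilon> \<xi>) * fourier f \<xi>) x =
      ?c * ?c * (LINT \<xi>|lborel. of_real (gauss_cutoff \<epsilon> \<xi>) * (LINT y|lborel. ?k \<xi> y * f y))"
  proof -
    have "cis (x \<bullet> \<xi>) * (of_real (gauss_cutoff \<epsilon> \<xi>) * fourier f \<xi>) =
      ?c * (of_real (gauss_cutoff \<epsilon> \<xi>) * (LINT y|lborel. ?k \<xi> y * f y))" for \<xi>
    proof -
      have "(LINT y|lborel. ?k \<xi> y * f y) = (LINT y|lborel. cis (x \<bullet> \<xi>) * (cis (- (y \<bullet> \<xi>)) * f y))"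
        by (simp add: mult.assoc[symmetric] cis_mult inner_diff_right inner_commute)
      also have "\<dots> = cis (x \<bullet> \<xi>) * (LINT y|lborel. cis (- (y \<bullet> \<xi>)) * f y)" by simp
      finally show ?thesis by (simp add: fourier_eq)
    qed
    then have "(LINT \<xi>|lborel. cis (x \<bullet> \<xi>) * (of_real (gauss_cutoff \<epsilon> \<xi>) * fourier f \<xi>)) =
        (LINT \<xi>|lborel. ?c * (of_real (gauss_cutoff \<epsilon> \<xi>) * (LINT y|lborel. ?k \<xi> y * f y)))"
      by (intro Bochner_Integration.integral_cong refl)
    also have "\<dots> = ?c * (LINT \<xi>|lborel. of_real (gauss_cutoff \<epsilon> \<xi>) * (LINT y|lborel. ?k \<xi> y * f y))"
      by (rule integral_mult_right_zero)
    finally show ?thesis by (simp only: inv_fourier_eq mult.assoc)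
  qed
  also have "(LINT \<xi>|lborel. of_real (gauss_cutoff \<epsilon> \<xi>) * (LINT y|lborel. ?k \<xi> y * f y)) =
      (LINT y|lborel. f y * (LINT \<xi>|lborel. ?k \<xi> y * of_real (gauss_cutoff \<epsilon> \<xi>)))"
    by (rule fubini_product[OF G f, of _ 1]) auto
  also have "\<dots> = of_real ((1 / \<epsilon>) ^ CARD('n) * (2 * pi) powr (real CARD('n) / 2)) *
      (LINT y|lborel. of_real (exp (- (norm ((x - y) /\<^sub>R \<epsilon>))\<^sup>2 / 2)) * f y)"
    unfolding inner by (subst integral_mult_right_zero[symmetric]) (simp add: mult_ac)
  also have "(LINT y|lborel. of_real (exp (- (norm ((x - y) /\<^sub>R \<epsilon>))\<^sup>2 / 2)) * f y) =
      \<bar>- \<epsilon>\<bar> ^ DIM(real^'n) *\<^sub>R (LINT z|lborel. of_real (exp (- (norm ((x - (x + (- \<epsilon>) *\<^sub>R z)) /\<^sub>R \<epsilon>))\<^sup>2 / 2)) * f (x + (- \<epsilon>) *\<^sub>R z))"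
    by (rule integral_affine) (use e in auto)
  also have "\<dots> = of_real (\<epsilon> ^ CARD('n)) * (LINT z|lborel. of_real (exp (- (norm z)\<^sup>2 / 2)) * f (x - \<epsilon> *\<^sub>R z))"
    using e by (simp add: scaleR_conv_of_real[where 'a=complex])
  finally show ?thesis
    using arg_cong[OF fconst_gauss[where 'n='n], of complex_of_real] e
    by (simp add: power_divide field_simps)
qed

lemma inverse_Suc_tendsto: "(\<lambda>n. 1 / (real n + 1)) \<longlonglongrightarrow> 0"
  using LIMSEQ_inverse_real_of_nat by (simp add: inverse_eq_divide add.commute)

theorem fourier_inversion:
  fixes f :: "real^'n::finite \<Rightarrow> complex"
  assumes f: "integrable lborel f" and cont: "continuous_on UNIV f" and B: "\<And>x. norm (f x) \<le> B"
    and F: "integrable lborel (fourier f)"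
  shows "inv_fourier (fourier f) x = f x"
proof -
  define e where "e n = 1 / (real n + 1)" for n
  have e: "e n > 0" for n by (simp add: e_def)
  have e0: "e \<longlonglongrightarrow> 0" unfolding e_def by (rule inverse_Suc_tendsto)
  have [measurable]: "f \<in> borel_measurable borel" "fourier f \<in> borel_measurable borel" using f F by auto
  have "(\<lambda>n. LINT \<xi>|lborel. cis (x \<bullet> \<xi>) * (of_real (gauss_cutoff (e n) \<xi>) * fourier f \<xi>))
      \<longlonglongrightarrow> (LINT \<xi>|lborel. cis (x \<bullet> \<xi>) * (of_real 1 * fourier f \<xi>))"
  proof (rule integral_dominated_convergence)
    show "integrable lborel (\<lambda>\<xi>. norm (fourier f \<xi>))" using F by auto
    show "AE \<xi> in lborel. (\<lambda>n. cis (x \<bullet> \<xi>) * (of_real (gauss_cutoff (e n) \<xi>) * fourier f \<xi>)) \<longlonglongrightarrow>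
        cis (x \<bullet> \<xi>) * (of_real 1 * fourier f \<xi>)"
      by (intro AE_I2 tendsto_intros gauss_cutoff_tendsto e0)
    show "AE \<xi> in lborel. norm (cis (x \<bullet> \<xi>) * (of_real (gauss_cutoff (e n) \<xi>) * fourier f \<xi>)) \<le> norm (fourier f \<xi>)" for n
      by (intro AE_I2) (simp only: norm_mult norm_of_real norm_cis gauss_cutoff_abs mult_1 gauss_cutoff_mult_le norm_ge_zero)
  qed auto
  then have L: "(\<lambda>n. inv_fourier (\<lambda>\<xi>. of_real (gauss_cutoff (e n) \<xi>) * fourier f \<xi>) x) \<longlonglongrightarrow> inv_fourier (fourier f) x"
    unfolding inv_fourier_eq by (intro tendsto_mult_left) simp
  have "(\<lambda>n. LINT z|lborel. of_real (exp (- (norm z)\<^sup>2 / 2)) * f (x - e n *\<^sub>R z)) \<longlonglongrightarrow>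
     (LINT z|lborel. of_real (exp (- (norm (z::real^'n))\<^sup>2 / 2)) * f (x - 0 *\<^sub>R z))"
  proof (rule integral_dominated_convergence)
    show "integrable lborel (\<lambda>z::real^'n. B * exp (- (norm z)\<^sup>2 / 2))"
      by (intro integrable_mult_right integrable_gauss)
    show "AE z in lborel. (\<lambda>n. of_real (exp (- (norm z)\<^sup>2 / 2)) * f (x - e n *\<^sub>R z)) \<longlonglongrightarrow>
        of_real (exp (- (norm z)\<^sup>2 / 2)) * f (x - 0 *\<^sub>R z)"
      by (intro AE_I2 tendsto_mult tendsto_const continuous_on_tendsto_compose[OF cont] tendsto_diff tendsto_scaleR e0) auto
    show "AE z in lborel. norm (of_real (exp (- (norm z)\<^sup>2 / 2)) * f (x - e n *\<^sub>R z)) \<le> B * exp (- (norm z)\<^sup>2 / 2)" for n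
      using B by (auto simp: norm_mult mult.commute)
  qed auto
  then have "(\<lambda>n. inv_fourier (\<lambda>\<xi>. of_real (gauss_cutoff (e n) \<xi>) * fourier f \<xi>) x) \<longlonglongrightarrow>
      of_real (fconst TYPE('n)) * (LINT z|lborel. of_real (exp (- (norm (z::real^'n))\<^sup>2 / 2)) * f (x - 0 *\<^sub>R z))"
    unfolding gauss_smoothing[OF f e] by (rule tendsto_mult_left)
  also have "of_real (fconst TYPE('n)) * (LINT z|lborel. of_real (exp (- (norm (z::real^'n))\<^sup>2 / 2)) * f (x - 0 *\<^sub>R z)) = f x"
    using arg_cong[OF integral_gauss[where 'n='n], of complex_of_real] by (simp add: mult.assoc[symmetric])
  finally show ?thesis using L LIMSEQ_unique by blast
qed

lemma inv_fourier_fourier_test: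
  assumes "\<phi> \<in> test_functions"
  shows "inv_fourier (fourier \<phi>) x = \<phi> x"
proof -
  obtain B where "\<And>x. norm (\<phi> x) \<le> B" by (rule test_bounded[OF assms]) auto
  then show ?thesis
    using fourier_inversion test_integrable test_cont schwartz_integrable fourier_test_schwartz assms by blast
qed

lemma inv_fourier_exchange:
  assumes "integrable lborel w" "integrable lborel \<phi>"
  shows "(LINT x|lborel. inv_fourier w x * \<phi> x) = (LINT \<xi>|lborel. w \<xi> * inv_fourier \<phi> \<xi>)"
proof -
  have "(LINT x|lborel. \<phi> x * (LINT \<xi>|lborel. cis (x \<bullet> \<xi>) * w \<xi>)) =
      (LINT \<xi>|lborel. w \<xi> * (LINT x|lborel. cis (x \<bullet> \<xi>) * \<phi> x))"
    by (rule fubini_product[OF assms(2,1), of _ 1]) auto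
  then have "of_real (fconst TYPE('a)) * (LINT x|lborel. \<phi> x * (LINT \<xi>|lborel. cis (x \<bullet> \<xi>) * w \<xi>)) =
      of_real (fconst TYPE('a)) * (LINT \<xi>|lborel. w \<xi> * (LINT x|lborel. cis (x \<bullet> \<xi>) * \<phi> x))" by simp
  then show ?thesis
    unfolding inv_fourier_eq
    by (subst (asm) (1 2) integral_mult_right_zero[symmetric]) (simp add: mult_ac inner_commute)
qed

lemma fourier_exchange:
  assumes "integrable lborel w" "integrable lborel \<phi>"
  shows "(LINT x|lborel. fourier w x * \<phi> x) = (LINT \<xi>|lborel. w \<xi> * fourier \<phi> \<xi>)"
proof -
  have "(LINT x|lborel. \<phi> x * (LINT \<xi>|lborel. cis (- (\<xi> \<bullet> x)) * w \<xi>)) =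
      (LINT \<xi>|lborel. w \<xi> * (LINT x|lborel. cis (- (\<xi> \<bullet> x)) * \<phi> x))"
    by (rule fubini_product[OF assms(2,1), of _ 1]) auto
  then have "of_real (fconst TYPE('a)) * (LINT x|lborel. \<phi> x * (LINT \<xi>|lborel. cis (- (\<xi> \<bullet> x)) * w \<xi>)) =
      of_real (fconst TYPE('a)) * (LINT \<xi>|lborel. w \<xi> * (LINT x|lborel. cis (- (\<xi> \<bullet> x)) * \<phi> x))" by simp
  then show ?thesis
    unfolding fourier_eq
    by (subst (asm) (1 2) integral_mult_right_zero[symmetric]) (simp add: mult_ac inner_commute)
qed

text \<open>Says that \<open>inv_fourier w\<close>, as a distribution, has the Fourier transform \<open>w\<close>.\<close>

lemma pairing_inversion:
  assumes "integrable lborel w" "\<phi> \<in> test_functions"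
  shows "(LINT x|lborel. inv_fourier w x * fourier \<phi> x) = (LINT \<xi>|lborel. w \<xi> * \<phi> \<xi>)"
  by (simp add: inv_fourier_exchange[OF assms(1) schwartz_integrable[OF fourier_test_schwartz[OF assms(2)]]]
      inv_fourier_fourier_test[OF assms(2)])

lemma cnj_measurable[measurable]: "cnj \<in> borel_measurable borel"
  by (intro borel_measurable_continuous_onI continuous_intros)

text \<open>After damping with a Gaussian, the integral of \<open>(norm (fourier f \<xi>))\<^sup>2\<close> is the pairing of \<open>cnj f\<close> with
  the smoothed \<open>f\<close>, which is bounded by \<open>B\<close>; Fatou's lemma removes the damping.\<close>

lemma plancherel_bound_fourier:
  fixes f :: "real^'n::finite \<Rightarrow> complex"
  assumes f: "integrable lborel f" and B: "\<And>x. norm (f x) \<le> B"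
  shows "(\<integral>\<^sup>+\<xi>. ennreal ((norm (fourier f \<xi>))\<^sup>2) \<partial>lborel) \<le> ennreal (B * (LINT x|lborel. norm (f x)))"
proof -
  let ?F = "fourier f" and ?I = "LINT x|lborel. norm (f x)" and ?c = "fconst TYPE('n)"
  have [measurable]: "f \<in> borel_measurable borel" using f by auto
  have B0: "0 \<le> B" using B[of 0] norm_ge_zero order_trans by blast
  have cut: "(\<integral>\<^sup>+\<xi>. ennreal (gauss_cutoff \<epsilon> \<xi> * (norm (?F \<xi>))\<^sup>2) \<partial>lborel) \<le> ennreal (B * ?I)" if e: "\<epsilon> > 0" for \<epsilon>
  proof -
    have int: "integrable lborel (\<lambda>\<xi>. gauss_cutoff \<epsilon> \<xi> * (norm (?F \<xi>))\<^sup>2)"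
    proof (rule Bochner_Integration.integrable_bound)
      show "integrable lborel (\<lambda>\<xi>. (?c * ?I)\<^sup>2 * gauss_cutoff \<epsilon> \<xi>)"
        using gauss_cutoff_integrable[of \<epsilon>] e by (intro integrable_mult_right) auto
      show "AE \<xi> in lborel. norm (gauss_cutoff \<epsilon> \<xi> * (norm (?F \<xi>))\<^sup>2) \<le> norm ((?c * ?I)\<^sup>2 * gauss_cutoff \<epsilon> \<xi>)"
      proof (rule AE_I2)
        fix \<xi> :: "real^'n"
        have "gauss_cutoff \<epsilon> \<xi> * (norm (?F \<xi>))\<^sup>2 \<le> gauss_cutoff \<epsilon> \<xi> * (?c * ?I)\<^sup>2"
          by (intro mult_left_mono power_mono norm_fourier_le gauss_cutoff_bounds) auto
        then show "norm (gauss_cutoff \<epsilon> \<xi> * (norm (?F \<xi>))\<^sup>2) \<le> norm ((?c * ?I)\<^sup>2 * gauss_cutoff \<epsilon> \<xi>)"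
          by (simp add: abs_mult mult.commute)
      qed
    qed auto
    have gF: "integrable lborel (\<lambda>\<xi>. of_real (gauss_cutoff \<epsilon> \<xi>) * ?F \<xi>)"
    proof (rule Bochner_Integration.integrable_bound)
      show "integrable lborel (\<lambda>\<xi>. (?c * ?I) * gauss_cutoff \<epsilon> \<xi>)"
        using gauss_cutoff_integrable[of \<epsilon>] e by (intro integrable_mult_right) auto
      show "AE \<xi> in lborel. norm (of_real (gauss_cutoff \<epsilon> \<xi>) * ?F \<xi>) \<le> norm ((?c * ?I) * gauss_cutoff \<epsilon> \<xi>)"
      proof (rule AE_I2)
        fix \<xi> :: "real^'n"
        have "gauss_cutoff \<epsilon> \<xi> * norm (?F \<xi>) \<le> gauss_cutoff \<epsilon> \<xi> * (?c * ?I)"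
          by (intro mult_left_mono norm_fourier_le gauss_cutoff_bounds)
        then show "norm (of_real (gauss_cutoff \<epsilon> \<xi>) * ?F \<xi>) \<le> norm ((?c * ?I) * gauss_cutoff \<epsilon> \<xi>)"
          using gauss_cutoff_bounds(1)[of \<epsilon> \<xi>] by (simp add: norm_mult mult.commute)
      qed
    qed auto
    have smooth_bound: "norm (inv_fourier (\<lambda>\<xi>. of_real (gauss_cutoff \<epsilon> \<xi>) * ?F \<xi>) x) \<le> B" for x
    proof -
      have "norm (LINT z|lborel. of_real (exp (- (norm z)\<^sup>2 / 2)) * f (x - \<epsilon> *\<^sub>R z)) \<le>
          (LINT z|lborel. B * exp (- (norm (z::real^'n))\<^sup>2 / 2))"
      proof (rule Bochner_Integration.integral_norm_bound_integral)
        show gB: "integrable lborel (\<lambda>z::real^'n. B * exp (- (norm z)\<^sup>2 / 2))"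
          by (intro integrable_mult_right integrable_gauss)
        show le: "norm (of_real (exp (- (norm z)\<^sup>2 / 2)) * f (x - \<epsilon> *\<^sub>R z)) \<le> B * exp (- (norm z)\<^sup>2 / 2)" for z
          using B by (auto simp: norm_mult mult.commute)
        show "integrable lborel (\<lambda>z. of_real (exp (- (norm z)\<^sup>2 / 2)) * f (x - \<epsilon> *\<^sub>R z))"
          using gB by (rule Bochner_Integration.integrable_bound) (use le B0 in auto)
      qed
      then have "?c * norm (LINT z|lborel. of_real (exp (- (norm z)\<^sup>2 / 2)) * f (x - \<epsilon> *\<^sub>R z)) \<le>
          ?c * (B * (LINT z|lborel. exp (- (norm (z::real^'n))\<^sup>2 / 2)))"
        by (intro mult_left_mono) (auto simp: less_imp_le)
      also have "\<dots> = B" using integral_gauss[where 'n='n] by (simp add: mult.left_commute)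
      finally show ?thesis unfolding gauss_smoothing[OF f e] by (simp add: norm_mult less_imp_le)
    qed
    have "complex_of_real (LINT \<xi>|lborel. gauss_cutoff \<epsilon> \<xi> * (norm (?F \<xi>))\<^sup>2) =
       (LINT \<xi>|lborel. (of_real (gauss_cutoff \<epsilon> \<xi>) * ?F \<xi>) * cnj (?F \<xi>))"
      unfolding integral_complex_of_real[symmetric]
      by (simp add: complex_norm_square mult.assoc del: of_real_power)
    also have "\<dots> = (LINT \<xi>|lborel. (of_real (gauss_cutoff \<epsilon> \<xi>) * ?F \<xi>) * inv_fourier (\<lambda>x. cnj (f x)) \<xi>)"
    proof -
      have "cnj (?F \<xi>) = inv_fourier (\<lambda>x. cnj (f x)) \<xi>" for \<xi>
      proof -
        have "cnj (LINT x|lborel. cis (- (x \<bullet> \<xi>)) * f x) = (LINT x|lborel. cnj (cis (- (x \<bullet> \<xi>)) * f x))"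
          by (rule Bochner_Integration.integral_cnj[symmetric])
        also have "\<dots> = (LINT x|lborel. cis (\<xi> \<bullet> x) * cnj (f x))"
          by (simp only: complex_cnj_mult cis_cnj minus_minus inner_commute)
        finally show ?thesis by (simp only: fourier_eq inv_fourier_eq complex_cnj_mult complex_cnj_complex_of_real)
      qed
      then show ?thesis by simp
    qed
    also have "\<dots> = (LINT x|lborel. inv_fourier (\<lambda>\<xi>. of_real (gauss_cutoff \<epsilon> \<xi>) * ?F \<xi>) x * cnj (f x))"
      using f by (intro inv_fourier_exchange[symmetric] gF) auto
    finally have "(LINT \<xi>|lborel. gauss_cutoff \<epsilon> \<xi> * (norm (?F \<xi>))\<^sup>2) =
      norm (LINT x|lborel. inv_fourier (\<lambda>\<xi>. of_real (gauss_cutoff \<epsilon> \<xi>) * ?F \<xi>) x * cnj (f x))"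
      using gauss_cutoff_bounds(1)[of \<epsilon>]
      by (metis (no_types, lifting) abs_of_nonneg integral_nonneg_AE AE_I2 norm_of_real mult_nonneg_nonneg zero_le_power2)
    also have "\<dots> \<le> (LINT x|lborel. B * norm (f x))"
    proof (rule Bochner_Integration.integral_norm_bound_integral)
      show fB: "integrable lborel (\<lambda>x. B * norm (f x))" using f by auto
      show le: "norm (inv_fourier (\<lambda>\<xi>. of_real (gauss_cutoff \<epsilon> \<xi>) * ?F \<xi>) x * cnj (f x)) \<le> B * norm (f x)" for x
        by (simp add: norm_mult mult_right_mono smooth_bound)
      show "integrable lborel (\<lambda>x. inv_fourier (\<lambda>\<xi>. of_real (gauss_cutoff \<epsilon> \<xi>) * ?F \<xi>) x * cnj (f x))"
        using fB by (rule Bochner_Integration.integrable_bound) (use le B0 in \<open>auto simp: abs_mult\<close>)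
    qed
    finally have "(LINT \<xi>|lborel. gauss_cutoff \<epsilon> \<xi> * (norm (?F \<xi>))\<^sup>2) \<le> B * ?I" by simp
    then show ?thesis
      using int gauss_cutoff_bounds(1)[of \<epsilon>] by (subst nn_integral_eq_integral) (auto intro!: ennreal_leI AE_I2 mult_nonneg_nonneg)
  qed
  define e where "e n = 1 / (real n + 1)" for n
  have e: "e n > 0" for n by (simp add: e_def)
  have e0: "e \<longlonglongrightarrow> 0" unfolding e_def by (rule inverse_Suc_tendsto)
  have "(\<integral>\<^sup>+\<xi>. ennreal ((norm (?F \<xi>))\<^sup>2) \<partial>lborel) =
      (\<integral>\<^sup>+\<xi>. liminf (\<lambda>n. ennreal (gauss_cutoff (e n) \<xi> * (norm (?F \<xi>))\<^sup>2)) \<partial>lborel)"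
  proof (rule nn_integral_cong)
    fix \<xi> :: "real^'n"
    have "(\<lambda>n. ennreal (gauss_cutoff (e n) \<xi> * (norm (?F \<xi>))\<^sup>2)) \<longlonglongrightarrow> ennreal (1 * (norm (?F \<xi>))\<^sup>2)"
      by (intro tendsto_ennrealI tendsto_mult gauss_cutoff_tendsto e0 tendsto_const)
    then show "ennreal ((norm (?F \<xi>))\<^sup>2) = liminf (\<lambda>n. ennreal (gauss_cutoff (e n) \<xi> * (norm (?F \<xi>))\<^sup>2))"
      by (simp add: lim_imp_Liminf)
  qed
  also have "\<dots> \<le> liminf (\<lambda>n. \<integral>\<^sup>+\<xi>. ennreal (gauss_cutoff (e n) \<xi> * (norm (?F \<xi>))\<^sup>2) \<partial>lborel)"
    by (intro nn_integral_liminf) auto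
  also have "\<dots> \<le> liminf (\<lambda>n. ennreal (B * ?I))"
    by (intro Liminf_mono always_eventually allI cut e)
  also have "\<dots> = ennreal (B * ?I)" by (simp add: Liminf_const)
  finally show ?thesis .
qed

text \<open>Used to see that the components of the velocity are square integrable at almost every time.\<close>

lemma plancherel_bound:
  fixes f :: "real^'n::finite \<Rightarrow> complex"
  assumes f: "integrable lborel f" and B: "AE x in lborel. norm (f x) \<le> B" and B0: "B \<ge> 0"
  shows "(\<integral>\<^sup>+\<xi>. ennreal ((norm (inv_fourier f \<xi>))\<^sup>2) \<partial>lborel) \<le> ennreal (B * (LINT x|lborel. norm (f x)))"
proof -
  have [measurable]: "f \<in> borel_measurable borel" using f by auto
  define g where "g x = (if norm (f x) \<le> B then f x else 0)" for x
  have gm[measurable]: "g \<in> borel_measurable borel" unfolding g_def by measurable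
  have fg: "AE x in lborel. f x = g x" using B by eventually_elim (simp add: g_def)
  have g: "integrable lborel g" using f by (rule integrable_cong_AE_imp) (use fg in auto)
  have "(\<integral>\<^sup>+\<xi>. ennreal ((norm (inv_fourier f \<xi>))\<^sup>2) \<partial>lborel) = (\<integral>\<^sup>+\<xi>. ennreal ((norm (fourier g (0 - \<xi>)))\<^sup>2) \<partial>lborel)"
    by (simp add: inv_fourier_eq_fourier fourier_cong_AE[OF fg])
  also have "\<dots> = (\<integral>\<^sup>+\<xi>. ennreal ((norm (fourier g \<xi>))\<^sup>2) \<partial>lborel)"
    by (rule nn_integral_reflect) simp
  also have "\<dots> \<le> ennreal (B * (LINT x|lborel. norm (g x)))"
    by (rule plancherel_bound_fourier[OF g]) (use B0 in \<open>simp add: g_def\<close>)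
  also have "(LINT x|lborel. norm (g x)) = (LINT x|lborel. norm (f x))"
    by (rule integral_cong_AE) (use fg in auto)
  finally show ?thesis .
qed

section \<open>Distributions whose Fourier transform is a function\<close>

subsection \<open>Uniqueness of the Fourier transform\<close>

lemma cutoffD:
  assumes "dyadic_cutoff \<theta>"
  shows "smooth \<theta>" "0 \<le> \<theta> \<xi>" "\<theta> \<xi> \<noteq> 0 \<Longrightarrow> 1/2 \<le> norm \<xi> \<and> norm \<xi> \<le> 2"
    "\<xi> \<noteq> 0 \<Longrightarrow> ((\<lambda>j::int. \<theta> ((2 powi (- j)) *\<^sub>R \<xi>)) has_sum 1) UNIV"
  using assms unfolding dyadic_cutoff_def by blast+

lemma cutoff_zero: "dyadic_cutoff \<theta> \<Longrightarrow> norm x > 2 \<Longrightarrow> \<theta> x = 0"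
  using cutoffD(3) by (meson linorder_not_less)

lemma cutoff_cont: "dyadic_cutoff \<theta> \<Longrightarrow> continuous_on UNIV \<theta>"
  by (intro smooth_continuous cutoffD(1))

lemma cutoff_integrable: "dyadic_cutoff \<theta> \<Longrightarrow> integrable lborel \<theta>"
  by (rule compact_support_integrable[where R=2]) (auto simp: cutoff_zero cutoff_cont)

lemma cutoff_bounded:
  assumes "dyadic_cutoff \<theta>"
  obtains B where "B > 0" "\<And>x. norm (\<theta> x) \<le> B"
proof -
  have "bounded (range \<theta>)"
    by (rule compact_support_bounded[OF cutoff_cont[OF assms], where R=2]) (use cutoff_zero[OF assms] in auto)
  then show ?thesis using that by (auto simp: bounded_pos)
qed

text \<open>Otherwise \<open>\<theta>\<close> and all its dyadic dilates would vanish almost everywhere, against the partition of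
  unity. Hence the cutoff can serve as the mollifier in the uniqueness proof.\<close>

lemma integral_cutoff_nonzero:
  fixes \<theta> :: "real^'n::finite \<Rightarrow> real"
  assumes \<theta>: "dyadic_cutoff \<theta>"
  shows "(LINT x|lborel. \<theta> x) \<noteq> 0"
proof
  assume z: "(LINT x|lborel. \<theta> x) = 0"
  have nn: "0 \<le> \<theta> x" for x using cutoffD(2)[OF \<theta>] .
  have "AE x in lborel. \<theta> x = 0"
    using integral_nonneg_eq_0_iff_AE[OF cutoff_integrable[OF \<theta>]] z nn by auto
  then have "AE x in lborel. \<theta> (0 + (2 powi (- j)) *\<^sub>R x) = 0" for j :: int
    by (rule AE_affine) simp
  then have "AE x in lborel. \<forall>j::int. \<theta> (0 + (2 powi (- j)) *\<^sub>R x) = 0"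
    by (subst AE_all_countable) auto
  moreover have "AE x in lborel. (x::real^'n) \<noteq> 0" by (rule AE_lborel_singleton)
  ultimately have "AE x::real^'n in lborel. False"
  proof eventually_elim
    case (elim x)
    then have "((\<lambda>j::int. 0::real) has_sum 1) UNIV"
      using cutoffD(4)[OF \<theta>, of x] by simp
    moreover have "((\<lambda>j::int. 0::real) has_sum 0) UNIV" by (rule has_sum_0) simp
    ultimately show False by (metis has_sum_unique zero_neq_one)
  qed
  then have "emeasure lborel {x \<in> space (lborel :: (real^'n) measure). True} = 0"
    by (intro emeasure_eq_0_AE) simp
  then show False by simp
qed

lemma bump_test:
  assumes \<theta>: "dyadic_cutoff \<theta>" and a: "a \<noteq> 0"
  shows "(\<lambda>x. complex_of_real (\<theta> (a *\<^sub>R x + b))) \<in> test_functions"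
proof -
  have "norm x \<le> (2 + norm b) / \<bar>a\<bar>" if "\<theta> (a *\<^sub>R x + b) \<noteq> 0" for x
  proof -
    have "norm (a *\<^sub>R x + b) \<le> 2" using cutoff_zero[OF \<theta>] that by (meson linorder_not_less)
    then have "\<bar>a\<bar> * norm x \<le> 2 + norm b"
      using norm_triangle_ineq4[of "a *\<^sub>R x + b" b] by simp
    then show ?thesis using a by (simp add: pos_le_divide_eq mult.commute)
  qed
  then have "bounded {x. complex_of_real (\<theta> (a *\<^sub>R x + b)) \<noteq> 0}"
    by (intro boundedI[of _ "(2 + norm b) / \<bar>a\<bar>"]) auto
  then show ?thesis
    using cutoffD(1)[OF \<theta>] by (auto simp: test_functions_def intro!: smooth_rescale)
qed

lemma indicator_tendsto_off_boundary:
  assumes "y \<in> box a b \<or> y \<notin> cbox a b" "X \<longlonglongrightarrow> y"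
  shows "(\<lambda>n. indicator (cbox a b) (X n) :: 'b::{topological_space,zero_neq_one}) \<longlonglongrightarrow> indicator (cbox a b) y"
proof (rule tendsto_eventually)
  show "\<forall>\<^sub>F n in sequentially. indicator (cbox a b) (X n) = (indicator (cbox a b) y :: 'b)"
  proof (cases "y \<in> box a b")
    case True
    then have "\<forall>\<^sub>F n in sequentially. X n \<in> box a b"
      by (rule topological_tendstoD[OF assms(2) open_box])
    then show ?thesis
      by eventually_elim (use True box_subset_cbox[of a b] in \<open>auto simp: indicator_def\<close>)
  next
    case False
    then have "y \<in> - cbox a b" using assms(1) by auto
    moreover have "open (- cbox a b)" by auto
    ultimately have "\<forall>\<^sub>F n in sequentially. X n \<in> - cbox a b"
      using topological_tendstoD[OF assms(2)] by blast
    then show ?thesis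
      by eventually_elim (use \<open>y \<in> - cbox a b\<close> in \<open>auto simp: indicator_def\<close>)
  qed
qed

text \<open>Mollifying the indicator of the box with the bump \<open>\<theta>\<close> at scale \<open>1 / (n + 1)\<close> gives averages of test
  functions, and these converge to a multiple of the indicator off the boundary of the box.\<close>

lemma locally_integrable_box_integral_zero:
  fixes g :: "real^'n::finite \<Rightarrow> complex" and \<theta> :: "real^'n \<Rightarrow> real"
  assumes \<theta>: "dyadic_cutoff \<theta>"
    and loc: "\<And>K. compact K \<Longrightarrow> set_integrable lborel K g"
    and zero: "\<And>\<phi>. \<phi> \<in> test_functions \<Longrightarrow> (LINT x|lborel. g x * \<phi> x) = 0"
  shows "(LINT x:cbox a b|lborel. g x) = 0"
proof -
  obtain R where R: "R > 0" "cbox a b \<subseteq> cball 0 R"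
    by (metis bounded_cbox bounded_subset_ballD ball_subset_cball subset_trans)
  define K where "K = cball (0::real^'n) (R + 2)"
  define g1 where "g1 y = indicator K y *\<^sub>R g y" for y
  have g1: "integrable lborel g1"
    using loc[of K] by (simp add: K_def g1_def[abs_def] set_integrable_def)
  have [measurable]: "g1 \<in> borel_measurable borel" using g1 by auto
  have \<theta>m[measurable]: "\<theta> \<in> borel_measurable borel" using cutoff_integrable[OF \<theta>] by auto
  obtain B where B: "\<And>x. norm (\<theta> x) \<le> B" by (rule cutoff_bounded[OF \<theta>]) auto
  define e where "e n = 1 / (real n + 1)" for n
  have e: "e n > 0" "e n \<le> 1" for n by (auto simp: e_def)
  have e0: "e \<longlonglongrightarrow> 0" unfolding e_def by (rule inverse_Suc_tendsto)
  let ?I1 = "indicator (cbox a b) :: _ \<Rightarrow> complex"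
  have one: "integrable lborel ?I1"
  proof -
    have "integrable lborel (\<lambda>x. complex_of_real (indicator (cbox a b) x))"
      using emeasure_lborel_cbox_finite by (intro integrable_of_real integrable_real_indicator) auto
    moreover have "complex_of_real (indicator (cbox a b) x) = indicator (cbox a b) x" for x
      by (simp add: indicator_def)
    ultimately show ?thesis by simp
  qed
  define H where "H n y = (LINT z|lborel. of_real (\<theta> z) * ?I1 (y - e n *\<^sub>R z))" for n and y :: "real^'n"
  have Hm[measurable]: "H n \<in> borel_measurable borel" for n unfolding H_def by measurable
  have H_zero: "(LINT y|lborel. g1 y * H n y) = 0" for n
  proof -
    let ?k = "\<lambda>y x. complex_of_real (\<theta> ((1 / e n) *\<^sub>R (y - x)))"
    have "(LINT y|lborel. g1 y * (LINT x|lborel. ?k y x * ?I1 x)) = (LINT x|lborel. ?I1 x * (LINT y|lborel. ?k y x * g1 y))"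
      by (rule fubini_product[OF g1 one, of _ B]) (use B in auto)
    also have "\<dots> = (LINT x|(lborel :: (real^'n) measure). 0)"
    proof (intro Bochner_Integration.integral_cong refl)
      fix x
      show "?I1 x * (LINT y|lborel. ?k y x * g1 y) = 0"
      proof (cases "x \<in> cbox a b")
        case True
        have "?k y x * g1 y = g y * complex_of_real (\<theta> ((1 / e n) *\<^sub>R y + (- (1 / e n) *\<^sub>R x)))" for y
        proof (cases "y \<in> K")
          case False
          then have "norm y > R + 2" by (simp add: K_def)
          moreover have "norm x \<le> R" using True R by auto
          ultimately have "2 < norm (y - x)" using norm_triangle_ineq2[of y x] by linarith
          also have "\<dots> \<le> (1 / e n) * norm (y - x)"
            using e[of n] by (simp add: divide_simps mult_left_le)
          finally have "2 < norm ((1 / e n) *\<^sub>R (y - x))" using e[of n] by simp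
          then show ?thesis using cutoff_zero[OF \<theta>] False by (simp add: g1_def scaleR_diff_right)
        qed (simp add: g1_def scaleR_diff_right)
        moreover have "(LINT y|lborel. g y * complex_of_real (\<theta> ((1 / e n) *\<^sub>R y + (- (1 / e n) *\<^sub>R x)))) = 0"
          by (rule zero[OF bump_test[OF \<theta>]]) (use e[of n] in simp)
        ultimately show ?thesis by simp
      qed simp
    qed
    finally have "(LINT y|lborel. g1 y * (LINT x|lborel. ?k y x * ?I1 x)) = 0" by simp
    moreover have "(LINT x|lborel. ?k y x * ?I1 x) = of_real (e n ^ CARD('n)) * H n y" for y
    proof -
      have "(LINT x|lborel. ?k y x * ?I1 x) =
          \<bar>- e n\<bar> ^ DIM(real^'n) *\<^sub>R (LINT z|lborel. ?k y (y + (- e n) *\<^sub>R z) * ?I1 (y + (- e n) *\<^sub>R z))"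
        by (rule integral_affine) (use e[of n] in auto)
      moreover have "?k y (y + (- e n) *\<^sub>R z) = of_real (\<theta> z)" for z using e[of n] by simp
      ultimately show ?thesis using e[of n] by (simp add: H_def scaleR_conv_of_real[where 'a=complex])
    qed
    ultimately have "(LINT y|lborel. of_real (e n ^ CARD('n)) * (g1 y * H n y)) = 0" by (simp only: mult.left_commute)
    then show ?thesis using e[of n] by simp
  qed
  let ?m = "complex_of_real (LINT x|lborel. \<theta> x)"
  have \<theta>c: "integrable lborel (\<lambda>z. complex_of_real (\<theta> z))" using cutoff_integrable[OF \<theta>] by auto
  have H_lim: "(\<lambda>n. H n y) \<longlonglongrightarrow> ?m * ?I1 y" if y: "y \<in> box a b \<or> y \<notin> cbox a b" for y
  proof -
    have "(\<lambda>n. LINT z|lborel. of_real (\<theta> z) * ?I1 (y - e n *\<^sub>R z)) \<longlonglongrightarrow> (LINT z|lborel. of_real (\<theta> z) * ?I1 y)"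
    proof (rule integral_dominated_convergence)
      show "integrable lborel (\<lambda>z. norm (complex_of_real (\<theta> z)))" using \<theta>c by (rule integrable_norm)
      show "AE z in lborel. (\<lambda>n. of_real (\<theta> z) * ?I1 (y - e n *\<^sub>R z)) \<longlonglongrightarrow> of_real (\<theta> z) * ?I1 y"
      proof (intro AE_I2 tendsto_mult_left indicator_tendsto_off_boundary y)
        fix z
        have "(\<lambda>n. y - e n *\<^sub>R z) \<longlonglongrightarrow> y - 0 *\<^sub>R z" by (intro tendsto_intros e0)
        then show "(\<lambda>n. y - e n *\<^sub>R z) \<longlonglongrightarrow> y" by simp
      qed
      show "AE z in lborel. norm (of_real (\<theta> z) * ?I1 (y - e n *\<^sub>R z)) \<le> norm (complex_of_real (\<theta> z))" for n
        by (intro AE_I2) (auto simp: norm_mult indicator_def)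
    qed auto
    then show ?thesis by (simp add: H_def)
  qed
  have "(\<lambda>n. LINT y|lborel. g1 y * H n y) \<longlonglongrightarrow> (LINT y|lborel. g1 y * (?m * ?I1 y))"
  proof (rule integral_dominated_convergence)
    let ?C = "LINT z|lborel. norm (complex_of_real (\<theta> z))"
    show "integrable lborel (\<lambda>y. norm (g1 y) * ?C)" using g1 by auto
    have "AE y in lborel. y \<notin> cbox a b - box a b"
      using null_sets_cbox_Diff_box[of a b] by (rule AE_not_in)
    then show "AE y in lborel. (\<lambda>n. g1 y * H n y) \<longlonglongrightarrow> g1 y * (?m * ?I1 y)"
      by eventually_elim (intro tendsto_mult_left H_lim, auto)
    show "AE y in lborel. norm (g1 y * H n y) \<le> norm (g1 y) * ?C" for n
    proof (rule AE_I2)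
      fix y
      have "norm (H n y) \<le> ?C"
        unfolding H_def
      proof (rule Bochner_Integration.integral_norm_bound_integral)
        show "integrable lborel (\<lambda>z. norm (complex_of_real (\<theta> z)))" using \<theta>c by (rule integrable_norm)
        show "integrable lborel (\<lambda>z. of_real (\<theta> z) * ?I1 (y - e n *\<^sub>R z))"
          using \<theta>c by (rule Bochner_Integration.integrable_bound) (auto simp: norm_mult indicator_def)
      qed (auto simp: norm_mult indicator_def)
      then show "norm (g1 y * H n y) \<le> norm (g1 y) * ?C" by (simp add: norm_mult mult_left_mono)
    qed
  qed auto
  then have "(LINT y|lborel. g1 y * (?m * ?I1 y)) = 0"
    unfolding H_zero by (simp add: LIMSEQ_const_iff)
  also have "(\<lambda>y. g1 y * (?m * ?I1 y)) = (\<lambda>y. ?m * (indicator (cbox a b) y *\<^sub>R g y))"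
    using R by (force simp: fun_eq_iff g1_def K_def indicator_def)
  also have "(LINT y|lborel. ?m * (indicator (cbox a b) y *\<^sub>R g y)) = ?m * (LINT y|lborel. indicator (cbox a b) y *\<^sub>R g y)"
    by (rule integral_mult_right_zero)
  finally show ?thesis
    using integral_cutoff_nonzero[OF \<theta>] by (simp add: set_lebesgue_integral_def)
qed

text \<open>All integrals over boxes vanish, so Lebesgue's differentiation theorem applies.\<close>

lemma locally_integrable_eq_zero:
  fixes g :: "real^'n::finite \<Rightarrow> complex" and \<theta> :: "real^'n \<Rightarrow> real"
  assumes \<theta>: "dyadic_cutoff \<theta>"
    and loc: "\<And>K. compact K \<Longrightarrow> set_integrable lborel K g"
    and zero: "\<And>\<phi>. \<phi> \<in> test_functions \<Longrightarrow> (LINT x|lborel. g x * \<phi> x) = 0"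
  shows "AE x in lborel. g x = 0"
proof -
  have int: "g integrable_on cbox a b" and int0: "integral (cbox a b) g = 0" for a b
    using set_borel_integral_eq_integral[OF loc[OF compact_cbox]]
      locally_integrable_box_integral_zero[OF assms] by auto
  obtain N where N: "negligible N"
    "\<And>x e. x \<notin> N \<Longrightarrow> 0 < e \<Longrightarrow> \<exists>d>0. \<forall>h. 0 < h \<and> h < d \<longrightarrow>
        norm (integral (cbox x (x + h *\<^sub>R One)) g /\<^sub>R h ^ DIM(real^'n) - g x) < e"
    using integrable_ccontinuous_explicit[of g] int by blast
  have "g x = 0" if x: "x \<notin> N" for x
  proof (rule ccontr)
    assume "g x \<noteq> 0"
    then obtain d where "d > 0" "\<forall>h. 0 < h \<and> h < d \<longrightarrow>
        norm (integral (cbox x (x + h *\<^sub>R One)) g /\<^sub>R h ^ DIM(real^'n) - g x) < norm (g x)"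
      using N(2)[OF x, of "norm (g x)"] by auto
    then show False by (auto simp: int0 dest!: spec[of _ "d/2"])
  qed
  moreover have "AE x in lebesgue. x \<notin> N"
    using N(1) by (intro AE_not_in) (simp add: negligible_iff_null_sets)
  ultimately have "AE x in lebesgue. g x = 0" by (auto elim: eventually_mono)
  then show ?thesis by (simp add: AE_completion_iff)
qed

subsection \<open>Locally integrable functions\<close>

definition locally_integrable :: "(real^'n::finite \<Rightarrow> 'b::euclidean_space) \<Rightarrow> bool" where
  "locally_integrable g \<longleftrightarrow> (\<forall>K. compact K \<longrightarrow> set_integrable lborel K g)"

lemma locally_integrableD:
  "locally_integrable g \<Longrightarrow> compact K \<Longrightarrow> integrable lborel (\<lambda>x. indicator K x *\<^sub>R g x)"
  by (simp add: locally_integrable_def set_integrable_def)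

lemma measurable_vec:
  fixes f :: "'a \<Rightarrow> 'b::euclidean_space^'n::finite"
  assumes "\<And>i. (\<lambda>x. f x $ i) \<in> borel_measurable M"
  shows "f \<in> borel_measurable M"
proof (subst borel_measurable_euclidean_space, rule ballI)
  fix b :: "'b^'n" assume "b \<in> Basis"
  then obtain i u where "b = axis i u" by (auto simp: Basis_vec_def)
  then show "(\<lambda>x. f x \<bullet> b) \<in> borel_measurable M"
    using assms[of i] by (simp add: inner_axis)
qed

lemma measurable_vec_nth[measurable (raw)]:
  fixes f :: "'a \<Rightarrow> 'b::euclidean_space^'n::finite"
  assumes "f \<in> borel_measurable M"
  shows "(\<lambda>x. f x $ i) \<in> borel_measurable M"
  using measurable_compose[OF assms, of "\<lambda>v. v $ i" borel]
  by (simp add: borel_measurable_continuous_onI continuous_intros)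

lemma measurable_vec_lambda[measurable (raw)]:
  fixes f :: "'n::finite \<Rightarrow> 'a \<Rightarrow> 'b::euclidean_space"
  assumes "\<And>i. f i \<in> borel_measurable M"
  shows "(\<lambda>x. \<chi> i. f i x) \<in> borel_measurable M"
  by (rule measurable_vec) (simp add: assms)

lemma locally_integrable_measurable:
  fixes g :: "real^'n::finite \<Rightarrow> 'b::euclidean_space"
  assumes "locally_integrable g"
  shows "g \<in> borel_measurable borel"
proof (rule borel_measurable_LIMSEQ_metric)
  show "(\<lambda>x. indicator (cball 0 (real n)) x *\<^sub>R g x) \<in> borel_measurable borel" for n
    using borel_measurable_integrable[OF locally_integrableD[OF assms compact_cball]] by simp
  show "(\<lambda>n. indicator (cball 0 (real n)) x *\<^sub>R g x) \<longlonglongrightarrow> g x" for x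
  proof (rule tendsto_eventually)
    obtain N where "norm x \<le> real N" using real_arch_simple by blast
    then show "\<forall>\<^sub>F n in sequentially. indicator (cball 0 (real n)) x *\<^sub>R g x = g x"
      by (intro eventually_sequentiallyI[of N]) (auto simp: indicator_def)
  qed
qed

lemma locally_integrable_bound:
  fixes g :: "real^'n::finite \<Rightarrow> 'b::euclidean_space" and h :: "real^'n \<Rightarrow> 'c::euclidean_space"
  assumes "locally_integrable g" "h \<in> borel_measurable borel"
    and "AE x in lborel. norm (h x) \<le> C * norm (g x)"
  shows "locally_integrable h"
  unfolding locally_integrable_def set_integrable_def
proof (intro allI impI)
  fix K :: "(real^'n) set" assume K: "compact K"
  then have [measurable]: "K \<in> sets borel" by (simp add: borel_closed compact_imp_closed)
  have "integrable lborel (\<lambda>x. C * norm (indicator K x *\<^sub>R g x))"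
    by (intro integrable_mult_right integrable_norm locally_integrableD[OF assms(1) K])
  then show "integrable lborel (\<lambda>x. indicator K x *\<^sub>R h x)"
    by (rule Bochner_Integration.integrable_bound)
      (use assms in \<open>auto simp: indicator_def elim!: eventually_mono\<close>)
qed

lemma integrable_locally_integrable:
  "integrable lborel g \<Longrightarrow> locally_integrable g"
  unfolding locally_integrable_def set_integrable_def
  by (auto intro!: integrable_mult_indicator simp: borel_closed compact_imp_closed)

lemma locally_integrable_nth:
  fixes g :: "real^'n::finite \<Rightarrow> complex^'m::finite"
  assumes "locally_integrable g"
  shows "locally_integrable (\<lambda>x. g x $ i)"
  by (rule locally_integrable_bound[OF assms, where C=1])
    (use locally_integrable_measurable[OF assms] in \<open>auto simp: Finite_Cartesian_Product.norm_nth_le\<close>)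

lemma locally_integrable_times_test:
  fixes g :: "real^'n::finite \<Rightarrow> complex"
  assumes "locally_integrable g" "\<phi> \<in> test_functions"
  shows "integrable lborel (\<lambda>x. g x * \<phi> x)"
proof -
  obtain R where R: "\<And>x. norm x > R \<Longrightarrow> \<phi> x = 0" by (rule test_support[OF assms(2)]) auto
  obtain B where B: "B > 0" "\<And>x. norm (\<phi> x) \<le> B" by (rule test_bounded[OF assms(2)]) auto
  have [measurable]: "g \<in> borel_measurable borel" "\<phi> \<in> borel_measurable borel"
    using assms locally_integrable_measurable test_measurable by auto
  have "integrable lborel (\<lambda>x. B * norm (indicator (cball 0 R) x *\<^sub>R g x))"
    by (intro integrable_mult_right integrable_norm locally_integrableD[OF assms(1) compact_cball])
  then show ?thesis
  proof (rule Bochner_Integration.integrable_bound)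
    have "norm (g x * \<phi> x) \<le> norm (B * norm (indicator (cball 0 R) x *\<^sub>R g x))" for x
    proof (cases "norm x > R")
      case False
      then show ?thesis using B by (simp add: norm_mult mult.commute[of B] mult_left_mono)
    qed (simp add: R)
    then show "AE x in lborel. norm (g x * \<phi> x) \<le> norm (B * norm (indicator (cball 0 R) x *\<^sub>R g x))" by simp
  qed auto
qed

subsection \<open>Locally integrable Fourier transforms and Fourier multipliers\<close>

lemma dist_of_nth[simp]: "dist_of w \<phi> $ i = (LINT x|lborel. w x $ i * \<phi> x)"
  by (simp add: dist_of_def)

lemma dist_of_cong_AE:
  assumes "AE x in lborel. w x = w' x"
    "w \<in> borel_measurable borel" "w' \<in> borel_measurable borel" "\<phi> \<in> borel_measurable borel"
  shows "dist_of w \<phi> = dist_of w' \<phi>"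
proof (unfold vec_eq_iff dist_of_nth, rule allI, rule integral_cong_AE)
  fix i
  show "AE x in lborel. w x $ i * \<phi> x = w' x $ i * \<phi> x"
    using assms(1) by eventually_elim simp
qed (use assms in auto)

lemma has_hat_iff: "has_hat T g \<longleftrightarrow> locally_integrable g \<and> (\<forall>\<phi>\<in>test_functions. T (fourier \<phi>) = dist_of g \<phi>)"
  unfolding has_hat_def locally_integrable_def dist_fourier_def by (auto simp: test_iff)

lemma has_hat_unique:
  assumes \<theta>: "dyadic_cutoff (\<theta> :: real^'n::finite \<Rightarrow> real)" and g: "has_hat (T :: 'n dist) g" and h: "has_hat T h"
  shows "AE x in lborel. g x = h x"
proof -
  have "AE x in lborel. g x $ i - h x $ i = 0" for i
  proof (rule locally_integrable_eq_zero[OF \<theta>])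
    have gi: "locally_integrable (\<lambda>x. g x $ i)" and hi: "locally_integrable (\<lambda>x. h x $ i)"
      using g h by (auto simp: has_hat_iff locally_integrable_nth)
    show "set_integrable lborel K (\<lambda>x. g x $ i - h x $ i)" if "compact K" for K
      using gi hi that unfolding locally_integrable_def by (intro set_integral_diff) auto
    show "(LINT x|lborel. (g x $ i - h x $ i) * \<phi> x) = 0" if \<phi>: "\<phi> \<in> test_functions" for \<phi>
    proof -
      have "dist_of g \<phi> $ i = dist_of h \<phi> $ i" using g h \<phi> by (simp add: has_hat_iff)
      then show ?thesis
        using locally_integrable_times_test[OF gi \<phi>] locally_integrable_times_test[OF hi \<phi>]
        by (simp add: left_diff_distrib)
    qed
  qed
  then have "AE x in lborel. \<forall>i. g x $ i - h x $ i = 0" by (subst AE_all_countable) auto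
  then show ?thesis by eventually_elim (simp add: vec_eq_iff)
qed

lemma has_hat_fhat: "has_hat T g \<Longrightarrow> has_hat T (fhat T)"
  using someI[of "has_hat T"] unfolding fhat_def by blast

lemma fhat_AE:
  assumes "dyadic_cutoff (\<theta> :: real^'n::finite \<Rightarrow> real)" "has_hat (T :: 'n dist) g"
  shows "AE x in lborel. fhat T x = g x"
  using has_hat_unique[OF assms(1) has_hat_fhat[OF assms(2)] assms(2)] .

lemma inv_fourier_fourier_test_fun: "\<phi> \<in> test_functions \<Longrightarrow> inv_fourier (fourier \<phi>) = \<phi>"
  by (rule ext) (rule inv_fourier_fourier_test)

lemma has_hat_inv_fourier:
  "locally_integrable w \<Longrightarrow> has_hat (dist_inv_fourier (dist_of w)) w"
  by (simp add: has_hat_iff dist_inv_fourier_def inv_fourier_fourier_test_fun)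

lemma has_hat_cong_AE:
  assumes "has_hat T g" "AE x in lborel. g x = h x" "h \<in> borel_measurable borel"
  shows "has_hat T h"
proof -
  have gm: "g \<in> borel_measurable borel" using assms(1) by (simp add: has_hat_iff locally_integrable_measurable)
  have "locally_integrable h"
    by (rule locally_integrable_bound[of g, where C=1])
      (use assms in \<open>auto simp: has_hat_iff elim: eventually_mono\<close>)
  moreover have "dist_of g \<phi> = dist_of h \<phi>" if "\<phi> \<in> test_functions" for \<phi>
    using assms gm test_measurable[OF that] by (intro dist_of_cong_AE) auto
  ultimately show ?thesis using assms(1) by (simp add: has_hat_iff)
qed

lemma matrix_vector_measurable[measurable (raw)]:
  fixes m :: "'a \<Rightarrow> complex^'n^'m::finite" and g :: "'a \<Rightarrow> complex^'n::finite"
  assumes [measurable]: "m \<in> borel_measurable M" "g \<in> borel_measurable M"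
  shows "(\<lambda>x. m x *v g x) \<in> borel_measurable M"
  unfolding matrix_vector_mult_def by measurable

lemma fourier_mult_apply:
  fixes T :: "'n::finite dist"
  assumes \<theta>: "dyadic_cutoff (\<theta> :: real^'n \<Rightarrow> real)" and g: "has_hat T g"
    and m[measurable]: "m \<in> borel_measurable borel" and \<phi>: "\<phi> \<in> test_functions"
  shows "fourier_mult m T (fourier \<phi>) = dist_of (\<lambda>\<xi>. m \<xi> *v g \<xi>) \<phi>"
proof -
  have [measurable]: "g \<in> borel_measurable borel" "fhat T \<in> borel_measurable borel"
    using g has_hat_fhat[OF g] by (auto simp: has_hat_iff locally_integrable_measurable)
  have "fourier_mult m T (fourier \<phi>) = dist_of (\<lambda>\<xi>. m \<xi> *v fhat T \<xi>) \<phi>"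
    by (simp add: fourier_mult_def dist_inv_fourier_def inv_fourier_fourier_test_fun[OF \<phi>])
  also have "\<dots> = dist_of (\<lambda>\<xi>. m \<xi> *v g \<xi>) \<phi>"
    by (rule dist_of_cong_AE) (use fhat_AE[OF \<theta> g] test_measurable[OF \<phi>] in \<open>auto elim: eventually_mono\<close>)
  finally show ?thesis .
qed

lemma has_hat_fourier_mult:
  fixes T :: "'n::finite dist"
  assumes "dyadic_cutoff (\<theta> :: real^'n \<Rightarrow> real)" "has_hat T g"
    and "m \<in> borel_measurable borel" "locally_integrable (\<lambda>\<xi>. m \<xi> *v g \<xi>)"
  shows "has_hat (fourier_mult m T) (\<lambda>\<xi>. m \<xi> *v g \<xi>)"
  using assms(4) fourier_mult_apply[OF assms(1-3)] by (auto simp: has_hat_iff)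

lemma mat_mult_vec: "mat c *v (x :: complex^'n::finite) = c *s x"
  by (simp add: vec_eq_iff matrix_vector_mult_def mat_def if_distrib[where f="\<lambda>z. z * _"] cong: if_cong)

lemma schwartz_seminorm_bound:
  fixes \<phi> :: "real^'n::finite \<Rightarrow> complex"
  assumes \<phi>: "\<phi> \<in> schwartz"
  shows "(1 + norm x) ^ N * norm (\<phi> x) \<le> schwartz_seminorm N \<phi>"
proof -
  let ?f = "\<lambda>ks x. (1 + norm x) ^ N * norm (foldr pd ks \<phi> x)"
  have bdd: "bdd_above (range (?f ks))" for ks
  proof -
    have "bounded (range (\<lambda>x. (1 + norm x) ^ N *\<^sub>R foldr pd ks \<phi> x))" using \<phi> unfolding schwartz_def by blast
    then obtain B where "\<And>x. norm ((1 + norm x) ^ N *\<^sub>R foldr pd ks \<phi> x) \<le> B" by (auto simp: bounded_iff)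
    then show ?thesis by (intro bdd_aboveI2[of _ _ B]) simp
  qed
  have fin: "finite {ks :: 'n list. length ks \<le> N}"
    using finite_lists_length_le[of "UNIV :: 'n set" N] by simp
  have "?f [] x \<le> (SUP x. ?f [] x)" by (rule cSUP_upper[OF _ bdd]) simp
  also have "\<dots> \<le> (\<Sum>ks | length ks \<le> N. SUP x. ?f ks x)"
  proof (rule member_le_sum[OF _ _ fin])
    show "0 \<le> (SUP x. ?f ks x)" for ks
      by (rule cSUP_upper2[OF bdd, of undefined]) auto
  qed simp
  finally show ?thesis by (simp add: schwartz_seminorm_def)
qed

text \<open>The inverse transform of a Schwartz function is bounded by its integral, hence by a seminorm of order
  \<open>2 d\<close>, where \<open>d\<close> is the dimension.\<close>

lemma tempered_inv_fourier:
  fixes w :: "real^'n::finite \<Rightarrow> complex^'n"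
  assumes w: "integrable lborel w"
  shows "tempered (dist_inv_fourier (dist_of w))"
proof -
  have wi: "integrable lborel (\<lambda>x. w x $ i)" for i
    by (rule integrable_bounded_linear[OF bounded_linear_vec_nth w])
  have [measurable]: "w \<in> borel_measurable borel" using w by auto
  let ?N = "2 * DIM(real^'n)" and ?I = "LINT x|lborel. norm (w x)" and ?c = "fconst TYPE('n)"
  let ?J = "LINT x|lborel. 1 / (1 + norm (x::real^'n)) ^ ?N"
  have int: "integrable lborel (\<lambda>x. w x $ i * inv_fourier \<phi> x)" if \<phi>: "\<phi> \<in> schwartz" for \<phi> i
  proof (rule Bochner_Integration.integrable_bound)
    show "integrable lborel (\<lambda>x. (?c * (LINT x|lborel. norm (\<phi> x))) *\<^sub>R (w x $ i))" using wi by auto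
    have "norm (w x $ i * inv_fourier \<phi> x) \<le> norm ((?c * (LINT x|lborel. norm (\<phi> x))) *\<^sub>R (w x $ i))" for x
    proof -
      have "norm (w x $ i) * norm (inv_fourier \<phi> x) \<le> norm (w x $ i) * \<bar>?c * (LINT x|lborel. norm (\<phi> x))\<bar>"
        by (intro mult_left_mono order_trans[OF norm_inv_fourier_le] abs_ge_self) auto
      then show ?thesis by (simp add: norm_mult mult.commute)
    qed
    then show "AE x in lborel. norm (w x $ i * inv_fourier \<phi> x) \<le> norm ((?c * (LINT x|lborel. norm (\<phi> x))) *\<^sub>R (w x $ i))" by simp
  qed (use schwartz_measurable[OF that] in auto)
  have bound: "norm (LINT x|lborel. w x $ i * inv_fourier \<phi> x) \<le> ?I * ?c * ?J * schwartz_seminorm ?N \<phi>" if \<phi>: "\<phi> \<in> schwartz" for \<phi> i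
  proof -
    have "(LINT x|lborel. norm (\<phi> x)) \<le> (LINT x|lborel. schwartz_seminorm ?N \<phi> * (1 / (1 + norm (x::real^'n)) ^ ?N))"
    proof (rule integral_mono)
      show "integrable lborel (\<lambda>x. norm (\<phi> x))" using schwartz_integrable[OF \<phi>] by auto
      show "integrable lborel (\<lambda>x::real^'n. schwartz_seminorm ?N \<phi> * (1 / (1 + norm (x::real^'n)) ^ ?N))"
        by (intro integrable_mult_right integrable_poly_decay)
      show "norm (\<phi> x) \<le> schwartz_seminorm ?N \<phi> * (1 / (1 + norm x) ^ ?N)" for x
        using schwartz_seminorm_bound[OF \<phi>, of x ?N] by (simp add: pos_le_divide_eq add_pos_nonneg mult.commute)
    qed
    also have "\<dots> = schwartz_seminorm ?N \<phi> * ?J" by (rule integral_mult_right_zero)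
    finally have *: "norm (inv_fourier \<phi> x) \<le> ?c * (schwartz_seminorm ?N \<phi> * ?J)" for x
      by (intro order_trans[OF norm_inv_fourier_le] mult_left_mono) (auto simp: less_imp_le)
    have "norm (LINT x|lborel. w x $ i * inv_fourier \<phi> x) \<le> (LINT x|lborel. norm (w x) * (?c * (schwartz_seminorm ?N \<phi> * ?J)))"
    proof (rule Bochner_Integration.integral_norm_bound_integral[OF int[OF \<phi>]])
      show "integrable lborel (\<lambda>x. norm (w x) * (?c * (schwartz_seminorm ?N \<phi> * ?J)))" using w by auto
      show "norm (w x $ i * inv_fourier \<phi> x) \<le> norm (w x) * (?c * (schwartz_seminorm ?N \<phi> * ?J))" for x
        unfolding norm_mult by (intro mult_mono * Finite_Cartesian_Product.norm_nth_le) auto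
    qed
    then show ?thesis by (simp add: mult_ac)
  qed
  have inv_add: "inv_fourier (\<lambda>x. \<phi> x + \<psi> x) x = inv_fourier \<phi> x + inv_fourier \<psi> x"
    if "\<phi> \<in> schwartz" "\<psi> \<in> schwartz" for \<phi> \<psi> :: "real^'n \<Rightarrow> complex" and x
    using fourier_add schwartz_integrable that by (auto simp: inv_fourier_eq_fourier)
  have inv_c: "inv_fourier (\<lambda>x. c * \<phi> x) x = c * inv_fourier \<phi> x" for c x and \<phi> :: "real^'n \<Rightarrow> complex"
    by (simp add: inv_fourier_eq_fourier fourier_cmult)
  show ?thesis
    unfolding tempered_def dist_inv_fourier_def
  proof (intro conjI ballI allI exI)
    fix \<phi> \<psi> :: "real^'n \<Rightarrow> complex" assume s: "\<phi> \<in> schwartz" "\<psi> \<in> schwartz"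
    show "dist_of w (inv_fourier (\<lambda>x. \<phi> x + \<psi> x)) = dist_of w (inv_fourier \<phi>) + dist_of w (inv_fourier \<psi>)"
      using int[OF s(1)] int[OF s(2)] by (simp add: vec_eq_iff inv_add[OF s] distrib_left)
  next
    fix c and \<phi> :: "real^'n \<Rightarrow> complex" assume s: "\<phi> \<in> schwartz"
    show "dist_of w (inv_fourier (\<lambda>x. c * \<phi> x)) = c *s dist_of w (inv_fourier \<phi>)"
      by (simp add: vec_eq_iff inv_c mult.left_commute[of _ c])
  next
    fix \<phi> :: "real^'n \<Rightarrow> complex" assume s: "\<phi> \<in> schwartz"
    have "norm (dist_of w (inv_fourier \<phi>)) \<le> (\<Sum>i\<in>UNIV. norm (dist_of w (inv_fourier \<phi>) $ i))"
      by (simp add: norm_vec_def L2_set_le_sum)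
    also have "\<dots> \<le> (\<Sum>i\<in>(UNIV::'n set). ?I * ?c * ?J * schwartz_seminorm ?N \<phi>)"
      unfolding dist_of_nth by (intro sum_mono bound s)
    finally show "norm (dist_of w (inv_fourier \<phi>)) \<le> (real CARD('n) * (?I * ?c * ?J)) * schwartz_seminorm ?N \<phi>"
      by (simp add: mult_ac)
  qed
qed

section \<open>An a priori estimate for the quadratic integral inequality\<close>

subsection \<open>The bilinear estimate\<close>

lemma nn_integral_exp_decay:
  fixes a c :: real
  assumes "a > 0"
  shows "(\<integral>\<^sup>+t. ennreal (a * exp (- a * (t - c))) * indicator {c..} t \<partial>lborel) = 1"
proof -
  have "(\<integral>\<^sup>+t. ennreal (a * exp (- a * (t - c))) * indicator {c..} t \<partial>lborel) = ennreal (0 - (- exp (- a * (c - c))))"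
  proof (rule nn_integral_FTC_atLeast[where F="\<lambda>t. - exp (- a * (t - c))"])
    show "((\<lambda>t. - exp (- a * (t - c))) has_real_derivative a * exp (- a * (t - c))) (at t)" for t
      by (auto intro!: derivative_eq_intros)
    have "((\<lambda>t. exp (- a * (t - c))) \<longlongrightarrow> 0) at_top"
    proof (rule filterlim_compose[OF exp_at_bot])
      have "filterlim (\<lambda>t. t + (- c)) at_top at_top"
        using filterlim_tendsto_add_at_top[OF tendsto_const filterlim_ident, of "-c"] by (simp add: add.commute)
      then show "filterlim (\<lambda>t. - a * (t - c)) at_bot at_top"
        using assms by (intro filterlim_tendsto_neg_mult_at_bot[OF tendsto_const]) auto
    qed
    then show "((\<lambda>t. - exp (- a * (t - c))) \<longlongrightarrow> 0) at_top"
      by (rule tendsto_eq_rhs[OF tendsto_minus]) simp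
  qed (use assms in auto)
  then show ?thesis by simp
qed

text \<open>The factor \<open>norm \<xi>\<close> is the size of the divergence in the nonlinear term.\<close>

definition heat_kernel :: "real \<Rightarrow> real \<Rightarrow> real \<Rightarrow> 'a::real_normed_vector \<Rightarrow> ennreal" where
  "heat_kernel \<kappa> t \<tau> \<xi> = indicator {0<..<t} \<tau> * ennreal (norm \<xi> * exp (- \<kappa> * (t - \<tau>) * (norm \<xi>)\<^sup>2))"

lemma heat_kernel_measurable[measurable]:
  fixes g :: "'b \<Rightarrow> 'a::euclidean_space"
  assumes [measurable]: "f \<in> borel_measurable M" "h \<in> borel_measurable M" "g \<in> borel_measurable M"
  shows "(\<lambda>x. heat_kernel \<kappa> (f x) (h x) (g x)) \<in> borel_measurable M"
proof -
  have eq: "heat_kernel \<kappa> (f x) (h x) (g x) = (if 0 < h x \<and> h x < f x then 1 else 0) *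
      ennreal (norm (g x) * exp (- \<kappa> * (f x - h x) * (norm (g x))\<^sup>2))" for x
    by (simp add: heat_kernel_def indicator_def)
  show ?thesis unfolding eq by measurable
qed

text \<open>The factor \<open>(norm \<xi>)\<^sup>2\<close> of the square equals the decay rate of the exponential up to \<open>2 \<kappa>\<close>, so the
  bound does not depend on \<open>\<xi>\<close>.\<close>

lemma heat_kernel_square_integral:
  fixes \<xi> :: "'a::real_normed_vector"
  assumes "\<kappa> > 0"
  shows "(\<integral>\<^sup>+t. (heat_kernel \<kappa> t \<tau> \<xi>)\<^sup>2 \<partial>lborel) \<le> ennreal (1 / (2 * \<kappa>))"
proof (cases "\<xi> = 0")
  case True
  then show ?thesis by (simp add: heat_kernel_def)
next
  case False
  define a where "a = 2 * \<kappa> * (norm \<xi>)\<^sup>2"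
  have a: "a > 0" using False assms by (simp add: a_def)
  have "(heat_kernel \<kappa> t \<tau> \<xi>)\<^sup>2 \<le> ennreal (1 / (2 * \<kappa>)) * (ennreal (a * exp (- a * (t - \<tau>))) * indicator {\<tau>..} t)" for t
  proof (cases "0 < \<tau> \<and> \<tau> < t")
    case True
    have "(norm \<xi> * exp (- \<kappa> * (t - \<tau>) * (norm \<xi>)\<^sup>2))\<^sup>2 = 1 / (2 * \<kappa>) * (a * exp (- a * (t - \<tau>)))"
      using assms by (simp add: a_def power_mult_distrib power2_eq_square[of "exp _"] exp_add[symmetric] algebra_simps)
    then show ?thesis using True a assms
      by (simp add: heat_kernel_def ennreal_power ennreal_mult[symmetric] less_imp_le)
  qed (auto simp: heat_kernel_def indicator_def)
  then have "(\<integral>\<^sup>+t. (heat_kernel \<kappa> t \<tau> \<xi>)\<^sup>2 \<partial>lborel) \<le>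
      (\<integral>\<^sup>+t. ennreal (1 / (2 * \<kappa>)) * (ennreal (a * exp (- a * (t - \<tau>))) * indicator {\<tau>..} t) \<partial>lborel)"
    by (intro nn_integral_mono)
  also have "\<dots> = ennreal (1 / (2 * \<kappa>))"
    by (subst nn_integral_cmult) (auto simp: nn_integral_exp_decay[OF a, of \<tau>, simplified])
  finally show ?thesis .
qed

lemma heat_kernel_square_integral':
  fixes \<xi> :: "'a::real_normed_vector"
  assumes "\<kappa> > 0"
  shows "(\<integral>\<^sup>+\<tau>. (heat_kernel \<kappa> t \<tau> \<xi>)\<^sup>2 \<partial>lborel) \<le> ennreal (1 / (2 * \<kappa>))"
proof -
  have le: "(heat_kernel \<kappa> t \<tau> \<xi>)\<^sup>2 \<le> (indicator {0<..} (t - \<tau>) * ennreal (norm \<xi> * exp (- \<kappa> * (t - \<tau>) * (norm \<xi>)\<^sup>2)))\<^sup>2" for \<tau>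
    by (intro power_mono) (auto simp: heat_kernel_def indicator_def)
  have "(\<integral>\<^sup>+\<tau>. (heat_kernel \<kappa> t \<tau> \<xi>)\<^sup>2 \<partial>lborel) \<le>
      (\<integral>\<^sup>+\<tau>. (indicator {0<..} (t - \<tau>) * ennreal (norm \<xi> * exp (- \<kappa> * (t - \<tau>) * (norm \<xi>)\<^sup>2)))\<^sup>2 \<partial>lborel)"
    by (intro nn_integral_mono le)
  also have "\<dots> = (\<integral>\<^sup>+s. (indicator {0<..} s * ennreal (norm \<xi> * exp (- \<kappa> * s * (norm \<xi>)\<^sup>2)))\<^sup>2 \<partial>lborel)"
    by (rule nn_integral_reflect[of "\<lambda>s. (indicator {0<..} s * ennreal (norm \<xi> * exp (- \<kappa> * s * (norm \<xi>)\<^sup>2)))\<^sup>2" t]) measurable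
  also have "\<dots> = (\<integral>\<^sup>+s. (indicator {0<..} (-1 + s) * ennreal (norm \<xi> * exp (- \<kappa> * (-1 + s) * (norm \<xi>)\<^sup>2)))\<^sup>2 \<partial>lborel)"
    by (rule nn_integral_translate[of "\<lambda>s. (indicator {0<..} s * ennreal (norm \<xi> * exp (- \<kappa> * s * (norm \<xi>)\<^sup>2)))\<^sup>2" "-1", symmetric]) measurable
  also have "\<dots> = (\<integral>\<^sup>+s. (heat_kernel \<kappa> s 1 \<xi>)\<^sup>2 \<partial>lborel)"
    by (intro nn_integral_cong) (auto simp: heat_kernel_def indicator_def)
  also have "\<dots> \<le> ennreal (1 / (2 * \<kappa>))" by (rule heat_kernel_square_integral[OF assms])
  finally show ?thesis .
qed

definition duhamel :: "real \<Rightarrow> (real \<times> 'a::euclidean_space \<Rightarrow> ennreal) \<Rightarrow> real \<times> 'a \<Rightarrow> ennreal" where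
  "duhamel \<kappa> F = (\<lambda>(t, \<xi>). \<integral>\<^sup>+\<tau>. heat_kernel \<kappa> t \<tau> \<xi> * F (\<tau>, \<xi>) \<partial>lborel)"

definition star :: "(real \<times> 'a::euclidean_space \<Rightarrow> ennreal) \<Rightarrow> (real \<times> 'a \<Rightarrow> ennreal) \<Rightarrow> real \<times> 'a \<Rightarrow> ennreal" where
  "star f g = (\<lambda>(\<tau>, \<xi>). \<integral>\<^sup>+\<eta>. f (\<tau>, \<eta>) * g (\<tau>, \<xi> - \<eta>) \<partial>lborel)"

definition mass :: "(real \<times> 'a::euclidean_space \<Rightarrow> ennreal) \<Rightarrow> real \<Rightarrow> ennreal" where
  "mass f t = (\<integral>\<^sup>+\<xi>. f (t, \<xi>) \<partial>lborel)"

lemma duhamel_measurable[measurable]: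
  assumes [measurable]: "F \<in> borel_measurable (borel \<Otimes>\<^sub>M borel)"
  shows "duhamel \<kappa> F \<in> borel_measurable (borel \<Otimes>\<^sub>M borel)"
  unfolding duhamel_def by measurable

lemma star_measurable[measurable]:
  assumes [measurable]: "f \<in> borel_measurable (borel \<Otimes>\<^sub>M borel)" "g \<in> borel_measurable (borel \<Otimes>\<^sub>M borel)"
  shows "star f g \<in> borel_measurable (borel \<Otimes>\<^sub>M borel)"
  unfolding star_def by measurable

lemma mass_measurable[measurable]:
  assumes [measurable]: "f \<in> borel_measurable (borel \<Otimes>\<^sub>M borel)"
  shows "mass f \<in> borel_measurable borel"
  unfolding mass_def[abs_def] by measurable

lemma mass_star:
  assumes [measurable]: "f \<in> borel_measurable (borel \<Otimes>\<^sub>M borel)" "g \<in> borel_measurable (borel \<Otimes>\<^sub>M borel)"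
  shows "mass (star f g) \<tau> = mass f \<tau> * mass g \<tau>"
proof -
  have "mass (star f g) \<tau> = (\<integral>\<^sup>+\<eta>. (\<integral>\<^sup>+\<xi>. f (\<tau>, \<eta>) * g (\<tau>, \<xi> - \<eta>) \<partial>lborel) \<partial>lborel)"
    unfolding mass_def star_def split_conv by (rule lborel_pair.Fubini') measurable
  also have "\<dots> = (\<integral>\<^sup>+\<eta>. f (\<tau>, \<eta>) * mass g \<tau> \<partial>lborel)"
  proof (rule nn_integral_cong)
    fix \<eta> :: 'a
    have "(\<integral>\<^sup>+\<xi>. g (\<tau>, - \<eta> + \<xi>) \<partial>lborel) = mass g \<tau>"
      unfolding mass_def by (rule nn_integral_translate) measurable
    then show "(\<integral>\<^sup>+\<xi>. f (\<tau>, \<eta>) * g (\<tau>, \<xi> - \<eta>) \<partial>lborel) = f (\<tau>, \<eta>) * mass g \<tau>"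
      by (subst nn_integral_cmult) (auto simp: add.commute)
  qed
  also have "\<dots> = mass f \<tau> * mass g \<tau>"
    unfolding mass_def by (rule nn_integral_multc) measurable
  finally show ?thesis .
qed

text \<open>Cauchy--Schwarz for the measure with density \<open>F\<close>: the kernel is square integrable in \<open>t\<close>, uniformly in
  the other variables. Applied to \<open>F = star f g\<close>, this is a bilinear estimate in \<open>L\<^sup>2\<close> in time with
  values in \<open>L\<^sup>1\<close>.\<close>

lemma duhamel_estimate:
  fixes F :: "real \<times> 'a::euclidean_space \<Rightarrow> ennreal"
  assumes [measurable]: "F \<in> borel_measurable (borel \<Otimes>\<^sub>M borel)" and \<kappa>: "\<kappa> > 0"
  shows "(\<integral>\<^sup>+t. (mass (duhamel \<kappa> F) t)\<^sup>2 \<partial>lborel) \<le> ennreal (1 / (2 * \<kappa>)) * (\<integral>\<^sup>+\<tau>. mass F \<tau> \<partial>lborel)\<^sup>2"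
proof -
  let ?L = "lborel \<Otimes>\<^sub>M lborel :: (real \<times> 'a) measure"
  \<comment> \<open>With \<open>F\<close> as part of the measure, the second factor in Cauchy--Schwarz is the constant 1.\<close>
  define \<nu> where "\<nu> = density ?L F"
  have [measurable_cong]: "sets \<nu> = sets (borel \<Otimes>\<^sub>M borel)"
    unfolding \<nu>_def by (simp cong: sets_pair_measure_cong)
  let ?k = "\<lambda>t p. heat_kernel \<kappa> t (fst p) (snd p)"
  have tot: "(\<integral>\<^sup>+p. 1 \<partial>\<nu>) = (\<integral>\<^sup>+\<tau>. mass F \<tau> \<partial>lborel)"
    unfolding \<nu>_def mass_def by (subst nn_integral_density) (auto simp: lborel.nn_integral_fst[symmetric] split_beta)
  have md: "mass (duhamel \<kappa> F) t = (\<integral>\<^sup>+p. ?k t p \<partial>\<nu>)" for t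
  proof -
    have "mass (duhamel \<kappa> F) t = (\<integral>\<^sup>+\<tau>. (\<integral>\<^sup>+\<xi>. heat_kernel \<kappa> t \<tau> \<xi> * F (\<tau>, \<xi>) \<partial>lborel) \<partial>lborel)"
      unfolding mass_def duhamel_def split_conv by (rule lborel_pair.Fubini') measurable
    also have "\<dots> = (\<integral>\<^sup>+p. ?k t p * F p \<partial>?L)"
      by (subst lborel.nn_integral_fst[symmetric]) auto
    also have "\<dots> = (\<integral>\<^sup>+p. ?k t p \<partial>\<nu>)"
      unfolding \<nu>_def by (subst nn_integral_density) (auto simp: mult.commute)
    finally show ?thesis .
  qed
  have "(\<integral>\<^sup>+t. (mass (duhamel \<kappa> F) t)\<^sup>2 \<partial>lborel) \<le> (\<integral>\<^sup>+t. (\<integral>\<^sup>+p. (?k t p)\<^sup>2 \<partial>\<nu>) * (\<integral>\<^sup>+p. 1 \<partial>\<nu>) \<partial>lborel)"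
  proof (rule nn_integral_mono)
    fix t :: real
    have "(\<integral>\<^sup>+p. ?k t p * 1 \<partial>\<nu>)\<^sup>2 \<le> (\<integral>\<^sup>+p. (?k t p)\<^sup>2 \<partial>\<nu>) * (\<integral>\<^sup>+p. 1\<^sup>2 \<partial>\<nu>)"
      by (rule Cauchy_Schwarz_nn_integral) measurable
    then show "(mass (duhamel \<kappa> F) t)\<^sup>2 \<le> (\<integral>\<^sup>+p. (?k t p)\<^sup>2 \<partial>\<nu>) * (\<integral>\<^sup>+p. 1 \<partial>\<nu>)" by (simp add: md)
  qed
  also have "\<dots> = (\<integral>\<^sup>+t. (\<integral>\<^sup>+p. F p * (?k t p)\<^sup>2 \<partial>?L) \<partial>lborel) * (\<integral>\<^sup>+p. 1 \<partial>\<nu>)"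
    unfolding \<nu>_def by (subst (2) nn_integral_multc[symmetric]) (auto simp: nn_integral_density)
  also have "(\<integral>\<^sup>+t. (\<integral>\<^sup>+p. F p * (?k t p)\<^sup>2 \<partial>?L) \<partial>lborel) = (\<integral>\<^sup>+p. (\<integral>\<^sup>+t. F p * (?k t p)\<^sup>2 \<partial>lborel) \<partial>?L)"
  proof -
    interpret pair_sigma_finite "lborel :: real measure" ?L
      by (intro pair_sigma_finite.intro sigma_finite_lborel sigma_finite_pair_measure)
    show ?thesis by (rule Fubini'[symmetric]) measurable
  qed
  also have "\<dots> \<le> (\<integral>\<^sup>+p. F p * ennreal (1 / (2 * \<kappa>)) \<partial>?L)"
    by (intro nn_integral_mono) (auto simp: nn_integral_cmult intro!: mult_left_mono heat_kernel_square_integral[OF \<kappa>, simplified])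
  also have "\<dots> = ennreal (1 / (2 * \<kappa>)) * (\<integral>\<^sup>+\<tau>. mass F \<tau> \<partial>lborel)"
    unfolding mass_def by (subst nn_integral_multc) (auto simp: lborel.nn_integral_fst[symmetric] mult.commute)
  finally show ?thesis
    unfolding tot by (simp add: power2_eq_square mult.assoc mult_right_mono)
qed

subsection \<open>A continuity argument\<close>

lemma ennreal_sum_square: "(a + b)\<^sup>2 \<le> 4 * a\<^sup>2 + 4 * (b::ennreal)\<^sup>2"
proof -
  have *: "(a + b)\<^sup>2 \<le> 4 * b\<^sup>2" if "a \<le> b" for a b :: ennreal
  proof -
    have "(a + b)\<^sup>2 \<le> (2 * b)\<^sup>2" using that by (intro power_mono) (auto simp: mult_2 add_right_mono)
    then show ?thesis by (simp add: power_mult_distrib)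
  qed
  show ?thesis
  proof (cases "a \<le> b")
    case True
    show ?thesis using add_increasing[OF _ *[OF True], of "4 * a\<^sup>2"] by simp
  next
    case False
    then have "(b + a)\<^sup>2 \<le> 4 * a\<^sup>2" by (intro *) simp
    then show ?thesis using add_increasing2[of "4 * b\<^sup>2" "(a + b)\<^sup>2" "4 * a\<^sup>2"] by (simp add: add.commute)
  qed
qed

lemma power2_le_imp_le_ennreal: "a\<^sup>2 \<le> b\<^sup>2 \<Longrightarrow> a \<le> (b::ennreal)"
proof (rule ccontr)
  assume le: "a\<^sup>2 \<le> b\<^sup>2" and "\<not> a \<le> b"
  then have ba: "b < a" by simp
  then obtain y where y: "b = ennreal y" "y \<ge> 0" by (cases b) auto
  show False
  proof (cases a)
    case (real x)
    then have "y < x" using ba y by (simp add: ennreal_less_iff)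
    then have "y\<^sup>2 < x\<^sup>2" using y by (intro power_strict_mono) auto
    moreover have "ennreal (x\<^sup>2) \<le> ennreal (y\<^sup>2)" using le real y by (simp add: ennreal_power)
    ultimately show False by (simp add: ennreal_le_iff)
  next
    case top
    then have "top \<le> ennreal (y\<^sup>2)" using le y by (simp add: ennreal_power power_top_ennreal)
    then show False by (simp add: top_unique)
  qed
qed

text \<open>The energy up to time \<open>S\<close> is continuous in \<open>S\<close> and starts at zero. If it ever exceeded \<open>2 \<alpha>\<close>, it would
  equal \<open>2 \<alpha>\<close> at some time, where the quadratic inequality forces \<open>1 \<le> 4 \<alpha> \<beta>\<close>.\<close>

lemma continuity_argument:
  fixes \<phi> :: "real \<Rightarrow> ennreal"
  assumes [measurable]: "\<phi> \<in> borel_measurable borel"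
    and fin: "\<And>T. (\<integral>\<^sup>+t. indicator {0<..<T} t * \<phi> t \<partial>lborel) < \<infinity>"
    and quad: "\<And>T. (\<integral>\<^sup>+t. indicator {0<..<T} t * \<phi> t \<partial>lborel) \<le>
      ennreal \<alpha> + ennreal \<beta> * (\<integral>\<^sup>+t. indicator {0<..<T} t * \<phi> t \<partial>lborel)\<^sup>2"
    and \<alpha>: "\<alpha> > 0" and \<beta>: "\<beta> \<ge> 0" and small: "4 * \<alpha> * \<beta> < 1"
  shows "(\<integral>\<^sup>+t. indicator {0<..<T} t * \<phi> t \<partial>lborel) \<le> ennreal (2 * \<alpha>)"
proof (rule ccontr)
  define L where "L T = (\<integral>\<^sup>+t. indicator {0<..<T} t * \<phi> t \<partial>lborel)" for T
  assume "\<not> ?thesis"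
  then have big: "L T > ennreal (2 * \<alpha>)" by (simp add: L_def)
  have T: "T > 0"
  proof (rule ccontr)
    assume "\<not> T > 0"
    then have "L T = 0" by (simp add: L_def)
    then show False using big by simp
  qed
  define g where "g t = enn2real (indicator {0<..<T} t * \<phi> t)" for t
  have [measurable]: "g \<in> borel_measurable borel" unfolding g_def by measurable
  have "AE t in lborel. indicator {0<..<T} t * \<phi> t \<noteq> \<infinity>"
    using fin[of T] by (intro nn_integral_PInf_AE) auto
  then have g_eq: "AE t in lborel. ennreal (g t) = indicator {0<..<T} t * \<phi> t"
    by eventually_elim (simp add: g_def less_top)
  have "(\<integral>\<^sup>+t. ennreal (g t) \<partial>lborel) = L T"
    unfolding L_def by (rule nn_integral_cong_AE[OF g_eq])
  then have g: "integrable lborel g"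
    using fin[of T] by (intro integrableI_nonneg) (auto simp: g_def L_def)
  define y where "y S = integral {0..S} g" for S
  have y: "ennreal (y S) = L S" if "0 \<le> S" "S \<le> T" for S
  proof -
    have gS: "set_integrable lborel {0..S} g"
      unfolding set_integrable_def using g by (intro integrable_mult_indicator) auto
    have "y S = (LINT t|lborel. indicator {0..S} t * g t)"
      using set_borel_integral_eq_integral(2)[OF gS] by (simp add: y_def set_lebesgue_integral_def)
    also have "ennreal \<dots> = (\<integral>\<^sup>+t. ennreal (indicator {0..S} t * g t) \<partial>lborel)"
      using gS by (intro nn_integral_eq_integral[symmetric]) (auto simp: set_integrable_def g_def)
    also have "\<dots> = L S"
      unfolding L_def
    proof (rule nn_integral_cong_AE)
      have "AE t in lborel. t \<noteq> S" by (rule AE_lborel_singleton)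
      with g_eq show "AE t in lborel. ennreal (indicator {0..S} t * g t) = indicator {0<..<S} t * \<phi> t"
      proof eventually_elim
        case (elim t)
        show ?case
        proof (cases "0 < t \<and> t < S")
          case True
          then show ?thesis using elim that by simp
        next
          case False
          then have eq: "indicator {0..S} t * g t = 0"
            using elim(2) by (cases "t \<in> {0..S}") (auto simp: g_def)
          show ?thesis unfolding eq using False by simp
        qed
      qed
    qed
    finally show ?thesis .
  qed
  have "g integrable_on {0..T}"
    using integrable_on_lborel[OF g] by (rule integrable_on_subinterval) simp
  then have "continuous_on {0..T} y" unfolding y_def by (rule indefinite_integral_continuous_1)
  moreover have "y 0 \<le> 2 * \<alpha>" using \<alpha> by (simp add: y_def)
  moreover have "2 * \<alpha> \<le> y T" 
  proof (rule ccontr)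
    assume "\<not> 2 * \<alpha> \<le> y T"
    then have "ennreal (y T) \<le> ennreal (2 * \<alpha>)" by (intro ennreal_leI) simp
    then show False using big y[of T] T by simp
  qed
  ultimately obtain S where S: "0 \<le> S" "S \<le> T" "y S = 2 * \<alpha>"
    using IVT'[of y 0 "2 * \<alpha>" T] T by auto
  have "ennreal (2 * \<alpha>) \<le> ennreal \<alpha> + ennreal \<beta> * (ennreal (2 * \<alpha>))\<^sup>2"
    using quad[of S] y[OF S(1,2)] S(3) by (simp add: L_def)
  also have "\<dots> = ennreal (\<alpha> + \<beta> * (2 * \<alpha>)\<^sup>2)"
    using \<alpha> \<beta> by (simp add: ennreal_power ennreal_mult[symmetric] ennreal_plus[symmetric] del: ennreal_plus)
  finally have "2 * \<alpha> \<le> \<alpha> + \<beta> * (2 * \<alpha>)\<^sup>2"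
    using \<alpha> \<beta> by (subst (asm) ennreal_le_iff) auto
  then have "\<alpha> * 1 \<le> \<alpha> * (4 * \<alpha> * \<beta>)" by (simp add: power2_eq_square algebra_simps)
  then show False using small \<alpha> by simp
qed

subsection \<open>Weights\<close>

definition weighted :: "('a::euclidean_space \<Rightarrow> real) \<Rightarrow> (real \<times> 'a \<Rightarrow> ennreal) \<Rightarrow> real \<times> 'a \<Rightarrow> ennreal" where
  "weighted m f = (\<lambda>(t, \<xi>). ennreal (exp (2 * sqrt t * m \<xi>)) * f (t, \<xi>))"

lemma weighted_measurable[measurable]:
  assumes [measurable]: "f \<in> borel_measurable (borel \<Otimes>\<^sub>M borel)" "m \<in> borel_measurable borel"
  shows "weighted m f \<in> borel_measurable (borel \<Otimes>\<^sub>M borel)"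
  unfolding weighted_def by measurable

text \<open>Completing the square: half of the Gaussian absorbs the exponential weight, at the cost of the factor
  \<open>exp (2 / \<mu>)\<close>.\<close>

lemma absorb_weight:
  fixes \<mu> s x y :: real
  assumes "\<mu> > 0" "s \<ge> 0" "0 \<le> y" "y \<le> x"
  shows "2 * sqrt s * y - \<mu> * s * x\<^sup>2 \<le> 2 / \<mu> - \<mu> / 2 * s * x\<^sup>2"
proof -
  define z where "z = sqrt s * x"
  have z2: "z\<^sup>2 = s * x\<^sup>2" using assms by (simp add: z_def power_mult_distrib)
  have "0 \<le> (\<mu> * z - 2)\<^sup>2" by simp
  then have "4 * \<mu> * z \<le> \<mu>\<^sup>2 * z\<^sup>2 + 4" by (simp add: power2_diff power_mult_distrib)
  then have "4 * \<mu> * z / (2 * \<mu>) \<le> (\<mu>\<^sup>2 * z\<^sup>2 + 4) / (2 * \<mu>)"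
    using assms by (intro divide_right_mono) auto
  moreover have "(\<mu>\<^sup>2 * z\<^sup>2 + 4) / (2 * \<mu>) = 2 / \<mu> + \<mu> / 2 * z\<^sup>2"
    using assms by (simp add: field_simps power2_eq_square)
  ultimately have "2 * (sqrt s * x) \<le> 2 / \<mu> + \<mu> / 2 * s * x\<^sup>2"
    using assms unfolding z2 by (simp add: z_def mult_ac)
  moreover have "2 * sqrt s * y \<le> 2 * (sqrt s * x)" using assms by (simp add: mult_left_mono)
  moreover have "\<mu> * s * x\<^sup>2 = \<mu> / 2 * s * x\<^sup>2 + \<mu> / 2 * s * x\<^sup>2" by simp
  ultimately show ?thesis by linarith
qed

lemma sqrt_diff_le: "0 \<le> b \<Longrightarrow> b \<le> a \<Longrightarrow> sqrt a - sqrt b \<le> sqrt (a - b)"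
  using sqrt_add_le_add_sqrt[of "a - b" b] by simp

text \<open>Since \<open>sqrt t - sqrt \<tau> \<le> sqrt (t - \<tau>)\<close>, the weight at time \<open>t\<close> splits into the weight at time \<open>\<tau>\<close>, which
  distributes over the two factors of a convolution, and a part that the heat kernel absorbs. So the
  weighted unknown satisfies the same kind of inequality as the unknown.\<close>

lemma weight_submultiplicative:
  fixes \<mu> t \<tau> x mx my mz :: real
  assumes "\<mu> > 0" "0 < \<tau>" "\<tau> < t" "0 \<le> mx" "mx \<le> x" "mx \<le> my + mz"
  shows "exp (2 * sqrt t * mx) * exp (- \<mu> * (t - \<tau>) * x\<^sup>2) \<le>
    exp (2 / \<mu>) * exp (- (\<mu> / 2) * (t - \<tau>) * x\<^sup>2) * (exp (2 * sqrt \<tau> * my) * exp (2 * sqrt \<tau> * mz))"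
proof -
  have "(sqrt t - sqrt \<tau>) * mx \<le> sqrt (t - \<tau>) * mx"
    using assms by (intro mult_right_mono sqrt_diff_le) auto
  moreover have "sqrt \<tau> * mx \<le> sqrt \<tau> * (my + mz)"
    using assms by (intro mult_left_mono) auto
  moreover have "2 * sqrt (t - \<tau>) * mx - \<mu> * (t - \<tau>) * x\<^sup>2 \<le> 2 / \<mu> - \<mu> / 2 * (t - \<tau>) * x\<^sup>2"
    using assms by (intro absorb_weight) auto
  ultimately have "2 * sqrt t * mx + (- \<mu> * (t - \<tau>) * x\<^sup>2) \<le>
      2 / \<mu> + (- (\<mu> / 2) * (t - \<tau>) * x\<^sup>2) + (2 * sqrt \<tau> * my + 2 * sqrt \<tau> * mz)"
    by (simp add: algebra_simps)
  then show ?thesis unfolding exp_add[symmetric] by simp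
qed

text \<open>\<open>N\<close> stands for the modulus of the Fourier transform of a mild solution and \<open>N0\<close> for that of the initial
  velocity. Extending \<open>N\<close> by zero to \<open>t \<le> 0\<close> lets all time integrals range over the whole line.\<close>

locale quadratic_inequality =
  fixes \<mu> C :: real and N :: "real \<times> 'a::euclidean_space \<Rightarrow> ennreal" and N0 :: "'a \<Rightarrow> ennreal"
  assumes \<mu>: "\<mu> > 0" and C: "C \<ge> 0"
    and N_measurable[measurable]: "N \<in> borel_measurable (borel \<Otimes>\<^sub>M borel)"
    and N0_measurable[measurable]: "N0 \<in> borel_measurable borel"
    and N_zero: "\<And>t \<xi>. t \<le> 0 \<Longrightarrow> N (t, \<xi>) = 0"
    and ineq: "AE t in lborel. 0 < t \<longrightarrow> (AE \<xi> in lborel.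
      N (t, \<xi>) \<le> ennreal (exp (- \<mu> * t * (norm \<xi>)\<^sup>2)) * N0 \<xi> + ennreal C * duhamel \<mu> (star N N) (t, \<xi>))"
    and fin: "(\<integral>\<^sup>+t. (mass N t)\<^sup>2 \<partial>lborel) < \<infinity>"
begin

definition D :: real where "D = exp (2 / \<mu>)"

lemma D_pos: "D > 0" by (simp add: D_def)

text \<open>Half of the Gaussian decay of the free evolution; the other half has been spent on the weight.\<close>

definition h :: "real \<times> 'a \<Rightarrow> ennreal" where
  "h = (\<lambda>(t, \<xi>). indicator {0<..} t * (ennreal (exp (- (\<mu> / 2) * t * (norm \<xi>)\<^sup>2)) * N0 \<xi>))"

lemma h_measurable[measurable]: "h \<in> borel_measurable (borel \<Otimes>\<^sub>M borel)"
  unfolding h_def by measurable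

text \<open>The exponents \<open>m\<close> of the weights \<open>exp (2 * sqrt t * m \<xi>)\<close>: the norm is the one that is wanted, its
  truncations are those for which the weighted energy is known to be finite beforehand.\<close>

definition admissible :: "('a \<Rightarrow> real) \<Rightarrow> bool" where
  "admissible m \<longleftrightarrow> m \<in> borel_measurable borel \<and> (\<forall>\<xi>. 0 \<le> m \<xi> \<and> m \<xi> \<le> norm \<xi>) \<and> (\<forall>\<xi> \<eta>. m \<xi> \<le> m \<eta> + m (\<xi> - \<eta>))"

lemma weighted_ineq:
  assumes m: "admissible m"
  shows "AE t in lborel. 0 < t \<longrightarrow> (AE \<xi> in lborel.
    weighted m N (t, \<xi>) \<le> ennreal D * h (t, \<xi>) +
      ennreal (C * D) * duhamel (\<mu> / 2) (star (weighted m N) (weighted m N)) (t, \<xi>))"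
  using ineq
proof eventually_elim
  case (elim t)
  have [measurable]: "m \<in> borel_measurable borel" using m by (simp add: admissible_def)
  have m0: "0 \<le> m \<xi>" "m \<xi> \<le> norm \<xi>" "m \<xi> \<le> m \<eta> + m (\<xi> - \<eta>)" for \<xi> \<eta>
    using m by (auto simp: admissible_def)
  show ?case
  proof
    assume t: "0 < t"
    let ?w = "\<lambda>t \<xi>. ennreal (exp (2 * sqrt t * m \<xi>))"
    from elim t have "AE \<xi> in lborel. N (t, \<xi>) \<le> ennreal (exp (- \<mu> * t * (norm \<xi>)\<^sup>2)) * N0 \<xi> + ennreal C * duhamel \<mu> (star N N) (t, \<xi>)"
      by simp
    then show "AE \<xi> in lborel. weighted m N (t, \<xi>) \<le> ennreal D * h (t, \<xi>) +
      ennreal (C * D) * duhamel (\<mu> / 2) (star (weighted m N) (weighted m N)) (t, \<xi>)"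
    proof eventually_elim
      case (elim \<xi>)
      have "exp (2 * sqrt t * m \<xi>) * exp (- \<mu> * t * (norm \<xi>)\<^sup>2) \<le> D * exp (- (\<mu> / 2) * t * (norm \<xi>)\<^sup>2)"
        using absorb_weight[OF \<mu>, of t "m \<xi>" "norm \<xi>"] t m0[of \<xi>] unfolding D_def exp_add[symmetric] by simp
      then have "?w t \<xi> * ennreal (exp (- \<mu> * t * (norm \<xi>)\<^sup>2)) \<le> ennreal D * ennreal (exp (- (\<mu> / 2) * t * (norm \<xi>)\<^sup>2))"
        using D_pos by (simp add: ennreal_mult[symmetric] less_imp_le ennreal_leI)
      then have 1: "?w t \<xi> * (ennreal (exp (- \<mu> * t * (norm \<xi>)\<^sup>2)) * N0 \<xi>) \<le> ennreal D * h (t, \<xi>)"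
        using t by (simp add: h_def mult.assoc[symmetric] mult_right_mono)
      have key: "?w t \<xi> * (heat_kernel \<mu> t \<tau> \<xi> * star N N (\<tau>, \<xi>)) \<le>
          ennreal D * (heat_kernel (\<mu> / 2) t \<tau> \<xi> * star (weighted m N) (weighted m N) (\<tau>, \<xi>))" for \<tau>
      proof (cases "0 < \<tau> \<and> \<tau> < t")
        case True
        have "?w t \<xi> * heat_kernel \<mu> t \<tau> \<xi> * (N (\<tau>, \<eta>) * N (\<tau>, \<xi> - \<eta>)) \<le>
          ennreal D * heat_kernel (\<mu> / 2) t \<tau> \<xi> * (weighted m N (\<tau>, \<eta>) * weighted m N (\<tau>, \<xi> - \<eta>))" for \<eta>
        proof -
          have "?w t \<xi> * heat_kernel \<mu> t \<tau> \<xi> \<le> ennreal D * heat_kernel (\<mu> / 2) t \<tau> \<xi> * (?w \<tau> \<eta> * ?w \<tau> (\<xi> - \<eta>))"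
          proof -
            have "norm \<xi> * (exp (2 * sqrt t * m \<xi>) * exp (- \<mu> * (t - \<tau>) * (norm \<xi>)\<^sup>2)) \<le>
              norm \<xi> * (D * exp (- (\<mu> / 2) * (t - \<tau>) * (norm \<xi>)\<^sup>2) * (exp (2 * sqrt \<tau> * m \<eta>) * exp (2 * sqrt \<tau> * m (\<xi> - \<eta>))))"
              unfolding D_def using True \<mu> m0 by (intro mult_left_mono weight_submultiplicative) auto
            then show ?thesis using True D_pos
              by (simp add: heat_kernel_def ennreal_mult[symmetric] less_imp_le ennreal_leI mult_ac)
          qed
          then have "?w t \<xi> * heat_kernel \<mu> t \<tau> \<xi> * (N (\<tau>, \<eta>) * N (\<tau>, \<xi> - \<eta>)) \<le>
            ennreal D * heat_kernel (\<mu> / 2) t \<tau> \<xi> * (?w \<tau> \<eta> * ?w \<tau> (\<xi> - \<eta>)) * (N (\<tau>, \<eta>) * N (\<tau>, \<xi> - \<eta>))"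
            by (rule mult_right_mono) simp
          then show ?thesis by (simp add: weighted_def mult_ac)
        qed
        then have "(\<integral>\<^sup>+\<eta>. ?w t \<xi> * heat_kernel \<mu> t \<tau> \<xi> * (N (\<tau>, \<eta>) * N (\<tau>, \<xi> - \<eta>)) \<partial>lborel) \<le>
          (\<integral>\<^sup>+\<eta>. ennreal D * heat_kernel (\<mu> / 2) t \<tau> \<xi> * (weighted m N (\<tau>, \<eta>) * weighted m N (\<tau>, \<xi> - \<eta>)) \<partial>lborel)"
          by (rule nn_integral_mono)
        then show ?thesis
          by (subst (asm) (1 2) nn_integral_cmult) (simp_all add: star_def mult.assoc)
      qed (auto simp: heat_kernel_def)
      have "?w t \<xi> * duhamel \<mu> (star N N) (t, \<xi>) = (\<integral>\<^sup>+\<tau>. ?w t \<xi> * (heat_kernel \<mu> t \<tau> \<xi> * star N N (\<tau>, \<xi>)) \<partial>lborel)"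
        unfolding duhamel_def split_conv by (rule nn_integral_cmult[symmetric]) measurable
      also have "\<dots> \<le> (\<integral>\<^sup>+\<tau>. ennreal D * (heat_kernel (\<mu> / 2) t \<tau> \<xi> * star (weighted m N) (weighted m N) (\<tau>, \<xi>)) \<partial>lborel)"
        by (intro nn_integral_mono key)
      also have "\<dots> = ennreal D * duhamel (\<mu> / 2) (star (weighted m N) (weighted m N)) (t, \<xi>)"
        unfolding duhamel_def split_conv by (rule nn_integral_cmult) measurable
      finally have 2: "?w t \<xi> * duhamel \<mu> (star N N) (t, \<xi>) \<le> ennreal D * duhamel (\<mu> / 2) (star (weighted m N) (weighted m N)) (t, \<xi>)" .
      have "weighted m N (t, \<xi>) \<le> ?w t \<xi> * (ennreal (exp (- \<mu> * t * (norm \<xi>)\<^sup>2)) * N0 \<xi> + ennreal C * duhamel \<mu> (star N N) (t, \<xi>))"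
        unfolding weighted_def split_conv by (intro mult_left_mono elim) simp
      also have "\<dots> = ?w t \<xi> * (ennreal (exp (- \<mu> * t * (norm \<xi>)\<^sup>2)) * N0 \<xi>) + ennreal C * (?w t \<xi> * duhamel \<mu> (star N N) (t, \<xi>))"
        by (simp add: distrib_left mult_ac)
      also have "\<dots> \<le> ennreal D * h (t, \<xi>) + ennreal C * (ennreal D * duhamel (\<mu> / 2) (star (weighted m N) (weighted m N)) (t, \<xi>))"
        by (intro add_mono 1 mult_left_mono 2) simp
      finally show ?case using C D_pos by (simp add: ennreal_mult less_imp_le mult.assoc)
    qed
  qed
qed

definition energy :: "('a \<Rightarrow> real) \<Rightarrow> real \<Rightarrow> ennreal" where
  "energy m T = (\<integral>\<^sup>+t. indicator {0<..<T} t * (mass (weighted m N) t)\<^sup>2 \<partial>lborel)"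

text \<open>The bilinear estimate is applied to the nonlinear term cut off at time \<open>T\<close>; the cutoff does not change
  the Duhamel integral before time \<open>T\<close>.\<close>

lemma energy_quadratic:
  assumes m: "admissible m"
  shows "energy m T \<le> 4 * (ennreal D)\<^sup>2 * (\<integral>\<^sup>+t. (mass h t)\<^sup>2 \<partial>lborel) +
    ennreal (4 * (C * D)\<^sup>2 / \<mu>) * (energy m T)\<^sup>2"
proof -
  have [measurable]: "m \<in> borel_measurable borel" using m by (simp add: admissible_def)
  let ?f = "weighted m N"
  define F where "F = (\<lambda>(\<tau>, \<xi>). indicator {0<..<T} \<tau> * star ?f ?f (\<tau>, \<xi>))"
  have [measurable]: "F \<in> borel_measurable (borel \<Otimes>\<^sub>M borel)" unfolding F_def by measurable
  have massF: "mass F \<tau> = indicator {0<..<T} \<tau> * (mass ?f \<tau>)\<^sup>2" for \<tau>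
  proof -
    have "mass F \<tau> = indicator {0<..<T} \<tau> * mass (star ?f ?f) \<tau>"
      unfolding F_def mass_def split_conv by (rule nn_integral_cmult) measurable
    then show ?thesis by (simp add: mass_star power2_eq_square)
  qed
  have dF: "duhamel (\<mu> / 2) F (t, \<xi>) = duhamel (\<mu> / 2) (star ?f ?f) (t, \<xi>)" if "t < T" for t \<xi>
    unfolding duhamel_def split_conv F_def
    by (intro nn_integral_cong) (use that in \<open>auto simp: heat_kernel_def indicator_def\<close>)
  have "AE t in lborel. indicator {0<..<T} t * (mass ?f t)\<^sup>2 \<le>
      4 * ((ennreal D)\<^sup>2 * (mass h t)\<^sup>2) + 4 * ((ennreal (C * D))\<^sup>2 * (mass (duhamel (\<mu> / 2) F) t)\<^sup>2)"
    using weighted_ineq[OF m]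
  proof eventually_elim
    case (elim t)
    show ?case
    proof (cases "0 < t \<and> t < T")
      case True
      then have "AE \<xi> in lborel. ?f (t, \<xi>) \<le> ennreal D * h (t, \<xi>) + ennreal (C * D) * duhamel (\<mu> / 2) F (t, \<xi>)"
        using elim by (simp add: dF)
      then have "mass ?f t \<le> (\<integral>\<^sup>+\<xi>. ennreal D * h (t, \<xi>) + ennreal (C * D) * duhamel (\<mu> / 2) F (t, \<xi>) \<partial>lborel)"
        unfolding mass_def by (rule nn_integral_mono_AE)
      also have "\<dots> = ennreal D * mass h t + ennreal (C * D) * mass (duhamel (\<mu> / 2) F) t"
        unfolding mass_def by (simp add: nn_integral_add nn_integral_cmult)
      finally have "(mass ?f t)\<^sup>2 \<le> (ennreal D * mass h t + ennreal (C * D) * mass (duhamel (\<mu> / 2) F) t)\<^sup>2"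
        by (rule power_mono) simp
      also have "\<dots> \<le> 4 * (ennreal D * mass h t)\<^sup>2 + 4 * (ennreal (C * D) * mass (duhamel (\<mu> / 2) F) t)\<^sup>2"
        by (rule ennreal_sum_square)
      finally show ?thesis using True by (simp add: power_mult_distrib)
    qed simp
  qed
  then have "energy m T \<le> (\<integral>\<^sup>+t. 4 * ((ennreal D)\<^sup>2 * (mass h t)\<^sup>2) + 4 * ((ennreal (C * D))\<^sup>2 * (mass (duhamel (\<mu> / 2) F) t)\<^sup>2) \<partial>lborel)"
    unfolding energy_def by (rule nn_integral_mono_AE)
  also have "\<dots> = 4 * ((ennreal D)\<^sup>2 * (\<integral>\<^sup>+t. (mass h t)\<^sup>2 \<partial>lborel)) +
      4 * ((ennreal (C * D))\<^sup>2 * (\<integral>\<^sup>+t. (mass (duhamel (\<mu> / 2) F) t)\<^sup>2 \<partial>lborel))"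
    by (simp add: nn_integral_add nn_integral_cmult)
  also have "\<dots> \<le> 4 * ((ennreal D)\<^sup>2 * (\<integral>\<^sup>+t. (mass h t)\<^sup>2 \<partial>lborel)) +
      4 * ((ennreal (C * D))\<^sup>2 * (ennreal (1 / (2 * (\<mu> / 2))) * (\<integral>\<^sup>+\<tau>. mass F \<tau> \<partial>lborel)\<^sup>2))"
    using \<mu> by (intro add_mono mult_left_mono duhamel_estimate) auto
  also have "(\<integral>\<^sup>+\<tau>. mass F \<tau> \<partial>lborel) = energy m T" by (simp add: massF energy_def)
  also have "4 * ((ennreal (C * D))\<^sup>2 * (ennreal (1 / (2 * (\<mu> / 2))) * (energy m T)\<^sup>2)) = ennreal (4 * (C * D)\<^sup>2 / \<mu>) * (energy m T)\<^sup>2"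
  proof -
    have "(ennreal (C * D))\<^sup>2 = ennreal ((C * D)\<^sup>2)" using C D_pos by (intro ennreal_power) simp
    moreover have "ennreal (4 * (C * D)\<^sup>2 / \<mu>) = ennreal 4 * (ennreal ((C * D)\<^sup>2) * ennreal (1 / \<mu>))"
      using \<mu> by (simp add: ennreal_mult[symmetric] del: ennreal_numeral)
    ultimately show ?thesis by (simp add: mult.assoc)
  qed
  finally show ?thesis by (simp add: mult.assoc)
qed

lemma admissible_min: "admissible (\<lambda>\<xi>. min (norm \<xi>) (real n))"
proof -
  have "min (norm \<xi>) (real n) \<le> min (norm \<eta>) (real n) + min (norm (\<xi> - \<eta>)) (real n)" for \<xi> \<eta> :: 'a
    using norm_triangle_ineq[of \<eta> "\<xi> - \<eta>"] norm_ge_zero[of \<eta>] norm_ge_zero[of "\<xi> - \<eta>"]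
    by (smt (verit) add_diff_cancel_left' diff_add_cancel of_nat_0_le_iff add.commute)
  then show ?thesis unfolding admissible_def by auto
qed

lemma admissible_norm: "admissible norm"
proof -
  have "norm \<xi> \<le> norm \<eta> + norm (\<xi> - \<eta>)" for \<xi> \<eta> :: 'a
    using norm_triangle_ineq[of \<eta> "\<xi> - \<eta>"] by simp
  then show ?thesis unfolding admissible_def by auto
qed

lemma energy_truncated_finite: "energy (\<lambda>\<xi>. min (norm \<xi>) (real n)) T < \<infinity>"
proof -
  let ?m = "\<lambda>\<xi>::'a. min (norm \<xi>) (real n)" and ?c = "ennreal (exp (2 * sqrt T * real n))"
  have "indicator {0<..<T} t * (mass (weighted ?m N) t)\<^sup>2 \<le> ?c\<^sup>2 * (mass N t)\<^sup>2" for t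
  proof (cases "0 < t \<and> t < T")
    case True
    have "sqrt t * min (norm \<xi>) (real n) \<le> sqrt T * real n" for \<xi> :: 'a
      using True by (intro mult_mono) auto
    then have "mass (weighted ?m N) t \<le> (\<integral>\<^sup>+\<xi>. ?c * N (t, \<xi>) \<partial>lborel)"
      unfolding mass_def weighted_def split_conv by (intro nn_integral_mono mult_right_mono ennreal_leI) auto
    also have "\<dots> = ?c * mass N t" unfolding mass_def by (rule nn_integral_cmult) measurable
    finally have "(mass (weighted ?m N) t)\<^sup>2 \<le> (?c * mass N t)\<^sup>2" by (rule power_mono) simp
    then show ?thesis using True by (simp add: power_mult_distrib)
  qed simp
  then have "energy ?m T \<le> (\<integral>\<^sup>+t. ?c\<^sup>2 * (mass N t)\<^sup>2 \<partial>lborel)"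
    unfolding energy_def by (rule nn_integral_mono)
  also have "\<dots> = ?c\<^sup>2 * (\<integral>\<^sup>+t. (mass N t)\<^sup>2 \<partial>lborel)" by (rule nn_integral_cmult) measurable
  also have "\<dots> < \<infinity>" using fin by (simp add: ennreal_mult_less_top ennreal_power)
  finally show ?thesis .
qed

lemma SUP_square_ennreal:
  fixes f :: "nat \<Rightarrow> ennreal"
  assumes "incseq f"
  shows "(SUP n. f n)\<^sup>2 \<le> (SUP n. (f n)\<^sup>2)"
proof -
  have "(SUP n. f n)\<^sup>2 = (SUP n. SUP k. f n * f k)"
    by (simp add: power2_eq_square SUP_mult_left_ennreal[symmetric] SUP_mult_right_ennreal)
  also have "\<dots> \<le> (SUP n. (f n)\<^sup>2)"
  proof (intro SUP_least)
    fix n k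
    have "f n * f k \<le> f (max n k) * f (max n k)"
      using assms by (intro mult_mono) (auto simp: incseq_def)
    then show "f n * f k \<le> (SUP n. (f n)\<^sup>2)"
      by (intro SUP_upper2[of "max n k"]) (auto simp: power2_eq_square)
  qed
  finally show ?thesis .
qed

text \<open>The full exponential weight is reached by monotone convergence from the truncated ones, to
  which the continuity argument applies because their energies are finite from the start.\<close>

theorem weighted_energy_bound:
  assumes \<alpha>: "\<alpha> > 0" and small: "32 * (C * D)\<^sup>2 * \<alpha> \<le> \<mu>"
    and H: "4 * (ennreal D)\<^sup>2 * (\<integral>\<^sup>+t. (mass h t)\<^sup>2 \<partial>lborel) \<le> ennreal \<alpha>"
  shows "(\<integral>\<^sup>+t. (mass (weighted norm N) t)\<^sup>2 \<partial>lborel) \<le> ennreal (2 * \<alpha>)"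
proof -
  let ?m = "\<lambda>n \<xi>::'a. min (norm \<xi>) (real n)"
  have bound: "energy (?m n) T \<le> ennreal (2 * \<alpha>)" for n T
    unfolding energy_def
  proof (rule continuity_argument[where \<beta>="4 * (C * D)\<^sup>2 / \<mu>"])
    show "(\<integral>\<^sup>+t. indicator {0<..<T} t * (mass (weighted (?m n) N) t)\<^sup>2 \<partial>lborel) < \<infinity>" for T
      using energy_truncated_finite[of n T] by (simp add: energy_def)
    show "(\<integral>\<^sup>+t. indicator {0<..<T} t * (mass (weighted (?m n) N) t)\<^sup>2 \<partial>lborel) \<le> ennreal \<alpha> +
      ennreal (4 * (C * D)\<^sup>2 / \<mu>) * (\<integral>\<^sup>+t. indicator {0<..<T} t * (mass (weighted (?m n) N) t)\<^sup>2 \<partial>lborel)\<^sup>2" for T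
      using order_trans[OF energy_quadratic[OF admissible_min[of n], of T] add_right_mono[OF H]] by (simp add: energy_def)
    have "4 * \<alpha> * (4 * (C * D)\<^sup>2 / \<mu>) = (32 * (C * D)\<^sup>2 * \<alpha>) / (2 * \<mu>)" by (simp add: field_simps)
    also have "\<dots> \<le> \<mu> / (2 * \<mu>)" using small \<mu> by (intro divide_right_mono) auto
    also have "\<dots> < 1" using \<mu> by simp
    finally show "4 * \<alpha> * (4 * (C * D)\<^sup>2 / \<mu>) < 1" .
  qed (use \<alpha> \<mu> in auto)
  have inc_m: "incseq (\<lambda>n. weighted (?m n) N (t, \<xi>))" if "t > 0" for t \<xi>
    unfolding incseq_def weighted_def split_conv
    using that by (auto intro!: mult_right_mono ennreal_leI mult_left_mono)
  have zero: "weighted m N (t, \<xi>) = 0" if "t \<le> 0" for m t \<xi>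
    using N_zero[OF that] by (simp add: weighted_def)
  have inc: "incseq (\<lambda>n. weighted (?m n) N (t, \<xi>))" for t \<xi>
    using inc_m[of t \<xi>] zero[of t] by (cases "t > 0") (auto simp: incseq_def)
  have sup: "weighted norm N (t, \<xi>) \<le> (SUP n. weighted (?m n) N (t, \<xi>))" for t \<xi>
  proof -
    obtain n where "norm \<xi> \<le> real n" using real_arch_simple by blast
    then have "weighted norm N (t, \<xi>) = weighted (?m n) N (t, \<xi>)" by (simp add: weighted_def)
    moreover have "weighted (?m n) N (t, \<xi>) \<le> (SUP n. weighted (?m n) N (t, \<xi>))" by (rule SUP_upper) simp
    ultimately show ?thesis by simp
  qed
  have "mass (weighted norm N) t \<le> (SUP n. mass (weighted (?m n) N) t)" for t
  proof -
    have "mass (weighted norm N) t \<le> (\<integral>\<^sup>+\<xi>. (SUP n. weighted (?m n) N (t, \<xi>)) \<partial>lborel)"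
      unfolding mass_def by (intro nn_integral_mono sup)
    also have "\<dots> = (SUP n. mass (weighted (?m n) N) t)"
      unfolding mass_def
    proof (rule nn_integral_monotone_convergence_SUP)
      show "incseq (\<lambda>n \<xi>. weighted (?m n) N (t, \<xi>))"
        using inc[of t] by (auto simp: incseq_def le_fun_def)
    qed measurable
    finally show ?thesis .
  qed
  moreover have inc_mass: "incseq (\<lambda>n. mass (weighted (?m n) N) t)" for t
    unfolding mass_def using inc[of t] by (auto simp: incseq_def intro!: nn_integral_mono)
  ultimately have sq: "(mass (weighted norm N) t)\<^sup>2 \<le> (SUP n. (mass (weighted (?m n) N) t)\<^sup>2)" for t
    by (intro order_trans[OF power_mono SUP_square_ennreal[OF inc_mass]]) auto
  let ?g = "\<lambda>n t. indicator {0<..<real n} t * (mass (weighted (?m n) N) t)\<^sup>2"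
  have g_inc: "incseq ?g"
    unfolding incseq_def le_fun_def
  proof (intro allI impI mult_mono)
    fix n k :: nat and t :: real assume "n \<le> k"
    then show "indicator {0<..<real n} t \<le> (indicator {0<..<real k} t :: ennreal)" by (auto simp: indicator_def)
    show "(mass (weighted (?m n) N) t)\<^sup>2 \<le> (mass (weighted (?m k) N) t)\<^sup>2"
      using inc_mass[of t] \<open>n \<le> k\<close> by (intro power_mono) (auto simp: incseq_def)
  qed auto
  have "(mass (weighted norm N) t)\<^sup>2 \<le> (SUP n. ?g n t)" for t
  proof (cases "t > 0")
    case True
    obtain k where k: "t < real k" using reals_Archimedean2 by blast
    have "(SUP n. (mass (weighted (?m n) N) t)\<^sup>2) \<le> (SUP n. ?g n t)"
    proof (rule SUP_least)
      fix n
      have "(mass (weighted (?m n) N) t)\<^sup>2 \<le> (mass (weighted (?m (max n k)) N) t)\<^sup>2"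
        using inc_mass[of t] by (intro power_mono) (auto simp: incseq_def)
      also have "\<dots> = ?g (max n k) t" using True k by (simp add: indicator_def)
      also have "\<dots> \<le> (SUP n. ?g n t)" by (rule SUP_upper) simp
      finally show "(mass (weighted (?m n) N) t)\<^sup>2 \<le> (SUP n. ?g n t)" .
    qed
    then show ?thesis using sq[of t] by (rule order_trans[rotated])
  next
    case False
    then have "mass (weighted norm N) t = 0" by (simp add: mass_def zero)
    then show ?thesis by simp
  qed
  then have "(\<integral>\<^sup>+t. (mass (weighted norm N) t)\<^sup>2 \<partial>lborel) \<le> (\<integral>\<^sup>+t. (SUP n. ?g n t) \<partial>lborel)"
    by (rule nn_integral_mono)
  also have "\<dots> = (SUP n. \<integral>\<^sup>+t. ?g n t \<partial>lborel)"
    by (rule nn_integral_monotone_convergence_SUP[OF g_inc]) measurable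
  also have "\<dots> \<le> ennreal (2 * \<alpha>)"
    using bound unfolding energy_def by (intro SUP_least)
  finally show ?thesis .
qed

text \<open>The excess \<open>w\<close> of the weighted solution over the constant \<open>2 D B\<close> satisfies a homogeneous
  linear inequality whose operator has norm at most \<open>1/2\<close>, so it vanishes.\<close>

theorem weighted_pointwise_bound:
  assumes \<alpha>: "\<alpha> > 0" and small: "32 * (C * D)\<^sup>2 * \<alpha> \<le> \<mu>"
    and H: "4 * (ennreal D)\<^sup>2 * (\<integral>\<^sup>+t. (mass h t)\<^sup>2 \<partial>lborel) \<le> ennreal \<alpha>"
    and B: "B \<ge> 0" "AE \<xi> in lborel. N0 \<xi> \<le> ennreal B"
  shows "AE t in lborel. AE \<xi> in lborel. weighted norm N (t, \<xi>) \<le> ennreal (2 * D * B)"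
proof -
  let ?f = "weighted norm N" and ?K = "ennreal (2 * D * B)"
  define w where "w = (\<lambda>p. ?f p - ?K)"
  have [measurable]: "w \<in> borel_measurable (borel \<Otimes>\<^sub>M borel)" unfolding w_def by measurable
  have E: "(\<integral>\<^sup>+t. (mass ?f t)\<^sup>2 \<partial>lborel) \<le> ennreal (2 * \<alpha>)"
    by (rule weighted_energy_bound[OF \<alpha> small H])
  have fw: "?f p \<le> ?K + w p" for p
  proof (cases "?f p \<le> ?K")
    case True
    then show ?thesis by (rule add_increasing2[rotated]) simp
  next
    case False
    then have "?K + w p = ?f p" unfolding w_def by (intro add_diff_inverse_ennreal) simp
    then show ?thesis by simp
  qed
  have small': "(ennreal (C * D))\<^sup>2 * (ennreal (1 / \<mu>) * ennreal (2 * \<alpha>)) \<le> (ennreal (1/2))\<^sup>2"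
  proof -
    have "(ennreal (C * D))\<^sup>2 * (ennreal (1 / \<mu>) * ennreal (2 * \<alpha>)) = ennreal ((C * D)\<^sup>2 * ((1 / \<mu>) * (2 * \<alpha>)))"
    proof -
      have "(ennreal (C * D))\<^sup>2 = ennreal ((C * D)\<^sup>2)" using C D_pos by (intro ennreal_power) simp
      then show ?thesis using \<mu> \<alpha> by (simp only: ennreal_mult[symmetric] zero_le_power2 less_imp_le mult_nonneg_nonneg zero_le_numeral zero_le_divide_1_iff)
    qed
    also have "\<dots> \<le> ennreal ((1/2)\<^sup>2)"
    proof (rule ennreal_leI)
      have "(C * D)\<^sup>2 * ((1 / \<mu>) * (2 * \<alpha>)) = (32 * (C * D)\<^sup>2 * \<alpha>) / (16 * \<mu>)" by (simp add: field_simps)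
      also have "\<dots> \<le> \<mu> / (16 * \<mu>)" using small \<mu> by (intro divide_right_mono) auto
      also have "\<dots> \<le> (1/2)\<^sup>2" using \<mu> by (simp add: power2_eq_square)
      finally show "(C * D)\<^sup>2 * ((1 / \<mu>) * (2 * \<alpha>)) \<le> (1/2)\<^sup>2" .
    qed
    also have "\<dots> = (ennreal (1/2))\<^sup>2" by (rule ennreal_power[symmetric]) simp
    finally show ?thesis .
  qed
  have half: "ennreal (C * D) * (\<integral>\<^sup>+\<tau>. heat_kernel (\<mu> / 2) t \<tau> \<xi> * mass ?f \<tau> \<partial>lborel) \<le> ennreal (1/2)" for t and \<xi> :: 'a
  proof -
    have "(\<integral>\<^sup>+\<tau>. heat_kernel (\<mu> / 2) t \<tau> \<xi> * mass ?f \<tau> \<partial>lborel)\<^sup>2 \<le>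
        (\<integral>\<^sup>+\<tau>. (heat_kernel (\<mu> / 2) t \<tau> \<xi>)\<^sup>2 \<partial>lborel) * (\<integral>\<^sup>+\<tau>. (mass ?f \<tau>)\<^sup>2 \<partial>lborel)"
      by (rule Cauchy_Schwarz_nn_integral) measurable
    also have "\<dots> \<le> ennreal (1 / \<mu>) * ennreal (2 * \<alpha>)"
      using heat_kernel_square_integral'[of "\<mu> / 2" t \<xi>] \<mu> by (intro mult_mono E) auto
    finally have "(ennreal (C * D) * (\<integral>\<^sup>+\<tau>. heat_kernel (\<mu> / 2) t \<tau> \<xi> * mass ?f \<tau> \<partial>lborel))\<^sup>2 \<le> (ennreal (1/2))\<^sup>2"
      unfolding power_mult_distrib by (intro order_trans[OF mult_left_mono small']) auto
    then show ?thesis by (rule power2_le_imp_le_ennreal)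
  qed
  have w_le: "AE t in lborel. 0 < t \<longrightarrow> (AE \<xi> in lborel. w (t, \<xi>) \<le> ennreal (C * D) * duhamel (\<mu> / 2) (star ?f w) (t, \<xi>))"
    using weighted_ineq[OF admissible_norm]
  proof eventually_elim
    case (elim t)
    show ?case
    proof
      assume t: "0 < t"
      with elim have "AE \<xi> in lborel. ?f (t, \<xi>) \<le> ennreal D * h (t, \<xi>) + ennreal (C * D) * duhamel (\<mu> / 2) (star ?f ?f) (t, \<xi>)" by simp
      then show "AE \<xi> in lborel. w (t, \<xi>) \<le> ennreal (C * D) * duhamel (\<mu> / 2) (star ?f w) (t, \<xi>)"
        using B(2)
      proof eventually_elim
        case (elim \<xi>)
        have "ennreal (exp (- (\<mu> / 2) * t * (norm \<xi>)\<^sup>2)) \<le> 1" using t \<mu> by (auto simp: ennreal_le_1)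
        then have "ennreal (exp (- (\<mu> / 2) * t * (norm \<xi>)\<^sup>2)) * N0 \<xi> \<le> 1 * ennreal B"
          using elim(2) by (rule mult_mono) auto
        then have "ennreal D * h (t, \<xi>) \<le> ennreal D * ennreal B"
          using t by (intro mult_left_mono) (auto simp: h_def)
        then have hK: "ennreal D * h (t, \<xi>) \<le> ennreal (D * B)" using D_pos B(1) by (simp add: ennreal_mult less_imp_le)
        have star_le: "star ?f ?f (\<tau>, \<xi>) \<le> ?K * mass ?f \<tau> + star ?f w (\<tau>, \<xi>)" for \<tau>
        proof -
          have "star ?f ?f (\<tau>, \<xi>) \<le> (\<integral>\<^sup>+\<eta>. ?K * ?f (\<tau>, \<eta>) + ?f (\<tau>, \<eta>) * w (\<tau>, \<xi> - \<eta>) \<partial>lborel)"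
            unfolding star_def split_conv
          proof (rule nn_integral_mono)
            fix \<eta>
            have "?f (\<tau>, \<eta>) * ?f (\<tau>, \<xi> - \<eta>) \<le> ?f (\<tau>, \<eta>) * (?K + w (\<tau>, \<xi> - \<eta>))"
              by (intro mult_left_mono fw) simp
            then show "?f (\<tau>, \<eta>) * ?f (\<tau>, \<xi> - \<eta>) \<le> ?K * ?f (\<tau>, \<eta>) + ?f (\<tau>, \<eta>) * w (\<tau>, \<xi> - \<eta>)"
              by (simp add: distrib_left mult.commute)
          qed
          also have "\<dots> = ?K * mass ?f \<tau> + star ?f w (\<tau>, \<xi>)"
            unfolding star_def mass_def split_conv by (subst nn_integral_add) (auto simp: nn_integral_cmult)
          finally show ?thesis .
        qed
        have "duhamel (\<mu> / 2) (star ?f ?f) (t, \<xi>) \<le>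
            (\<integral>\<^sup>+\<tau>. ?K * (heat_kernel (\<mu> / 2) t \<tau> \<xi> * mass ?f \<tau>) + heat_kernel (\<mu> / 2) t \<tau> \<xi> * star ?f w (\<tau>, \<xi>) \<partial>lborel)"
          unfolding duhamel_def split_conv
        proof (rule nn_integral_mono)
          fix \<tau>
          have "heat_kernel (\<mu> / 2) t \<tau> \<xi> * star ?f ?f (\<tau>, \<xi>) \<le>
              heat_kernel (\<mu> / 2) t \<tau> \<xi> * (?K * mass ?f \<tau> + star ?f w (\<tau>, \<xi>))"
            by (rule mult_left_mono[OF star_le]) simp
          then show "heat_kernel (\<mu> / 2) t \<tau> \<xi> * star ?f ?f (\<tau>, \<xi>) \<le>
              ?K * (heat_kernel (\<mu> / 2) t \<tau> \<xi> * mass ?f \<tau>) + heat_kernel (\<mu> / 2) t \<tau> \<xi> * star ?f w (\<tau>, \<xi>)"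
            by (simp only: distrib_left mult.left_commute[of ?K])
        qed
        also have "\<dots> = ?K * (\<integral>\<^sup>+\<tau>. heat_kernel (\<mu> / 2) t \<tau> \<xi> * mass ?f \<tau> \<partial>lborel) + duhamel (\<mu> / 2) (star ?f w) (t, \<xi>)"
          unfolding duhamel_def split_conv by (subst nn_integral_add) (auto simp: nn_integral_cmult)
        finally have "ennreal (C * D) * duhamel (\<mu> / 2) (star ?f ?f) (t, \<xi>) \<le>
           ennreal (C * D) * (?K * (\<integral>\<^sup>+\<tau>. heat_kernel (\<mu> / 2) t \<tau> \<xi> * mass ?f \<tau> \<partial>lborel) + duhamel (\<mu> / 2) (star ?f w) (t, \<xi>))"
          by (rule mult_left_mono) simp
        also have "\<dots> = ?K * (ennreal (C * D) * (\<integral>\<^sup>+\<tau>. heat_kernel (\<mu> / 2) t \<tau> \<xi> * mass ?f \<tau> \<partial>lborel)) +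
            ennreal (C * D) * duhamel (\<mu> / 2) (star ?f w) (t, \<xi>)"
          by (simp add: distrib_left mult_ac)
        also have "\<dots> \<le> ?K * ennreal (1/2) + ennreal (C * D) * duhamel (\<mu> / 2) (star ?f w) (t, \<xi>)"
          by (intro add_right_mono mult_left_mono half) simp
        also have "?K * ennreal (1/2) = ennreal (D * B)"
          using D_pos B(1) by (subst ennreal_mult[symmetric]) auto
        finally have "?f (t, \<xi>) \<le> ennreal (D * B) + (ennreal (D * B) + ennreal (C * D) * duhamel (\<mu> / 2) (star ?f w) (t, \<xi>))"
          by (intro order_trans[OF elim(1) add_mono[OF hK]])
        also have "\<dots> = ?K + ennreal (C * D) * duhamel (\<mu> / 2) (star ?f w) (t, \<xi>)"
          using D_pos B(1) by (simp add: add.assoc[symmetric] ennreal_plus[symmetric] del: ennreal_plus)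
        finally show ?case by (simp add: w_def ennreal_minus_le_iff)
      qed
    qed
  qed
  have w0: "w (t, \<xi>) = 0" if "t \<le> 0" for t \<xi>
    using N_zero[OF that] by (simp add: w_def weighted_def)
  define J where "J = (\<integral>\<^sup>+t. (mass w t)\<^sup>2 \<partial>lborel)"
  have wf: "mass w t \<le> mass ?f t" for t
    unfolding mass_def w_def by (intro nn_integral_mono) (simp add: diff_le_self_ennreal)
  have J_fin: "J < \<infinity>"
  proof -
    have "J \<le> (\<integral>\<^sup>+t. (mass ?f t)\<^sup>2 \<partial>lborel)" unfolding J_def by (intro nn_integral_mono power_mono wf) simp
    also have "\<dots> \<le> ennreal (2 * \<alpha>)" by (rule E)
    finally show ?thesis by (simp add: le_less_trans)
  qed
  have "J \<le> (\<integral>\<^sup>+t. (ennreal (C * D))\<^sup>2 * (mass (duhamel (\<mu> / 2) (star ?f w)) t)\<^sup>2 \<partial>lborel)"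
    unfolding J_def
  proof (rule nn_integral_mono_AE)
    show "AE t in lborel. (mass w t)\<^sup>2 \<le> (ennreal (C * D))\<^sup>2 * (mass (duhamel (\<mu> / 2) (star ?f w)) t)\<^sup>2"
      using w_le
    proof eventually_elim
      case (elim t)
      show ?case
      proof (cases "t > 0")
        case True
        with elim have "AE \<xi> in lborel. w (t, \<xi>) \<le> ennreal (C * D) * duhamel (\<mu> / 2) (star ?f w) (t, \<xi>)" by simp
        then have "mass w t \<le> (\<integral>\<^sup>+\<xi>. ennreal (C * D) * duhamel (\<mu> / 2) (star ?f w) (t, \<xi>) \<partial>lborel)"
          unfolding mass_def by (rule nn_integral_mono_AE)
        also have "\<dots> = ennreal (C * D) * mass (duhamel (\<mu> / 2) (star ?f w)) t"
          unfolding mass_def by (rule nn_integral_cmult) measurable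
        finally show ?thesis unfolding power_mult_distrib[symmetric] by (rule power_mono) simp
      next
        case False
        then have "mass w t = 0" by (simp add: mass_def w0)
        then show ?thesis by simp
      qed
    qed
  qed
  also have "\<dots> = (ennreal (C * D))\<^sup>2 * (\<integral>\<^sup>+t. (mass (duhamel (\<mu> / 2) (star ?f w)) t)\<^sup>2 \<partial>lborel)"
    by (rule nn_integral_cmult) measurable
  also have "\<dots> \<le> (ennreal (C * D))\<^sup>2 * (ennreal (1 / \<mu>) * (\<integral>\<^sup>+\<tau>. mass (star ?f w) \<tau> \<partial>lborel)\<^sup>2)"
    using duhamel_estimate[of "star ?f w" "\<mu> / 2"] \<mu> by (intro mult_left_mono) auto
  also have "\<dots> \<le> (ennreal (C * D))\<^sup>2 * (ennreal (1 / \<mu>) * (ennreal (2 * \<alpha>) * J))"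
  proof (intro mult_left_mono)
    have "(\<integral>\<^sup>+\<tau>. mass (star ?f w) \<tau> \<partial>lborel)\<^sup>2 = (\<integral>\<^sup>+\<tau>. mass ?f \<tau> * mass w \<tau> \<partial>lborel)\<^sup>2"
      by (simp add: mass_star)
    also have "\<dots> \<le> (\<integral>\<^sup>+t. (mass ?f t)\<^sup>2 \<partial>lborel) * J"
      unfolding J_def by (rule Cauchy_Schwarz_nn_integral) measurable
    also have "\<dots> \<le> ennreal (2 * \<alpha>) * J" by (intro mult_right_mono E) simp
    finally show "(\<integral>\<^sup>+\<tau>. mass (star ?f w) \<tau> \<partial>lborel)\<^sup>2 \<le> ennreal (2 * \<alpha>) * J" .
  qed auto
  also have "\<dots> = (ennreal (C * D))\<^sup>2 * (ennreal (1 / \<mu>) * ennreal (2 * \<alpha>)) * J" by (simp add: mult_ac)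
  also have "\<dots> \<le> (ennreal (1/2))\<^sup>2 * J" by (intro mult_right_mono small') simp
  finally have "J \<le> (ennreal (1/2))\<^sup>2 * J" .
  moreover obtain j where j: "J = ennreal j" "j \<ge> 0" using J_fin by (cases J) auto
  moreover have "(ennreal (1/2))\<^sup>2 * ennreal j = ennreal ((1/2)\<^sup>2 * j)"
  proof -
    have "(ennreal (1/2))\<^sup>2 = ennreal ((1/2)\<^sup>2)" by (rule ennreal_power) simp
    then show ?thesis using j(2) by (simp only: ennreal_mult[symmetric] zero_le_power2)
  qed
  ultimately have "ennreal j \<le> ennreal ((1/2)\<^sup>2 * j)" by (simp only:)
  then have "j \<le> (1/2)\<^sup>2 * j" using j(2) by (subst (asm) ennreal_le_iff) auto
  then have "j = 0" using j(2) by (simp add: power2_eq_square)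
  then have "J = 0" by (simp add: j)
  then have "AE t in lborel. (mass w t)\<^sup>2 = 0" unfolding J_def by (subst (asm) nn_integral_0_iff_AE) auto
  then show ?thesis
  proof eventually_elim
    case (elim t)
    then have "mass w t = 0" by simp
    then have "AE \<xi> in lborel. w (t, \<xi>) = 0" unfolding mass_def by (subst (asm) nn_integral_0_iff_AE) auto
    then show ?case by eventually_elim (use fw in \<open>metis add_0_right\<close>)
  qed
qed

end

section \<open>The nonlinear term on the Fourier side\<close>

subsection \<open>Convolution\<close>

definition conv :: "('a::euclidean_space \<Rightarrow> complex) \<Rightarrow> ('a \<Rightarrow> complex) \<Rightarrow> 'a \<Rightarrow> complex" where
  "conv f g \<xi> = (LINT \<eta>|lborel. f \<eta> * g (\<xi> - \<eta>))"

lemma integrable_conv_pair: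
  fixes f g :: "'a::euclidean_space \<Rightarrow> complex"
  assumes f: "integrable lborel f" and g: "integrable lborel g"
  shows "integrable (lborel \<Otimes>\<^sub>M lborel) (\<lambda>(\<eta>, \<xi>). f \<eta> * g (\<xi> - \<eta>))"
proof -
  have [measurable]: "f \<in> borel_measurable borel" "g \<in> borel_measurable borel" using f g by auto
  have gt: "integrable lborel (\<lambda>\<xi>. g (\<xi> - \<eta>))" for \<eta>
    using integrable_affine[OF g, of 1 "-\<eta>"] by (simp add: add.commute)
  have gn: "(LINT \<xi>|lborel. norm (g (\<xi> - \<eta>))) = (LINT \<xi>|lborel. norm (g \<xi>))" for \<eta>
    using integral_translate[of "\<lambda>\<xi>. norm (g \<xi>)" "-\<eta>"] by (simp add: add.commute)
  show ?thesis
  proof (rule lborel_pair.Fubini_integrable)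
    show "integrable lborel (\<lambda>\<eta>. LINT \<xi>|lborel. norm (case (\<eta>, \<xi>) of (\<eta>, \<xi>) \<Rightarrow> f \<eta> * g (\<xi> - \<eta>)))"
      using f by (simp add: norm_mult gn)
    show "AE \<eta> in lborel. integrable lborel (\<lambda>\<xi>. case (\<eta>, \<xi>) of (\<eta>, \<xi>) \<Rightarrow> f \<eta> * g (\<xi> - \<eta>))"
      using gt by simp
  qed measurable
qed

lemma conv_integrable:
  fixes f g :: "'a::euclidean_space \<Rightarrow> complex"
  assumes f: "integrable lborel f" and g: "integrable lborel g"
  shows "integrable lborel (conv f g)"
  using lborel_pair.integrable_snd[OF integrable_conv_pair[OF assms]] by (simp add: conv_def[abs_def])

lemma norm_conv_le:
  "ennreal (norm (conv f g \<xi>)) \<le> (\<integral>\<^sup>+\<eta>. ennreal (norm (f \<eta>)) * ennreal (norm (g (\<xi> - \<eta>))) \<partial>lborel)"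
proof (cases "integrable lborel (\<lambda>\<eta>. f \<eta> * g (\<xi> - \<eta>))")
  case True
  then have "ennreal (norm (conv f g \<xi>)) \<le> (\<integral>\<^sup>+\<eta>. ennreal (norm (f \<eta> * g (\<xi> - \<eta>))) \<partial>lborel)"
    unfolding conv_def by (rule integral_norm_bound_ennreal)
  then show ?thesis by (simp add: norm_mult ennreal_mult)
next
  case False
  then show ?thesis by (simp add: conv_def not_integrable_integral_eq)
qed

lemma inv_fourier_conv:
  fixes f g :: "real^'n::finite \<Rightarrow> complex"
  assumes f: "integrable lborel f" and g: "integrable lborel g"
  shows "inv_fourier f x * inv_fourier g x = inv_fourier (\<lambda>\<xi>. of_real (fconst TYPE('n)) * conv f g \<xi>) x"
proof -
  let ?c = "complex_of_real (fconst TYPE('n))"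
  have [measurable]: "f \<in> borel_measurable borel" "g \<in> borel_measurable borel" using f g by auto
  have int: "integrable (lborel \<Otimes>\<^sub>M lborel) (\<lambda>(\<eta>, \<xi>). cis (x \<bullet> \<xi>) * (f \<eta> * g (\<xi> - \<eta>)))"
    using integrable_conv_pair[OF assms]
    by (rule Bochner_Integration.integrable_bound) (auto simp: norm_mult split_beta)
  have "(LINT \<xi>|lborel. cis (x \<bullet> \<xi>) * conv f g \<xi>) = (LINT \<xi>|lborel. LINT \<eta>|lborel. cis (x \<bullet> \<xi>) * (f \<eta> * g (\<xi> - \<eta>)))"
    by (simp add: conv_def)
  also have "\<dots> = (LINT \<eta>|lborel. LINT \<xi>|lborel. cis (x \<bullet> \<xi>) * (f \<eta> * g (\<xi> - \<eta>)))"
    by (rule lborel_pair.Fubini_integral[OF int])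
  also have "\<dots> = (LINT \<eta>|lborel. cis (x \<bullet> \<eta>) * f \<eta> * (LINT \<zeta>|lborel. cis (x \<bullet> \<zeta>) * g \<zeta>))"
  proof (intro Bochner_Integration.integral_cong refl)
    fix \<eta>
    have "(LINT \<xi>|lborel. cis (x \<bullet> \<xi>) * (f \<eta> * g (\<xi> - \<eta>))) = (LINT \<zeta>|lborel. cis (x \<bullet> (\<eta> + \<zeta>)) * (f \<eta> * g (\<eta> + \<zeta> - \<eta>)))"
      by (rule integral_translate[symmetric]) measurable
    also have "\<dots> = (LINT \<zeta>|lborel. (cis (x \<bullet> \<eta>) * f \<eta>) * (cis (x \<bullet> \<zeta>) * g \<zeta>))"
      by (intro Bochner_Integration.integral_cong refl) (simp add: inner_add_right cis_mult[symmetric] mult_ac)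
    also have "\<dots> = cis (x \<bullet> \<eta>) * f \<eta> * (LINT \<zeta>|lborel. cis (x \<bullet> \<zeta>) * g \<zeta>)" by (rule integral_mult_right_zero)
    finally show "(LINT \<xi>|lborel. cis (x \<bullet> \<xi>) * (f \<eta> * g (\<xi> - \<eta>))) = cis (x \<bullet> \<eta>) * f \<eta> * (LINT \<zeta>|lborel. cis (x \<bullet> \<zeta>) * g \<zeta>)" .
  qed
  also have "\<dots> = (LINT \<eta>|lborel. cis (x \<bullet> \<eta>) * f \<eta>) * (LINT \<zeta>|lborel. cis (x \<bullet> \<zeta>) * g \<zeta>)"
    by (rule integral_mult_left_zero)
  finally have eq: "(LINT \<xi>|lborel. cis (x \<bullet> \<xi>) * conv f g \<xi>) = (LINT \<eta>|lborel. cis (x \<bullet> \<eta>) * f \<eta>) * (LINT \<zeta>|lborel. cis (x \<bullet> \<zeta>) * g \<zeta>)" .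
  have "inv_fourier (\<lambda>\<xi>. ?c * conv f g \<xi>) x = ?c * inv_fourier (conv f g) x"
    by (simp add: inv_fourier_eq_fourier fourier_cmult)
  then show ?thesis by (simp add: inv_fourier_eq eq mult_ac)
qed

text \<open>Both sides have the same pairing with every test function. The right-hand side is a continuous
  function, which gives the transform of a product a meaning at the single frequency zero.\<close>

lemma conv_eq_fourier_AE:
  fixes f g :: "real^'n::finite \<Rightarrow> complex" and \<theta> :: "real^'n \<Rightarrow> real"
  assumes \<theta>: "dyadic_cutoff \<theta>" and f: "integrable lborel f" and g: "integrable lborel g"
    and fg: "integrable lborel (\<lambda>x. inv_fourier f x * inv_fourier g x)"
  shows "AE \<xi> in lborel. of_real (fconst TYPE('n)) * conv f g \<xi> = fourier (\<lambda>x. inv_fourier f x * inv_fourier g x) \<xi>"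
proof -
  let ?W = "\<lambda>\<xi>. of_real (fconst TYPE('n)) * conv f g \<xi>" and ?p = "\<lambda>x. inv_fourier f x * inv_fourier g x"
  have W: "integrable lborel ?W" using conv_integrable[OF f g] by auto
  have Fp: "locally_integrable (fourier ?p)"
  proof (rule locally_integrable_bound[where g="\<lambda>_. 1::real"])
    show "locally_integrable (\<lambda>_::real^'n. 1::real)"
      unfolding locally_integrable_def set_integrable_def
      by (auto simp: borel_closed compact_imp_closed intro!: integrable_real_indicator emeasure_compact_finite)
    show "fourier ?p \<in> borel_measurable borel" using fg by (intro fourier_measurable) auto
    show "AE \<xi> in lborel. norm (fourier ?p \<xi>) \<le> (fconst TYPE('n) * (LINT x|lborel. norm (?p x))) * norm (1::real)"
      using norm_fourier_le[of ?p] by simp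
  qed
  have "AE \<xi> in lborel. ?W \<xi> - fourier ?p \<xi> = 0"
  proof (rule locally_integrable_eq_zero[OF \<theta>])
    show "set_integrable lborel K (\<lambda>\<xi>. ?W \<xi> - fourier ?p \<xi>)" if "compact K" for K
      using Fp integrable_locally_integrable[OF W] that unfolding locally_integrable_def by (intro set_integral_diff) auto
    show "(LINT \<xi>|lborel. (?W \<xi> - fourier ?p \<xi>) * \<phi> \<xi>) = 0" if \<phi>: "\<phi> \<in> test_functions" for \<phi>
    proof -
      have "(LINT \<xi>|lborel. fourier ?p \<xi> * \<phi> \<xi>) = (LINT x|lborel. ?p x * fourier \<phi> x)"
        by (rule fourier_exchange[OF fg test_integrable[OF \<phi>]])
      also have "\<dots> = (LINT x|lborel. inv_fourier ?W x * fourier \<phi> x)" by (simp only: inv_fourier_conv[OF f g])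
      also have "\<dots> = (LINT \<xi>|lborel. ?W \<xi> * \<phi> \<xi>)" by (rule pairing_inversion[OF W \<phi>])
      finally show ?thesis
        using locally_integrable_times_test[OF Fp \<phi>] locally_integrable_times_test[OF integrable_locally_integrable[OF W] \<phi>]
        by (simp add: left_diff_distrib)
    qed
  qed
  then show ?thesis by eventually_elim simp
qed

subsection \<open>The divergence of the tensor product\<close>

definition nonlin :: "(real^'n::finite \<Rightarrow> complex^'n) \<Rightarrow> real^'n \<Rightarrow> complex^'n" where
  "nonlin g \<xi> = (\<chi> l. \<Sum>k\<in>UNIV. \<i> * of_real (\<xi> $ k) *
     (of_real (fconst TYPE('n)) * conv (\<lambda>\<eta>. g \<eta> $ k) (\<lambda>\<eta>. g \<eta> $ l) \<xi>))"

lemma integrable_nth: "integrable M g \<Longrightarrow> integrable M (\<lambda>x. g x $ i)"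
  for g :: "'a \<Rightarrow> complex^'n::finite"
  by (rule integrable_bounded_linear[OF bounded_linear_vec_nth])

lemma locally_integrable_mult_continuous:
  fixes f h :: "real^'n::finite \<Rightarrow> complex"
  assumes f: "locally_integrable f" and h: "continuous_on UNIV h"
  shows "locally_integrable (\<lambda>x. h x * f x)"
  unfolding locally_integrable_def set_integrable_def
proof (intro allI impI)
  fix K :: "(real^'n) set" assume K: "compact K"
  then have [measurable]: "K \<in> sets borel" by (simp add: borel_closed compact_imp_closed)
  have [measurable]: "f \<in> borel_measurable borel" "h \<in> borel_measurable borel"
    using locally_integrable_measurable[OF f] borel_measurable_continuous_onI[OF h] by auto
  have "bounded (h ` K)" using K h by (intro compact_imp_bounded compact_continuous_image continuous_on_subset[OF h]) auto
  then obtain B where B: "\<And>x. x \<in> K \<Longrightarrow> norm (h x) \<le> B" unfolding bounded_iff by auto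
  have "integrable lborel (\<lambda>x. B * norm (indicator K x *\<^sub>R f x))"
    by (intro integrable_mult_right integrable_norm locally_integrableD[OF f K])
  then show "integrable lborel (\<lambda>x. indicator K x *\<^sub>R (h x * f x))"
  proof (rule Bochner_Integration.integrable_bound)
    have "norm (indicator K x *\<^sub>R (h x * f x)) \<le> norm (B * norm (indicator K x *\<^sub>R f x))" for x
    proof (cases "x \<in> K")
      case True
      then have "norm (h x) * norm (f x) \<le> \<bar>B\<bar> * norm (f x)" using B[OF True] by (intro mult_right_mono) auto
      then show ?thesis using True by (simp add: norm_mult abs_mult)
    qed simp
    then show "AE x in lborel. norm (indicator K x *\<^sub>R (h x * f x)) \<le> norm (B * norm (indicator K x *\<^sub>R f x))" by simp
  qed measurable
qed

lemma locally_integrable_sum: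
  fixes f :: "'i \<Rightarrow> real^'n::finite \<Rightarrow> 'b::euclidean_space"
  assumes "\<And>i. i \<in> I \<Longrightarrow> locally_integrable (f i)"
  shows "locally_integrable (\<lambda>x. \<Sum>i\<in>I. f i x)"
  using assms unfolding locally_integrable_def set_integrable_def
  by (auto simp: scaleR_sum_right intro!: Bochner_Integration.integrable_sum)

lemma norm_vec_le_sum: "norm (v :: complex^'n::finite) \<le> (\<Sum>i\<in>UNIV. norm (v $ i))"
  by (simp add: norm_vec_def L2_set_le_sum)

lemma locally_integrable_vec:
  fixes f :: "real^'n::finite \<Rightarrow> complex^'m::finite"
  assumes "\<And>i. locally_integrable (\<lambda>x. f x $ i)"
  shows "locally_integrable f"
proof (rule locally_integrable_bound[where C=1])
  show "locally_integrable (\<lambda>x. \<Sum>i\<in>UNIV. norm (f x $ i))"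
  proof (rule locally_integrable_sum)
    show "locally_integrable (\<lambda>x. norm (f x $ i))" for i
      by (rule locally_integrable_bound[OF assms[of i], where C=1])
        (use locally_integrable_measurable[OF assms[of i]] in auto)
  qed
  show "f \<in> borel_measurable borel" by (intro measurable_vec locally_integrable_measurable assms)
  show "AE x in lborel. norm (f x) \<le> 1 * norm (\<Sum>i\<in>UNIV. norm (f x $ i))"
    by (intro AE_I2) (simp add: sum_nonneg norm_vec_le_sum)
qed

lemma locally_integrable_nonlin:
  fixes g :: "real^'n::finite \<Rightarrow> complex^'n"
  assumes "integrable lborel g"
  shows "locally_integrable (nonlin g)"
proof (rule locally_integrable_vec)
  fix l
  have "locally_integrable (\<lambda>\<xi>. (\<i> * of_real (\<xi> $ k)) * (of_real (fconst TYPE('n)) * conv (\<lambda>\<eta>. g \<eta> $ k) (\<lambda>\<eta>. g \<eta> $ l) \<xi>))" for k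
    using conv_integrable[OF integrable_nth[OF assms] integrable_nth[OF assms]]
    by (intro locally_integrable_mult_continuous integrable_locally_integrable integrable_mult_right continuous_intros) auto
  then show "locally_integrable (\<lambda>\<xi>. nonlin g \<xi> $ l)"
    unfolding nonlin_def vec_lambda_beta by (intro locally_integrable_sum)
qed

lemma fval_nth:
  fixes T :: "'n::finite dist"
  assumes \<theta>: "dyadic_cutoff (\<theta> :: real^'n \<Rightarrow> real)" and g: "has_hat T g"
  shows "fval T x $ i = inv_fourier (\<lambda>\<xi>. g \<xi> $ i) x"
proof -
  have [measurable]: "g \<in> borel_measurable borel" "fhat T \<in> borel_measurable borel"
    using g has_hat_fhat[OF g] by (auto simp: has_hat_iff locally_integrable_measurable)
  have "fourier (\<lambda>\<xi>. fhat T \<xi> $ i) = fourier (\<lambda>\<xi>. g \<xi> $ i)"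
    by (rule fourier_cong_AE) (use fhat_AE[OF \<theta> g] in \<open>auto elim: eventually_mono\<close>)
  then show ?thesis by (simp add: fval_def inv_fourier_eq_fourier)
qed

text \<open>Testing with \<open>pd k (fourier \<phi>)\<close> means testing on the Fourier side with \<open>- \<i> * \<xi> $ k * \<phi> \<xi>\<close>, and the
  product of two components is an inverse transform by \<open>inv_fourier_conv\<close>.\<close>

lemma has_hat_div_tensor:
  fixes T :: "'n::finite dist"
  assumes \<theta>: "dyadic_cutoff (\<theta> :: real^'n \<Rightarrow> real)" and g: "has_hat T g" and gi: "integrable lborel g"
  shows "has_hat (div_tensor T) (nonlin g)"
  unfolding has_hat_iff
proof (intro conjI ballI locally_integrable_nonlin[OF gi])
  fix \<phi> :: "real^'n \<Rightarrow> complex" assume \<phi>: "\<phi> \<in> test_functions"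
  show "div_tensor T (fourier \<phi>) = dist_of (nonlin g) \<phi>"
  proof (unfold vec_eq_iff, rule allI)
    fix l
    let ?W = "\<lambda>k \<xi>. of_real (fconst TYPE('n)) * conv (\<lambda>\<eta>. g \<eta> $ k) (\<lambda>\<eta>. g \<eta> $ l) \<xi>"
    have W: "integrable lborel (?W k)" for k
      using conv_integrable[OF integrable_nth[OF gi] integrable_nth[OF gi]] by (intro integrable_mult_right)
    have W\<phi>: "integrable lborel (\<lambda>\<xi>. \<i> * of_real (\<xi> $ k) * ?W k \<xi> * \<phi> \<xi>)" for k
      using W by (intro locally_integrable_times_test[OF _ \<phi>] locally_integrable_mult_continuous
        integrable_locally_integrable continuous_intros) auto
    have "(fval T x $ k *s fval T x) $ l = inv_fourier (?W k) x" for x k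
      using inv_fourier_conv[OF integrable_nth[OF gi, of k] integrable_nth[OF gi, of l], of x]
      by (simp add: fval_nth[OF \<theta> g])
    then have "div_tensor T (fourier \<phi>) $ l = - (\<Sum>k\<in>UNIV. LINT x|lborel. inv_fourier (?W k) x * pd k (fourier \<phi>) x)"
      by (simp add: div_tensor_def del: vector_smult_component)
    also have "\<dots> = - (\<Sum>k\<in>UNIV. LINT \<xi>|lborel. ?W k \<xi> * (- \<i> * of_real (\<xi> $ k) * \<phi> \<xi>))"
      unfolding fourier_pd[OF test_second_moment[OF \<phi>]]
      by (simp only: pairing_inversion[OF W test_mult_coord[OF \<phi>]])
    also have "\<dots> = (\<Sum>k\<in>UNIV. LINT \<xi>|lborel. \<i> * of_real (\<xi> $ k) * ?W k \<xi> * \<phi> \<xi>)"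
    proof -
      have "?W k \<xi> * (- \<i> * of_real (\<xi> $ k) * \<phi> \<xi>) = - (\<i> * of_real (\<xi> $ k) * ?W k \<xi> * \<phi> \<xi>)" for k \<xi>
        by (simp add: mult_ac)
      then show ?thesis by (simp only: Bochner_Integration.integral_minus sum_negf minus_minus)
    qed
    also have "\<dots> = (LINT \<xi>|lborel. (\<Sum>k\<in>UNIV. \<i> * of_real (\<xi> $ k) * ?W k \<xi> * \<phi> \<xi>))"
      by (rule Bochner_Integration.integral_sum[symmetric]) (rule W\<phi>)
    also have "\<dots> = dist_of (nonlin g) \<phi> $ l"
      by (simp only: dist_of_nth nonlin_def vec_lambda_beta sum_distrib_right)
    finally show "div_tensor T (fourier \<phi>) $ l = dist_of (nonlin g) \<phi> $ l" .
  qed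
qed

subsection \<open>The Leray projection\<close>

lemma leray_symbol_measurable[measurable]: "leray_symbol \<in> borel_measurable (borel :: (real^'n::finite) measure)"
  unfolding leray_symbol_def[abs_def] by measurable

lemma norm_leray_symbol_nth: "norm (leray_symbol \<xi> $ l $ m) \<le> 2"
proof -
  have "\<bar>\<xi> $ l * \<xi> $ m / (norm \<xi>)\<^sup>2\<bar> \<le> 1"
  proof (cases "\<xi> = 0")
    case False
    have "\<bar>\<xi> $ l * \<xi> $ m\<bar> \<le> norm \<xi> * norm \<xi>"
      unfolding abs_mult by (intro mult_mono component_le_norm_cart) auto
    then show ?thesis using False by (simp add: power2_eq_square divide_le_eq)
  qed simp
  moreover have "\<bar>(if b then 1 else 0) - a\<bar> \<le> 2" if "\<bar>a\<bar> \<le> 1" for a :: real and b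
    using that by auto
  ultimately have "\<bar>(if l = m then 1 else 0) - \<xi> $ l * \<xi> $ m / (norm \<xi>)\<^sup>2\<bar> \<le> 2" by blast
  then show ?thesis by (simp only: leray_symbol_def vec_lambda_beta norm_of_real)
qed

definition leray_bound :: "'n::finite itself \<Rightarrow> real" where
  "leray_bound _ = 2 * (real CARD('n))\<^sup>2"

lemma leray_bound_nonneg[simp]: "0 \<le> leray_bound T" by (simp add: leray_bound_def)

lemma norm_leray_le:
  fixes x :: "complex^'n::finite"
  shows "norm (leray_symbol \<xi> *v x) \<le> leray_bound TYPE('n) * norm x"
proof -
  have "norm (leray_symbol \<xi> *v x) \<le> (\<Sum>l\<in>UNIV. norm (\<Sum>m\<in>UNIV. leray_symbol \<xi> $ l $ m * x $ m))"
    using norm_vec_le_sum[of "leray_symbol \<xi> *v x"] by (simp add: matrix_vector_mult_def)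
  also have "\<dots> \<le> (\<Sum>l\<in>(UNIV::'n set). \<Sum>m\<in>(UNIV::'n set). 2 * norm x)"
    by (intro sum_mono order_trans[OF norm_sum])
      (auto simp: norm_mult intro!: sum_mono mult_mono norm_leray_symbol_nth Finite_Cartesian_Product.norm_nth_le)
  also have "\<dots> = leray_bound TYPE('n) * norm x" by (simp add: leray_bound_def power2_eq_square)
  finally show ?thesis .
qed

lemma locally_integrable_leray:
  fixes g :: "real^'n::finite \<Rightarrow> complex^'n"
  assumes "locally_integrable g"
  shows "locally_integrable (\<lambda>\<xi>. leray_symbol \<xi> *v g \<xi>)"
  by (rule locally_integrable_bound[OF assms, where C="leray_bound TYPE('n)"])
    (use locally_integrable_measurable[OF assms] norm_leray_le in auto)

lemma has_hat_leray_div_tensor: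
  fixes T :: "'n::finite dist"
  assumes \<theta>: "dyadic_cutoff (\<theta> :: real^'n \<Rightarrow> real)" and g: "has_hat T g" and gi: "integrable lborel g"
  shows "has_hat (leray (div_tensor T)) (\<lambda>\<xi>. leray_symbol \<xi> *v nonlin g \<xi>)"
  unfolding leray_def
  by (rule has_hat_fourier_mult[OF \<theta> has_hat_div_tensor[OF assms] leray_symbol_measurable
        locally_integrable_leray[OF locally_integrable_nonlin[OF gi]]])

lemma heat_apply:
  fixes T :: "'n::finite dist"
  assumes \<theta>: "dyadic_cutoff (\<theta> :: real^'n \<Rightarrow> real)" and g: "has_hat T g" and \<phi>: "\<phi> \<in> test_functions"
  shows "heat \<mu> t T (fourier \<phi>) = dist_of (\<lambda>\<xi>. of_real (exp (- \<mu> * t * (norm \<xi>)\<^sup>2)) *s g \<xi>) \<phi>"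
proof -
  have "(\<lambda>\<xi>::real^'n. mat (complex_of_real (exp (- \<mu> * t * (norm \<xi>)\<^sup>2))) :: complex^'n^'n) \<in> borel_measurable borel"
    unfolding mat_def by measurable
  from fourier_mult_apply[OF \<theta> g this \<phi>] show ?thesis
    by (simp add: heat_def scalar_mult_def mat_mult_vec)
qed

definition nonlin_bound :: "'n::finite itself \<Rightarrow> real" where
  "nonlin_bound _ = (real CARD('n))\<^sup>2 * fconst TYPE('n)"

lemma nonlin_bound_nonneg[simp]: "0 \<le> nonlin_bound (T :: 'n::finite itself)"
  using fconst_pos[where 'n='n] by (simp add: nonlin_bound_def less_imp_le)

lemma norm_nonlin_le:
  fixes g :: "real^'n::finite \<Rightarrow> complex^'n"
  shows "ennreal (norm (nonlin g \<xi>)) \<le> ennreal (nonlin_bound TYPE('n) * norm \<xi>) *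
    (\<integral>\<^sup>+\<eta>. ennreal (norm (g \<eta>)) * ennreal (norm (g (\<xi> - \<eta>))) \<partial>lborel)"
proof -
  let ?I = "\<integral>\<^sup>+\<eta>. ennreal (norm (g \<eta>)) * ennreal (norm (g (\<xi> - \<eta>))) \<partial>lborel" and ?c = "fconst TYPE('n)"
  have c: "ennreal (norm (conv (\<lambda>\<eta>. g \<eta> $ k) (\<lambda>\<eta>. g \<eta> $ l) \<xi>)) \<le> ?I" for k l
    by (rule order_trans[OF norm_conv_le])
      (auto intro!: nn_integral_mono mult_mono ennreal_leI Finite_Cartesian_Product.norm_nth_le)
  have "norm (nonlin g \<xi>) \<le> (\<Sum>l\<in>UNIV. \<Sum>k\<in>UNIV. norm \<xi> * (?c * norm (conv (\<lambda>\<eta>. g \<eta> $ k) (\<lambda>\<eta>. g \<eta> $ l) \<xi>)))"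
  proof (rule order_trans[OF norm_vec_le_sum sum_mono])
    fix l
    show "norm (nonlin g \<xi> $ l) \<le> (\<Sum>k\<in>UNIV. norm \<xi> * (?c * norm (conv (\<lambda>\<eta>. g \<eta> $ k) (\<lambda>\<eta>. g \<eta> $ l) \<xi>)))"
      unfolding nonlin_def vec_lambda_beta
      by (rule order_trans[OF norm_sum sum_mono])
        (auto simp: norm_mult less_imp_le intro!: mult_right_mono component_le_norm_cart)
  qed
  then have "ennreal (norm (nonlin g \<xi>)) \<le> (\<Sum>l\<in>UNIV. \<Sum>k\<in>UNIV. ennreal (norm \<xi> * ?c) * ennreal (norm (conv (\<lambda>\<eta>. g \<eta> $ k) (\<lambda>\<eta>. g \<eta> $ l) \<xi>)))"
    by (simp add: ennreal_leI ennreal_mult[symmetric] sum_ennreal sum_nonneg less_imp_le mult.assoc)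
  also have "\<dots> \<le> (\<Sum>l\<in>(UNIV::'n set). \<Sum>k\<in>(UNIV::'n set). ennreal (norm \<xi> * ?c) * ?I)"
    by (intro sum_mono mult_left_mono c) simp
  also have "\<dots> = ennreal (nonlin_bound TYPE('n) * norm \<xi>) * ?I"
  proof -
    have "ennreal (nonlin_bound TYPE('n) * norm \<xi>) = of_nat CARD('n) * (of_nat CARD('n) * ennreal (norm \<xi> * ?c))"
      by (simp add: nonlin_bound_def power2_eq_square ennreal_of_nat_eq_real_of_nat ennreal_mult[symmetric] less_imp_le mult_ac)
    then show ?thesis by (simp add: mult.assoc)
  qed
  finally show ?thesis .
qed

section \<open>Mild solutions on the Fourier side\<close>

subsection \<open>A measurable representative of the Fourier transform\<close>

lemma conj_exp_top: "conj_exp \<infinity> = 1"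
  by (simp add: conj_exp_def)

lemma epowr_one: "epowr x 1 = x"
  by (cases x) (auto simp: epowr_def)

lemma epowr_two: "epowr x 2 = x\<^sup>2"
  by (cases x) (auto simp: epowr_def ennreal_power power_top_ennreal)

lemma Lq_norm_one: "Lq_norm M 1 f = (\<integral>\<^sup>+x. f x \<partial>M)"
  by (simp add: Lq_norm_def epowr_one)

lemma hatL_norm_top: "locint_hat T \<Longrightarrow> hatL_norm \<infinity> T = (\<integral>\<^sup>+\<xi>. ennreal (norm (fhat T \<xi>)) \<partial>lborel)"
  by (simp add: hatL_norm_def conj_exp_top[simplified] Lq_norm_one)

text \<open>Setting the representative to zero at the exceptional times at which it is not integrable
  makes it integrable at every time, without changing it at almost every time.\<close>

lemma mild_representative:
  fixes u :: "real \<Rightarrow> 'n::finite dist"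
  assumes "L2_hatLinf u"
  obtains v :: "real \<times> (real^'n) \<Rightarrow> complex^'n"
  where "v \<in> borel_measurable (borel \<Otimes>\<^sub>M borel)"
    and "\<And>t. integrable lborel (\<lambda>\<xi>. v (t, \<xi>))"
    and "\<And>t \<xi>. t \<le> 0 \<Longrightarrow> v (t, \<xi>) = 0"
    and "AE t in lborel. 0 < t \<longrightarrow> has_hat (u t) (\<lambda>\<xi>. v (t, \<xi>))"
    and "(\<integral>\<^sup>+t. (mass (\<lambda>p. ennreal (norm (v p))) t)\<^sup>2 \<partial>lborel) < \<infinity>"
proof -
  obtain w :: "real \<times> (real^'n) \<Rightarrow> complex^'n" where w: "w \<in> borel_measurable borel"
    and good: "AE t in lebesgue. 0 < t \<longrightarrow> locint_hat (u t) \<and> (AE \<xi> in lborel. w (t, \<xi>) = fhat (u t) \<xi>)"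
    and fin: "Lq_norm (restrict_space lebesgue {0<..}) 2 (\<lambda>t. hatL_norm \<infinity> (u t)) < \<infinity>"
    using assms unfolding L2_hatLinf_def by blast
  have [measurable]: "w \<in> borel_measurable (borel \<Otimes>\<^sub>M borel)" using w by (simp add: borel_prod)
  have good': "AE t in lborel. 0 < t \<longrightarrow> locint_hat (u t) \<and> (AE \<xi> in lborel. w (t, \<xi>) = fhat (u t) \<xi>)"
    using good by (simp add: AE_completion_iff)
  define A where "A t = (\<integral>\<^sup>+\<xi>. ennreal (norm (w (t, \<xi>))) \<partial>lborel)" for t
  have [measurable]: "A \<in> borel_measurable borel" unfolding A_def by measurable
  have A: "AE t in lborel. 0 < t \<longrightarrow> hatL_norm \<infinity> (u t) = A t"
    using good'
  proof eventually_elim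
    case (elim t)
    show ?case
    proof
      assume "0 < t"
      with elim have l: "locint_hat (u t)" and ae: "AE \<xi> in lborel. w (t, \<xi>) = fhat (u t) \<xi>" by auto
      show "hatL_norm \<infinity> (u t) = A t"
        unfolding hatL_norm_top[OF l] A_def
        by (rule nn_integral_cong_AE) (use ae in \<open>auto elim: eventually_mono\<close>)
    qed
  qed
  have "(\<integral>\<^sup>+t. epowr (hatL_norm \<infinity> (u t)) 2 \<partial>restrict_space lebesgue {0<..}) < \<infinity>"
  proof (rule ccontr)
    assume "\<not> ?thesis"
    then have "(\<integral>\<^sup>+t. epowr (hatL_norm \<infinity> (u t)) 2 \<partial>restrict_space lebesgue {0<..}) = \<infinity>"
      by (simp add: less_top[symmetric])
    then have "Lq_norm (restrict_space lebesgue {0<..}) 2 (\<lambda>t. hatL_norm \<infinity> (u t)) = \<infinity>"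
      by (simp add: Lq_norm_def epowr_def)
    then show False using fin by simp
  qed
  also have "(\<integral>\<^sup>+t. epowr (hatL_norm \<infinity> (u t)) 2 \<partial>restrict_space lebesgue {0<..}) =
      (\<integral>\<^sup>+t. (hatL_norm \<infinity> (u t))\<^sup>2 * indicator {0<..} t \<partial>lborel)"
    by (subst nn_integral_restrict_space) (auto simp: epowr_two nn_integral_completion)
  also have "\<dots> = (\<integral>\<^sup>+t. (A t)\<^sup>2 * indicator {0<..} t \<partial>lborel)"
    by (rule nn_integral_cong_AE) (use A in \<open>auto simp: indicator_def elim: eventually_mono\<close>)
  finally have Afin: "(\<integral>\<^sup>+t. (A t)\<^sup>2 * indicator {0<..} t \<partial>lborel) < \<infinity>" .
  then have "AE t in lborel. (A t)\<^sup>2 * indicator {0<..} t \<noteq> \<infinity>"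
    by (intro nn_integral_PInf_AE) auto
  then have A_AE: "AE t in lborel. 0 < t \<longrightarrow> A t < \<infinity>"
    by eventually_elim (auto simp: less_top[symmetric] power_eq_top_ennreal)
  define v where "v = (\<lambda>(t, \<xi>). if 0 < t \<and> A t < \<infinity> then w (t, \<xi>) else 0)"
  have vm[measurable]: "v \<in> borel_measurable (borel \<Otimes>\<^sub>M borel)" unfolding v_def by measurable
  show ?thesis
  proof (rule that[OF vm])
    show "integrable lborel (\<lambda>\<xi>. v (t, \<xi>))" for t
    proof (cases "0 < t \<and> A t < \<infinity>")
      case True
      then show ?thesis by (simp add: integrable_iff_bounded v_def A_def)
    next
      case False
      then have "(\<lambda>\<xi>. v (t, \<xi>)) = (\<lambda>_. 0)" by (auto simp: v_def)
      then show ?thesis by simp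
    qed
    show "v (t, \<xi>) = 0" if "t \<le> 0" for t \<xi> using that by (simp add: v_def)
    show "AE t in lborel. 0 < t \<longrightarrow> has_hat (u t) (\<lambda>\<xi>. v (t, \<xi>))"
      using good' A_AE
    proof eventually_elim
      case (elim t)
      show ?case
      proof
        assume t: "0 < t"
        with elim obtain g where "has_hat (u t) g" unfolding locint_hat_def by blast
        then have "has_hat (u t) (fhat (u t))" by (rule has_hat_fhat)
        then show "has_hat (u t) (\<lambda>\<xi>. v (t, \<xi>))"
          by (rule has_hat_cong_AE) (use t elim in \<open>auto simp: v_def elim: eventually_mono\<close>)
      qed
    qed
    have "(mass (\<lambda>p. ennreal (norm (v p))) t)\<^sup>2 \<le> (A t)\<^sup>2 * indicator {0<..} t" for t
    proof (cases "0 < t \<and> A t < \<infinity>")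
      case True
      then show ?thesis by (simp add: mass_def v_def A_def)
    next
      case False
      then have "(\<lambda>\<xi>. v (t, \<xi>)) = (\<lambda>_. 0)" by (auto simp: v_def)
      then have "mass (\<lambda>p. ennreal (norm (v p))) t = (\<integral>\<^sup>+\<xi>. 0 \<partial>(lborel :: (real^'n) measure))"
        unfolding mass_def by (intro nn_integral_cong) (simp add: fun_eq_iff)
      then show ?thesis by simp
    qed
    then have "(\<integral>\<^sup>+t. (mass (\<lambda>p. ennreal (norm (v p))) t)\<^sup>2 \<partial>lborel) \<le> (\<integral>\<^sup>+t. (A t)\<^sup>2 * indicator {0<..} t \<partial>lborel)"
      by (rule nn_integral_mono)
    then show "(\<integral>\<^sup>+t. (mass (\<lambda>p. ennreal (norm (v p))) t)\<^sup>2 \<partial>lborel) < \<infinity>"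
      using Afin by (rule le_less_trans)
  qed
qed

subsection \<open>The Duhamel formula\<close>

text \<open>Nothing is known about the solution at times in a null set. Hence the completed measure in the
  definition of a mild solution, and the passage to a Borel version here.\<close>

lemma integral_lebesgue_AE:
  fixes f g :: "'a::euclidean_space \<Rightarrow> 'b::{banach, second_countable_topology}"
  assumes ae: "AE x in lborel. f x = g x" and g[measurable]: "g \<in> borel_measurable borel"
  shows "integral\<^sup>L lebesgue f = integral\<^sup>L lborel g"
proof -
  have gl: "g \<in> borel_measurable lebesgue" by (rule measurable_completion) simp
  have ae': "AE x in lebesgue. g x = f x" using ae by (simp add: AE_completion_iff eq_commute)
  have "f \<in> borel_measurable lebesgue"
  proof (rule measurableI)
    fix S :: "'b set" assume S: "S \<in> sets borel"
    show "f -` S \<inter> space lebesgue \<in> sets lebesgue"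
    proof (rule complete_measure.in_sets_AE)
      show "complete_measure (lebesgue :: 'a measure)" ..
      show "AE x in lebesgue. (x \<in> g -` S \<inter> space lebesgue) = (x \<in> f -` S \<inter> space lebesgue)"
        using ae' by eventually_elim auto
      show "g -` S \<inter> space lebesgue \<in> sets lebesgue" by (rule measurable_sets[OF gl S])
    qed auto
  qed auto
  then have "integral\<^sup>L lebesgue f = integral\<^sup>L lebesgue g"
    using gl ae' by (intro integral_cong_AE) (auto elim: eventually_mono)
  also have "\<dots> = integral\<^sup>L lborel g" by (rule integral_completion) simp
  finally show ?thesis .
qed

lemma integrable_vec:
  fixes f :: "'a \<Rightarrow> complex^'n::finite"
  assumes "\<And>i. integrable M (\<lambda>x. f x $ i)"
  shows "integrable M f"
proof (rule Bochner_Integration.integrable_bound)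
  show "integrable M (\<lambda>x. \<Sum>i\<in>UNIV. norm (f x $ i))" using assms by auto
  show "f \<in> borel_measurable M" using assms by (intro measurable_vec) auto
  show "AE x in M. norm (f x) \<le> norm (\<Sum>i\<in>UNIV. norm (f x $ i))"
    by (intro AE_I2) (simp add: sum_nonneg norm_vec_le_sum)
qed

lemma integral_vec_nth:
  fixes f :: "'a \<Rightarrow> complex^'n::finite"
  assumes "integrable M f"
  shows "integral\<^sup>L M f $ i = (LINT x|M. f x $ i)"
  using integral_bounded_linear[OF bounded_linear_vec_nth assms, of i] by simp

definition force :: "(real \<times> (real^'n::finite) \<Rightarrow> complex^'n) \<Rightarrow> real \<times> (real^'n) \<Rightarrow> complex^'n" where
  "force v = (\<lambda>(\<tau>, \<xi>). leray_symbol \<xi> *v nonlin (\<lambda>\<eta>. v (\<tau>, \<eta>)) \<xi>)"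

definition heat_factor :: "real \<Rightarrow> real \<Rightarrow> real \<Rightarrow> real^'n::finite \<Rightarrow> real" where
  "heat_factor \<mu> t \<tau> \<xi> = indicator {0<..<t} \<tau> * exp (- \<mu> * (t - \<tau>) * (norm \<xi>)\<^sup>2)"

definition duhamel_hat ::
    "real \<Rightarrow> (real \<times> (real^'n::finite) \<Rightarrow> complex^'n) \<Rightarrow> real \<Rightarrow> real^'n \<Rightarrow> complex^'n" where
  "duhamel_hat \<mu> v t \<xi> = (\<chi> i. LINT \<tau>|lborel. of_real (heat_factor \<mu> t \<tau> \<xi>) * force v (\<tau>, \<xi>) $ i)"

lemma heat_factor_measurable[measurable]:
  assumes [measurable]: "f \<in> borel_measurable M" "h \<in> borel_measurable M" "g \<in> borel_measurable M"
  shows "(\<lambda>x. heat_factor \<mu> (f x) (h x) (g x)) \<in> borel_measurable M"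
proof -
  have eq: "heat_factor \<mu> (f x) (h x) (g x) = (if 0 < h x \<and> h x < f x then 1 else 0) *
      exp (- \<mu> * (f x - h x) * (norm (g x))\<^sup>2)" for x
    by (simp add: heat_factor_def indicator_def)
  show ?thesis unfolding eq by measurable
qed

lemma heat_factor_bounds: "\<mu> > 0 \<Longrightarrow> 0 \<le> heat_factor \<mu> t \<tau> \<xi> \<and> heat_factor \<mu> t \<tau> \<xi> \<le> 1"
  by (auto simp: heat_factor_def indicator_def)

lemma force_measurable[measurable]:
  fixes v :: "real \<times> (real^'n::finite) \<Rightarrow> complex^'n"
  assumes [measurable]: "v \<in> borel_measurable (borel \<Otimes>\<^sub>M borel)"
  shows "force v \<in> borel_measurable (borel \<Otimes>\<^sub>M borel)"
proof -
  have "(\<lambda>(\<tau>, \<xi>). nonlin (\<lambda>\<eta>. v (\<tau>, \<eta>)) \<xi>) \<in> borel_measurable (borel \<Otimes>\<^sub>M borel)"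
    unfolding nonlin_def conv_def by measurable
  then have [measurable]: "(\<lambda>p. nonlin (\<lambda>\<eta>. v (fst p, \<eta>)) (snd p)) \<in> borel_measurable (borel \<Otimes>\<^sub>M borel)"
    by (simp add: split_beta)
  show ?thesis unfolding force_def split_beta by measurable
qed

definition force_bound :: "'n::finite itself \<Rightarrow> real" where
  "force_bound _ = leray_bound TYPE('n) * nonlin_bound TYPE('n)"

lemma force_bound_nonneg[simp]: "0 \<le> force_bound (T :: 'n::finite itself)"
  by (simp add: force_bound_def)

lemma norm_force_le:
  fixes v :: "real \<times> (real^'n::finite) \<Rightarrow> complex^'n"
  defines "N \<equiv> \<lambda>p. ennreal (norm (v p))"
  shows "ennreal (norm (force v (\<tau>, \<xi>))) \<le> ennreal (force_bound TYPE('n) * norm \<xi>) * star N N (\<tau>, \<xi>)"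
proof -
  have "ennreal (norm (force v (\<tau>, \<xi>))) \<le> ennreal (leray_bound TYPE('n)) * ennreal (norm (nonlin (\<lambda>\<eta>. v (\<tau>, \<eta>)) \<xi>))"
    by (simp add: force_def ennreal_mult[symmetric] ennreal_leI norm_leray_le)
  also have "\<dots> \<le> ennreal (leray_bound TYPE('n)) * (ennreal (nonlin_bound TYPE('n) * norm \<xi>) * star N N (\<tau>, \<xi>))"
    unfolding star_def N_def split_conv by (intro mult_left_mono norm_nonlin_le) simp
  also have "\<dots> = ennreal (force_bound TYPE('n) * norm \<xi>) * star N N (\<tau>, \<xi>)"
    by (simp add: force_bound_def ennreal_mult mult_ac)
  finally show ?thesis .
qed

lemma integrable_force_pair:
  fixes v :: "real \<times> (real^'n::finite) \<Rightarrow> complex^'n"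
  assumes [measurable]: "v \<in> borel_measurable (borel \<Otimes>\<^sub>M borel)"
    and fin: "(\<integral>\<^sup>+t. (mass (\<lambda>p. ennreal (norm (v p))) t)\<^sup>2 \<partial>lborel) < \<infinity>"
    and \<mu>: "\<mu> > 0"
    and h[measurable]: "h \<in> borel_measurable borel" and hb: "\<And>\<xi>. norm \<xi> * norm (h \<xi>) \<le> B"
  shows "integrable (lborel \<Otimes>\<^sub>M lborel) (\<lambda>(\<tau>, \<xi>). of_real (heat_factor \<mu> t \<tau> \<xi>) * force v (\<tau>, \<xi>) $ i * h \<xi>)"
proof -
  let ?N = "\<lambda>p. ennreal (norm (v p))" and ?C = "force_bound TYPE('n)"
  have B0: "0 \<le> B" using hb[of 0] by simp
  have le: "ennreal (norm (of_real (heat_factor \<mu> t \<tau> \<xi>) * force v (\<tau>, \<xi>) $ i * h \<xi>)) \<le> ennreal (?C * B) * star ?N ?N (\<tau>, \<xi>)" for \<tau> \<xi>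
  proof -
    have "norm (of_real (heat_factor \<mu> t \<tau> \<xi>) * force v (\<tau>, \<xi>) $ i * h \<xi>) \<le> 1 * norm (force v (\<tau>, \<xi>)) * norm (h \<xi>)"
      using heat_factor_bounds[OF \<mu>, of t \<tau> \<xi>] unfolding norm_mult
      by (intro mult_right_mono mult_mono Finite_Cartesian_Product.norm_nth_le) auto
    then have "ennreal (norm (of_real (heat_factor \<mu> t \<tau> \<xi>) * force v (\<tau>, \<xi>) $ i * h \<xi>)) \<le> ennreal (norm (force v (\<tau>, \<xi>))) * ennreal (norm (h \<xi>))"
      by (simp add: ennreal_mult[symmetric] ennreal_leI)
    also have "\<dots> \<le> ennreal (?C * norm \<xi>) * star ?N ?N (\<tau>, \<xi>) * ennreal (norm (h \<xi>))"
      by (intro mult_right_mono norm_force_le) simp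
    also have "\<dots> = ennreal (?C * (norm \<xi> * norm (h \<xi>))) * star ?N ?N (\<tau>, \<xi>)"
      by (simp add: ennreal_mult mult_ac)
    also have "\<dots> \<le> ennreal (?C * B) * star ?N ?N (\<tau>, \<xi>)"
      by (intro mult_right_mono ennreal_leI mult_left_mono hb) auto
    finally show ?thesis .
  qed
  have "(\<integral>\<^sup>+p. ennreal (norm (case p of (\<tau>, \<xi>) \<Rightarrow> of_real (heat_factor \<mu> t \<tau> \<xi>) * force v (\<tau>, \<xi>) $ i * h \<xi>)) \<partial>(lborel \<Otimes>\<^sub>M lborel))
      \<le> (\<integral>\<^sup>+p. ennreal (?C * B) * star ?N ?N p \<partial>(lborel \<Otimes>\<^sub>M lborel))"
    by (intro nn_integral_mono) (auto simp del: norm_mult simp: le split: prod.split)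
  also have "\<dots> = ennreal (?C * B) * (\<integral>\<^sup>+\<tau>. mass (star ?N ?N) \<tau> \<partial>lborel)"
    by (subst nn_integral_cmult) (auto simp: mass_def[abs_def] lborel.nn_integral_fst[symmetric])
  also have "\<dots> = ennreal (?C * B) * (\<integral>\<^sup>+\<tau>. (mass ?N \<tau>)\<^sup>2 \<partial>lborel)"
    by (simp add: mass_star power2_eq_square)
  also have "\<dots> < \<infinity>" using fin by (simp add: ennreal_mult_less_top)
  finally show ?thesis
    unfolding integrable_iff_bounded by (auto simp: split_beta)
qed

text \<open>Testing the mild formulation with \<open>fourier \<phi>\<close> and exchanging the integrals over time and frequency. The
  factor \<open>norm \<xi>\<close> of the nonlinear term is harmless next to a Schwartz function, so that the exchange
  needs only the square integrability in time.\<close>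

lemma mild_solution_hat:
  fixes u :: "real \<Rightarrow> 'n::finite dist"
  assumes \<theta>: "dyadic_cutoff (\<theta> :: real^'n \<Rightarrow> real)" and \<mu>: "\<mu> > 0"
    and mild: "global_mild_solution \<mu> u0 u" and g0: "has_hat u0 g0"
    and v[measurable]: "v \<in> borel_measurable (borel \<Otimes>\<^sub>M borel)"
    and vi: "\<And>t. integrable lborel (\<lambda>\<xi>. v (t, \<xi>))"
    and vhat: "AE t in lborel. 0 < t \<longrightarrow> has_hat (u t) (\<lambda>\<xi>. v (t, \<xi>))"
    and fin: "(\<integral>\<^sup>+t. (mass (\<lambda>p. ennreal (norm (v p))) t)\<^sup>2 \<partial>lborel) < \<infinity>"
    and t: "t > 0"
  shows "has_hat (u t) (\<lambda>\<xi>. of_real (exp (- \<mu> * t * (norm \<xi>)\<^sup>2)) *s g0 \<xi> - duhamel_hat \<mu> v t \<xi>)"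
proof -
  note pair = integrable_force_pair[OF v fin \<mu>]
  have g0l: "locally_integrable g0" using g0 by (simp add: has_hat_iff)
  have [measurable]: "g0 \<in> borel_measurable borel" using g0l by (rule locally_integrable_measurable)
  let ?e = "\<lambda>\<xi>::real^'n. complex_of_real (exp (- \<mu> * t * (norm \<xi>)\<^sup>2))"
  have l1: "locally_integrable (\<lambda>\<xi>. ?e \<xi> *s g0 \<xi>)"
  proof (rule locally_integrable_vec)
    show "locally_integrable (\<lambda>\<xi>. (?e \<xi> *s g0 \<xi>) $ i)" for i
      unfolding vector_smult_component
      by (intro locally_integrable_mult_continuous locally_integrable_nth g0l continuous_intros)
  qed
  have l2: "locally_integrable (duhamel_hat \<mu> v t)"
  proof (rule locally_integrable_vec)
    fix i
    show "locally_integrable (\<lambda>\<xi>. duhamel_hat \<mu> v t \<xi> $ i)"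
      unfolding locally_integrable_def set_integrable_def
    proof (intro allI impI)
      fix K :: "(real^'n) set" assume K: "compact K"
      then have [measurable]: "K \<in> sets borel" by (simp add: borel_closed compact_imp_closed)
      obtain R where R: "R > 0" "\<And>x. x \<in> K \<Longrightarrow> norm x \<le> R" using compact_imp_bounded[OF K] by (auto simp: bounded_pos)
      have "integrable (lborel \<Otimes>\<^sub>M lborel) (\<lambda>(\<tau>, \<xi>). of_real (heat_factor \<mu> t \<tau> \<xi>) * force v (\<tau>, \<xi>) $ i * (indicator K \<xi> :: complex))"
        by (rule pair[where B=R]) (use R in \<open>auto simp: indicator_def\<close>)
      from lborel_pair.integrable_snd[OF this]
      have "integrable lborel (\<lambda>\<xi>. (LINT \<tau>|lborel. of_real (heat_factor \<mu> t \<tau> \<xi>) * force v (\<tau>, \<xi>) $ i) * (indicator K \<xi> :: complex))"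
        by simp
      moreover have "(LINT \<tau>|lborel. of_real (heat_factor \<mu> t \<tau> \<xi>) * force v (\<tau>, \<xi>) $ i) * (indicator K \<xi> :: complex) =
          indicator K \<xi> *\<^sub>R (duhamel_hat \<mu> v t \<xi> $ i)" for \<xi>
        by (simp add: duhamel_hat_def indicator_def)
      ultimately show "integrable lborel (\<lambda>\<xi>. indicator K \<xi> *\<^sub>R (duhamel_hat \<mu> v t \<xi> $ i))" by simp
    qed
  qed
  have l: "locally_integrable (\<lambda>\<xi>. ?e \<xi> *s g0 \<xi> - duhamel_hat \<mu> v t \<xi>)"
    using l1 l2 unfolding locally_integrable_def by (auto intro!: set_integral_diff)
  show ?thesis
    unfolding has_hat_iff
  proof (intro conjI l ballI)
    fix \<phi> :: "real^'n \<Rightarrow> complex" assume \<phi>: "\<phi> \<in> test_functions"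
    note [measurable] = test_measurable[OF \<phi>]
    have f\<phi>: "fourier \<phi> \<in> schwartz" by (rule fourier_test_schwartz[OF \<phi>])
    obtain B where B: "\<And>\<xi>. norm \<xi> * norm (\<phi> \<xi>) \<le> B"
    proof -
      obtain B where "\<And>x. (1 + norm x) ^ 1 * norm (\<phi> x) \<le> B"
        by (rule schwartz_decay[OF test_schwartz[OF \<phi>], where N=1]) auto
      then have "norm \<xi> * norm (\<phi> \<xi>) \<le> B" for \<xi>
        using order_trans[OF mult_right_mono[of "norm \<xi>" "1 + norm \<xi>" "norm (\<phi> \<xi>)"]] by simp
      then show ?thesis using that by blast
    qed
    let ?G = "\<lambda>\<tau>. indicator {0<..<t} \<tau> *\<^sub>R dist_of (\<lambda>\<xi>. of_real (exp (- \<mu> * (t - \<tau>) * (norm \<xi>)\<^sup>2)) *s force v (\<tau>, \<xi>)) \<phi>"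
    have G_nth: "?G \<tau> $ i = (LINT \<xi>|lborel. of_real (heat_factor \<mu> t \<tau> \<xi>) * force v (\<tau>, \<xi>) $ i * \<phi> \<xi>)" for \<tau> i
      by (simp add: heat_factor_def indicator_def)
    have pi: "integrable (lborel \<Otimes>\<^sub>M lborel) (\<lambda>(\<tau>, \<xi>). of_real (heat_factor \<mu> t \<tau> \<xi>) * force v (\<tau>, \<xi>) $ i * \<phi> \<xi>)" for i
      by (rule pair[OF _ B]) measurable
    have Gi: "integrable lborel ?G"
    proof (rule integrable_vec)
      show "integrable lborel (\<lambda>\<tau>. ?G \<tau> $ i)" for i
        unfolding G_nth using lborel_pair.integrable_fst[OF pi[of i]] by simp
    qed
    have "AE \<tau> in lborel. indicator {0<..<t} \<tau> *\<^sub>R heat \<mu> (t - \<tau>) (leray (div_tensor (u \<tau>))) (fourier \<phi>) = ?G \<tau>"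
      using vhat
    proof eventually_elim
      case (elim \<tau>)
      show ?case
      proof (cases "0 < \<tau> \<and> \<tau> < t")
        case True
        then have "has_hat (u \<tau>) (\<lambda>\<xi>. v (\<tau>, \<xi>))" using elim by simp
        from heat_apply[OF \<theta> has_hat_leray_div_tensor[OF \<theta> this vi] \<phi>]
        show ?thesis using True by (simp add: force_def)
      qed simp
    qed
    then have "(LINT \<tau>:{0<..<t}|lebesgue. heat \<mu> (t - \<tau>) (leray (div_tensor (u \<tau>))) (fourier \<phi>)) = (LINT \<tau>|lborel. ?G \<tau>)"
      unfolding set_lebesgue_integral_def by (rule integral_lebesgue_AE) (use Gi in auto)
    moreover have "heat \<mu> t u0 (fourier \<phi>) = dist_of (\<lambda>\<xi>. ?e \<xi> *s g0 \<xi>) \<phi>"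
      by (rule heat_apply[OF \<theta> g0 \<phi>])
    ultimately have ut: "u t (fourier \<phi>) = dist_of (\<lambda>\<xi>. ?e \<xi> *s g0 \<xi>) \<phi> - (LINT \<tau>|lborel. ?G \<tau>)"
      using mild t f\<phi> unfolding global_mild_solution_def by simp
    show "u t (fourier \<phi>) = dist_of (\<lambda>\<xi>. ?e \<xi> *s g0 \<xi> - duhamel_hat \<mu> v t \<xi>) \<phi>"
    proof (unfold vec_eq_iff, rule allI)
      fix i
      have "(LINT \<tau>|lborel. ?G \<tau>) $ i = (LINT \<tau>|lborel. LINT \<xi>|lborel. of_real (heat_factor \<mu> t \<tau> \<xi>) * force v (\<tau>, \<xi>) $ i * \<phi> \<xi>)"
        by (simp only: integral_vec_nth[OF Gi] G_nth)
      also have "\<dots> = (LINT \<xi>|lborel. LINT \<tau>|lborel. of_real (heat_factor \<mu> t \<tau> \<xi>) * force v (\<tau>, \<xi>) $ i * \<phi> \<xi>)"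
        by (rule lborel_pair.Fubini_integral[OF pi, symmetric])
      also have "\<dots> = (LINT \<xi>|lborel. duhamel_hat \<mu> v t \<xi> $ i * \<phi> \<xi>)"
        by (simp add: duhamel_hat_def)
      finally have "u t (fourier \<phi>) $ i = (LINT \<xi>|lborel. (?e \<xi> *s g0 \<xi>) $ i * \<phi> \<xi>) - (LINT \<xi>|lborel. duhamel_hat \<mu> v t \<xi> $ i * \<phi> \<xi>)"
        unfolding ut by (simp only: vector_minus_component dist_of_nth)
      also have "\<dots> = (LINT \<xi>|lborel. (?e \<xi> *s g0 \<xi>) $ i * \<phi> \<xi> - duhamel_hat \<mu> v t \<xi> $ i * \<phi> \<xi>)"
        by (rule Bochner_Integration.integral_diff[symmetric])
          (intro locally_integrable_times_test[OF _ \<phi>] locally_integrable_nth l1 l2)+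
      also have "\<dots> = dist_of (\<lambda>\<xi>. ?e \<xi> *s g0 \<xi> - duhamel_hat \<mu> v t \<xi>) \<phi> $ i"
        by (simp only: dist_of_nth vector_minus_component left_diff_distrib)
      finally show "u t (fourier \<phi>) $ i = dist_of (\<lambda>\<xi>. ?e \<xi> *s g0 \<xi> - duhamel_hat \<mu> v t \<xi>) \<phi> $ i" .
    qed
  qed
qed

definition duhamel_const :: "'n::finite itself \<Rightarrow> real" where
  "duhamel_const _ = real CARD('n) * force_bound TYPE('n)"

lemma norm_duhamel_hat_le:
  fixes v :: "real \<times> (real^'n::finite) \<Rightarrow> complex^'n"
  defines "N \<equiv> \<lambda>p. ennreal (norm (v p))"
  assumes \<mu>: "\<mu> > 0" and v[measurable]: "v \<in> borel_measurable (borel \<Otimes>\<^sub>M borel)"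
  shows "ennreal (norm (duhamel_hat \<mu> v t \<xi>)) \<le> ennreal (duhamel_const TYPE('n)) * duhamel \<mu> (star N N) (t, \<xi>)"
proof -
  have [measurable]: "N \<in> borel_measurable (borel \<Otimes>\<^sub>M borel)" unfolding N_def by measurable
  have i: "ennreal (norm (duhamel_hat \<mu> v t \<xi> $ i)) \<le> ennreal (force_bound TYPE('n)) * duhamel \<mu> (star N N) (t, \<xi>)" for i
  proof -
    have "ennreal (norm (duhamel_hat \<mu> v t \<xi> $ i)) \<le> (\<integral>\<^sup>+\<tau>. ennreal (norm (of_real (heat_factor \<mu> t \<tau> \<xi>) * force v (\<tau>, \<xi>) $ i)) \<partial>lborel)"
    proof (cases "integrable lborel (\<lambda>\<tau>. of_real (heat_factor \<mu> t \<tau> \<xi>) * force v (\<tau>, \<xi>) $ i)")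
      case True
      then show ?thesis unfolding duhamel_hat_def vec_lambda_beta by (rule integral_norm_bound_ennreal)
    next
      case False
      then show ?thesis by (simp add: duhamel_hat_def not_integrable_integral_eq)
    qed
    also have "\<dots> \<le> (\<integral>\<^sup>+\<tau>. ennreal (force_bound TYPE('n)) * (heat_kernel \<mu> t \<tau> \<xi> * star N N (\<tau>, \<xi>)) \<partial>lborel)"
    proof (rule nn_integral_mono)
      fix \<tau>
      have hf: "0 \<le> heat_factor \<mu> t \<tau> \<xi>" using heat_factor_bounds[OF \<mu>] by blast
      have "norm (of_real (heat_factor \<mu> t \<tau> \<xi>) * force v (\<tau>, \<xi>) $ i) \<le> heat_factor \<mu> t \<tau> \<xi> * norm (force v (\<tau>, \<xi>))"
        unfolding norm_mult norm_of_real abs_of_nonneg[OF hf]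
        by (intro mult_left_mono Finite_Cartesian_Product.norm_nth_le hf)
      then have "ennreal (norm (of_real (heat_factor \<mu> t \<tau> \<xi>) * force v (\<tau>, \<xi>) $ i)) \<le> ennreal (heat_factor \<mu> t \<tau> \<xi>) * ennreal (norm (force v (\<tau>, \<xi>)))"
        using hf by (simp add: ennreal_mult[symmetric] ennreal_leI)
      also have "\<dots> \<le> ennreal (heat_factor \<mu> t \<tau> \<xi>) * (ennreal (force_bound TYPE('n) * norm \<xi>) * star N N (\<tau>, \<xi>))"
        unfolding N_def by (intro mult_left_mono norm_force_le) simp
      also have "ennreal (heat_factor \<mu> t \<tau> \<xi>) * (ennreal (force_bound TYPE('n) * norm \<xi>) * star N N (\<tau>, \<xi>)) =
          ennreal (force_bound TYPE('n)) * (heat_kernel \<mu> t \<tau> \<xi> * star N N (\<tau>, \<xi>))"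
        by (simp add: heat_factor_def heat_kernel_def indicator_def ennreal_mult mult_ac)
      finally show "ennreal (norm (of_real (heat_factor \<mu> t \<tau> \<xi>) * force v (\<tau>, \<xi>) $ i)) \<le>
          ennreal (force_bound TYPE('n)) * (heat_kernel \<mu> t \<tau> \<xi> * star N N (\<tau>, \<xi>))" .
    qed
    also have "\<dots> = ennreal (force_bound TYPE('n)) * duhamel \<mu> (star N N) (t, \<xi>)"
      unfolding duhamel_def split_conv by (rule nn_integral_cmult) measurable
    finally show ?thesis .
  qed
  have "ennreal (norm (duhamel_hat \<mu> v t \<xi>)) \<le> ennreal (\<Sum>i\<in>UNIV. norm (duhamel_hat \<mu> v t \<xi> $ i))"
    by (intro ennreal_leI norm_vec_le_sum)
  also have "\<dots> = (\<Sum>i\<in>UNIV. ennreal (norm (duhamel_hat \<mu> v t \<xi> $ i)))" by (simp add: sum_ennreal)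
  also have "\<dots> \<le> (\<Sum>i\<in>(UNIV::'n set). ennreal (force_bound TYPE('n)) * duhamel \<mu> (star N N) (t, \<xi>))"
    by (intro sum_mono i)
  also have "\<dots> = ennreal (duhamel_const TYPE('n)) * duhamel \<mu> (star N N) (t, \<xi>)"
    by (simp add: duhamel_const_def ennreal_mult ennreal_of_nat_eq_real_of_nat mult.assoc)
  finally show ?thesis .
qed

lemma norm_vsmult: "norm (c *s (x :: complex^'n::finite)) = norm c * norm x"
  by (simp add: norm_vec_def norm_mult L2_set_right_distrib)

text \<open>Absolute values in the Duhamel formula: the divergence contributes \<open>norm \<xi>\<close> and the product a
  convolution.\<close>

lemma mild_quadratic_inequality:
  fixes u :: "real \<Rightarrow> 'n::finite dist"
  assumes \<theta>: "dyadic_cutoff (\<theta> :: real^'n \<Rightarrow> real)" and \<mu>: "\<mu> > 0"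
    and mild: "global_mild_solution \<mu> u0 u" and g0: "has_hat u0 g0"
    and v[measurable]: "v \<in> borel_measurable (borel \<Otimes>\<^sub>M borel)"
    and vi: "\<And>t. integrable lborel (\<lambda>\<xi>. v (t, \<xi>))" and v0: "\<And>t \<xi>. t \<le> 0 \<Longrightarrow> v (t, \<xi>) = 0"
    and vhat: "AE t in lborel. 0 < t \<longrightarrow> has_hat (u t) (\<lambda>\<xi>. v (t, \<xi>))"
    and fin: "(\<integral>\<^sup>+t. (mass (\<lambda>p. ennreal (norm (v p))) t)\<^sup>2 \<partial>lborel) < \<infinity>"
  shows "quadratic_inequality \<mu> (duhamel_const TYPE('n)) (\<lambda>p. ennreal (norm (v p))) (\<lambda>\<xi>. ennreal (norm (g0 \<xi>)))"
proof
  let ?N = "\<lambda>p. ennreal (norm (v p))"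
  show "AE t in lborel. 0 < t \<longrightarrow> (AE \<xi> in lborel. ?N (t, \<xi>) \<le>
     ennreal (exp (- \<mu> * t * (norm \<xi>)\<^sup>2)) * ennreal (norm (g0 \<xi>)) + ennreal (duhamel_const TYPE('n)) * duhamel \<mu> (star ?N ?N) (t, \<xi>))"
    using vhat
  proof eventually_elim
    case (elim t)
    show ?case
    proof
      assume t: "0 < t"
      have "AE \<xi> in lborel. v (t, \<xi>) = of_real (exp (- \<mu> * t * (norm \<xi>)\<^sup>2)) *s g0 \<xi> - duhamel_hat \<mu> v t \<xi>"
        using elim t by (intro has_hat_unique[OF \<theta> _ mild_solution_hat[OF \<theta> \<mu> mild g0 v vi vhat fin t]]) simp
      then show "AE \<xi> in lborel. ?N (t, \<xi>) \<le> ennreal (exp (- \<mu> * t * (norm \<xi>)\<^sup>2)) * ennreal (norm (g0 \<xi>)) +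
          ennreal (duhamel_const TYPE('n)) * duhamel \<mu> (star ?N ?N) (t, \<xi>)"
      proof eventually_elim
        case (elim \<xi>)
        have "norm (v (t, \<xi>)) \<le> exp (- \<mu> * t * (norm \<xi>)\<^sup>2) * norm (g0 \<xi>) + norm (duhamel_hat \<mu> v t \<xi>)"
          unfolding elim by (rule order_trans[OF norm_triangle_ineq4]) (simp add: norm_vsmult)
        then have "ennreal (norm (v (t, \<xi>))) \<le> ennreal (exp (- \<mu> * t * (norm \<xi>)\<^sup>2)) * ennreal (norm (g0 \<xi>)) + ennreal (norm (duhamel_hat \<mu> v t \<xi>))"
          by (simp add: ennreal_mult[symmetric] ennreal_plus[symmetric] ennreal_leI del: ennreal_plus)
        also have "\<dots> \<le> ennreal (exp (- \<mu> * t * (norm \<xi>)\<^sup>2)) * ennreal (norm (g0 \<xi>)) + ennreal (duhamel_const TYPE('n)) * duhamel \<mu> (star ?N ?N) (t, \<xi>)"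
          by (intro add_left_mono norm_duhamel_hat_le[OF \<mu> v])
        finally show ?case .
      qed
    qed
  qed
  have [measurable]: "g0 \<in> borel_measurable borel"
    using g0 by (intro locally_integrable_measurable) (simp add: has_hat_iff)
  show "(\<lambda>\<xi>. ennreal (norm (g0 \<xi>))) \<in> borel_measurable borel" by measurable
  show "0 \<le> duhamel_const TYPE('n)" by (simp add: duhamel_const_def)
qed (use \<mu> v0 fin in auto)

section \<open>Initial data in Fourier--Herz spaces\<close>

lemma has_hat_dyadic_block:
  fixes T :: "'n::finite dist"
  assumes \<theta>: "dyadic_cutoff (\<theta> :: real^'n \<Rightarrow> real)" and g: "has_hat T g"
  shows "has_hat (dyadic_block \<theta> j T) (\<lambda>\<xi>. of_real (\<theta> ((2 powi (- j)) *\<^sub>R \<xi>)) *s g \<xi>)"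
proof -
  let ?m = "\<lambda>\<xi>. complex_of_real (\<theta> ((2 powi (- j)) *\<^sub>R \<xi>))"
  have gl: "locally_integrable g" using g by (simp add: has_hat_iff)
  have [measurable]: "\<theta> \<in> borel_measurable borel" using cutoff_integrable[OF \<theta>] by auto
  have gm: "g \<in> borel_measurable borel" by (rule locally_integrable_measurable[OF gl])
  obtain B where B: "\<And>x. norm (\<theta> x) \<le> B" by (rule cutoff_bounded[OF \<theta>]) auto
  have meas: "(\<lambda>\<xi>. mat (?m \<xi>) :: complex^'n^'n) \<in> borel_measurable borel" unfolding mat_def by measurable
  have "locally_integrable (\<lambda>\<xi>. mat (?m \<xi>) *v g \<xi>)"
  proof (rule locally_integrable_bound[OF gl, where C=B])
    show "(\<lambda>\<xi>. mat (?m \<xi>) *v g \<xi>) \<in> borel_measurable borel" using meas gm by (rule matrix_vector_measurable)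
    show "AE \<xi> in lborel. norm (mat (?m \<xi>) *v g \<xi>) \<le> B * norm (g \<xi>)"
      using B by (intro AE_I2) (auto simp: mat_mult_vec norm_vsmult intro!: mult_right_mono)
  qed
  from has_hat_fourier_mult[OF \<theta> g meas this] show ?thesis
    by (simp add: dyadic_block_def scalar_mult_def mat_mult_vec)
qed

text \<open>Only the three dyadic dilates around \<open>log 2 (norm \<xi>)\<close> can be nonzero at \<open>\<xi>\<close>.\<close>

lemma dyadic_partition:
  fixes \<theta> :: "real^'n::finite \<Rightarrow> real"
  assumes \<theta>: "dyadic_cutoff \<theta>" and \<xi>: "\<xi> \<noteq> 0"
  obtains J where "finite J" "card J \<le> 3" "\<And>j::int. \<theta> ((2 powi (- j)) *\<^sub>R \<xi>) \<noteq> 0 \<Longrightarrow> j \<in> J"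
    "(\<Sum>j\<in>J. \<theta> ((2 powi (- j)) *\<^sub>R \<xi>)) = 1"
proof -
  define m where "m = \<lfloor>log 2 (norm \<xi>)\<rfloor>"
  let ?f = "\<lambda>j::int. \<theta> ((2 powi (- j)) *\<^sub>R \<xi>)"
  have pos: "norm \<xi> > 0" using \<xi> by simp
  have J: "j \<in> {m - 1..m + 1}" if "?f j \<noteq> 0" for j
  proof -
    have n: "norm ((2 powi (- j)) *\<^sub>R \<xi>) = 2 powr (log 2 (norm \<xi>) - j)"
      using pos by (simp add: powr_diff powr_real_of_int' power_int_minus divide_inverse mult.commute)
    have "1/2 \<le> 2 powr (log 2 (norm \<xi>) - j)" "2 powr (log 2 (norm \<xi>) - j) \<le> 2"
      using cutoffD(3)[OF \<theta> that] unfolding n by auto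
    then have "2 powr (-1) \<le> 2 powr (log 2 (norm \<xi>) - j)" "2 powr (log 2 (norm \<xi>) - j) \<le> 2 powr 1"
      by (auto simp: powr_minus)
    then have "-1 \<le> log 2 (norm \<xi>) - j" "log 2 (norm \<xi>) - j \<le> 1"
      by (simp_all only: powr_le_cancel_iff one_less_numeral_iff semiring_norm)
    then show ?thesis unfolding m_def by (auto simp: le_floor_iff floor_le_iff) linarith+
  qed
  have "(?f has_sum 1) UNIV" by (rule cutoffD(4)[OF \<theta> \<xi>])
  then have "(?f has_sum 1) {m - 1..m + 1}"
    by (rule has_sum_cong_neutral[THEN iffD1, rotated -1]) (use J in auto)
  moreover have "(?f has_sum (\<Sum>j\<in>{m - 1..m + 1}. ?f j)) {m - 1..m + 1}" by (rule has_sum_finite) simp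
  ultimately have "(\<Sum>j\<in>{m - 1..m + 1}. ?f j) = 1" by (metis has_sum_unique)
  then show ?thesis using J by (intro that[of "{m - 1..m + 1}"]) auto
qed

text \<open>At almost every frequency at most three dyadic blocks contribute, and each is bounded by the norm.\<close>

lemma hat_bounded:
  fixes u0 :: "'n::finite dist"
  assumes \<theta>: "dyadic_cutoff (\<theta> :: real^'n \<Rightarrow> real)" and g: "has_hat u0 g"
    and fin: "herz_norm \<theta> 0 1 \<infinity> u0 < \<infinity>"
  obtains B where "B \<ge> 0" "AE \<xi> in lborel. norm (g \<xi>) \<le> B"
proof -
  let ?F = "\<lambda>j::int. hatL_norm 1 (dyadic_block \<theta> j u0)"
  let ?S = "esssup (count_space (UNIV :: int set)) ?F"
  have S: "?S < \<infinity>" using fin by (simp add: herz_norm_def Lq_norm_def)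
  have "AE j in count_space (UNIV :: int set). ?F j \<le> ?S" by (rule esssup_AE)
  then have F: "?F j \<le> ?S" for j by (simp add: AE_count_space)
  have [measurable]: "g \<in> borel_measurable borel"
    using g by (intro locally_integrable_measurable) (simp add: has_hat_iff)
  have blk: "AE \<xi> in lborel. ennreal (norm (of_real (\<theta> ((2 powi (- j)) *\<^sub>R \<xi>)) *s g \<xi>)) \<le> ?S" for j :: int
  proof -
    let ?b = "dyadic_block \<theta> j u0"
    have lt: "?F j < \<infinity>" using F[of j] S by (rule le_less_trans)
    have "?F j = esssup lborel (\<lambda>\<xi>. ennreal (norm (fhat ?b \<xi>)))"
      using lt by (auto simp: hatL_norm_def conj_exp_def Lq_norm_def split: if_splits)
    moreover have "fhat ?b \<in> borel_measurable borel"
      using has_hat_fhat[OF has_hat_dyadic_block[OF \<theta> g]] by (intro locally_integrable_measurable) (simp add: has_hat_iff)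
    ultimately have "AE \<xi> in lborel. ennreal (norm (fhat ?b \<xi>)) \<le> ?F j"
      using esssup_AE[of "\<lambda>\<xi>. ennreal (norm (fhat ?b \<xi>))" lborel] by simp
    with fhat_AE[OF \<theta> has_hat_dyadic_block[OF \<theta> g, of j]] show ?thesis
      by eventually_elim (use F[of j] in \<open>auto intro: order_trans\<close>)
  qed
  obtain S' where S': "?S = ennreal S'" "S' \<ge> 0" using S by (cases ?S) auto
  have "AE \<xi> in lborel. \<forall>j::int. ennreal (norm (of_real (\<theta> ((2 powi (- j)) *\<^sub>R \<xi>)) *s g \<xi>)) \<le> ?S"
    using blk by (subst AE_all_countable) auto
  moreover have "AE \<xi> in lborel. (\<xi>::real^'n) \<noteq> 0" by (rule AE_lborel_singleton)
  ultimately have "AE \<xi> in lborel. norm (g \<xi>) \<le> 3 * S'"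
  proof eventually_elim
    case (elim \<xi>)
    have le: "\<theta> ((2 powi (- j)) *\<^sub>R \<xi>) * norm (g \<xi>) \<le> S'" for j :: int
      using elim(1) S' cutoffD(2)[OF \<theta>] by (simp add: norm_vsmult)
    obtain J where J: "finite J" "card J \<le> 3" "(\<Sum>j\<in>J. \<theta> ((2 powi (- j)) *\<^sub>R \<xi>)) = 1"
      using dyadic_partition[OF \<theta> elim(2)] by metis
    have "norm (g \<xi>) = (\<Sum>j\<in>J. \<theta> ((2 powi (- j)) *\<^sub>R \<xi>)) * norm (g \<xi>)" using J by simp
    also have "\<dots> \<le> (\<Sum>j\<in>J. S')" unfolding sum_distrib_right by (intro sum_mono le)
    also have "\<dots> \<le> 3 * S'" using J(2) S'(2) by (simp add: mult_right_mono)
    finally show ?case .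
  qed
  then show ?thesis using S'(2) by (intro that[of "3 * S'"]) auto
qed

lemma nn_integral_int_le:
  fixes f :: "int \<Rightarrow> ennreal"
  shows "(\<integral>\<^sup>+k. f k \<partial>count_space UNIV) \<le> (\<integral>\<^sup>+n. f (int n) \<partial>count_space UNIV) + (\<integral>\<^sup>+n. f (- int n) \<partial>count_space UNIV)"
proof -
  have "(\<integral>\<^sup>+k. f k \<partial>count_space UNIV) \<le> (\<integral>\<^sup>+k. f k * indicator {0..} k + f k * indicator {..0} k \<partial>count_space UNIV)"
    by (intro nn_integral_mono) (auto simp: indicator_def)
  also have "\<dots> = (\<integral>\<^sup>+k. f k * indicator {0..} k \<partial>count_space UNIV) + (\<integral>\<^sup>+k. f k * indicator {..0} k \<partial>count_space UNIV)"
    by (rule nn_integral_add) auto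
  also have "(\<integral>\<^sup>+k. f k * indicator {0..} k \<partial>count_space UNIV) = (\<integral>\<^sup>+n. f (int n) \<partial>count_space UNIV)"
  proof -
    have "bij_betw int UNIV {0..}" by (rule bij_betwI[where g=nat]) auto
    then show ?thesis
      by (simp add: nn_integral_count_space_indicator[symmetric] nn_integral_bij_count_space[symmetric])
  qed
  also have "(\<integral>\<^sup>+k. f k * indicator {..0} k \<partial>count_space UNIV) = (\<integral>\<^sup>+n. f (- int n) \<partial>count_space UNIV)"
  proof -
    have "bij_betw (\<lambda>n. - int n) UNIV {..0}" by (rule bij_betwI[where g="\<lambda>k. nat (- k)"]) auto
    from nn_integral_bij_count_space[OF this, of f] show ?thesis
      by (simp add: nn_integral_count_space_indicator[symmetric])
  qed
  finally show ?thesis .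
qed

lemma measurable_nn_integral_int:
  fixes f :: "'a \<Rightarrow> int \<Rightarrow> ennreal"
  assumes [measurable]: "\<And>k. (\<lambda>x. f x k) \<in> borel_measurable M"
  shows "(\<lambda>x. \<integral>\<^sup>+k. f x k \<partial>count_space UNIV) \<in> borel_measurable M"
proof -
  have "(\<integral>\<^sup>+k. f x k \<partial>count_space UNIV) = (\<Sum>n. f x (int_decode n))" for x
    using nn_integral_bij_count_space[OF bij_int_decode, of "f x"] by (simp add: nn_integral_count_space_nat)
  then show ?thesis by simp
qed

lemma geometric_int: "(\<integral>\<^sup>+k. ennreal (2 powr (- real_of_int \<bar>j - k\<bar>)) \<partial>count_space (UNIV :: int set)) \<le> 4"
proof -
  have "bij_betw (\<lambda>k. j + k) UNIV (UNIV :: int set)" by (rule bij_betwI[where g="\<lambda>k. k - j"]) auto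
  from nn_integral_bij_count_space[OF this, of "\<lambda>k. ennreal (2 powr (- real_of_int \<bar>j - k\<bar>))"]
  have "(\<integral>\<^sup>+k. ennreal (2 powr (- real_of_int \<bar>j - k\<bar>)) \<partial>count_space (UNIV :: int set)) =
     (\<integral>\<^sup>+k. ennreal (2 powr (- real_of_int \<bar>k\<bar>)) \<partial>count_space UNIV)" by simp
  also have "\<dots> \<le> (\<integral>\<^sup>+n. ennreal (2 powr (- real n)) \<partial>count_space UNIV) + (\<integral>\<^sup>+n. ennreal (2 powr (- real n)) \<partial>count_space UNIV)"
    using nn_integral_int_le[of "\<lambda>k. ennreal (2 powr (- real_of_int \<bar>k\<bar>))"] by simp
  also have "(\<integral>\<^sup>+n. ennreal (2 powr (- real n)) \<partial>count_space UNIV) = 2"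
  proof -
    have "(\<lambda>n. (1/2::real) ^ n) sums (1 / (1 - 1/2))" by (rule geometric_sums) simp
    moreover have "2 powr (- real n) = (1/2) ^ n" for n
      by (simp add: powr_minus powr_realpow power_one_over inverse_eq_divide)
    ultimately have "(\<lambda>n. 2 powr (- real n)) sums 2" by simp
    then have "(\<Sum>n. ennreal (2 powr (- real n))) = ennreal 2" by (intro suminf_ennreal_eq) auto
    then show ?thesis by (simp add: nn_integral_count_space_nat)
  qed
  finally show ?thesis by simp
qed

lemma ennreal_mult_le_squares: "2 * (a * b) \<le> a\<^sup>2 + (b::ennreal)\<^sup>2"
proof (cases "a = \<infinity> \<or> b = \<infinity>")
  case True
  then show ?thesis by (auto simp: power_top_ennreal)
next
  case False
  then obtain x y where xy: "a = ennreal x" "x \<ge> 0" "b = ennreal y" "y \<ge> 0" by (cases a; cases b) auto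
  have "ennreal (2 * (x * y)) \<le> ennreal (x\<^sup>2 + y\<^sup>2)"
    using sum_squares_bound[of x y] by (intro ennreal_leI) (simp add: mult.assoc)
  then show ?thesis using xy by (simp add: ennreal_mult ennreal_power)
qed

lemma dyadic_kernel_le: "x > 0 \<Longrightarrow> y > 0 \<Longrightarrow> x * y / (x\<^sup>2 + y\<^sup>2) \<le> min (x / y) (y / (x::real))"
proof -
  assume "x > 0" "y > 0"
  moreover from this have "x * y / (x\<^sup>2 + y\<^sup>2) \<le> x * y / y\<^sup>2" "x * y / (x\<^sup>2 + y\<^sup>2) \<le> x * y / x\<^sup>2"
    by (intro divide_left_mono; simp add: add_pos_pos)+
  ultimately show ?thesis by (simp add: power2_eq_square)
qed

text \<open>Expand the square into blocks \<open>j\<close>, \<open>k\<close> and integrate in time first. With \<open>b j\<close> the \<open>j\<close>-th term of the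
  Fourier--Herz norm, the pair \<open>(j, k)\<close> contributes \<open>b j * b k * 2\<^sup>j * 2\<^sup>k / (4\<^sup>j + 4\<^sup>k)\<close> up to a constant. The last
  factor is at most \<open>2\<close> to the power \<open>-\<bar>j - k\<bar>\<close>, and Schur's test bounds the double sum by the sum of the
  squares of the \<open>b j\<close>.\<close>

lemma herz_heat_bound:
  fixes u0 :: "'n::finite dist"
  assumes \<theta>: "dyadic_cutoff (\<theta> :: real^'n \<Rightarrow> real)" and g: "has_hat u0 g" and \<kappa>: "\<kappa> > 0"
    and small: "herz_norm \<theta> (-1) \<infinity> 2 u0 \<le> ennreal \<epsilon>" and \<epsilon>: "\<epsilon> \<ge> 0"
  shows "(\<integral>\<^sup>+t. indicator {0<..} t * (\<integral>\<^sup>+\<xi>. ennreal (exp (- \<kappa> * t * (norm \<xi>)\<^sup>2)) * ennreal (norm (g \<xi>)) \<partial>lborel)\<^sup>2 \<partial>lborel)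
    \<le> ennreal (16 / \<kappa> * \<epsilon>\<^sup>2)"
proof -
  let ?Z = "count_space (UNIV :: int set)"
  let ?\<theta> = "\<lambda>j \<xi>. \<theta> ((2 powi (- j)) *\<^sub>R \<xi>)"
  let ?w = "\<lambda>j::int. 2 powr (of_int j :: real)"
  have [measurable]: "\<theta> \<in> borel_measurable borel" using cutoff_integrable[OF \<theta>] by auto
  have [measurable]: "g \<in> borel_measurable borel"
    using g by (intro locally_integrable_measurable) (simp add: has_hat_iff)
  define a where "a j = (\<integral>\<^sup>+\<xi>. ennreal (?\<theta> j \<xi>) * ennreal (norm (g \<xi>)) \<partial>lborel)" for j :: int
  define b where "b j = ennreal (2 powr ((-1) * of_int j)) * a j" for j :: int
  have ab: "a j = ennreal (?w j) * b j" for j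
    unfolding b_def mult.assoc[symmetric] by (subst ennreal_mult[symmetric]) (auto simp: powr_add[symmetric])
  have b_le: "b j \<le> ennreal (2 powr ((-1) * of_int j)) * hatL_norm \<infinity> (dyadic_block \<theta> j u0)" for j
  proof -
    have "a j \<le> hatL_norm \<infinity> (dyadic_block \<theta> j u0)"
    proof (cases "locint_hat (dyadic_block \<theta> j u0)")
      case True
      have "a j = (\<integral>\<^sup>+\<xi>. ennreal (norm (fhat (dyadic_block \<theta> j u0) \<xi>)) \<partial>lborel)"
        unfolding a_def
      proof (rule nn_integral_cong_AE)
        show "AE \<xi> in lborel. ennreal (?\<theta> j \<xi>) * ennreal (norm (g \<xi>)) = ennreal (norm (fhat (dyadic_block \<theta> j u0) \<xi>))"
          using fhat_AE[OF \<theta> has_hat_dyadic_block[OF \<theta> g, of j]]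
          by eventually_elim (use cutoffD(2)[OF \<theta>] in \<open>simp add: norm_vsmult ennreal_mult\<close>)
      qed
      then show ?thesis by (simp add: hatL_norm_top[simplified, OF True])
    qed (simp add: hatL_norm_def)
    then show ?thesis unfolding b_def by (rule mult_left_mono) simp
  qed
  have bsum: "(\<integral>\<^sup>+j. (b j)\<^sup>2 \<partial>?Z) \<le> ennreal (\<epsilon>\<^sup>2)"
  proof -
    define X where "X = (\<integral>\<^sup>+j. (ennreal (2 powr ((-1) * of_int j)) * hatL_norm \<infinity> (dyadic_block \<theta> j u0))\<^sup>2 \<partial>?Z)"
    have "epowr X (1/2) \<le> ennreal \<epsilon>"
      using small by (simp add: herz_norm_def Lq_norm_def X_def epowr_two)
    then have "X \<noteq> \<infinity>" by (auto simp: epowr_def top_unique)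
    then obtain x where x: "X = ennreal x" "x \<ge> 0" by (cases X) auto
    have "ennreal (x powr (1/2)) \<le> ennreal \<epsilon>" using \<open>epowr X (1/2) \<le> ennreal \<epsilon>\<close> x by (simp add: epowr_def)
    then have "sqrt x \<le> \<epsilon>" using \<epsilon> x by (simp add: powr_half_sqrt ennreal_le_iff)
    then have "x \<le> \<epsilon>\<^sup>2" using x(2) by (metis real_sqrt_le_iff real_sqrt_pow2 power_mono real_sqrt_ge_zero)
    moreover have "(\<integral>\<^sup>+j. (b j)\<^sup>2 \<partial>?Z) \<le> X"
      unfolding X_def by (intro nn_integral_mono power_mono b_le) simp
    ultimately show ?thesis using x by (metis ennreal_leI order_trans)
  qed
  \<comment> \<open>On the support of the block \<open>j\<close>, \<open>norm \<xi>\<close> is at least half of \<open>2\<^sup>j\<close>; the square gives the factor \<open>1/4\<close>.\<close>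
  define l where "l = \<kappa> / 4"
  have l: "l > 0" using \<kappa> by (simp add: l_def)
  let ?e = "\<lambda>j t. ennreal (exp (- l * t * (?w j)\<^sup>2))"
  have mass: "(\<integral>\<^sup>+\<xi>. ennreal (exp (- \<kappa> * t * (norm \<xi>)\<^sup>2)) * ennreal (norm (g \<xi>)) \<partial>lborel) \<le> (\<integral>\<^sup>+j. ?e j t * a j \<partial>?Z)" if t: "t > 0" for t
  proof -
    have "AE \<xi> in lborel. (\<xi>::real^'n) \<noteq> 0" by (rule AE_lborel_singleton)
    then have "AE \<xi> in lborel. ennreal (exp (- \<kappa> * t * (norm \<xi>)\<^sup>2)) * ennreal (norm (g \<xi>)) \<le>
        (\<integral>\<^sup>+j. ?e j t * (ennreal (?\<theta> j \<xi>) * ennreal (norm (g \<xi>))) \<partial>?Z)"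
    proof eventually_elim
      case (elim \<xi>)
      obtain J where J: "finite J" "\<And>j. ?\<theta> j \<xi> \<noteq> 0 \<Longrightarrow> j \<in> J" "(\<Sum>j\<in>J. ?\<theta> j \<xi>) = 1"
        using dyadic_partition[OF \<theta> elim] by metis
      let ?E = "ennreal (exp (- \<kappa> * t * (norm \<xi>)\<^sup>2))"
      have le: "?E * ennreal (?\<theta> j \<xi>) \<le> ?e j t * ennreal (?\<theta> j \<xi>)" for j
      proof (cases "?\<theta> j \<xi> = 0")
        case False
        have n: "norm ((2 powi (- j)) *\<^sub>R \<xi>) = norm \<xi> / ?w j"
          by (simp add: powr_real_of_int' power_int_minus divide_inverse mult.commute)
        have "1/2 \<le> norm \<xi> / ?w j" using cutoffD(3)[OF \<theta> False] n by simp
        then have "?w j / 2 \<le> norm \<xi>" by (simp add: field_simps)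
        then have "(?w j / 2)\<^sup>2 \<le> (norm \<xi>)\<^sup>2" by (intro power_mono) auto
        then have "\<kappa> * t * (?w j / 2)\<^sup>2 \<le> \<kappa> * t * (norm \<xi>)\<^sup>2" using \<kappa> t by (intro mult_left_mono) auto
        then have "exp (- \<kappa> * t * (norm \<xi>)\<^sup>2) \<le> exp (- l * t * (?w j)\<^sup>2)"
          by (simp add: l_def power_divide)
        then show ?thesis by (intro mult_right_mono ennreal_leI) auto
      qed simp
      have "?E * ennreal (norm (g \<xi>)) = (\<Sum>j\<in>J. ?E * ennreal (?\<theta> j \<xi>)) * ennreal (norm (g \<xi>))"
        using J(3) cutoffD(2)[OF \<theta>] by (simp add: sum_distrib_left[symmetric] sum_ennreal)
      also have "\<dots> \<le> (\<Sum>j\<in>J. ?e j t * ennreal (?\<theta> j \<xi>)) * ennreal (norm (g \<xi>))"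
        by (intro mult_right_mono sum_mono le) simp
      also have "\<dots> = (\<Sum>j\<in>J. ?e j t * (ennreal (?\<theta> j \<xi>) * ennreal (norm (g \<xi>))))"
        by (simp add: sum_distrib_right mult.assoc)
      also have "\<dots> = (\<integral>\<^sup>+j. ?e j t * (ennreal (?\<theta> j \<xi>) * ennreal (norm (g \<xi>))) \<partial>?Z)"
      proof (rule nn_integral_count_space'[symmetric])
        show "?e j t * (ennreal (?\<theta> j \<xi>) * ennreal (norm (g \<xi>))) = 0" if "j \<notin> J" for j
        proof -
          have "?\<theta> j \<xi> = 0" using J(2) that by blast
          then show ?thesis by simp
        qed
      qed (use J(1) in auto)
      finally show ?case .
    qed
    then have "(\<integral>\<^sup>+\<xi>. ennreal (exp (- \<kappa> * t * (norm \<xi>)\<^sup>2)) * ennreal (norm (g \<xi>)) \<partial>lborel) \<le>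
        (\<integral>\<^sup>+\<xi>. (\<integral>\<^sup>+j. ?e j t * (ennreal (?\<theta> j \<xi>) * ennreal (norm (g \<xi>))) \<partial>?Z) \<partial>lborel)"
      by (rule nn_integral_mono_AE)
    also have "\<dots> = (\<integral>\<^sup>+j. (\<integral>\<^sup>+\<xi>. ?e j t * (ennreal (?\<theta> j \<xi>) * ennreal (norm (g \<xi>))) \<partial>lborel) \<partial>?Z)"
      by (rule nn_integral_count_space_nn_integral) auto
    also have "\<dots> = (\<integral>\<^sup>+j. ?e j t * a j \<partial>?Z)"
      unfolding a_def by (intro nn_integral_cong nn_integral_cmult) measurable
    finally show ?thesis .
  qed
  have time: "(\<integral>\<^sup>+t. indicator {0<..} t * (?e j t * ?e k t) \<partial>lborel) \<le> ennreal (1 / (l * ((?w j)\<^sup>2 + (?w k)\<^sup>2)))" for j k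
  proof -
    define A where "A = l * ((?w j)\<^sup>2 + (?w k)\<^sup>2)"
    have A: "A > 0" unfolding A_def using l by (intro mult_pos_pos add_pos_pos) auto
    have "(\<integral>\<^sup>+t. indicator {0<..} t * (?e j t * ?e k t) \<partial>lborel) \<le> (\<integral>\<^sup>+t. ennreal (1 / A) * (ennreal (A * exp (- A * (t - 0))) * indicator {0..} t) \<partial>lborel)"
    proof (rule nn_integral_mono)
      fix t
      have "exp (- l * t * (?w j)\<^sup>2) * exp (- l * t * (?w k)\<^sup>2) = 1 / A * (A * exp (- A * (t - 0)))"
      proof -
        have "- l * t * (?w j)\<^sup>2 + - l * t * (?w k)\<^sup>2 = - A * (t - 0)" by (simp add: A_def algebra_simps)
        then show ?thesis using A unfolding exp_add[symmetric] by simp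
      qed
      then have "?e j t * ?e k t = ennreal (1 / A) * ennreal (A * exp (- A * (t - 0)))"
        using A by (simp only: ennreal_mult[symmetric] exp_ge_zero less_imp_le mult_nonneg_nonneg zero_le_divide_1_iff)
      then show "indicator {0<..} t * (?e j t * ?e k t) \<le> ennreal (1 / A) * (ennreal (A * exp (- A * (t - 0))) * indicator {0..} t)"
        by (auto simp: indicator_def)
    qed
    also have "\<dots> = ennreal (1 / A)"
      by (subst nn_integral_cmult) (auto simp: nn_integral_exp_decay[OF A, of 0, simplified])
    finally show ?thesis by (simp add: A_def)
  qed
  let ?r = "\<lambda>j k::int. ennreal (2 powr (- real_of_int \<bar>j - k\<bar>))"
  have pairing: "(a j * a k) * ennreal (1 / (l * ((?w j)\<^sup>2 + (?w k)\<^sup>2))) \<le> ennreal (1 / (2 * l)) * (?r j k * (b j)\<^sup>2 + ?r j k * (b k)\<^sup>2)" for j k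
  proof -
    have "?w j * ?w k / ((?w j)\<^sup>2 + (?w k)\<^sup>2) \<le> min (?w j / ?w k) (?w k / ?w j)"
      by (rule dyadic_kernel_le) auto
    also have "\<dots> \<le> 2 powr (- real_of_int \<bar>j - k\<bar>)"
      by (cases "j \<le> k") (auto simp: powr_diff[symmetric] min_le_iff_disj)
    finally have "1 / l * (?w j * ?w k / ((?w j)\<^sup>2 + (?w k)\<^sup>2)) \<le> 1 / l * (2 powr (- real_of_int \<bar>j - k\<bar>))"
      using l by (intro mult_left_mono) auto
    then have "ennreal (?w j * ?w k * (1 / (l * ((?w j)\<^sup>2 + (?w k)\<^sup>2)))) \<le> ennreal (1 / l * (2 powr (- real_of_int \<bar>j - k\<bar>)))"
      by (intro ennreal_leI) simp
    then have le: "ennreal (?w j) * ennreal (?w k) * ennreal (1 / (l * ((?w j)\<^sup>2 + (?w k)\<^sup>2))) \<le> ennreal (1 / l) * ?r j k"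
      using l by (simp add: ennreal_mult[symmetric])
    have "(a j * a k) * ennreal (1 / (l * ((?w j)\<^sup>2 + (?w k)\<^sup>2))) =
        (ennreal (?w j) * ennreal (?w k) * ennreal (1 / (l * ((?w j)\<^sup>2 + (?w k)\<^sup>2)))) * (b j * b k)"
      unfolding ab by (simp add: mult_ac)
    also have "\<dots> \<le> (ennreal (1 / l) * ?r j k) * (b j * b k)" by (intro mult_right_mono le) simp
    also have "\<dots> = (ennreal (1 / (2 * l)) * ?r j k) * (2 * (b j * b k))"
    proof -
      have "ennreal (1 / l) = ennreal (1 / (2 * l)) * ennreal 2" using l by (subst ennreal_mult[symmetric]) auto
      then show ?thesis by (simp add: mult_ac)
    qed
    also have "\<dots> \<le> (ennreal (1 / (2 * l)) * ?r j k) * ((b j)\<^sup>2 + (b k)\<^sup>2)"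
      by (intro mult_left_mono ennreal_mult_le_squares) simp
    finally show ?thesis by (simp add: distrib_left mult.assoc)
  qed
  have "(\<integral>\<^sup>+t. indicator {0<..} t * (\<integral>\<^sup>+\<xi>. ennreal (exp (- \<kappa> * t * (norm \<xi>)\<^sup>2)) * ennreal (norm (g \<xi>)) \<partial>lborel)\<^sup>2 \<partial>lborel)
      \<le> (\<integral>\<^sup>+t. (\<integral>\<^sup>+j. (\<integral>\<^sup>+k. (a j * a k) * (indicator {0<..} t * (?e j t * ?e k t)) \<partial>?Z) \<partial>?Z) \<partial>lborel)"
  proof (rule nn_integral_mono)
    fix t :: real
    show "indicator {0<..} t * (\<integral>\<^sup>+\<xi>. ennreal (exp (- \<kappa> * t * (norm \<xi>)\<^sup>2)) * ennreal (norm (g \<xi>)) \<partial>lborel)\<^sup>2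
        \<le> (\<integral>\<^sup>+j. (\<integral>\<^sup>+k. (a j * a k) * (indicator {0<..} t * (?e j t * ?e k t)) \<partial>?Z) \<partial>?Z)"
    proof (cases "t > 0")
      case True
      have "(\<integral>\<^sup>+\<xi>. ennreal (exp (- \<kappa> * t * (norm \<xi>)\<^sup>2)) * ennreal (norm (g \<xi>)) \<partial>lborel)\<^sup>2 \<le> (\<integral>\<^sup>+j. ?e j t * a j \<partial>?Z)\<^sup>2"
        by (intro power_mono mass[OF True]) simp
      also have "\<dots> = (\<integral>\<^sup>+j. (\<integral>\<^sup>+k. (?e j t * a j) * (?e k t * a k) \<partial>?Z) \<partial>?Z)"
        by (simp add: power2_eq_square nn_integral_cmult nn_integral_multc)
      finally show ?thesis using True by (simp add: mult_ac)
    qed simp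
  qed
  also have "\<dots> = (\<integral>\<^sup>+j. (\<integral>\<^sup>+k. (\<integral>\<^sup>+t. (a j * a k) * (indicator {0<..} t * (?e j t * ?e k t)) \<partial>lborel) \<partial>?Z) \<partial>?Z)"
  proof -
    have "(\<integral>\<^sup>+t. (\<integral>\<^sup>+j. (\<integral>\<^sup>+k. (a j * a k) * (indicator {0<..} t * (?e j t * ?e k t)) \<partial>?Z) \<partial>?Z) \<partial>lborel) =
        (\<integral>\<^sup>+j. (\<integral>\<^sup>+t. (\<integral>\<^sup>+k. (a j * a k) * (indicator {0<..} t * (?e j t * ?e k t)) \<partial>?Z) \<partial>lborel) \<partial>?Z)"
      by (intro nn_integral_count_space_nn_integral measurable_nn_integral_int) auto
    also have "\<dots> = (\<integral>\<^sup>+j. (\<integral>\<^sup>+k. (\<integral>\<^sup>+t. (a j * a k) * (indicator {0<..} t * (?e j t * ?e k t)) \<partial>lborel) \<partial>?Z) \<partial>?Z)"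
      by (intro nn_integral_cong nn_integral_count_space_nn_integral) auto
    finally show ?thesis .
  qed
  also have "\<dots> \<le> (\<integral>\<^sup>+j. (\<integral>\<^sup>+k. ennreal (1 / (2 * l)) * (?r j k * (b j)\<^sup>2 + ?r j k * (b k)\<^sup>2) \<partial>?Z) \<partial>?Z)"
  proof (intro nn_integral_mono)
    fix j k :: int
    have "(\<integral>\<^sup>+t. (a j * a k) * (indicator {0<..} t * (?e j t * ?e k t)) \<partial>lborel) = (a j * a k) * (\<integral>\<^sup>+t. indicator {0<..} t * (?e j t * ?e k t) \<partial>lborel)"
      by (rule nn_integral_cmult) measurable
    also have "\<dots> \<le> (a j * a k) * ennreal (1 / (l * ((?w j)\<^sup>2 + (?w k)\<^sup>2)))" by (intro mult_left_mono time) simp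
    also have "\<dots> \<le> ennreal (1 / (2 * l)) * (?r j k * (b j)\<^sup>2 + ?r j k * (b k)\<^sup>2)" by (rule pairing)
    finally show "(\<integral>\<^sup>+t. (a j * a k) * (indicator {0<..} t * (?e j t * ?e k t)) \<partial>lborel) \<le> ennreal (1 / (2 * l)) * (?r j k * (b j)\<^sup>2 + ?r j k * (b k)\<^sup>2)" .
  qed
  also have "\<dots> = ennreal (1 / (2 * l)) * ((\<integral>\<^sup>+j. (\<integral>\<^sup>+k. ?r j k * (b j)\<^sup>2 \<partial>?Z) \<partial>?Z) + (\<integral>\<^sup>+j. (\<integral>\<^sup>+k. ?r j k * (b k)\<^sup>2 \<partial>?Z) \<partial>?Z))"
    by (simp add: nn_integral_cmult nn_integral_add)
  also have "(\<integral>\<^sup>+j. (\<integral>\<^sup>+k. ?r j k * (b k)\<^sup>2 \<partial>?Z) \<partial>?Z) = (\<integral>\<^sup>+k. (\<integral>\<^sup>+j. ?r j k * (b k)\<^sup>2 \<partial>?Z) \<partial>?Z)"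
    by (rule nn_integral_count_space_nn_integral) auto
  also have "\<dots> = (\<integral>\<^sup>+j. (\<integral>\<^sup>+k. ?r j k * (b j)\<^sup>2 \<partial>?Z) \<partial>?Z)"
    by (simp add: abs_minus_commute)
  also have "ennreal (1 / (2 * l)) * ((\<integral>\<^sup>+j. (\<integral>\<^sup>+k. ?r j k * (b j)\<^sup>2 \<partial>?Z) \<partial>?Z) + (\<integral>\<^sup>+j. (\<integral>\<^sup>+k. ?r j k * (b j)\<^sup>2 \<partial>?Z) \<partial>?Z))
      \<le> ennreal (1 / (2 * l)) * (4 * ennreal (\<epsilon>\<^sup>2) + 4 * ennreal (\<epsilon>\<^sup>2))"
  proof -
    have "(\<integral>\<^sup>+j. (\<integral>\<^sup>+k. ?r j k * (b j)\<^sup>2 \<partial>?Z) \<partial>?Z) \<le> (\<integral>\<^sup>+j. 4 * (b j)\<^sup>2 \<partial>?Z)"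
    proof (rule nn_integral_mono)
      fix j :: int
      have "(\<integral>\<^sup>+k. ?r j k * (b j)\<^sup>2 \<partial>?Z) = (\<integral>\<^sup>+k. ?r j k \<partial>?Z) * (b j)\<^sup>2" by (rule nn_integral_multc) simp
      also have "\<dots> \<le> 4 * (b j)\<^sup>2" by (intro mult_right_mono geometric_int) simp
      finally show "(\<integral>\<^sup>+k. ?r j k * (b j)\<^sup>2 \<partial>?Z) \<le> 4 * (b j)\<^sup>2" .
    qed
    also have "\<dots> = 4 * (\<integral>\<^sup>+j. (b j)\<^sup>2 \<partial>?Z)" by (rule nn_integral_cmult) simp
    also have "\<dots> \<le> 4 * ennreal (\<epsilon>\<^sup>2)" by (intro mult_left_mono bsum) simp
    finally show ?thesis by (intro mult_left_mono add_mono) auto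
  qed
  also have "\<dots> = ennreal (16 / \<kappa> * \<epsilon>\<^sup>2)"
  proof -
    have "4 * ennreal (\<epsilon>\<^sup>2) + 4 * ennreal (\<epsilon>\<^sup>2) = ennreal (8 * \<epsilon>\<^sup>2)"
      by (simp add: ennreal_mult distrib_right[symmetric])
    then have "ennreal (1 / (2 * l)) * (4 * ennreal (\<epsilon>\<^sup>2) + 4 * ennreal (\<epsilon>\<^sup>2)) = ennreal (1 / (2 * l) * (8 * \<epsilon>\<^sup>2))"
      using l by (simp only: ennreal_mult[symmetric] zero_le_mult_iff zero_le_power2 less_imp_le zero_le_divide_1_iff zero_le_numeral simp_thms)
    then show ?thesis by (simp add: l_def)
  qed
  finally show ?thesis .
qed

section \<open>Exponential weights and the Oseen kernel\<close>

subsection \<open>Integrability of exponential weights\<close>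

lemma integrable_powr_exp_1d:
  fixes c :: real
  assumes c: "c > -1"
  shows "integrable lborel (\<lambda>y. \<bar>y\<bar> powr c * exp (- \<bar>y\<bar>))"
proof -
  let ?f = "\<lambda>y. indicator {0..} y * (y powr c / exp y)"
  have "((\<lambda>t. t powr (c + 1 - 1) / exp t) has_integral Gamma (c + 1)) {0..}"
    using c by (intro Gamma_integral_real) simp
  moreover have "?f = (\<lambda>t. if t \<in> {0..} then t powr c / exp t else 0)" by (auto simp: indicator_def)
  ultimately have "(?f has_integral Gamma (c + 1)) UNIV"
    by (simp only: has_integral_restrict_UNIV) simp
  then have I: "(\<integral>\<^sup>+y. ennreal (?f y) \<partial>lborel) = ennreal (Gamma (c + 1))"
    by (intro nn_integral_has_integral_lborel) auto
  have "(\<integral>\<^sup>+y. ennreal (\<bar>y\<bar> powr c * exp (- \<bar>y\<bar>)) \<partial>lborel) \<le> (\<integral>\<^sup>+y. ennreal (?f y) + ennreal (?f (0 - y)) \<partial>lborel)"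
    by (intro nn_integral_mono) (auto simp: indicator_def exp_minus divide_inverse)
  also have "\<dots> = (\<integral>\<^sup>+y. ennreal (?f y) \<partial>lborel) + (\<integral>\<^sup>+y. ennreal (?f (0 - y)) \<partial>lborel)"
    by (rule nn_integral_add) auto
  also have "(\<integral>\<^sup>+y. ennreal (?f (0 - y)) \<partial>lborel) = (\<integral>\<^sup>+y. ennreal (?f y) \<partial>lborel)"
    by (rule nn_integral_reflect[of "\<lambda>y. ennreal (?f y)" 0]) measurable
  finally have "(\<integral>\<^sup>+y. ennreal (\<bar>y\<bar> powr c * exp (- \<bar>y\<bar>)) \<partial>lborel) < \<infinity>"
    unfolding I by (rule le_less_trans) simp
  then show ?thesis by (simp add: integrable_iff_bounded)
qed

text \<open>As \<open>a \<le> 0\<close>, the power \<open>norm x powr a\<close> is at most the product of the powers \<open>\<bar>x \<bullet> b\<bar> powr (a / d)\<close>. Their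
  exponents exceed \<open>-1\<close>, which leaves one-dimensional Gamma integrals.\<close>

lemma integrable_powr_exp_neg:
  fixes a :: real
  assumes a: "- real DIM('a::euclidean_space) < a" "a \<le> 0"
  shows "integrable lborel (\<lambda>x::'a. norm x powr a * exp (- real DIM('a) * norm x))"
proof (rule Bochner_Integration.integrable_bound)
  let ?d = "real DIM('a)"
  have d: "?d > 0" by simp
  show "integrable lborel (\<lambda>x::'a. \<Prod>b\<in>Basis. \<bar>x \<bullet> b\<bar> powr (a / ?d) * exp (- \<bar>x \<bullet> b\<bar>))"
  proof (rule integrable_prod_Basis)
    show "integrable lborel (\<lambda>y. \<bar>y\<bar> powr (a / ?d) * exp (- \<bar>y\<bar>))"
      using a d by (intro integrable_powr_exp_1d) (simp add: less_divide_eq)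
  qed simp
  have "AE x in lborel. \<forall>b\<in>(Basis::'a set). x \<bullet> b \<noteq> 0"
  proof (rule AE_finite_allI)
    fix b :: 'a assume b: "b \<in> Basis"
    have "negligible {x::'a. x \<bullet> b = 0}" by (rule negligible_standard_hyperplane[OF b])
    then have "AE x in lebesgue. x \<notin> {x::'a. x \<bullet> b = 0}"
      by (intro AE_not_in) (simp add: negligible_iff_null_sets)
    then have "AE x in lborel. x \<notin> {x::'a. x \<bullet> b = 0}" by (simp only: AE_completion_iff)
    then show "AE x in lborel. x \<bullet> b \<noteq> 0" by eventually_elim simp
  qed simp
  then show "AE x::'a in lborel. norm (norm x powr a * exp (- ?d * norm x)) \<le> norm (\<Prod>b\<in>Basis. \<bar>x \<bullet> b\<bar> powr (a / ?d) * exp (- \<bar>x \<bullet> b\<bar>))"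
  proof eventually_elim
    case (elim x)
    have "norm x powr a * exp (- ?d * norm x) = (\<Prod>b\<in>(Basis::'a set). norm x powr (a / ?d) * exp (- norm x))"
    proof -
      have "norm x > 0" using elim nonempty_Basis by fastforce
      then have "(norm x powr (a / ?d)) ^ DIM('a) = norm x powr a"
        using d by (simp add: powr_realpow[symmetric] powr_powr)
      then show ?thesis by (simp add: power_mult_distrib exp_of_nat_mult[symmetric])
    qed
    also have "\<dots> \<le> (\<Prod>b\<in>Basis. \<bar>x \<bullet> b\<bar> powr (a / ?d) * exp (- \<bar>x \<bullet> b\<bar>))"
    proof (intro prod_mono conjI mult_mono)
      fix b :: 'a assume b: "b \<in> Basis"
      show "norm x powr (a / ?d) \<le> \<bar>x \<bullet> b\<bar> powr (a / ?d)"
        using elim b a d Basis_le_norm[OF b, of x] by (intro powr_mono2') (auto simp: divide_le_0_iff)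
      show "exp (- norm x) \<le> exp (- \<bar>x \<bullet> b\<bar>)" using Basis_le_norm[OF b, of x] by simp
    qed auto
    finally show ?case by (simp add: prod_nonneg abs_of_nonneg)
  qed
qed measurable

lemma powr_le_exp:
  fixes x a b :: real
  assumes "x \<ge> 0" "a > 0" "b > 0"
  shows "x powr a \<le> (a / b) powr a * exp (b * x)"
proof -
  have "b / a * x \<le> exp (b / a * x)" using exp_ge_add_one_self[of "b / a * x"] by linarith
  then have "x \<le> a / b * exp (b / a * x)" using assms by (simp add: field_simps)
  then have "x powr a \<le> (a / b * exp (b / a * x)) powr a" using assms by (intro powr_mono2) auto
  also have "\<dots> = (a / b) powr a * exp (b / a * x) powr a" using assms by (intro powr_mult)
  also have "exp (b / a * x) powr a = exp (b * x)" using assms by (simp add: powr_def)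
  finally show ?thesis .
qed

text \<open>Scaling gives all decay rates for negative exponents; a positive excess \<open>e\<close> of the exponent is absorbed
  by half of the exponential.\<close>

lemma integrable_powr_exp:
  fixes a b :: real
  assumes a: "- real DIM('a::euclidean_space) < a" and b: "b > 0"
  shows "integrable lborel (\<lambda>x::'a. norm x powr a * exp (- b * norm x))"
proof -
  let ?d = "real DIM('a)"
  have d: "?d \<ge> 1" by (simp add: Suc_leI)
  define a' where "a' = min a (-1/2)"
  have a': "- ?d < a'" "a' \<le> 0" "a' \<le> a" 
  proof -
    have "- ?d < -1/2" using d by linarith
    then show "- ?d < a'" "a' \<le> 0" "a' \<le> a" using a by (auto simp: a'_def)
  qed
  have base: "integrable lborel (\<lambda>x::'a. norm x powr a' * exp (- b / 2 * norm x))"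
  proof -
    let ?c = "b / (2 * ?d)"
    have c: "?c > 0" using b d by simp
    have "integrable lborel (\<lambda>x::'a. norm (0 + ?c *\<^sub>R x) powr a' * exp (- ?d * norm (0 + ?c *\<^sub>R x)))"
      by (rule integrable_affine[OF integrable_powr_exp_neg[OF a'(1,2)] less_imp_neq[OF c, symmetric]])
    then have "integrable lborel (\<lambda>x::'a. ?c powr (- a') * (norm (0 + ?c *\<^sub>R x) powr a' * exp (- ?d * norm (0 + ?c *\<^sub>R x))))"
      by (rule integrable_mult_right)
    moreover have "?c powr (- a') * (norm (0 + ?c *\<^sub>R x) powr a' * exp (- ?d * norm (0 + ?c *\<^sub>R x))) = norm x powr a' * exp (- b / 2 * norm x)" for x :: 'a
    proof -
      have n: "norm (0 + ?c *\<^sub>R x) = ?c * norm x" using b by simp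
      have p: "(?c * norm x) powr a' = ?c powr a' * norm x powr a'" by (rule powr_mult)
      have "?c powr (- a') * ?c powr a' = 1" using c b by (simp add: powr_add[symmetric])
      then have "?c powr (- a') * (?c powr a' * norm x powr a') = norm x powr a'" by (simp only: mult.assoc[symmetric] mult_1)
      moreover have "- ?d * (?c * norm x) = - b / 2 * norm x" using d by (simp add: field_simps)
      ultimately show ?thesis unfolding n p by (simp only: mult.assoc[symmetric])
    qed
    ultimately show ?thesis by (simp only:)
  qed
  define e where "e = a - a'"
  show ?thesis
  proof (cases "e = 0")
    case True
    show ?thesis
      by (rule Bochner_Integration.integrable_bound[OF base])
        (use True b in \<open>auto simp: e_def intro!: AE_I2 mult_left_mono mult_right_mono\<close>)
  next
    case False
    then have e: "e > 0" using a' by (simp add: e_def)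
    show ?thesis
    proof (rule Bochner_Integration.integrable_bound[OF integrable_mult_right[OF base, of "(e / (b/2)) powr e"]])
      show "AE x::'a in lborel. norm (norm x powr a * exp (- b * norm x)) \<le> norm ((e / (b/2)) powr e * (norm x powr a' * exp (- b / 2 * norm x)))"
      proof (rule AE_I2)
        fix x :: 'a
        have "norm x powr a * exp (- b * norm x) = norm x powr a' * (norm x powr e) * exp (- b * norm x)"
          by (simp add: powr_add[symmetric] e_def)
        also have "\<dots> \<le> norm x powr a' * ((e / (b/2)) powr e * exp (b/2 * norm x)) * exp (- b * norm x)"
          using e b by (intro mult_right_mono mult_left_mono powr_le_exp) auto
        also have "\<dots> = (e / (b/2)) powr e * (norm x powr a' * exp (- b / 2 * norm x))"
        proof -
          have "exp (b/2 * norm x) * exp (- b * norm x) = exp (- b / 2 * norm x)"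
            unfolding exp_add[symmetric] by (simp add: field_simps)
          then show ?thesis by (simp only: mult.assoc mult.left_commute[of "norm x powr a'"])
        qed
        finally show "norm (norm x powr a * exp (- b * norm x)) \<le> norm ((e / (b/2)) powr e * (norm x powr a' * exp (- b / 2 * norm x)))"
          by simp
      qed
    qed measurable
  qed
qed

lemma linear_le_quadratic:
  fixes a x :: real
  assumes "a > 0"
  shows "x \<le> a * x\<^sup>2 + 1 / (4 * a)"
proof -
  have "0 \<le> (2 * a * x - 1)\<^sup>2 / (4 * a)" using assms by simp
  also have "\<dots> = a * x\<^sup>2 + 1 / (4 * a) - x" using assms by (simp add: power2_eq_square field_simps)
  finally show ?thesis by simp
qed

lemma integrable_exp:
  assumes "b > 0"
  shows "integrable lborel (\<lambda>x::'a::euclidean_space. exp (- b * norm x))"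
proof (rule integrable_cong_AE_imp)
  show "integrable lborel (\<lambda>x::'a. norm x powr 0 * exp (- b * norm x))"
    using assms by (intro integrable_powr_exp) auto
  have "AE x in lborel. x \<noteq> (0::'a)" by (rule AE_lborel_singleton)
  then show "AE x::'a in lborel. norm x powr 0 * exp (- b * norm x) = exp (- b * norm x)" by eventually_elim simp
qed measurable

lemma gaussian_second_moment:
  assumes "c > 0"
  shows "integrable lborel (\<lambda>x::'a::euclidean_space. (1 + (norm x)\<^sup>2) * exp (- c * (norm x)\<^sup>2))"
proof (rule Bochner_Integration.integrable_bound)
  let ?C = "exp (1 / (4 * c))"
  show "integrable lborel (\<lambda>x::'a. ?C * (exp (- 1 * norm x) + norm x powr 2 * exp (- 1 * norm x)))"
    by (intro integrable_mult_right Bochner_Integration.integrable_add integrable_exp integrable_powr_exp) (auto intro: less_le_trans[of _ 0])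
  show "AE x::'a in lborel. norm ((1 + (norm x)\<^sup>2) * exp (- c * (norm x)\<^sup>2)) \<le> norm (?C * (exp (- 1 * norm x) + norm x powr 2 * exp (- 1 * norm x)))"
  proof (rule AE_I2)
    fix x :: 'a
    have "exp (- c * (norm x)\<^sup>2) \<le> ?C * exp (- 1 * norm x)"
      using linear_le_quadratic[OF assms, of "norm x"] unfolding exp_add[symmetric] by simp
    then have "(1 + (norm x)\<^sup>2) * exp (- c * (norm x)\<^sup>2) \<le> (1 + (norm x)\<^sup>2) * (?C * exp (- 1 * norm x))"
      by (intro mult_left_mono) auto
    also have "\<dots> = ?C * (exp (- 1 * norm x) + norm x powr 2 * exp (- 1 * norm x))"
      by (simp add: powr_numeral algebra_simps)
    finally show "norm ((1 + (norm x)\<^sup>2) * exp (- c * (norm x)\<^sup>2)) \<le> norm (?C * (exp (- 1 * norm x) + norm x powr 2 * exp (- 1 * norm x)))"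
      by (simp add: add_nonneg_nonneg)
  qed
qed measurable

subsection \<open>The Oseen kernel on the Fourier side\<close>

definition oseen_hat :: "real \<Rightarrow> real \<Rightarrow> real^'n::finite \<Rightarrow> complex^'n^'n" where
  "oseen_hat \<mu> t \<xi> = (\<chi> l m. of_real (exp (- \<mu> * t * (norm \<xi>)\<^sup>2)) * leray_symbol \<xi> $ l $ m)"

lemma oseen_nth: "oseen \<mu> t x $ l $ m = inv_fourier (\<lambda>\<xi>. oseen_hat \<mu> t \<xi> $ l $ m) x"
  by (simp add: oseen_def oseen_hat_def)

lemma oseen_hat_mult: "oseen_hat \<mu> t \<xi> *v x = of_real (exp (- \<mu> * t * (norm \<xi>)\<^sup>2)) *s (leray_symbol \<xi> *v x)"
  by (simp add: vec_eq_iff oseen_hat_def matrix_vector_mult_def sum_distrib_left mult.assoc)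

lemma oseen_hat_measurable[measurable]: "oseen_hat \<mu> t \<in> borel_measurable (borel :: (real^'n::finite) measure)"
  unfolding oseen_hat_def[abs_def] by measurable

lemma oseen_hat_second_moment:
  assumes "\<mu> > 0" "t > 0"
  shows "integrable lborel (\<lambda>\<xi>::real^'n::finite. (1 + (norm \<xi>)\<^sup>2) *\<^sub>R (oseen_hat \<mu> t \<xi> $ l $ m))"
proof (rule Bochner_Integration.integrable_bound)
  show "integrable lborel (\<lambda>\<xi>::real^'n. 2 * ((1 + (norm \<xi>)\<^sup>2) * exp (- (\<mu> * t) * (norm \<xi>)\<^sup>2)))"
    using assms by (intro integrable_mult_right gaussian_second_moment) simp
  show "AE \<xi>::real^'n in lborel. norm ((1 + (norm \<xi>)\<^sup>2) *\<^sub>R (oseen_hat \<mu> t \<xi> $ l $ m)) \<le> norm (2 * ((1 + (norm \<xi>)\<^sup>2) * exp (- (\<mu> * t) * (norm \<xi>)\<^sup>2)))"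
  proof (rule AE_I2)
    fix \<xi> :: "real^'n"
    have "(1 + (norm \<xi>)\<^sup>2) * (exp (- \<mu> * t * (norm \<xi>)\<^sup>2) * norm (leray_symbol \<xi> $ l $ m)) \<le> (1 + (norm \<xi>)\<^sup>2) * (exp (- \<mu> * t * (norm \<xi>)\<^sup>2) * 2)"
      by (intro mult_left_mono norm_leray_symbol_nth) auto
    then show "norm ((1 + (norm \<xi>)\<^sup>2) *\<^sub>R (oseen_hat \<mu> t \<xi> $ l $ m)) \<le> norm (2 * ((1 + (norm \<xi>)\<^sup>2) * exp (- (\<mu> * t) * (norm \<xi>)\<^sup>2)))"
      by (simp add: oseen_hat_def norm_mult abs_mult mult_ac)
  qed
qed measurable

lemma second_moment_imp:
  fixes f :: "real^'n::finite \<Rightarrow> complex"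
  assumes f: "integrable lborel (\<lambda>\<xi>. (1 + (norm \<xi>)\<^sup>2) *\<^sub>R f \<xi>)" and [measurable]: "f \<in> borel_measurable borel"
  shows "integrable lborel f" "integrable lborel (\<lambda>\<xi>. \<i> * of_real (\<xi> $ k) * f \<xi>)"
proof -
  show "integrable lborel f"
    using f by (rule Bochner_Integration.integrable_bound) (auto simp: distrib_right)
  show "integrable lborel (\<lambda>\<xi>. \<i> * of_real (\<xi> $ k) * f \<xi>)"
    using f
  proof (rule Bochner_Integration.integrable_bound)
    show "AE \<xi> in lborel. norm (\<i> * of_real (\<xi> $ k) * f \<xi>) \<le> norm ((1 + (norm \<xi>)\<^sup>2) *\<^sub>R f \<xi>)"
    proof (rule AE_I2)
      fix \<xi> :: "real^'n"
      have "\<bar>\<xi> $ k\<bar> \<le> norm \<xi>" by (rule component_le_norm_cart)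
      also have "\<dots> \<le> 1 * (norm \<xi>)\<^sup>2 + 1 / (4 * 1)" by (rule linear_le_quadratic) simp
      also have "\<dots> \<le> 1 + (norm \<xi>)\<^sup>2" by simp
      finally show "norm (\<i> * of_real (\<xi> $ k) * f \<xi>) \<le> norm ((1 + (norm \<xi>)\<^sup>2) *\<^sub>R f \<xi>)"
        by (simp add: norm_mult mult_right_mono)
    qed
  qed measurable
qed

lemma has_vector_derivative_vec:
  fixes f :: "real \<Rightarrow> 'b::real_normed_vector^'n::finite"
  assumes "\<And>i. ((\<lambda>h. f h $ i) has_vector_derivative D $ i) (at x)"
  shows "(f has_vector_derivative D) (at x)"
  unfolding has_vector_derivative_def has_derivative_at_within
proof
  show "bounded_linear (\<lambda>h. h *\<^sub>R D)" by (rule bounded_linear_scaleR_left)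
  show "((\<lambda>y. (f y - f x - (y - x) *\<^sub>R D) /\<^sub>R norm (y - x)) \<longlongrightarrow> 0) (at x)"
  proof (rule vec_tendstoI)
    fix i
    show "((\<lambda>y. ((f y - f x - (y - x) *\<^sub>R D) /\<^sub>R norm (y - x)) $ i) \<longlongrightarrow> 0 $ i) (at x)"
      using assms[of i] unfolding has_vector_derivative_def has_derivative_at_within by simp
  qed
qed

text \<open>Differentiation acts on the matrix-valued kernel as a whole, whence the detour through
  \<open>has_vector_derivative_vec\<close>.\<close>

lemma pd_oseen_nth:
  fixes x :: "real^'n::finite"
  assumes "\<mu> > 0" "t > 0"
  shows "pd k (oseen \<mu> t) x $ l $ m = inv_fourier (\<lambda>\<xi>. \<i> * of_real (\<xi> $ k) * oseen_hat \<mu> t \<xi> $ l $ m) x"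
proof -
  let ?D = "\<chi> l m. inv_fourier (\<lambda>\<xi>. \<i> * of_real (\<xi> $ k) * oseen_hat \<mu> t \<xi> $ l $ m) x"
  have "((\<lambda>h. oseen \<mu> t (x + h *\<^sub>R axis k 1)) has_vector_derivative ?D) (at 0)"
    by (intro has_vector_derivative_vec)
      (simp add: oseen_nth has_vector_derivative_inv_fourier[OF oseen_hat_second_moment[OF assms]])
  then have "pd k (oseen \<mu> t) x = ?D" unfolding pd_def by (rule vector_derivative_at)
  then show ?thesis by simp
qed

lemma inv_fourier_sum:
  assumes "finite I" "\<And>m. m \<in> I \<Longrightarrow> integrable lborel (w m)"
  shows "(\<Sum>m\<in>I. inv_fourier (w m) x * c m) = inv_fourier (\<lambda>\<xi>. \<Sum>m\<in>I. w m \<xi> * c m) x"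
  using assms
proof (induction I rule: finite_induct)
  case empty
  then show ?case by (simp add: inv_fourier_def)
next
  case (insert i I)
  have "inv_fourier (\<lambda>\<xi>. w i \<xi> * c i + (\<Sum>m\<in>I. w m \<xi> * c m)) x =
      inv_fourier (\<lambda>\<xi>. w i \<xi> * c i) x + inv_fourier (\<lambda>\<xi>. \<Sum>m\<in>I. w m \<xi> * c m) x"
    unfolding inv_fourier_eq_fourier using insert.prems
    by (intro fourier_add Bochner_Integration.integrable_sum integrable_mult_left) auto
  moreover have "inv_fourier (\<lambda>\<xi>. w i \<xi> * c i) x = inv_fourier (w i) x * c i"
    using fourier_cmult[of "c i" "w i" "-x"] by (simp add: inv_fourier_eq_fourier mult.commute)
  ultimately show ?case using insert by simp
qed

lemma dist_of_inv_fourier: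
  assumes w: "\<And>i. integrable lborel (\<lambda>\<xi>. w \<xi> $ i)" and \<phi>: "\<phi> \<in> test_functions"
    and f: "\<And>x i. f x $ i = inv_fourier (\<lambda>\<xi>. w \<xi> $ i) x"
  shows "dist_of f (fourier \<phi>) = dist_of w \<phi>"
  by (simp add: vec_eq_iff f pairing_inversion[OF w \<phi>])

lemma dist_of_oseen:
  assumes \<mu>: "\<mu> > 0" "t > 0" and \<phi>: "\<phi> \<in> test_functions"
  shows "dist_of (\<lambda>x. oseen \<mu> t x *v c) (fourier \<phi>) = dist_of (\<lambda>\<xi>. oseen_hat \<mu> t \<xi> *v c) \<phi>"
proof (rule dist_of_inv_fourier[OF _ \<phi>])
  have i: "integrable lborel (\<lambda>\<xi>. oseen_hat \<mu> t \<xi> $ l $ m)" for l m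
    by (rule second_moment_imp(1)[OF oseen_hat_second_moment[OF \<mu>]]) measurable
  show "integrable lborel (\<lambda>\<xi>. (oseen_hat \<mu> t \<xi> *v c) $ l)" for l
    unfolding matrix_vector_mult_def vec_lambda_beta using i by (intro Bochner_Integration.integrable_sum integrable_mult_left)
  show "(oseen \<mu> t x *v c) $ l = inv_fourier (\<lambda>\<xi>. (oseen_hat \<mu> t \<xi> *v c) $ l) x" for x l
    unfolding matrix_vector_mult_def vec_lambda_beta oseen_nth by (rule inv_fourier_sum) (auto intro: i)
qed

lemma dist_of_pd_oseen:
  fixes c :: "'n::finite \<Rightarrow> complex^'n"
  assumes \<mu>: "\<mu> > 0" "t > 0" and \<phi>: "\<phi> \<in> test_functions"
  shows "dist_of (\<lambda>x. \<Sum>k\<in>UNIV. pd k (oseen \<mu> t) x *v c k) (fourier \<phi>) =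
    dist_of (\<lambda>\<xi>. oseen_hat \<mu> t \<xi> *v (\<Sum>k\<in>UNIV. (\<i> * of_real (\<xi> $ k)) *s c k)) \<phi>"
proof (rule dist_of_inv_fourier[OF _ \<phi>])
  let ?w = "\<lambda>l p \<xi>. \<i> * of_real (\<xi> $ fst p) * oseen_hat \<mu> t \<xi> $ l $ snd p"
  have i: "integrable lborel (?w l p)" for l p
    by (rule second_moment_imp(2)[OF oseen_hat_second_moment[OF \<mu>]]) measurable
  have eq: "(oseen_hat \<mu> t \<xi> *v (\<Sum>k\<in>UNIV. (\<i> * of_real (\<xi> $ k)) *s c k)) $ l = (\<Sum>p\<in>UNIV. ?w l p \<xi> * c (fst p) $ snd p)" for \<xi> l
  proof -
    have "(oseen_hat \<mu> t \<xi> *v (\<Sum>k\<in>UNIV. (\<i> * of_real (\<xi> $ k)) *s c k)) $ l =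
        (\<Sum>m\<in>UNIV. \<Sum>k\<in>UNIV. \<i> * of_real (\<xi> $ k) * oseen_hat \<mu> t \<xi> $ l $ m * c k $ m)"
      by (simp add: matrix_vector_mult_def sum_distrib_left mult_ac)
    also have "\<dots> = (\<Sum>k\<in>UNIV. \<Sum>m\<in>UNIV. \<i> * of_real (\<xi> $ k) * oseen_hat \<mu> t \<xi> $ l $ m * c k $ m)"
      by (rule sum.swap)
    finally show ?thesis by (simp add: sum.cartesian_product split_beta UNIV_Times_UNIV)
  qed
  show "integrable lborel (\<lambda>\<xi>. (oseen_hat \<mu> t \<xi> *v (\<Sum>k\<in>UNIV. (\<i> * of_real (\<xi> $ k)) *s c k)) $ l)" for l
    unfolding eq using i by (intro Bochner_Integration.integrable_sum integrable_mult_left)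
  show "(\<Sum>k\<in>UNIV. pd k (oseen \<mu> t) x *v c k) $ l = inv_fourier (\<lambda>\<xi>. (oseen_hat \<mu> t \<xi> *v (\<Sum>k\<in>UNIV. (\<i> * of_real (\<xi> $ k)) *s c k)) $ l) x" for x l
  proof -
    have "(\<Sum>k\<in>UNIV. pd k (oseen \<mu> t) x *v c k) $ l = (\<Sum>p\<in>UNIV. inv_fourier (?w l p) x * c (fst p) $ snd p)"
      by (simp add: matrix_vector_mult_def pd_oseen_nth[OF \<mu>] sum.cartesian_product split_beta UNIV_Times_UNIV)
    also have "\<dots> = inv_fourier (\<lambda>\<xi>. \<Sum>p\<in>UNIV. ?w l p \<xi> * c (fst p) $ snd p) x"
      by (rule inv_fourier_sum) (auto intro: i)
    finally show ?thesis by (simp only: eq)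
  qed
qed

section \<open>Large-time asymptotics\<close>

text \<open>The situation after the a priori estimate has been applied to a small solution: \<open>v\<close> represents the
  Fourier transform of \<open>u\<close>, and \<open>K\<close> bounds it with its exponential weight.\<close>

locale small_mild_solution =
  fixes \<theta> :: "real^'n::finite \<Rightarrow> real" and \<mu> :: real and u0 :: "'n dist" and u :: "real \<Rightarrow> 'n dist"
    and g0 :: "real^'n \<Rightarrow> complex^'n" and v :: "real \<times> (real^'n) \<Rightarrow> complex^'n" and K :: real
  assumes \<theta>: "dyadic_cutoff \<theta>" and \<mu>: "\<mu> > 0" and dim: "CARD('n) \<ge> 3"
    and mild: "global_mild_solution \<mu> u0 u" and g0: "has_hat u0 g0"
    and v[measurable]: "v \<in> borel_measurable (borel \<Otimes>\<^sub>M borel)"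
    and vi: "\<And>t. integrable lborel (\<lambda>\<xi>. v (t, \<xi>))" and v_zero: "\<And>t \<xi>. t \<le> 0 \<Longrightarrow> v (t, \<xi>) = 0"
    and vhat: "AE t in lborel. 0 < t \<longrightarrow> has_hat (u t) (\<lambda>\<xi>. v (t, \<xi>))"
    and fin: "(\<integral>\<^sup>+t. (mass (\<lambda>p. ennreal (norm (v p))) t)\<^sup>2 \<partial>lborel) < \<infinity>"
    and K0: "K \<ge> 0"
    and pointwise: "AE t in lborel. AE \<xi> in lborel. exp (2 * sqrt t * norm \<xi>) * norm (v (t, \<xi>)) \<le> K"
    and energy: "(\<integral>\<^sup>+t. (mass (weighted norm (\<lambda>p. ennreal (norm (v p)))) t)\<^sup>2 \<partial>lborel) < \<infinity>"
begin

subsection \<open>The quadratic moments\<close>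

text \<open>The exponent is half of the one in \<open>pointwise\<close>. In a convolution one factor uses its full weight, and
  the other one only half of it; what is left over is decay in the frequency of the product.\<close>

definition moment :: "real \<Rightarrow> ennreal" where
  "moment \<tau> = (\<integral>\<^sup>+\<xi>. ennreal (exp (sqrt \<tau> * norm \<xi>) * norm (v (\<tau>, \<xi>))) \<partial>lborel)"

lemma moment_measurable[measurable]: "moment \<in> borel_measurable borel"
  unfolding moment_def[abs_def] by measurable

lemma moment_zero: "\<tau> \<le> 0 \<Longrightarrow> moment \<tau> = 0"
  by (simp add: moment_def v_zero)

text \<open>The width of \<open>v\<close> in frequency is \<open>1 / sqrt \<tau>\<close>, so the integral is of order \<open>\<tau>\<close> to the power \<open>-d/2\<close> with
  \<open>d \<ge> 3\<close>.\<close>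

lemma moment_decay:
  assumes "AE \<xi> in lborel. exp (2 * sqrt \<tau> * norm \<xi>) * norm (v (\<tau>, \<xi>)) \<le> K" and \<tau>: "\<tau> \<ge> 1"
  shows "moment \<tau> \<le> ennreal K * (\<integral>\<^sup>+\<xi>. ennreal (exp (- norm (\<xi>::real^'n))) \<partial>lborel) * ennreal (\<tau> powr (- 3/2))"
proof -
  let ?E = "\<integral>\<^sup>+\<xi>. ennreal (exp (- norm (\<xi>::real^'n))) \<partial>lborel"
  let ?s = "1 / sqrt \<tau>"
  have s: "?s > 0" "?s \<le> 1" using \<tau> by auto
  have "moment \<tau> \<le> (\<integral>\<^sup>+\<xi>. ennreal K * ennreal (exp (- sqrt \<tau> * norm (\<xi>::real^'n))) \<partial>lborel)"
    unfolding moment_def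
  proof (rule nn_integral_mono_AE)
    show "AE \<xi> in lborel. ennreal (exp (sqrt \<tau> * norm \<xi>) * norm (v (\<tau>, \<xi>))) \<le> ennreal K * ennreal (exp (- sqrt \<tau> * norm \<xi>))"
      using assms(1)
    proof eventually_elim
      case (elim \<xi>)
      have "exp (sqrt \<tau> * norm \<xi>) * norm (v (\<tau>, \<xi>)) = exp (2 * sqrt \<tau> * norm \<xi>) * norm (v (\<tau>, \<xi>)) * exp (- sqrt \<tau> * norm \<xi>)"
      proof -
        have "exp (2 * sqrt \<tau> * norm \<xi>) * exp (- sqrt \<tau> * norm \<xi>) = exp (sqrt \<tau> * norm \<xi>)"
          unfolding exp_add[symmetric] by simp
        then show ?thesis by (metis mult.assoc mult.commute)
      qed
      also have "\<dots> \<le> K * exp (- sqrt \<tau> * norm \<xi>)" using elim by (intro mult_right_mono) auto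
      finally show ?case using K0 by (simp add: ennreal_mult[symmetric] ennreal_leI)
    qed
  qed
  also have "\<dots> = ennreal K * (\<integral>\<^sup>+\<xi>. ennreal (exp (- sqrt \<tau> * norm (\<xi>::real^'n))) \<partial>lborel)"
    by (rule nn_integral_cmult) measurable
  also have "(\<integral>\<^sup>+\<xi>. ennreal (exp (- sqrt \<tau> * norm (\<xi>::real^'n))) \<partial>lborel) =
      ennreal \<bar>?s\<bar> ^ DIM(real^'n) * (\<integral>\<^sup>+\<xi>. ennreal (exp (- sqrt \<tau> * norm (0 + ?s *\<^sub>R \<xi>::real^'n))) \<partial>lborel)"
    using s by (subst nn_integral_affine[where c="?s" and t=0]) (auto simp: ennreal_power)
  also have "(\<integral>\<^sup>+\<xi>. ennreal (exp (- sqrt \<tau> * norm (0 + ?s *\<^sub>R \<xi>::real^'n))) \<partial>lborel) = ?E"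
    using \<tau> by (intro nn_integral_cong) simp
  also have "ennreal \<bar>?s\<bar> ^ DIM(real^'n) \<le> ennreal (\<tau> powr (- 3/2))"
  proof -
    have "?s ^ CARD('n) \<le> ?s ^ 3" using s dim by (intro power_decreasing) auto
    also have "?s ^ 3 = \<tau> powr (- 3/2)"
    proof -
      have "?s = \<tau> powr (-1/2)" using powr_minus_divide[of \<tau> "1/2"] \<tau> by (simp add: powr_half_sqrt)
      then have "?s ^ 3 = (\<tau> powr (-1/2)) ^ 3" by (simp only:)
      also have "\<dots> = \<tau> powr (- 3/2)" using \<tau> by (simp add: powr_realpow[symmetric] powr_powr)
      finally show ?thesis .
    qed
    finally show ?thesis using s by (simp add: ennreal_power ennreal_leI)
  qed
  finally show ?thesis by (simp add: mult_right_mono mult_left_mono mult_ac)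
qed

lemma integral_powr_tail: "(\<integral>\<^sup>+\<tau>. ennreal (\<tau> powr (- 3/2)) * indicator {1..} \<tau> \<partial>lborel) = 2"
proof -
  have "(\<integral>\<^sup>+\<tau>. ennreal (\<tau> powr (- 3/2)) * indicator {1..} \<tau> \<partial>lborel) = ennreal (0 - (- 2 * 1 powr (-1/2)))"
  proof (rule nn_integral_FTC_atLeast[where F="\<lambda>\<tau>. - 2 * \<tau> powr (-1/2)"])
    show "((\<lambda>\<tau>. - 2 * \<tau> powr (-1/2)) has_real_derivative \<tau> powr (- 3/2)) (at \<tau>)" if "1 \<le> \<tau>" for \<tau> :: real
      using that by (auto intro!: derivative_eq_intros)
    have "((\<lambda>\<tau>::real. \<tau> powr (-1/2)) \<longlongrightarrow> 0) at_top"
      by (rule tendsto_neg_powr) (auto simp: filterlim_ident)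
    then show "((\<lambda>\<tau>::real. - 2 * \<tau> powr (-1/2)) \<longlongrightarrow> 0) at_top"
      by (rule tendsto_mult_right_zero)
  qed auto
  then show ?thesis by simp
qed

text \<open>Near time zero the weighted energy controls the moments, later the pointwise bound does;
  integrability at infinity is where the dimension has to be at least three.\<close>

lemma moment_integral: "(\<integral>\<^sup>+\<tau>. moment \<tau> \<partial>lborel) < \<infinity>"
proof -
  let ?A = "mass (weighted norm (\<lambda>p. ennreal (norm (v p))))"
  let ?E = "\<integral>\<^sup>+\<xi>. ennreal (exp (- norm (\<xi>::real^'n))) \<partial>lborel"
  have [measurable]: "?A \<in> borel_measurable borel" by measurable
  have E: "?E < \<infinity>" using integrable_exp[of 1, where 'a="real^'n"] by (simp add: integrable_iff_bounded)
  have le1: "a \<le> 1 + a\<^sup>2" for a :: ennreal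
  proof (cases "a \<le> 1")
    case False
    then have "1 * a \<le> a * a" by (intro mult_right_mono) auto
    then show ?thesis by (simp add: power2_eq_square add_increasing)
  qed (simp add: add_increasing2)
  have "AE \<tau> in lborel. moment \<tau> \<le> (indicator {0..1} \<tau> + (?A \<tau>)\<^sup>2) + ennreal K * ?E * (ennreal (\<tau> powr (- 3/2)) * indicator {1..} \<tau>)"
    using pointwise
  proof eventually_elim
    case (elim \<tau>)
    consider "\<tau> \<le> 0" | "0 < \<tau>" "\<tau> \<le> 1" | "\<tau> > 1" by linarith
    then show ?case
    proof cases
      case 2
      have "moment \<tau> \<le> ?A \<tau>"
        unfolding moment_def mass_def weighted_def split_conv
        using 2 by (intro nn_integral_mono) (auto simp: ennreal_mult[symmetric] intro!: ennreal_leI mult_right_mono)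
      also have "\<dots> \<le> 1 + (?A \<tau>)\<^sup>2" by (rule le1)
      finally show ?thesis using 2 by (simp add: add_increasing2)
    next
      case 3
      then show ?thesis using moment_decay[OF elim] by (simp add: add_increasing mult.assoc)
    qed (simp add: moment_zero)
  qed
  then have "(\<integral>\<^sup>+\<tau>. moment \<tau> \<partial>lborel) \<le> (\<integral>\<^sup>+\<tau>. (indicator {0..1} \<tau> + (?A \<tau>)\<^sup>2) + ennreal K * ?E * (ennreal (\<tau> powr (- 3/2)) * indicator {1..} \<tau>) \<partial>lborel)"
    by (rule nn_integral_mono_AE)
  also have "\<dots> = (\<integral>\<^sup>+\<tau>. indicator {0..1} \<tau> \<partial>(lborel :: real measure)) + (\<integral>\<^sup>+\<tau>. (?A \<tau>)\<^sup>2 \<partial>lborel) +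
      ennreal K * ?E * (\<integral>\<^sup>+\<tau>. ennreal (\<tau> powr (- 3/2)) * indicator {1..} \<tau> \<partial>lborel)"
    by (simp add: nn_integral_add nn_integral_cmult)
  also have "\<dots> < \<infinity>"
    unfolding integral_powr_tail using energy E by (simp add: ennreal_mult_less_top)
  finally show ?thesis .
qed

definition rmoment :: "real \<Rightarrow> real" where "rmoment \<tau> = enn2real (moment \<tau>)"

lemma rmoment_measurable[measurable]: "rmoment \<in> borel_measurable borel"
  unfolding rmoment_def[abs_def] by measurable

lemma rmoment_nonneg[simp]: "0 \<le> rmoment \<tau>" by (simp add: rmoment_def)

lemma moment_finite: "AE \<tau> in lborel. moment \<tau> = ennreal (rmoment \<tau>)"
proof -
  have "AE \<tau> in lborel. moment \<tau> \<noteq> \<infinity>" using moment_integral by (intro nn_integral_PInf_AE) auto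
  then show ?thesis by eventually_elim (simp add: rmoment_def less_top)
qed

lemma rmoment_integrable: "integrable lborel rmoment"
proof (rule integrableI_nonneg)
  have "(\<integral>\<^sup>+\<tau>. ennreal (rmoment \<tau>) \<partial>lborel) = (\<integral>\<^sup>+\<tau>. moment \<tau> \<partial>lborel)"
    by (rule nn_integral_cong_AE) (use moment_finite in \<open>auto elim: eventually_mono\<close>)
  then show "(\<integral>\<^sup>+\<tau>. ennreal (rmoment \<tau>) \<partial>lborel) < \<infinity>" using moment_integral by simp
qed auto

definition field :: "'n \<Rightarrow> real \<Rightarrow> real^'n \<Rightarrow> complex" where
  "field k \<tau> = inv_fourier (\<lambda>\<xi>. v (\<tau>, \<xi>) $ k)"

text \<open>Defined as a Fourier transform rather than as a convolution, because it is needed at every frequency, and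
  at zero in particular.\<close>

definition prod_hat :: "'n \<Rightarrow> 'n \<Rightarrow> real \<Rightarrow> real^'n \<Rightarrow> complex" where
  "prod_hat k l \<tau> = fourier (\<lambda>x. field k \<tau> x * field l \<tau> x)"

definition good :: "real \<Rightarrow> bool" where
  "good \<tau> \<longleftrightarrow> (AE \<xi> in lborel. exp (2 * sqrt \<tau> * norm \<xi>) * norm (v (\<tau>, \<xi>)) \<le> K) \<and> moment \<tau> = ennreal (rmoment \<tau>)"

lemma AE_good: "AE \<tau> in lborel. good \<tau>"
  using pointwise moment_finite by eventually_elim (simp add: good_def)

lemma v_nth_integrable: "integrable lborel (\<lambda>\<xi>. v (\<tau>, \<xi>) $ k)"
  by (rule integrable_nth[OF vi])

lemma field_measurable_pair[measurable]: "(\<lambda>p. field k (fst p) (snd p)) \<in> borel_measurable (borel \<Otimes>\<^sub>M borel)"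
  unfolding field_def inv_fourier_eq by measurable

lemma field_measurable[measurable]: "field k \<tau> \<in> borel_measurable borel"
  unfolding field_def using v_nth_integrable by (intro inv_fourier_measurable) auto

lemma prod_hat_measurable_pair[measurable]: "(\<lambda>p. prod_hat k l (fst p) (snd p)) \<in> borel_measurable (borel \<Otimes>\<^sub>M borel)"
proof -
  have "(\<lambda>p. field k (fst (fst p)) (snd p)) \<in> borel_measurable (((borel :: real measure) \<Otimes>\<^sub>M (borel :: (real^'n) measure)) \<Otimes>\<^sub>M borel)" for k
  proof -
    have "(\<lambda>p. (fst (fst p), snd p)) \<in> (borel \<Otimes>\<^sub>M borel) \<Otimes>\<^sub>M borel \<rightarrow>\<^sub>M (borel :: real measure) \<Otimes>\<^sub>M (borel :: (real^'n) measure)"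
      by measurable
    from measurable_compose[OF this field_measurable_pair[of k]] show ?thesis by (simp only: fst_conv snd_conv)
  qed
  note [measurable] = this
  show ?thesis unfolding prod_hat_def fourier_eq by measurable
qed

lemma prod_hat_measurable2[measurable]:
  assumes [measurable]: "f \<in> borel_measurable M" "h \<in> borel_measurable M"
  shows "(\<lambda>x. prod_hat k l (f x) (h x)) \<in> borel_measurable M"
proof -
  have "(\<lambda>x. (f x, h x)) \<in> M \<rightarrow>\<^sub>M borel \<Otimes>\<^sub>M borel" by measurable
  from measurable_compose[OF this prod_hat_measurable_pair[of k l]] show ?thesis by (simp only: fst_conv snd_conv)
qed

lemma v_bounded:
  assumes "good \<tau>" "\<tau> > 0"
  shows "AE \<xi> in lborel. norm (v (\<tau>, \<xi>)) \<le> K * exp (- 2 * sqrt \<tau> * norm \<xi>)"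
proof -
  have "AE \<xi> in lborel. exp (2 * sqrt \<tau> * norm \<xi>) * norm (v (\<tau>, \<xi>)) \<le> K" using assms by (simp add: good_def)
  then show ?thesis
  proof eventually_elim
    case (elim \<xi>)
    then have "exp (2 * sqrt \<tau> * norm \<xi>) * norm (v (\<tau>, \<xi>)) * exp (- 2 * sqrt \<tau> * norm \<xi>) \<le> K * exp (- 2 * sqrt \<tau> * norm \<xi>)"
      by (intro mult_right_mono) auto
    moreover have "exp (2 * sqrt \<tau> * norm \<xi>) * norm (v (\<tau>, \<xi>)) * exp (- 2 * sqrt \<tau> * norm \<xi>) = norm (v (\<tau>, \<xi>))"
    proof -
      have "exp (2 * sqrt \<tau> * norm \<xi>) * exp (- 2 * sqrt \<tau> * norm \<xi>) = 1"
        unfolding exp_add[symmetric] by simp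
      then show ?thesis by (metis mult.assoc mult.commute mult_1)
    qed
    ultimately show ?case by (simp only:)
  qed
qed

lemma product_integrable:
  assumes "good \<tau>" "\<tau> > 0"
  shows "integrable lborel (\<lambda>x. field k \<tau> x * field l \<tau> x)"
proof -
  have sq: "integrable lborel (\<lambda>x. (norm (field k \<tau> x))\<^sup>2)" for k
  proof -
    have "AE \<xi> in lborel. norm (v (\<tau>, \<xi>) $ k) \<le> K"
      using v_bounded[OF assms]
    proof eventually_elim
      case (elim \<xi>)
      have "norm (v (\<tau>, \<xi>) $ k) \<le> norm (v (\<tau>, \<xi>))" by (rule Finite_Cartesian_Product.norm_nth_le)
      also have "\<dots> \<le> K * exp (- 2 * sqrt \<tau> * norm \<xi>)" by (rule elim)
      also have "\<dots> \<le> K * 1" using K0 assms(2) by (intro mult_left_mono) auto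
      finally show ?case by simp
    qed
    from plancherel_bound[OF v_nth_integrable this K0]
    have "(\<integral>\<^sup>+x. ennreal ((norm (field k \<tau> x))\<^sup>2) \<partial>lborel) < \<infinity>"
      unfolding field_def by (rule le_less_trans) simp
    then show ?thesis by (simp add: integrable_iff_bounded)
  qed
  show ?thesis
  proof (rule Bochner_Integration.integrable_bound[OF Bochner_Integration.integrable_add[OF sq[of k] sq[of l]]])
    show "AE x in lborel. norm (field k \<tau> x * field l \<tau> x) \<le> norm ((norm (field k \<tau> x))\<^sup>2 + (norm (field l \<tau> x))\<^sup>2)"
    proof (rule AE_I2)
      fix x
      have "2 * norm (field k \<tau> x) * norm (field l \<tau> x) \<le> (norm (field k \<tau> x))\<^sup>2 + (norm (field l \<tau> x))\<^sup>2"
        by (rule sum_squares_bound)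
      moreover have "0 \<le> norm (field k \<tau> x) * norm (field l \<tau> x)" by simp
      ultimately show "norm (field k \<tau> x * field l \<tau> x) \<le> norm ((norm (field k \<tau> x))\<^sup>2 + (norm (field l \<tau> x))\<^sup>2)"
        unfolding norm_mult real_norm_def by linarith
    qed
  qed measurable
qed

lemma prod_hat_conv:
  assumes "good \<tau>" "\<tau> > 0"
  shows "AE \<xi> in lborel. of_real (fconst TYPE('n)) * conv (\<lambda>\<eta>. v (\<tau>, \<eta>) $ k) (\<lambda>\<eta>. v (\<tau>, \<eta>) $ l) \<xi> = prod_hat k l \<tau> \<xi>"
  using conv_eq_fourier_AE[OF \<theta> v_nth_integrable v_nth_integrable product_integrable[OF assms, unfolded field_def]]
  unfolding prod_hat_def field_def .

lemma continuous_le_AE: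
  fixes f h :: "real^'n \<Rightarrow> real"
  assumes "continuous_on UNIV f" "continuous_on UNIV h" "AE x in lborel. f x \<le> h x"
  shows "f x \<le> h x"
proof (rule ccontr)
  assume "\<not> f x \<le> h x"
  then have ne: "{x. h x < f x} \<noteq> {}" by (auto simp: not_le)
  have op: "open {x. h x < f x}" by (rule open_Collect_less[OF assms(2,1)])
  have "AE x in lebesgue. f x \<le> h x" using assms(3) by (simp only: AE_completion_iff)
  then have "AE x in lebesgue. x \<notin> {x. h x < f x}" by eventually_elim simp
  then have "{x. h x < f x} \<in> null_sets lebesgue"
    using op by (subst AE_iff_null_sets) auto
  then have "negligible {x. h x < f x}" by (simp add: negligible_iff_null_sets)
  then show False using open_not_negligible[OF op ne] by blast
qed

definition moment_const :: real where "moment_const = fconst TYPE('n) * K"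

lemma moment_const_nonneg: "0 \<le> moment_const"
  using K0 by (simp add: moment_const_def less_imp_le)

text \<open>By \<open>norm \<xi> \<le> norm \<eta> + norm (\<xi> - \<eta>)\<close>, the weights of the two factors of the convolution combine to a weight
  in \<open>\<xi>\<close>. The bound holds almost everywhere and then everywhere by continuity.\<close>

lemma prod_hat_bound:
  assumes g: "good \<tau>" and \<tau>: "\<tau> > 0"
  shows "norm (prod_hat k l \<tau> \<xi>) \<le> moment_const * rmoment \<tau> * exp (- sqrt \<tau> * norm \<xi>)"
proof (rule continuous_le_AE)
  show "continuous_on UNIV (\<lambda>\<xi>. norm (prod_hat k l \<tau> \<xi>))"
    unfolding prod_hat_def by (intro continuous_on_norm continuous_fourier product_integrable[OF g \<tau>])
  show "continuous_on UNIV (\<lambda>\<xi>. moment_const * rmoment \<tau> * exp (- sqrt \<tau> * norm \<xi>))"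
    by (intro continuous_intros)
  show "AE \<xi> in lborel. norm (prod_hat k l \<tau> \<xi>) \<le> moment_const * rmoment \<tau> * exp (- sqrt \<tau> * norm \<xi>)"
    using prod_hat_conv[OF assms, of k l]
  proof eventually_elim
    case (elim \<xi>)
    let ?f = "\<lambda>\<eta>. v (\<tau>, \<eta>)"
    have refl: "AE \<eta> in lborel. norm (?f (\<xi> - \<eta>)) \<le> K * exp (- 2 * sqrt \<tau> * norm (\<xi> - \<eta>))"
      using AE_affine[OF v_bounded[OF assms], of "-1" \<xi>] by simp
    have "ennreal (norm (conv (\<lambda>\<eta>. ?f \<eta> $ k) (\<lambda>\<eta>. ?f \<eta> $ l) \<xi>)) \<le>
        (\<integral>\<^sup>+\<eta>. ennreal (norm (?f \<eta> $ k)) * ennreal (norm (?f (\<xi> - \<eta>) $ l)) \<partial>lborel)"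
      by (rule norm_conv_le)
    also have "\<dots> \<le> (\<integral>\<^sup>+\<eta>. ennreal (K * exp (- sqrt \<tau> * norm \<xi>)) * ennreal (exp (sqrt \<tau> * norm \<eta>) * norm (?f \<eta>)) \<partial>lborel)"
    proof (rule nn_integral_mono_AE)
      show "AE \<eta> in lborel. ennreal (norm (?f \<eta> $ k)) * ennreal (norm (?f (\<xi> - \<eta>) $ l)) \<le>
          ennreal (K * exp (- sqrt \<tau> * norm \<xi>)) * ennreal (exp (sqrt \<tau> * norm \<eta>) * norm (?f \<eta>))"
        using refl
      proof eventually_elim
        case (elim \<eta>)
        have "sqrt \<tau> * norm \<xi> \<le> sqrt \<tau> * (norm \<eta> + norm (\<xi> - \<eta>))"
          using norm_triangle_ineq[of \<eta> "\<xi> - \<eta>"] \<tau> by (intro mult_left_mono) auto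
        moreover have "0 \<le> sqrt \<tau> * norm (\<xi> - \<eta>)" using \<tau> by simp
        ultimately have "- 2 * sqrt \<tau> * norm (\<xi> - \<eta>) \<le> - sqrt \<tau> * norm \<xi> + sqrt \<tau> * norm \<eta>"
          by (simp add: algebra_simps)
        then have "exp (- 2 * sqrt \<tau> * norm (\<xi> - \<eta>)) \<le> exp (- sqrt \<tau> * norm \<xi>) * exp (sqrt \<tau> * norm \<eta>)"
          unfolding exp_add[symmetric] by simp
        then have "norm (?f (\<xi> - \<eta>)) \<le> K * (exp (- sqrt \<tau> * norm \<xi>) * exp (sqrt \<tau> * norm \<eta>))"
          by (intro order_trans[OF elim] mult_left_mono K0)
        then have "norm (?f \<eta> $ k) * norm (?f (\<xi> - \<eta>) $ l) \<le> norm (?f \<eta>) * (K * (exp (- sqrt \<tau> * norm \<xi>) * exp (sqrt \<tau> * norm \<eta>)))"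
          by (intro mult_mono order_trans[OF Finite_Cartesian_Product.norm_nth_le] Finite_Cartesian_Product.norm_nth_le) auto
        then show ?case using K0 by (simp add: ennreal_mult[symmetric] ennreal_leI mult_ac)
      qed
    qed
    also have "\<dots> = ennreal (K * exp (- sqrt \<tau> * norm \<xi>)) * moment \<tau>"
      unfolding moment_def by (rule nn_integral_cmult) measurable
    also have "\<dots> = ennreal (K * exp (- sqrt \<tau> * norm \<xi>) * rmoment \<tau>)"
      using g K0 by (simp add: good_def ennreal_mult)
    finally have "norm (conv (\<lambda>\<eta>. ?f \<eta> $ k) (\<lambda>\<eta>. ?f \<eta> $ l) \<xi>) \<le> K * exp (- sqrt \<tau> * norm \<xi>) * rmoment \<tau>"
      using K0 by (subst (asm) ennreal_le_iff) auto
    then have "fconst TYPE('n) * norm (conv (\<lambda>\<eta>. ?f \<eta> $ k) (\<lambda>\<eta>. ?f \<eta> $ l) \<xi>) \<le> fconst TYPE('n) * (K * exp (- sqrt \<tau> * norm \<xi>) * rmoment \<tau>)"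
      by (intro mult_left_mono) (auto simp: less_imp_le)
    then show ?case
      unfolding elim[symmetric] by (simp add: norm_mult moment_const_def mult_ac less_imp_le)
  qed
qed

lemma prod_hat_zero: "\<tau> \<le> 0 \<Longrightarrow> prod_hat k l \<tau> \<xi> = 0"
  by (simp add: prod_hat_def field_def v_zero fourier_def inv_fourier_def)

lemma prod_hat_bound': "good \<tau> \<Longrightarrow> norm (prod_hat k l \<tau> \<xi>) \<le> moment_const * rmoment \<tau>"
proof (cases "\<tau> > 0")
  case True
  assume "good \<tau>"
  then have "norm (prod_hat k l \<tau> \<xi>) \<le> moment_const * rmoment \<tau> * exp (- sqrt \<tau> * norm \<xi>)"
    using True by (rule prod_hat_bound)
  also have "\<dots> \<le> moment_const * rmoment \<tau> * 1"
    using True moment_const_nonneg by (intro mult_left_mono) auto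
  finally show ?thesis by simp
qed (simp add: prod_hat_zero moment_const_nonneg)

lemma prod_hat_time_integrable:
  assumes [measurable]: "f \<in> borel_measurable borel" and f: "\<And>\<tau>. norm (f \<tau>) \<le> 1"
  shows "integrable lborel (\<lambda>\<tau>. f \<tau> * prod_hat k l \<tau> \<xi>)"
proof (rule Bochner_Integration.integrable_bound)
  show "integrable lborel (\<lambda>\<tau>. moment_const * rmoment \<tau>)" by (intro integrable_mult_right rmoment_integrable)
  show "AE \<tau> in lborel. norm (f \<tau> * prod_hat k l \<tau> \<xi>) \<le> norm (moment_const * rmoment \<tau>)"
    using AE_good
  proof eventually_elim
    case (elim \<tau>)
    have "norm (f \<tau> * prod_hat k l \<tau> \<xi>) \<le> 1 * (moment_const * rmoment \<tau>)"
      unfolding norm_mult by (intro mult_mono f prod_hat_bound'[OF elim]) auto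
    then show ?case by simp
  qed
qed measurable

definition first_moment :: "'n \<Rightarrow> complex^'n" where
  "first_moment k = (\<chi> l. LINT \<tau>|lborel. prod_hat k l \<tau> 0)"

text \<open>The normalising factor turns the space integral of a product into its transform at frequency zero.\<close>

lemma momentum_integral_eq: "(2 * pi) powr (- real CARD('n) / 2) *\<^sub>R momentum_integral u k = first_moment k"
proof -
  let ?c = "fconst TYPE('n)"
  let ?M = "\<lambda>\<tau>. \<chi> l. of_real (1 / ?c) * prod_hat k l \<tau> 0"
  have cne: "?c \<noteq> 0" using fconst_pos[where 'n='n] by (rule less_imp_neq[symmetric])
  have [measurable]: "?M \<in> borel_measurable borel" by measurable
  have phi: "integrable lborel (\<lambda>\<tau>. prod_hat k l \<tau> 0)" for l
    using prod_hat_time_integrable[of "\<lambda>_. 1" k l 0] by simp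
  have Mi: "integrable lborel ?M"
    using phi by (intro integrable_vec) (simp del: of_real_divide)
  have "AE \<tau> in lborel. indicator {0<..} \<tau> *\<^sub>R (LINT x|lborel. fval (u \<tau>) x $ k *s fval (u \<tau>) x) = ?M \<tau>"
    using AE_good vhat
  proof eventually_elim
    case (elim \<tau>)
    show ?case
    proof (cases "\<tau> > 0")
      case True
      with elim have h: "has_hat (u \<tau>) (\<lambda>\<xi>. v (\<tau>, \<xi>))" by simp
      have f: "(fval (u \<tau>) x $ k *s fval (u \<tau>) x) $ l = field k \<tau> x * field l \<tau> x" for x l
        by (simp add: fval_nth[OF \<theta> h] field_def)
      have int: "integrable lborel (\<lambda>x. fval (u \<tau>) x $ k *s fval (u \<tau>) x)"
        by (rule integrable_vec) (simp only: f product_integrable[OF elim(1) True])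
      have "(LINT x|lborel. fval (u \<tau>) x $ k *s fval (u \<tau>) x) = ?M \<tau>"
      proof (unfold vec_eq_iff, rule allI)
        fix l
        have "prod_hat k l \<tau> 0 = of_real ?c * (LINT x|lborel. field k \<tau> x * field l \<tau> x)"
          by (simp add: prod_hat_def fourier_eq)
        then show "(LINT x|lborel. fval (u \<tau>) x $ k *s fval (u \<tau>) x) $ l = ?M \<tau> $ l"
          unfolding integral_vec_nth[OF int] f using cne by simp
      qed
      then show ?thesis using True by simp
    next
      case False
      then show ?thesis by (simp add: prod_hat_zero vec_eq_iff)
    qed
  qed
  then have "momentum_integral u k = (LINT \<tau>|lborel. ?M \<tau>)"
    unfolding momentum_integral_def set_lebesgue_integral_def by (rule integral_lebesgue_AE) measurable
  moreover have "(2 * pi) powr (- real CARD('n) / 2) = ?c" by (simp add: fconst_def)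
  ultimately show ?thesis
    using cne integral_vec_nth[OF Mi] by (simp only:) (simp add: vec_eq_iff first_moment_def scaleR_conv_of_real[where 'a=complex])
qed

end

subsection \<open>Linear operations on distributions given by functions\<close>

lemma dist_of_add:
  assumes "locally_integrable f" "locally_integrable g" "\<phi> \<in> test_functions"
  shows "dist_of (\<lambda>x. f x + g x) \<phi> = dist_of f \<phi> + dist_of g \<phi>"
  using locally_integrable_times_test[OF locally_integrable_nth[OF assms(1)] assms(3)]
    locally_integrable_times_test[OF locally_integrable_nth[OF assms(2)] assms(3)]
  by (simp add: vec_eq_iff distrib_right)

lemma dist_of_diff:
  assumes "locally_integrable f" "locally_integrable g" "\<phi> \<in> test_functions"
  shows "dist_of (\<lambda>x. f x - g x) \<phi> = dist_of f \<phi> - dist_of g \<phi>"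
  using locally_integrable_times_test[OF locally_integrable_nth[OF assms(1)] assms(3)]
    locally_integrable_times_test[OF locally_integrable_nth[OF assms(2)] assms(3)]
  by (simp add: vec_eq_iff left_diff_distrib)

lemma locally_integrable_add: "locally_integrable f \<Longrightarrow> locally_integrable g \<Longrightarrow> locally_integrable (\<lambda>x. f x + g x)"
  unfolding locally_integrable_def by (auto intro!: set_integral_add)

lemma locally_integrable_diff: "locally_integrable f \<Longrightarrow> locally_integrable g \<Longrightarrow> locally_integrable (\<lambda>x. f x - g x)"
  unfolding locally_integrable_def by (auto intro!: set_integral_diff)

lemma locally_integrable_oseen:
  fixes c :: "real^'n::finite \<Rightarrow> complex^'n"
  assumes \<mu>: "\<mu> > 0" "t > 0" and c: "\<And>m. continuous_on UNIV (\<lambda>\<xi>. c \<xi> $ m)"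
  shows "locally_integrable (\<lambda>\<xi>. oseen_hat \<mu> t \<xi> *v c \<xi>)"
proof (rule locally_integrable_vec)
  fix l
  have i: "locally_integrable (\<lambda>\<xi>::real^'n. oseen_hat \<mu> t \<xi> $ l $ m)" for m
    by (intro integrable_locally_integrable second_moment_imp(1)[OF oseen_hat_second_moment[OF \<mu>]]) measurable
  have "locally_integrable (\<lambda>\<xi>. \<Sum>m\<in>UNIV. c \<xi> $ m * oseen_hat \<mu> t \<xi> $ l $ m)"
    by (intro locally_integrable_sum locally_integrable_mult_continuous i c)
  then show "locally_integrable (\<lambda>\<xi>. (oseen_hat \<mu> t \<xi> *v c \<xi>) $ l)"
    by (simp add: matrix_vector_mult_def mult.commute)
qed

context small_mild_solution
begin

subsection \<open>The Fourier transform of the remainder\<close>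

definition flux :: "('n \<Rightarrow> 'n \<Rightarrow> complex) \<Rightarrow> real^'n \<Rightarrow> complex^'n" where
  "flux W \<xi> = (\<chi> l. \<Sum>k\<in>UNIV. \<i> * of_real (\<xi> $ k) * W k l)"

lemma flux_measurable: "(\<lambda>p. flux (\<lambda>k l. prod_hat k l (fst p) (snd p)) (snd p)) \<in> borel_measurable (borel \<Otimes>\<^sub>M borel)"
  unfolding flux_def by measurable

text \<open>The identity is known at almost every time for almost every frequency; it is needed with the quantifiers
  exchanged.\<close>

lemma force_eq_flux:
  "AE \<xi> in lborel. AE \<tau> in lborel. 0 < \<tau> \<longrightarrow> force v (\<tau>, \<xi>) = leray_symbol \<xi> *v flux (\<lambda>k l. prod_hat k l \<tau> \<xi>) \<xi>"
proof -
  let ?D = "\<lambda>\<tau> \<xi>. indicator {0<..} \<tau> * norm (force v (\<tau>, \<xi>) - leray_symbol \<xi> *v flux (\<lambda>k l. prod_hat k l \<tau> \<xi>) \<xi>)"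
  note [measurable] = flux_measurable
  have m: "(\<lambda>p. ?D (fst p) (snd p)) \<in> borel_measurable (borel \<Otimes>\<^sub>M borel)" by measurable
  have "AE \<tau> in lborel. AE \<xi> in lborel. ?D \<tau> \<xi> = 0"
    using AE_good
  proof eventually_elim
    case (elim \<tau>)
    show ?case
    proof (cases "\<tau> > 0")
      case True
      have "AE \<xi> in lborel. \<forall>k\<in>UNIV. \<forall>l\<in>UNIV. of_real (fconst TYPE('n)) * conv (\<lambda>\<eta>. v (\<tau>, \<eta>) $ k) (\<lambda>\<eta>. v (\<tau>, \<eta>) $ l) \<xi> = prod_hat k l \<tau> \<xi>"
        by (intro AE_finite_allI) (auto intro: prod_hat_conv[OF elim True])
      then show ?thesis
        by eventually_elim (simp add: force_def nonlin_def flux_def)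
    qed simp
  qed
  moreover have set: "{p \<in> space (lborel \<Otimes>\<^sub>M lborel). ?D (fst p) (snd p) = 0} \<in> sets (lborel \<Otimes>\<^sub>M (lborel :: (real^'n) measure))"
    using m by measurable
  ultimately have "AE \<xi> in lborel. AE \<tau> in lborel. ?D \<tau> \<xi> = 0"
    using lborel_pair.AE_commute[OF set] by (simp only:)
  then show ?thesis by eventually_elim (auto elim!: eventually_mono split: if_splits simp: indicator_def)
qed

definition source :: "'n \<Rightarrow> 'n \<Rightarrow> real \<Rightarrow> real^'n \<Rightarrow> complex" where
  "source k l t \<xi> = (LINT \<tau>|lborel. of_real (heat_factor \<mu> t \<tau> \<xi>) * prod_hat k l \<tau> \<xi>)"

lemma norm_heat_factor: "norm (complex_of_real (heat_factor \<mu> t \<tau> \<xi>)) = heat_factor \<mu> t \<tau> \<xi>"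
  using heat_factor_bounds[OF \<mu>, of t \<tau> \<xi>] by simp

lemma norm_heat_factor_le: "norm (complex_of_real (heat_factor \<mu> t \<tau> \<xi>)) \<le> 1"
  using heat_factor_bounds[OF \<mu>, of t \<tau> \<xi>] by simp

lemma heat_factor_integrable: "integrable lborel (\<lambda>\<tau>. of_real (heat_factor \<mu> t \<tau> \<xi>) * prod_hat k l \<tau> \<xi>)"
  by (intro prod_hat_time_integrable norm_heat_factor_le) measurable

lemma duhamel_hat_eq:
  "AE \<xi> in lborel. duhamel_hat \<mu> v t \<xi> = leray_symbol \<xi> *v flux (\<lambda>k l. source k l t \<xi>) \<xi>"
  using force_eq_flux
proof eventually_elim
  case (elim \<xi>)
  show ?case
  proof (unfold vec_eq_iff, rule allI)
    fix i
    let ?h = "\<lambda>\<tau>. complex_of_real (heat_factor \<mu> t \<tau> \<xi>)"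
    have "duhamel_hat \<mu> v t \<xi> $ i = (LINT \<tau>|lborel. ?h \<tau> * force v (\<tau>, \<xi>) $ i)" by (simp add: duhamel_hat_def)
    also have "\<dots> = (LINT \<tau>|lborel. (\<Sum>l\<in>UNIV. \<Sum>k\<in>UNIV. leray_symbol \<xi> $ i $ l * (\<i> * of_real (\<xi> $ k)) * (?h \<tau> * prod_hat k l \<tau> \<xi>)))"
    proof (rule integral_cong_AE)
      show "AE \<tau> in lborel. ?h \<tau> * force v (\<tau>, \<xi>) $ i = (\<Sum>l\<in>UNIV. \<Sum>k\<in>UNIV. leray_symbol \<xi> $ i $ l * (\<i> * of_real (\<xi> $ k)) * (?h \<tau> * prod_hat k l \<tau> \<xi>))"
        using elim
      proof eventually_elim
        case (elim \<tau>)
        show ?case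
        proof (cases "0 < \<tau>")
          case True
          with elim show ?thesis by (simp add: flux_def matrix_vector_mult_def sum_distrib_left mult_ac)
        qed (simp add: heat_factor_def)
      qed
      show "(\<lambda>\<tau>. ?h \<tau> * force v (\<tau>, \<xi>) $ i) \<in> borel_measurable lborel" by measurable
      show "(\<lambda>\<tau>. \<Sum>l\<in>UNIV. \<Sum>k\<in>UNIV. leray_symbol \<xi> $ i $ l * (\<i> * of_real (\<xi> $ k)) * (?h \<tau> * prod_hat k l \<tau> \<xi>)) \<in> borel_measurable lborel" by measurable
    qed
    also have "\<dots> = (\<Sum>l\<in>UNIV. \<Sum>k\<in>UNIV. leray_symbol \<xi> $ i $ l * (\<i> * of_real (\<xi> $ k)) * source k l t \<xi>)"
      unfolding source_def
      by (subst Bochner_Integration.integral_sum, intro Bochner_Integration.integrable_sum integrable_mult_right heat_factor_integrable,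
          subst Bochner_Integration.integral_sum, intro integrable_mult_right heat_factor_integrable) simp
    also have "\<dots> = (leray_symbol \<xi> *v flux (\<lambda>k l. source k l t \<xi>) \<xi>) $ i"
      by (simp add: flux_def matrix_vector_mult_def sum_distrib_left mult_ac)
    finally show "duhamel_hat \<mu> v t \<xi> $ i = (leray_symbol \<xi> *v flux (\<lambda>k l. source k l t \<xi>) \<xi>) $ i" .
  qed
qed

text \<open>The Duhamel integral minus its leading term, written as one integral over all times: the leading term
  replaces the heat factor by its value at \<open>\<tau> = 0\<close> and the transform of the product by its value at frequency
  zero.\<close>

definition defect :: "'n \<Rightarrow> 'n \<Rightarrow> real \<Rightarrow> real^'n \<Rightarrow> complex" where
  "defect k l t \<xi> = (LINT \<tau>|lborel. of_real (heat_factor \<mu> t \<tau> \<xi>) * prod_hat k l \<tau> \<xi> -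
     of_real (exp (- \<mu> * t * (norm \<xi>)\<^sup>2)) * prod_hat k l \<tau> 0)"

lemma prod_hat_zero_integrable: "integrable lborel (\<lambda>\<tau>. c * prod_hat k l \<tau> 0)"
  using prod_hat_time_integrable[of "\<lambda>_. 1" k l 0] by simp

lemma defect_eq: "defect k l t \<xi> = source k l t \<xi> - of_real (exp (- \<mu> * t * (norm \<xi>)\<^sup>2)) * first_moment k $ l"
  unfolding defect_def source_def
  by (subst Bochner_Integration.integral_diff) (auto intro: heat_factor_integrable prod_hat_zero_integrable simp: first_moment_def)

lemma source_measurable[measurable]: "source k l t \<in> borel_measurable borel"
  unfolding source_def[abs_def] by measurable

lemma defect_measurable[measurable]: "defect k l t \<in> borel_measurable borel"
  unfolding defect_eq[abs_def] by measurable

definition remainder_hat :: "real^'n \<Rightarrow> real \<Rightarrow> real^'n \<Rightarrow> complex^'n" where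
  "remainder_hat M0 t \<xi> = of_real (exp (- \<mu> * t * (norm \<xi>)\<^sup>2)) *s g0 \<xi> - duhamel_hat \<mu> v t \<xi>
     - oseen_hat \<mu> t \<xi> *v cvec M0 + oseen_hat \<mu> t \<xi> *v (\<Sum>k\<in>UNIV. (\<i> * of_real (\<xi> $ k)) *s first_moment k)"

lemma has_hat_remainder:
  assumes t: "t > 0"
  shows "has_hat (asymptotic_remainder \<mu> M0 u t) (remainder_hat M0 t)"
proof -
  note h = mild_solution_hat[OF \<theta> \<mu> mild g0 v vi vhat fin t]
  let ?f = "\<lambda>\<xi>. of_real (exp (- \<mu> * t * (norm \<xi>)\<^sup>2)) *s g0 \<xi> - duhamel_hat \<mu> v t \<xi>"
  let ?a = "\<lambda>\<xi>. oseen_hat \<mu> t \<xi> *v cvec M0"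
  let ?b = "\<lambda>\<xi>. oseen_hat \<mu> t \<xi> *v (\<Sum>k\<in>UNIV. (\<i> * of_real (\<xi> $ k)) *s first_moment k)"
  have lf: "locally_integrable ?f" using h by (simp only: has_hat_iff)
  have la: "locally_integrable ?a" by (intro locally_integrable_oseen[OF \<mu> t]) simp
  have lb: "locally_integrable ?b"
    by (intro locally_integrable_oseen[OF \<mu> t]) (auto intro!: continuous_intros)
  show ?thesis
    unfolding has_hat_iff remainder_hat_def[abs_def]
  proof (intro conjI ballI)
    show "locally_integrable (\<lambda>\<xi>. ?f \<xi> - ?a \<xi> + ?b \<xi>)"
      by (intro locally_integrable_add locally_integrable_diff lf la lb)
    fix \<phi> :: "real^'n \<Rightarrow> complex" assume \<phi>: "\<phi> \<in> test_functions"
    have "asymptotic_remainder \<mu> M0 u t (fourier \<phi>) = dist_of ?f \<phi> - dist_of ?a \<phi> + dist_of ?b \<phi>"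
      unfolding asymptotic_remainder_def momentum_integral_eq dist_of_oseen[OF \<mu> t \<phi>] dist_of_pd_oseen[OF \<mu> t \<phi>]
      using h \<phi> by (simp only: has_hat_iff)
    also have "\<dots> = dist_of (\<lambda>\<xi>. ?f \<xi> - ?a \<xi> + ?b \<xi>) \<phi>"
      by (simp only: dist_of_add[OF locally_integrable_diff[OF lf la] lb \<phi>] dist_of_diff[OF lf la \<phi>])
    finally show "asymptotic_remainder \<mu> M0 u t (fourier \<phi>) = dist_of (\<lambda>\<xi>. ?f \<xi> - ?a \<xi> + ?b \<xi>) \<phi>" .
  qed
qed

lemma remainder_hat_eq:
  "AE \<xi> in lborel. remainder_hat M0 t \<xi> = of_real (exp (- \<mu> * t * (norm \<xi>)\<^sup>2)) *s (g0 \<xi> - leray_symbol \<xi> *v cvec M0)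
     - leray_symbol \<xi> *v flux (\<lambda>k l. defect k l t \<xi>) \<xi>"
  using duhamel_hat_eq[of t]
proof eventually_elim
  case (elim \<xi>)
  let ?e = "complex_of_real (exp (- \<mu> * t * (norm \<xi>)\<^sup>2))"
  let ?m = "\<Sum>k\<in>UNIV. (\<i> * of_real (\<xi> $ k)) *s first_moment k"
  have "flux (\<lambda>k l. defect k l t \<xi>) \<xi> = flux (\<lambda>k l. source k l t \<xi>) \<xi> - ?e *s ?m"
    by (simp add: vec_eq_iff flux_def defect_eq right_diff_distrib sum_subtractf sum_distrib_left mult_ac)
  then have "leray_symbol \<xi> *v flux (\<lambda>k l. defect k l t \<xi>) \<xi> = leray_symbol \<xi> *v flux (\<lambda>k l. source k l t \<xi>) \<xi> - ?e *s (leray_symbol \<xi> *v ?m)"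
    by (simp only: matrix_vector_mult_diff_distrib vector_scalar_commute)
  then show ?case
    unfolding remainder_hat_def elim oseen_hat_mult by (simp add: vector_ssub_ldistrib)
qed

lemma norm_flux_le: "norm (flux W \<xi>) \<le> norm \<xi> * (\<Sum>l\<in>UNIV. \<Sum>k\<in>UNIV. norm (W k l))"
proof -
  have "norm (flux W \<xi>) \<le> (\<Sum>l\<in>UNIV. norm (flux W \<xi> $ l))" by (rule norm_vec_le_sum)
  also have "\<dots> \<le> (\<Sum>l\<in>UNIV. \<Sum>k\<in>UNIV. norm \<xi> * norm (W k l))"
  proof (rule sum_mono)
    fix l
    have "norm (flux W \<xi> $ l) \<le> (\<Sum>k\<in>UNIV. norm (\<i> * of_real (\<xi> $ k) * W k l))"
      unfolding flux_def vec_lambda_beta by (rule norm_sum)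
    also have "\<dots> \<le> (\<Sum>k\<in>UNIV. norm \<xi> * norm (W k l))"
      by (intro sum_mono) (simp add: norm_mult mult_right_mono component_le_norm_cart)
    finally show "norm (flux W \<xi> $ l) \<le> (\<Sum>k\<in>UNIV. norm \<xi> * norm (W k l))" .
  qed
  finally show ?thesis by (simp add: sum_distrib_left)
qed

text \<open>A bound for \<open>sqrt t\<close> times the transform of the remainder at the frequency \<open>\<eta> / sqrt t\<close>. The factor
  \<open>sqrt t\<close> is the \<open>1/2\<close> in the exponent \<open>(s + 1) / 2\<close> of the theorem.\<close>

definition profile :: "real \<Rightarrow> real \<Rightarrow> real \<Rightarrow> real^'n \<Rightarrow> real" where
  "profile A \<alpha> t \<eta> = A * t powr ((1 - \<alpha>) / 2) * (norm \<eta> powr \<alpha> * exp (- \<mu> * (norm \<eta>)\<^sup>2)) +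
     leray_bound TYPE('n) * (norm \<eta> * (\<Sum>l\<in>UNIV. \<Sum>k\<in>UNIV. norm (defect k l t ((1 / sqrt t) *\<^sub>R \<eta>))))"

lemma profile_measurable[measurable]: "profile A \<alpha> t \<in> borel_measurable borel"
  unfolding profile_def[abs_def] by measurable

lemma profile_nonneg: "A \<ge> 0 \<Longrightarrow> 0 \<le> profile A \<alpha> t \<eta>"
  unfolding profile_def by (intro add_nonneg_nonneg mult_nonneg_nonneg sum_nonneg) auto

lemma remainder_hat_le_profile:
  assumes t: "t > 0" and A: "AE \<xi> in lborel. norm (g0 \<xi> - leray_symbol \<xi> *v cvec M0) \<le> A * norm \<xi> powr \<alpha>"
  shows "AE \<xi> in lborel. norm (remainder_hat M0 t \<xi>) \<le> profile A \<alpha> t (sqrt t *\<^sub>R \<xi>) / sqrt t"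
  using remainder_hat_eq[of M0 t] A
proof eventually_elim
  case (elim \<xi>)
  let ?S = "\<Sum>l\<in>UNIV. \<Sum>k\<in>UNIV. norm (defect k l t \<xi>)"
  have "norm (remainder_hat M0 t \<xi>) \<le> exp (- \<mu> * t * (norm \<xi>)\<^sup>2) * norm (g0 \<xi> - leray_symbol \<xi> *v cvec M0) +
      norm (leray_symbol \<xi> *v flux (\<lambda>k l. defect k l t \<xi>) \<xi>)"
    unfolding elim(1) by (rule order_trans[OF norm_triangle_ineq4]) (simp only: norm_vsmult norm_of_real abs_exp_cancel)
  also have "\<dots> \<le> exp (- \<mu> * t * (norm \<xi>)\<^sup>2) * (A * norm \<xi> powr \<alpha>) + leray_bound TYPE('n) * (norm \<xi> * ?S)"
    by (intro add_mono mult_left_mono elim order_trans[OF norm_leray_le] norm_flux_le) auto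
  also have "\<dots> = profile A \<alpha> t (sqrt t *\<^sub>R \<xi>) / sqrt t"
  proof -
    have n: "norm (sqrt t *\<^sub>R \<xi>) = sqrt t * norm \<xi>" using t by simp
    have "t powr ((1 - \<alpha>) / 2) * (sqrt t * norm \<xi>) powr \<alpha> = sqrt t * norm \<xi> powr \<alpha>"
    proof -
      have "(sqrt t * norm \<xi>) powr \<alpha> = t powr (\<alpha> / 2) * norm \<xi> powr \<alpha>"
        using t by (simp add: powr_mult powr_half_sqrt[symmetric] powr_powr)
      moreover have "t powr ((1 - \<alpha>) / 2) * t powr (\<alpha> / 2) = sqrt t"
        using t unfolding powr_add[symmetric] by (simp add: powr_half_sqrt[symmetric] diff_divide_distrib)
      ultimately show ?thesis by (simp only: mult.assoc[symmetric])
    qed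
    then have "A * t powr ((1 - \<alpha>) / 2) * ((sqrt t * norm \<xi>) powr \<alpha> * exp (- \<mu> * (sqrt t * norm \<xi>)\<^sup>2)) =
        sqrt t * (exp (- \<mu> * t * (norm \<xi>)\<^sup>2) * (A * norm \<xi> powr \<alpha>))"
      using t by (simp add: power_mult_distrib mult_ac)
    moreover have "(1 / sqrt t) *\<^sub>R (sqrt t *\<^sub>R \<xi>) = \<xi>" using t by simp
    ultimately show ?thesis using t unfolding profile_def n by (auto simp: field_simps)
  qed
  finally show ?case .
qed

subsection \<open>The limit of the rescaled remainder\<close>

text \<open>For \<open>\<tau> \<le> t / 4\<close> the heat factor still contains \<open>3/4\<close> of the Gaussian, which beats \<open>exp (- x / 2)\<close>; for
  later \<open>\<tau>\<close> the weight of the product does, as \<open>sqrt (\<tau> / t) \<ge> 1/2\<close>.\<close>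

lemma heat_weight_le:
  assumes "t > 0" "x \<ge> 0" "0 < \<tau>" "\<tau> < t"
  shows "exp (- \<mu> * (1 - \<tau> / t) * x\<^sup>2) * exp (- sqrt (\<tau> / t) * x) \<le> exp (1 / (12 * \<mu>)) * exp (- x / 2)"
proof -
  define \<sigma> where "\<sigma> = \<tau> / t"
  have \<sigma>: "0 < \<sigma>" "\<sigma> < 1" using assms by (auto simp: \<sigma>_def)
  have lin: "x / 2 \<le> 3 / 4 * (\<mu> * x\<^sup>2) + 1 / (12 * \<mu>)"
    using linear_le_quadratic[of "3 / 2 * \<mu>" x] \<mu> by simp
  have "- \<mu> * (1 - \<sigma>) * x\<^sup>2 - sqrt \<sigma> * x \<le> 1 / (12 * \<mu>) - x / 2"
  proof (cases "\<sigma> \<le> 1 / 4")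
    case True
    then have "3 / 4 * (\<mu> * x\<^sup>2) \<le> (1 - \<sigma>) * (\<mu> * x\<^sup>2)" using \<mu> by (intro mult_right_mono) auto
    moreover have "0 \<le> sqrt \<sigma> * x" using \<sigma> assms by simp
    ultimately show ?thesis using lin by (simp add: algebra_simps)
  next
    case False
    then have "sqrt (1 / 4) \<le> sqrt \<sigma>" by (intro real_sqrt_le_mono) simp
    then have "1 / 2 * x \<le> sqrt \<sigma> * x" using assms by (intro mult_right_mono) (auto simp: real_sqrt_divide)
    moreover have "0 \<le> (1 - \<sigma>) * (\<mu> * x\<^sup>2)" "0 \<le> 1 / (12 * \<mu>)" using \<sigma> \<mu> by auto
    ultimately have "- ((1 - \<sigma>) * (\<mu> * x\<^sup>2)) - sqrt \<sigma> * x \<le> 1 / (12 * \<mu>) - x / 2" by linarith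
    then show ?thesis by (simp add: mult_ac)
  qed
  then have "exp (- \<mu> * (1 - \<sigma>) * x\<^sup>2 + - sqrt \<sigma> * x) \<le> exp (1 / (12 * \<mu>) + - x / 2)" by simp
  then show ?thesis unfolding exp_add \<sigma>_def .
qed

lemma gauss_le_exp: "exp (- \<mu> * x\<^sup>2) \<le> exp (1 / (12 * \<mu>)) * exp (- x / 2)"
proof -
  have "x / 2 \<le> 3 / 4 * (\<mu> * x\<^sup>2) + 1 / (12 * \<mu>)"
    using linear_le_quadratic[of "3 / 2 * \<mu>" x] \<mu> by simp
  moreover have "0 \<le> \<mu> * x\<^sup>2" using \<mu> by simp
  ultimately have "- \<mu> * x\<^sup>2 \<le> 1 / (12 * \<mu>) + - x / 2" by simp
  then show ?thesis unfolding exp_add[symmetric] by simp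
qed

definition defect_const :: real where
  "defect_const = 2 * moment_const * exp (1 / (12 * \<mu>)) * (LINT \<tau>|lborel. rmoment \<tau>)"

lemma defect_const_nonneg: "0 \<le> defect_const"
  unfolding defect_const_def using moment_const_nonneg by (intro mult_nonneg_nonneg integral_nonneg_AE) auto

text \<open>The bound does not depend on \<open>t\<close> and is integrable in \<open>\<tau>\<close>, as dominated convergence requires.\<close>

lemma integrand_bound:
  assumes g: "good \<tau>" and t: "t > 0"
  shows "norm (of_real (heat_factor \<mu> t \<tau> ((1 / sqrt t) *\<^sub>R \<eta>)) * prod_hat k l \<tau> ((1 / sqrt t) *\<^sub>R \<eta>) -
      of_real (exp (- \<mu> * (norm \<eta>)\<^sup>2)) * prod_hat k l \<tau> 0)
    \<le> 2 * moment_const * exp (1 / (12 * \<mu>)) * exp (- norm \<eta> / 2) * rmoment \<tau>"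
proof -
  let ?\<xi> = "(1 / sqrt t) *\<^sub>R \<eta>"
  let ?M = "moment_const * rmoment \<tau> * (exp (1 / (12 * \<mu>)) * exp (- norm \<eta> / 2))"
  have M: "0 \<le> moment_const * rmoment \<tau>" using moment_const_nonneg by simp
  have "norm (of_real (heat_factor \<mu> t \<tau> ?\<xi>) * prod_hat k l \<tau> ?\<xi>) \<le> ?M"
  proof (cases "0 < \<tau> \<and> \<tau> < t")
    case True
    have e: "heat_factor \<mu> t \<tau> ?\<xi> = exp (- \<mu> * (1 - \<tau> / t) * (norm \<eta>)\<^sup>2)"
      using True t by (simp add: heat_factor_def power_divide field_simps)
    have s: "sqrt \<tau> * norm ?\<xi> = sqrt (\<tau> / t) * norm \<eta>" using t by (simp add: real_sqrt_divide)
    have "norm (of_real (heat_factor \<mu> t \<tau> ?\<xi>) * prod_hat k l \<tau> ?\<xi>) = heat_factor \<mu> t \<tau> ?\<xi> * norm (prod_hat k l \<tau> ?\<xi>)"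
      by (simp only: norm_mult norm_heat_factor)
    also have "\<dots> \<le> exp (- \<mu> * (1 - \<tau> / t) * (norm \<eta>)\<^sup>2) * (moment_const * rmoment \<tau> * exp (- sqrt \<tau> * norm ?\<xi>))"
      unfolding e using True by (intro mult_left_mono prod_hat_bound[OF g]) auto
    also have "\<dots> = moment_const * rmoment \<tau> * (exp (- \<mu> * (1 - \<tau> / t) * (norm \<eta>)\<^sup>2) * exp (- sqrt (\<tau> / t) * norm \<eta>))"
      unfolding mult_minus_left s by (simp only: mult_ac)
    also have "\<dots> \<le> ?M" using True t by (intro mult_left_mono heat_weight_le M) auto
    finally show ?thesis .
  next
    case False
    then have "heat_factor \<mu> t \<tau> ?\<xi> = 0" by (auto simp: heat_factor_def)
    then show ?thesis using M by simp
  qed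
  moreover have "norm (of_real (exp (- \<mu> * (norm \<eta>)\<^sup>2)) * prod_hat k l \<tau> 0) \<le> ?M"
  proof -
    have "norm (of_real (exp (- \<mu> * (norm \<eta>)\<^sup>2)) * prod_hat k l \<tau> 0) = exp (- \<mu> * (norm \<eta>)\<^sup>2) * norm (prod_hat k l \<tau> 0)"
      by (simp add: norm_mult)
    also have "\<dots> \<le> (exp (1 / (12 * \<mu>)) * exp (- norm \<eta> / 2)) * (moment_const * rmoment \<tau>)"
      by (intro mult_mono gauss_le_exp prod_hat_bound'[OF g]) auto
    finally show ?thesis by (simp only: mult_ac)
  qed
  ultimately have "norm (of_real (heat_factor \<mu> t \<tau> ?\<xi>) * prod_hat k l \<tau> ?\<xi> - of_real (exp (- \<mu> * (norm \<eta>)\<^sup>2)) * prod_hat k l \<tau> 0) \<le> ?M + ?M"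
    by (intro order_trans[OF norm_triangle_ineq4] add_mono)
  also have "?M + ?M = 2 * moment_const * exp (1 / (12 * \<mu>)) * exp (- norm \<eta> / 2) * rmoment \<tau>"
    by simp
  finally show ?thesis .
qed

lemma defect_rescaled:
  assumes "t > 0"
  shows "defect k l t ((1 / sqrt t) *\<^sub>R \<eta>) = (LINT \<tau>|lborel. of_real (heat_factor \<mu> t \<tau> ((1 / sqrt t) *\<^sub>R \<eta>)) * prod_hat k l \<tau> ((1 / sqrt t) *\<^sub>R \<eta>) -
      of_real (exp (- \<mu> * (norm \<eta>)\<^sup>2)) * prod_hat k l \<tau> 0)"
proof -
  have "- \<mu> * t * (norm ((1 / sqrt t) *\<^sub>R \<eta>))\<^sup>2 = - \<mu> * (norm \<eta>)\<^sup>2"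
    using assms by (simp add: power_divide)
  then show ?thesis by (simp only: defect_def)
qed

lemma defect_bound:
  assumes t: "t > 0"
  shows "norm (defect k l t ((1 / sqrt t) *\<^sub>R \<eta>)) \<le> defect_const * exp (- norm \<eta> / 2)"
proof -
  have "norm (defect k l t ((1 / sqrt t) *\<^sub>R \<eta>)) \<le> (LINT \<tau>|lborel. 2 * moment_const * exp (1 / (12 * \<mu>)) * exp (- norm \<eta> / 2) * rmoment \<tau>)"
    unfolding defect_rescaled[OF t]
  proof (intro order_trans[OF integral_norm_bound] integral_mono_AE integrable_norm)
    show "integrable lborel (\<lambda>\<tau>. of_real (heat_factor \<mu> t \<tau> ((1 / sqrt t) *\<^sub>R \<eta>)) * prod_hat k l \<tau> ((1 / sqrt t) *\<^sub>R \<eta>) -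
        of_real (exp (- \<mu> * (norm \<eta>)\<^sup>2)) * prod_hat k l \<tau> 0)"
      by (intro Bochner_Integration.integrable_diff heat_factor_integrable prod_hat_zero_integrable)
    show "integrable lborel (\<lambda>\<tau>. 2 * moment_const * exp (1 / (12 * \<mu>)) * exp (- norm \<eta> / 2) * rmoment \<tau>)"
      by (intro integrable_mult_right rmoment_integrable)
    show "AE \<tau> in lborel. norm (of_real (heat_factor \<mu> t \<tau> ((1 / sqrt t) *\<^sub>R \<eta>)) * prod_hat k l \<tau> ((1 / sqrt t) *\<^sub>R \<eta>) -
        of_real (exp (- \<mu> * (norm \<eta>)\<^sup>2)) * prod_hat k l \<tau> 0) \<le> 2 * moment_const * exp (1 / (12 * \<mu>)) * exp (- norm \<eta> / 2) * rmoment \<tau>"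
      using AE_good by eventually_elim (rule integrand_bound[OF _ t])
  qed
  also have "\<dots> = defect_const * exp (- norm \<eta> / 2)" by (simp add: defect_const_def)
  finally show ?thesis .
qed

text \<open>For fixed \<open>\<tau>\<close> the rescaled frequency tends to zero and \<open>prod_hat k l \<tau>\<close> is continuous, so the integrand
  tends to zero.\<close>

lemma defect_tendsto_0: "((\<lambda>t. defect k l t ((1 / sqrt t) *\<^sub>R \<eta>)) \<longlongrightarrow> 0) at_top"
proof -
  let ?F = "\<lambda>t \<tau>. of_real (heat_factor \<mu> t \<tau> ((1 / sqrt t) *\<^sub>R \<eta>)) * prod_hat k l \<tau> ((1 / sqrt t) *\<^sub>R \<eta>) -
      of_real (exp (- \<mu> * (norm \<eta>)\<^sup>2)) * prod_hat k l \<tau> 0"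
  have "((\<lambda>t. LINT \<tau>|lborel. ?F t \<tau>) \<longlongrightarrow> (LINT (\<tau>::real)|lborel. (0::complex))) at_top"
  proof (rule integral_dominated_convergence_at_top[where w="\<lambda>\<tau>. 2 * moment_const * exp (1 / (12 * \<mu>)) * exp (- norm \<eta> / 2) * rmoment \<tau>"])
    show "(\<lambda>\<tau>. 0::complex) \<in> borel_measurable lborel" by simp
    show "?F t \<in> borel_measurable lborel" for t by measurable
    show "integrable lborel (\<lambda>\<tau>. 2 * moment_const * exp (1 / (12 * \<mu>)) * exp (- norm \<eta> / 2) * rmoment \<tau>)"
      by (intro integrable_mult_right rmoment_integrable)
    show "\<forall>\<^sub>F t in at_top. AE \<tau> in lborel. norm (?F t \<tau>) \<le> 2 * moment_const * exp (1 / (12 * \<mu>)) * exp (- norm \<eta> / 2) * rmoment \<tau>"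
      using eventually_gt_at_top[of "0::real"]
    proof eventually_elim
      case (elim t)
      show ?case using AE_good by eventually_elim (rule integrand_bound[OF _ elim])
    qed
    show "AE \<tau> in lborel. ((\<lambda>t. ?F t \<tau>) \<longlongrightarrow> 0) at_top"
      using AE_good
    proof eventually_elim
      case (elim \<tau>)
      show ?case
      proof (cases "\<tau> > 0")
        case True
        have z: "((\<lambda>t::real. (1 / sqrt t) *\<^sub>R \<eta>) \<longlongrightarrow> 0) at_top"
          by (rule tendsto_eq_rhs[OF tendsto_scaleR[OF _ tendsto_const]]) (real_asymp, simp)
        have "isCont (prod_hat k l \<tau>) 0"
          unfolding prod_hat_def using continuous_fourier[OF product_integrable[OF elim True]]
          by (simp add: continuous_on_eq_continuous_at)
        then have p: "((\<lambda>t. prod_hat k l \<tau> ((1 / sqrt t) *\<^sub>R \<eta>)) \<longlongrightarrow> prod_hat k l \<tau> 0) at_top"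
          by (rule isCont_tendsto_compose[OF _ z])
        have "((\<lambda>t. exp (- \<mu> * (1 - \<tau> / t) * (norm \<eta>)\<^sup>2)) \<longlongrightarrow> exp (- \<mu> * (1 - 0) * (norm \<eta>)\<^sup>2)) at_top"
          by (intro tendsto_intros tendsto_divide_0[OF tendsto_const] filterlim_at_top_imp_at_infinity filterlim_ident)
        moreover have "\<forall>\<^sub>F t in at_top. exp (- \<mu> * (1 - \<tau> / t) * (norm \<eta>)\<^sup>2) = heat_factor \<mu> t \<tau> ((1 / sqrt t) *\<^sub>R \<eta>)"
          using eventually_gt_at_top[of \<tau>]
          by eventually_elim (use True in \<open>simp add: heat_factor_def power_divide field_simps\<close>)
        ultimately have "((\<lambda>t. heat_factor \<mu> t \<tau> ((1 / sqrt t) *\<^sub>R \<eta>)) \<longlongrightarrow> exp (- \<mu> * (1 - 0) * (norm \<eta>)\<^sup>2)) at_top"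
          by (rule Lim_transform_eventually)
        from tendsto_diff[OF tendsto_mult[OF tendsto_of_real[OF this] p] tendsto_const]
        show ?thesis by (rule tendsto_eq_rhs) simp
      next
        case False
        then show ?thesis by (simp add: prod_hat_zero)
      qed
    qed
  qed
  then have "((\<lambda>t. LINT \<tau>|lborel. ?F t \<tau>) \<longlongrightarrow> 0) at_top" by simp
  moreover have "\<forall>\<^sub>F t in at_top. (LINT \<tau>|lborel. ?F t \<tau>) = defect k l t ((1 / sqrt t) *\<^sub>R \<eta>)"
    using eventually_gt_at_top[of "0::real"] by eventually_elim (rule defect_rescaled[symmetric])
  ultimately show ?thesis by (rule Lim_transform_eventually)
qed

lemma profile_tendsto_0:
  assumes "\<alpha> > 1"
  shows "((\<lambda>t. profile A \<alpha> t \<eta>) \<longlongrightarrow> 0) at_top"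
proof -
  have "((\<lambda>t::real. t powr ((1 - \<alpha>) / 2)) \<longlongrightarrow> 0) at_top"
    using assms by (intro tendsto_neg_powr filterlim_ident) simp
  then have "((\<lambda>t. profile A \<alpha> t \<eta>) \<longlongrightarrow> A * 0 * (norm \<eta> powr \<alpha> * exp (- \<mu> * (norm \<eta>)\<^sup>2)) +
      leray_bound TYPE('n) * (norm \<eta> * (\<Sum>l\<in>(UNIV::'n set). \<Sum>k\<in>(UNIV::'n set). norm (0::complex)))) at_top"
    unfolding profile_def by (intro tendsto_intros defect_tendsto_0)
  then show ?thesis by simp
qed

text \<open>The surplus power \<open>\<alpha> - 1\<close> is absorbed by a quarter of the exponential. A single factor \<open>norm \<eta>\<close> is kept,
  since it decides which \<open>s\<close> are possible.\<close>

lemma profile_bound: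
  assumes \<alpha>: "\<alpha> > 1" and A: "A \<ge> 0"
  obtains Q where "Q \<ge> 0" "\<And>t \<eta>. t \<ge> 1 \<Longrightarrow> profile A \<alpha> t \<eta> \<le> Q * (norm \<eta> * exp (- (1/4) * norm \<eta>))"
proof
  let ?q = "((\<alpha> - 1) / (1/4)) powr (\<alpha> - 1) * exp (1 / (12 * \<mu>))"
  let ?Q = "A * ?q + leray_bound TYPE('n) * (real CARD('n) * real CARD('n) * defect_const)"
  show "?Q \<ge> 0" using A defect_const_nonneg by (intro add_nonneg_nonneg mult_nonneg_nonneg) auto
  fix t :: real and \<eta> :: "real^'n" assume t: "t \<ge> 1"
  let ?x = "norm \<eta>"
  let ?r = "?x * exp (- (1/4) * ?x)"
  have ee: "exp (1/4 * ?x) * exp (- ?x / 2) = exp (- (1/4) * ?x)"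
    unfolding exp_add[symmetric] by simp
  have "A * t powr ((1 - \<alpha>) / 2) * (?x powr \<alpha> * exp (- \<mu> * ?x\<^sup>2)) \<le> A * 1 * (?q * ?r)"
  proof (rule mult_mono[OF mult_left_mono])
    show "t powr ((1 - \<alpha>) / 2) \<le> 1" using powr_mono[of "(1 - \<alpha>) / 2" 0 t] t \<alpha> by simp
    have "?x powr \<alpha> = ?x * ?x powr (\<alpha> - 1)"
      by (cases "?x = 0") (use \<alpha> in \<open>auto simp: powr_diff\<close>)
    then have "?x powr \<alpha> * exp (- \<mu> * ?x\<^sup>2) = ?x * (?x powr (\<alpha> - 1) * exp (- \<mu> * ?x\<^sup>2))" by (simp only: mult.assoc)
    also have "\<dots> \<le> ?x * ((((\<alpha> - 1) / (1/4)) powr (\<alpha> - 1) * exp (1/4 * ?x)) * (exp (1 / (12 * \<mu>)) * exp (- ?x / 2)))"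
      using \<alpha> by (intro mult_left_mono mult_mono powr_le_exp gauss_le_exp) auto
    also have "\<dots> = ?x * (?q * (exp (1/4 * ?x) * exp (- ?x / 2)))" by (simp only: mult_ac)
    also have "\<dots> = ?q * ?r" unfolding ee by (simp only: mult_ac)
    finally show "?x powr \<alpha> * exp (- \<mu> * ?x\<^sup>2) \<le> ?q * ?r" .
  qed (use A in auto)
  moreover have "leray_bound TYPE('n) * (?x * (\<Sum>l\<in>UNIV. \<Sum>k\<in>UNIV. norm (defect k l t ((1 / sqrt t) *\<^sub>R \<eta>)))) \<le>
      leray_bound TYPE('n) * (?x * (\<Sum>l\<in>(UNIV::'n set). \<Sum>k\<in>(UNIV::'n set). defect_const * exp (- (1/4) * ?x)))"
  proof (intro mult_left_mono sum_mono)
    fix l k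
    have "norm (defect k l t ((1 / sqrt t) *\<^sub>R \<eta>)) \<le> defect_const * exp (- ?x / 2)" using t by (intro defect_bound) simp
    also have "\<dots> \<le> defect_const * exp (- (1/4) * ?x)" using defect_const_nonneg by (intro mult_left_mono) auto
    finally show "norm (defect k l t ((1 / sqrt t) *\<^sub>R \<eta>)) \<le> defect_const * exp (- (1/4) * ?x)" .
  qed auto
  ultimately have "profile A \<alpha> t \<eta> \<le> A * 1 * (?q * ?r) + leray_bound TYPE('n) * (?x * (\<Sum>l\<in>(UNIV::'n set). \<Sum>k\<in>(UNIV::'n set). defect_const * exp (- (1/4) * ?x)))"
    unfolding profile_def by (rule add_mono)
  also have "\<dots> = ?Q * ?r" unfolding distrib_right by simp
  finally show "profile A \<alpha> t \<eta> \<le> ?Q * ?r" .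
qed

end

subsection \<open>Self-similar decay\<close>

text \<open>The substitution \<open>\<xi> = \<eta> / sqrt t\<close> cancels the power of \<open>t\<close> exactly and leaves the \<open>r\<close>-norm of
  \<open>norm \<eta> powr s * m t \<eta>\<close>, which tends to zero by dominated convergence.\<close>

lemma self_similar_decay:
  fixes m :: "real \<Rightarrow> 'a::euclidean_space \<Rightarrow> real" and r s c Q :: real
  assumes r: "r > 0" and c: "c > 0" and rs: "- real DIM('a) < r * (s + 1)" and Q: "Q \<ge> 0"
    and [measurable]: "\<And>t. m t \<in> borel_measurable borel"
    and m0: "\<And>t \<eta>. 0 \<le> m t \<eta>"
    and bound: "\<And>t \<eta>. t \<ge> 1 \<Longrightarrow> m t \<eta> \<le> Q * (norm \<eta> * exp (- c * norm \<eta>))"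
    and lim: "\<And>\<eta>. ((\<lambda>t. m t \<eta>) \<longlongrightarrow> 0) at_top"
  shows "((\<lambda>t. ennreal (t powr (real DIM('a) / (2 * r) + (s + 1) / 2)) *
      epowr (\<integral>\<^sup>+\<xi>. ennreal ((norm \<xi> powr s * (m t (sqrt t *\<^sub>R \<xi>) / sqrt t)) powr r) \<partial>lborel) (1 / r)) \<longlongrightarrow> 0) at_top"
proof -
  let ?d = "real DIM('a)"
  let ?f = "\<lambda>t \<eta>. (norm \<eta> powr s * m t \<eta>) powr r"
  let ?w = "\<lambda>\<eta>::'a. Q powr r * (norm \<eta> powr (r * (s + 1)) * exp (- (r * c) * norm \<eta>))"
  have w: "integrable lborel ?w"
    using r c rs by (intro integrable_mult_right integrable_powr_exp) auto
  have fw: "?f t \<eta> \<le> ?w \<eta>" if t: "t \<ge> 1" for t \<eta>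
  proof (cases "\<eta> = 0")
    case False
    then have n: "norm \<eta> > 0" by simp
    have "norm \<eta> powr s * m t \<eta> \<le> norm \<eta> powr s * (Q * (norm \<eta> * exp (- c * norm \<eta>)))"
      by (intro mult_left_mono bound t) auto
    also have "\<dots> = Q * (norm \<eta> powr (s + 1) * exp (- c * norm \<eta>))" using n by (simp add: powr_add)
    finally have "?f t \<eta> \<le> (Q * (norm \<eta> powr (s + 1) * exp (- c * norm \<eta>))) powr r"
      using r m0[of t \<eta>] by (intro powr_mono2) auto
    also have "\<dots> = Q powr r * ((norm \<eta> powr (s + 1)) powr r * exp (- c * norm \<eta>) powr r)" by (simp only: powr_mult)
    also have "\<dots> = ?w \<eta>" by (simp add: powr_powr powr_def[of "exp _"] mult_ac)
    finally show ?thesis .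
  qed (use r in auto)
  have fi: "integrable lborel (?f t)" if t: "t \<ge> 1" for t
  proof (rule Bochner_Integration.integrable_bound[OF w])
    show "?f t \<in> borel_measurable lborel" by measurable
    show "AE \<eta> in lborel. norm (?f t \<eta>) \<le> norm (?w \<eta>)"
    proof (rule AE_I2)
      fix \<eta> :: 'a
      show "norm (?f t \<eta>) \<le> norm (?w \<eta>)"
        unfolding real_norm_def using fw[OF t, of \<eta>] powr_ge_zero[of "norm \<eta> powr s * m t \<eta>" r] by linarith
    qed
  qed
  define I where "I t = (LINT \<eta>|lborel. ?f t \<eta>)" for t
  have "((\<lambda>t. I t) \<longlongrightarrow> (LINT (\<eta>::'a)|lborel. (0::real))) at_top"
    unfolding I_def
  proof (rule integral_dominated_convergence_at_top[where w="?w"])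
    show "?f t \<in> borel_measurable lborel" for t by measurable
    show "AE \<eta> in lborel. ((\<lambda>t. ?f t \<eta>) \<longlongrightarrow> 0) at_top"
    proof (rule AE_I2)
      fix \<eta> :: 'a
      have "((\<lambda>t. norm \<eta> powr s * m t \<eta>) \<longlongrightarrow> norm \<eta> powr s * 0) at_top" by (intro tendsto_intros lim)
      then have "((\<lambda>t. norm \<eta> powr s * m t \<eta>) \<longlongrightarrow> 0) at_top" by simp
      then show "((\<lambda>t. ?f t \<eta>) \<longlongrightarrow> 0) at_top"
        using r m0 by (intro tendsto_zero_powrI[where b=r] tendsto_const) auto
    qed
    show "\<forall>\<^sub>F t in at_top. AE \<eta> in lborel. norm (?f t \<eta>) \<le> ?w \<eta>"
      using eventually_ge_at_top[of 1] by eventually_elim (use fw in auto)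
  qed (use w in auto)
  then have I_lim: "(I \<longlongrightarrow> 0) at_top" by simp
  have I0: "0 \<le> I t" for t unfolding I_def by (rule integral_nonneg_AE) simp
  have "((\<lambda>t. ennreal (I t powr (1 / r))) \<longlongrightarrow> ennreal 0) at_top"
    using r I0 by (intro tendsto_ennrealI tendsto_zero_powrI[OF I_lim, where b="1 / r"] tendsto_const) auto
  moreover have "\<forall>\<^sub>F t in at_top. ennreal (I t powr (1 / r)) = ennreal (t powr (?d / (2 * r) + (s + 1) / 2)) *
      epowr (\<integral>\<^sup>+\<xi>. ennreal ((norm \<xi> powr s * (m t (sqrt t *\<^sub>R \<xi>) / sqrt t)) powr r) \<partial>lborel) (1 / r)"
    using eventually_ge_at_top[of "1::real"]
  proof eventually_elim
    case (elim t)
    then have t: "t > 0" by simp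
    let ?c = "1 / sqrt t"
    let ?a = "t powr (- (?d / 2) - r * (s + 1) / 2)"
    have "(\<integral>\<^sup>+\<xi>. ennreal ((norm (\<xi>::'a) powr s * (m t (sqrt t *\<^sub>R \<xi>) / sqrt t)) powr r) \<partial>lborel) =
        ennreal \<bar>?c\<bar> ^ DIM('a) * (\<integral>\<^sup>+\<eta>. ennreal ((norm (0 + ?c *\<^sub>R \<eta>::'a) powr s * (m t (sqrt t *\<^sub>R (0 + ?c *\<^sub>R \<eta>)) / sqrt t)) powr r) \<partial>lborel)"
      using t by (subst nn_integral_affine[where c="?c" and t=0]) (auto simp: ennreal_power)
    also have "(\<integral>\<^sup>+\<eta>. ennreal ((norm (0 + ?c *\<^sub>R \<eta>::'a) powr s * (m t (sqrt t *\<^sub>R (0 + ?c *\<^sub>R \<eta>)) / sqrt t)) powr r) \<partial>lborel) =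
        (\<integral>\<^sup>+\<eta>. ennreal (t powr (- (r * (s + 1) / 2))) * ennreal (?f t \<eta>) \<partial>lborel)"
    proof (intro nn_integral_cong)
      fix \<eta> :: 'a
      have h: "sqrt t *\<^sub>R (0 + ?c *\<^sub>R \<eta>) = \<eta>" using t by simp
      have c': "?c = t powr (- (1/2))" using t by (simp add: powr_minus_divide powr_half_sqrt)
      have n: "norm (0 + ?c *\<^sub>R \<eta>) = t powr (- (1/2)) * norm \<eta>" unfolding c'[symmetric] using t by simp
      have "norm (0 + ?c *\<^sub>R \<eta>) powr s * (m t \<eta> / sqrt t) = (t powr (- (1/2))) powr s * norm \<eta> powr s * (m t \<eta> * t powr (- (1/2)))"
        unfolding n powr_mult c'[symmetric] by simp
      also have "\<dots> = ((t powr (- (1/2))) powr s * t powr (- (1/2))) * (norm \<eta> powr s * m t \<eta>)" by (simp only: mult_ac)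
      also have "(t powr (- (1/2))) powr s * t powr (- (1/2)) = t powr (- ((s + 1) / 2))"
        unfolding powr_powr powr_add[symmetric] by (rule arg_cong[where f="(powr) t"]) (simp add: field_simps)
      finally have "(norm (0 + ?c *\<^sub>R \<eta>) powr s * (m t \<eta> / sqrt t)) powr r = t powr (- (r * (s + 1) / 2)) * ?f t \<eta>"
        by (simp only: powr_mult powr_powr) (simp add: mult.commute)
      then show "ennreal ((norm (0 + ?c *\<^sub>R \<eta>) powr s * (m t (sqrt t *\<^sub>R (0 + ?c *\<^sub>R \<eta>)) / sqrt t)) powr r) =
          ennreal (t powr (- (r * (s + 1) / 2))) * ennreal (?f t \<eta>)"
        unfolding h by (simp only: ennreal_mult[OF powr_ge_zero powr_ge_zero])
    qed
    also have "\<dots> = ennreal (t powr (- (r * (s + 1) / 2))) * (\<integral>\<^sup>+\<eta>. ennreal (?f t \<eta>) \<partial>lborel)"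
      by (rule nn_integral_cmult) measurable
    also have "(\<integral>\<^sup>+\<eta>. ennreal (?f t \<eta>) \<partial>lborel) = ennreal (I t)"
      unfolding I_def by (rule nn_integral_eq_integral[OF fi[OF elim]]) simp
    also have "ennreal \<bar>?c\<bar> ^ DIM('a) = ennreal (t powr (- (?d / 2)))"
    proof -
      have "\<bar>?c\<bar> = t powr (- (1/2))" using t by (simp add: powr_minus_divide powr_half_sqrt)
      then have "\<bar>?c\<bar> ^ DIM('a) = t powr (- (?d / 2))" using t by (simp add: powr_realpow[symmetric] powr_powr)
      then show ?thesis by (simp only: ennreal_power abs_ge_zero)
    qed
    also have "ennreal (t powr (- (?d / 2))) * (ennreal (t powr (- (r * (s + 1) / 2))) * ennreal (I t)) = ennreal (?a * I t)"
    proof -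
      have "?a = t powr (- (?d / 2)) * t powr (- (r * (s + 1) / 2))" unfolding powr_add[symmetric] by simp
      then show ?thesis using I0[of t] by (simp only: ennreal_mult[OF powr_ge_zero] ennreal_mult[OF powr_ge_zero powr_ge_zero] mult.assoc mult_nonneg_nonneg powr_ge_zero)
    qed
    finally have J: "(\<integral>\<^sup>+\<xi>. ennreal ((norm (\<xi>::'a) powr s * (m t (sqrt t *\<^sub>R \<xi>) / sqrt t)) powr r) \<partial>lborel) = ennreal (?a * I t)" .
    have "t powr (?d / (2 * r) + (s + 1) / 2) * (?a * I t) powr (1 / r) = I t powr (1 / r)"
    proof -
      have "(?a * I t) powr (1 / r) = t powr (- (?d / (2 * r) + (s + 1) / 2)) * I t powr (1 / r)"
      proof -
        have "(- (?d / 2) - r * (s + 1) / 2) * (1 / r) = - (?d / (2 * r) + (s + 1) / 2)" using r by (simp add: field_simps)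
        then show ?thesis by (simp only: powr_mult powr_powr)
      qed
      moreover have "t powr (?d / (2 * r) + (s + 1) / 2) * t powr (- (?d / (2 * r) + (s + 1) / 2)) = 1"
        using t unfolding powr_add[symmetric] by simp
      ultimately show ?thesis by (simp only: mult.assoc[symmetric] mult_1)
    qed
    then show ?case
      unfolding J epowr_def using I0[of t] by (simp add: ennreal_mult[symmetric])
  qed
  ultimately show ?thesis using Lim_transform_eventually by fastforce
qed

lemma epowr_mono: "x \<le> y \<Longrightarrow> r \<ge> 0 \<Longrightarrow> epowr x r \<le> epowr y r"
  unfolding epowr_def by (auto simp: top_unique less_top intro!: ennreal_leI powr_mono2 enn2real_mono)

lemma conj_exp_real:
  assumes p: "1 < p"
  shows "conj_exp p \<noteq> \<infinity>" "1 \<le> enn2real (conj_exp p)" "1 / enn2real (conj_exp p) = 1 - enn2real (1 / p)"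
proof -
  have "1 / p < 1"
  proof (cases p)
    case (real x)
    then have "x > 1" using p unfolding ennreal_1[symmetric] by (simp add: ennreal_less_iff del: ennreal_1)
    then show ?thesis using real unfolding ennreal_1[symmetric] by (simp add: divide_ennreal ennreal_less_iff del: ennreal_1)
  qed simp
  then obtain y where y: "1 / p = ennreal y" "0 \<le> y" "y < 1"
    by (cases "1 / p") (auto simp: ennreal_1[symmetric] ennreal_less_iff simp del: ennreal_1)
  then have c: "conj_exp p = ennreal (1 / (1 - y))"
    unfolding conj_exp_def by (simp add: ennreal_1[symmetric] ennreal_minus divide_ennreal del: ennreal_1)
  show "conj_exp p \<noteq> \<infinity>" unfolding c by simp
  show "1 \<le> enn2real (conj_exp p)" unfolding c using y by simp
  show "1 / enn2real (conj_exp p) = 1 - enn2real (1 / p)" unfolding c using y by simp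
qed

text \<open>The condition on \<open>s\<close> makes the power singularity of the profile at the origin \<open>r\<close>-integrable, where
  \<open>r\<close> is the conjugate exponent; it is then integrable as well.\<close>

lemma exponent_condition:
  fixes s d :: real and p :: ennreal
  assumes p: "1 < p" and d: "d > 0"
    and s: "p < \<infinity> \<longrightarrow> s > - min (d / enn2real (conj_exp p)) (1 + d / enn2real p)" "p = \<infinity> \<longrightarrow> s \<ge> -1"
  defines "r \<equiv> enn2real (conj_exp p)"
  shows "- d < r * (s + 1)" "- d < s + 1"
proof -
  have r: "1 \<le> r" "1 / r = 1 - enn2real (1 / p)" using conj_exp_real[OF p] by (auto simp: r_def)
  have "- d < r * (s + 1) \<and> - d < s + 1"
  proof (cases "p = \<infinity>")
    case True
    then have "s + 1 \<ge> 0" using s by simp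
    then have "0 \<le> r * (s + 1)" using r by simp
    then show ?thesis using d \<open>s + 1 \<ge> 0\<close> by linarith
  next
    case False
    then have "p < \<infinity>" by (simp add: less_top)
    then have "- (d / r) < s" using s by (auto simp: r_def)
    then have "- d < r * s" using r by (simp add: field_simps)
    moreover have "d / r \<le> d" using r d by (simp add: divide_le_eq)
    ultimately show ?thesis using r \<open>- (d / r) < s\<close> by (simp add: distrib_left)
  qed
  then show "- d < r * (s + 1)" "- d < s + 1" by auto
qed

context small_mild_solution
begin

text \<open>The bound by the profile makes the transform integrable, so that the remainder is a tempered distribution
  with a function as its transform and the \<open>hatL_norm\<close> is not infinite by default.\<close>

lemma riesz_remainder:
  assumes t: "t \<ge> 1" and \<alpha>: "\<alpha> > 1" and A0: "A \<ge> 0"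
    and A: "AE \<xi> in lborel. norm (g0 \<xi> - leray_symbol \<xi> *v cvec M0) \<le> A * norm \<xi> powr \<alpha>"
    and s: "- real CARD('n) < s + 1"
  shows "locint_hat (riesz s (asymptotic_remainder \<mu> M0 u t))"
    and "AE \<xi> in lborel. norm (fhat (riesz s (asymptotic_remainder \<mu> M0 u t)) \<xi>) \<le> norm \<xi> powr s * (profile A \<alpha> t (sqrt t *\<^sub>R \<xi>) / sqrt t)"
proof -
  let ?T = "asymptotic_remainder \<mu> M0 u t"
  let ?w = "\<lambda>\<xi>. mat (of_real (norm \<xi> powr s)) *v fhat ?T \<xi>"
  have t0: "t > 0" using t by simp
  note h = has_hat_remainder[OF t0, of M0]
  have "has_hat ?T (fhat ?T)" by (rule has_hat_fhat[OF h])
  then have [measurable]: "fhat ?T \<in> borel_measurable borel" by (intro locally_integrable_measurable) (simp add: has_hat_iff)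
  have wb: "AE \<xi> in lborel. norm (?w \<xi>) \<le> norm \<xi> powr s * (profile A \<alpha> t (sqrt t *\<^sub>R \<xi>) / sqrt t)"
    using fhat_AE[OF \<theta> h] remainder_hat_le_profile[OF t0 A]
  proof eventually_elim
    case (elim \<xi>)
    have "norm (fhat ?T \<xi>) \<le> profile A \<alpha> t (sqrt t *\<^sub>R \<xi>) / sqrt t" using elim by simp
    then have "norm \<xi> powr s * norm (fhat ?T \<xi>) \<le> norm \<xi> powr s * (profile A \<alpha> t (sqrt t *\<^sub>R \<xi>) / sqrt t)"
      by (intro mult_left_mono) auto
    then show ?case unfolding mat_mult_vec norm_vsmult norm_of_real by simp
  qed
  obtain Q where Q: "Q \<ge> 0" "\<And>t \<eta>. t \<ge> 1 \<Longrightarrow> profile A \<alpha> t \<eta> \<le> Q * (norm \<eta> * exp (- (1/4) * norm \<eta>))"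
    by (rule profile_bound[OF \<alpha> A0]) blast
  have w: "integrable lborel ?w"
  proof (rule Bochner_Integration.integrable_bound)
    show "integrable lborel (\<lambda>\<xi>::real^'n. Q * (norm \<xi> powr (s + 1) * exp (- (sqrt t / 4) * norm \<xi>)))"
      using s t by (intro integrable_mult_right integrable_powr_exp) auto
    show "?w \<in> borel_measurable lborel"
    proof (rule measurable_vec)
      show "(\<lambda>\<xi>. ?w \<xi> $ i) \<in> borel_measurable lborel" for i
        unfolding mat_mult_vec vector_smult_component by measurable
    qed
    show "AE \<xi> in lborel. norm (?w \<xi>) \<le> norm (Q * (norm \<xi> powr (s + 1) * exp (- (sqrt t / 4) * norm \<xi>)))"
      using wb
    proof eventually_elim
      case (elim \<xi>)
      have "profile A \<alpha> t (sqrt t *\<^sub>R \<xi>) / sqrt t \<le> Q * (norm (sqrt t *\<^sub>R \<xi>) * exp (- (1/4) * norm (sqrt t *\<^sub>R \<xi>))) / sqrt t"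
        using t by (intro divide_right_mono Q(2)) auto
      also have "\<dots> = Q * (norm \<xi> * exp (- (sqrt t / 4) * norm \<xi>))" using t by simp
      finally have "norm \<xi> powr s * (profile A \<alpha> t (sqrt t *\<^sub>R \<xi>) / sqrt t) \<le> norm \<xi> powr s * (Q * (norm \<xi> * exp (- (sqrt t / 4) * norm \<xi>)))"
        by (intro mult_left_mono) auto
      also have "\<dots> = Q * (norm \<xi> powr (s + 1) * exp (- (sqrt t / 4) * norm \<xi>))"
        by (cases "\<xi> = 0") (simp_all add: powr_add)
      finally show ?case using elim Q(1) by simp
    qed
  qed
  have hat: "has_hat (riesz s ?T) ?w"
    unfolding riesz_def scalar_mult_def fourier_mult_def by (intro has_hat_inv_fourier integrable_locally_integrable w)
  moreover have "tempered (riesz s ?T)"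
    unfolding riesz_def scalar_mult_def fourier_mult_def by (rule tempered_inv_fourier[OF w])
  ultimately show "locint_hat (riesz s ?T)" unfolding locint_hat_def by blast
  show "AE \<xi> in lborel. norm (fhat (riesz s ?T) \<xi>) \<le> norm \<xi> powr s * (profile A \<alpha> t (sqrt t *\<^sub>R \<xi>) / sqrt t)"
    using fhat_AE[OF \<theta> hat] wb by eventually_elim simp
qed

lemma remainder_tendsto_0:
  assumes p: "1 < p" and s: "p < \<infinity> \<longrightarrow> s > - min (real CARD('n) / enn2real (conj_exp p)) (1 + real CARD('n) / enn2real p)"
      "p = \<infinity> \<longrightarrow> s \<ge> -1"
    and \<alpha>: "\<alpha> > 1" and A0: "A \<ge> 0"
    and A: "AE \<xi> in lborel. norm (g0 \<xi> - leray_symbol \<xi> *v cvec M0) \<le> A * norm \<xi> powr \<alpha>"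
  shows "((\<lambda>t. ennreal (t powr (real CARD('n) / 2 * (1 - enn2real (1 / p)) + (s + 1) / 2)) *
          hatL_norm p (riesz s (asymptotic_remainder \<mu> M0 u t))) \<longlongrightarrow> 0) at_top"
proof -
  define r where "r = enn2real (conj_exp p)"
  have r: "conj_exp p \<noteq> \<infinity>" "1 \<le> r" "1 - enn2real (1 / p) = 1 / r" using conj_exp_real[OF p] by (auto simp: r_def)
  have e: "- real CARD('n) < r * (s + 1)" "- real CARD('n) < s + 1"
    using exponent_condition[OF p _ s] by (auto simp: r_def)
  obtain Q where Q: "Q \<ge> 0" "\<And>t \<eta>. t \<ge> 1 \<Longrightarrow> profile A \<alpha> t \<eta> \<le> Q * (norm \<eta> * exp (- (1/4) * norm \<eta>))"
    by (rule profile_bound[OF \<alpha> A0]) blast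
  let ?m = "profile A \<alpha>"
  let ?J = "\<lambda>t. \<integral>\<^sup>+\<xi>. ennreal ((norm \<xi> powr s * (?m t (sqrt t *\<^sub>R \<xi>) / sqrt t)) powr r) \<partial>lborel"
  have exponent: "real CARD('n) / 2 * (1 - enn2real (1 / p)) + (s + 1) / 2 = real DIM(real^'n) / (2 * r) + (s + 1) / 2"
    unfolding r(3) by simp
  have lim: "((\<lambda>t. ennreal (t powr (real DIM(real^'n) / (2 * r) + (s + 1) / 2)) * epowr (?J t) (1 / r)) \<longlongrightarrow> 0) at_top"
    using r e by (intro self_similar_decay[where c="1/4" and Q=Q] Q profile_tendsto_0[OF \<alpha>] profile_nonneg[OF A0] profile_measurable) auto
  show ?thesis
    unfolding exponent
  proof (rule tendsto_sandwich[OF _ _ tendsto_const lim])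
    show "\<forall>\<^sub>F t in at_top. ennreal (t powr (real DIM(real^'n) / (2 * r) + (s + 1) / 2)) * hatL_norm p (riesz s (asymptotic_remainder \<mu> M0 u t)) \<le>
        ennreal (t powr (real DIM(real^'n) / (2 * r) + (s + 1) / 2)) * epowr (?J t) (1 / r)"
      using eventually_ge_at_top[of 1]
    proof eventually_elim
      case (elim t)
      note R = riesz_remainder[OF elim \<alpha> A0 A e(2)]
      have "(\<integral>\<^sup>+\<xi>. epowr (ennreal (norm (fhat (riesz s (asymptotic_remainder \<mu> M0 u t)) \<xi>))) r \<partial>lborel) \<le> ?J t"
      proof (rule nn_integral_mono_AE)
        show "AE \<xi> in lborel. epowr (ennreal (norm (fhat (riesz s (asymptotic_remainder \<mu> M0 u t)) \<xi>))) r \<le>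
            ennreal ((norm \<xi> powr s * (?m t (sqrt t *\<^sub>R \<xi>) / sqrt t)) powr r)"
          using R(2) by eventually_elim (use r in \<open>auto simp: epowr_def intro!: ennreal_leI powr_mono2\<close>)
      qed
      then have "hatL_norm p (riesz s (asymptotic_remainder \<mu> M0 u t)) \<le> epowr (?J t) (1 / r)"
        using R(1) r by (simp add: hatL_norm_def Lq_norm_def r_def[symmetric] epowr_mono)
      then show ?case by (rule mult_left_mono) simp
    qed
  qed simp
qed

end

text \<open>Away from the origin the power is bounded below, so there the boundedness of the transform suffices.\<close>

lemma initial_remainder_bound:
  fixes g :: "real^'n::finite \<Rightarrow> complex^'n"
  assumes B: "AE \<xi> in lborel. norm (g \<xi>) \<le> B" and \<alpha>: "\<alpha> > 0" and r: "r > 0"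
    and O: "AE \<xi> in lborel. norm \<xi> < r \<longrightarrow> norm (g \<xi> - leray_symbol \<xi> *v c) \<le> C * norm \<xi> powr \<alpha>"
  obtains A where "A \<ge> 0" "AE \<xi> in lborel. norm (g \<xi> - leray_symbol \<xi> *v c) \<le> A * norm \<xi> powr \<alpha>"
proof
  let ?E = "\<bar>B\<bar> + leray_bound TYPE('n) * norm c"
  let ?A = "\<bar>C\<bar> + ?E / r powr \<alpha>"
  have E: "?E \<ge> 0" by simp
  then show "?A \<ge> 0" by (intro add_nonneg_nonneg divide_nonneg_nonneg) auto
  show "AE \<xi> in lborel. norm (g \<xi> - leray_symbol \<xi> *v c) \<le> ?A * norm \<xi> powr \<alpha>"
    using B O
  proof eventually_elim
    case (elim \<xi>)
    show ?case
    proof (cases "norm \<xi> < r")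
      case True
      then have "norm (g \<xi> - leray_symbol \<xi> *v c) \<le> C * norm \<xi> powr \<alpha>" using elim by simp
      also have "\<dots> \<le> ?A * norm \<xi> powr \<alpha>"
        by (rule mult_right_mono[OF _ powr_ge_zero])
          (use divide_nonneg_nonneg[OF E, of "r powr \<alpha>"] abs_ge_self[of C] powr_ge_zero[of r \<alpha>] in linarith)
      finally show ?thesis .
    next
      case False
      have "norm (g \<xi> - leray_symbol \<xi> *v c) \<le> norm (g \<xi>) + norm (leray_symbol \<xi> *v c)" by (rule norm_triangle_ineq4)
      also have "\<dots> \<le> ?E" using elim norm_leray_le[of \<xi> c] by (intro add_mono) auto
      also have "\<dots> = ?E / r powr \<alpha> * r powr \<alpha>" using r by simp
      also have "\<dots> \<le> ?A * norm \<xi> powr \<alpha>"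
        using False r \<alpha> E by (intro mult_mono powr_mono2) auto
      finally show ?thesis .
    qed
  qed
qed

theorem theorem2p4:
  fixes \<mu> :: real and \<theta> :: "real^'n::finite \<Rightarrow> real"
  assumes "CARD('n) \<ge> 3" and "\<mu> > 0" and "dyadic_cutoff \<theta>"
  shows "\<exists>\<epsilon>>0. \<forall>(p::ennreal) (s::real) (u0 :: 'n dist) (M0 :: real^'n) (\<alpha>::real)
      (u :: real \<Rightarrow> 'n dist).
    1 < p \<longrightarrow>
    (p < \<infinity> \<longrightarrow> s > - min (real CARD('n) / enn2real (conj_exp p))
                             (1 + real CARD('n) / enn2real p)) \<longrightarrow>
    (p = \<infinity> \<longrightarrow> s \<ge> -1) \<longrightarrow>
    u0 \<in> herz \<theta> (-1) \<infinity> 2 \<inter> herz \<theta> 0 1 \<infinity> \<longrightarrow>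
    real_dist u0 \<longrightarrow>
    div_free u0 \<longrightarrow>
    herz_norm \<theta> (-1) \<infinity> 2 u0 < ennreal \<epsilon> \<longrightarrow>
    M0 \<noteq> 0 \<longrightarrow>
    \<alpha> > 1 \<longrightarrow>
    (\<exists>C r. r > 0 \<and> (AE \<xi> in lborel. norm \<xi> < r \<longrightarrow>
       norm (fhat u0 \<xi> - leray_symbol \<xi> *v cvec M0) \<le> C * norm \<xi> powr \<alpha>)) \<longrightarrow>
    global_mild_solution \<mu> u0 u \<longrightarrow>
    ((\<lambda>t. ennreal (t powr (real CARD('n) / 2 * (1 - enn2real (1 / p)) + (s + 1) / 2)) *
          hatL_norm p (riesz s (asymptotic_remainder \<mu> M0 u t))) \<longlongrightarrow> 0) at_top"
proof -
  note \<mu> = assms(2) and \<theta> = assms(3)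
  define C where "C = duhamel_const TYPE('n)"
  define D where "D = exp (2 / \<mu>)"
  \<comment> \<open>The energy bound \<open>a\<close> has to satisfy \<open>32 (C D)\<^sup>2 a \<le> \<mu>\<close>; the summand 1 keeps the quotient defined for \<open>C = 0\<close>.\<close>
  define a where "a = \<mu> / (32 * (C * D)\<^sup>2 + 1)"
  have den: "32 * (C * D)\<^sup>2 + 1 > 0" by (rule add_nonneg_pos) auto
  have a: "a > 0" using \<mu> den by (simp add: a_def)
  have small: "32 * (C * D)\<^sup>2 * a \<le> \<mu>"
  proof -
    have "32 * (C * D)\<^sup>2 * a \<le> (32 * (C * D)\<^sup>2 + 1) * a" using a by (intro mult_right_mono) auto
    also have "\<dots> = \<mu>" using den by (simp add: a_def)
    finally show ?thesis .
  qed
  \<comment> \<open>Chosen so that \<open>herz_heat_bound\<close> with decay rate \<open>\<mu> / 2\<close> yields exactly the energy \<open>a\<close>.\<close>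
  define \<epsilon> where "\<epsilon> = sqrt (a * \<mu> / 128) / D"
  have D: "D > 0" by (simp add: D_def)
  have \<epsilon>: "\<epsilon> > 0" using a \<mu> D by (simp add: \<epsilon>_def)
  have \<epsilon>2: "4 * D\<^sup>2 * (16 / (\<mu> / 2) * \<epsilon>\<^sup>2) = a"
    using a \<mu> D by (simp add: \<epsilon>_def power_divide)
  show ?thesis
  proof (intro exI[of _ \<epsilon>] conjI allI impI)
    show "0 < \<epsilon>" by (rule \<epsilon>)
    fix p :: ennreal and s \<alpha> :: real and u0 :: "'n dist" and M0 :: "real^'n" and u :: "real \<Rightarrow> 'n dist"
    assume p: "1 < p" and s: "p < \<infinity> \<longrightarrow> s > - min (real CARD('n) / enn2real (conj_exp p)) (1 + real CARD('n) / enn2real p)"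
        "p = \<infinity> \<longrightarrow> s \<ge> -1"
      and u0: "u0 \<in> herz \<theta> (-1) \<infinity> 2 \<inter> herz \<theta> 0 1 \<infinity>" and norm_u0: "herz_norm \<theta> (-1) \<infinity> 2 u0 < ennreal \<epsilon>"
      and \<alpha>: "\<alpha> > 1" and O: "\<exists>C r. r > 0 \<and> (AE \<xi> in lborel. norm \<xi> < r \<longrightarrow>
         norm (fhat u0 \<xi> - leray_symbol \<xi> *v cvec M0) \<le> C * norm \<xi> powr \<alpha>)"
      and mild: "global_mild_solution \<mu> u0 u"
    define g0 where "g0 = fhat u0"
    have g0: "has_hat u0 g0"
      using u0 has_hat_fhat unfolding g0_def herz_def locint_hat_def by blast
    obtain B where B: "B \<ge> 0" "AE \<xi> in lborel. norm (g0 \<xi>) \<le> B"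
    proof (rule hat_bounded[OF \<theta> g0])
      show "herz_norm \<theta> 0 1 \<infinity> u0 < \<infinity>" using u0 unfolding herz_def by blast
    qed
    obtain A where A: "A \<ge> 0" "AE \<xi> in lborel. norm (g0 \<xi> - leray_symbol \<xi> *v cvec M0) \<le> A * norm \<xi> powr \<alpha>"
    proof -
      from O obtain C' r where "r > 0" "AE \<xi> in lborel. norm \<xi> < r \<longrightarrow> norm (g0 \<xi> - leray_symbol \<xi> *v cvec M0) \<le> C' * norm \<xi> powr \<alpha>"
        unfolding g0_def by blast
      from initial_remainder_bound[OF B(2) _ this] \<alpha> show ?thesis using that by auto
    qed
    have L2: "L2_hatLinf u" using mild by (simp add: global_mild_solution_def)
    obtain v where v: "v \<in> borel_measurable (borel \<Otimes>\<^sub>M borel)" "\<And>t. integrable lborel (\<lambda>\<xi>. v (t, \<xi>))"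
        "\<And>t \<xi>. t \<le> 0 \<Longrightarrow> v (t, \<xi>) = 0" "AE t in lborel. 0 < t \<longrightarrow> has_hat (u t) (\<lambda>\<xi>. v (t, \<xi>))"
        "(\<integral>\<^sup>+t. (mass (\<lambda>p. ennreal (norm (v p))) t)\<^sup>2 \<partial>lborel) < \<infinity>"
      by (rule mild_representative[OF L2]) (rule that)
    let ?N = "\<lambda>p. ennreal (norm (v p))"
    interpret Q: quadratic_inequality \<mu> C ?N "\<lambda>\<xi>. ennreal (norm (g0 \<xi>))"
      unfolding C_def by (rule mild_quadratic_inequality[OF \<theta> \<mu> mild g0 v])
    have QD: "Q.D = D" by (simp add: Q.D_def D_def)
    have H: "4 * (ennreal Q.D)\<^sup>2 * (\<integral>\<^sup>+t. (mass Q.h t)\<^sup>2 \<partial>lborel) \<le> ennreal a"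
    proof -
      have "(\<integral>\<^sup>+t. (mass Q.h t)\<^sup>2 \<partial>lborel) = (\<integral>\<^sup>+t. indicator {0<..} t * (\<integral>\<^sup>+\<xi>. ennreal (exp (- (\<mu> / 2) * t * (norm \<xi>)\<^sup>2)) * ennreal (norm (g0 \<xi>)) \<partial>lborel)\<^sup>2 \<partial>lborel)"
        by (intro nn_integral_cong) (auto simp: mass_def Q.h_def indicator_def)
      also have "\<dots> \<le> ennreal (16 / (\<mu> / 2) * \<epsilon>\<^sup>2)"
        using \<mu> norm_u0 \<epsilon> by (intro herz_heat_bound[OF \<theta> g0]) auto
      finally have "4 * (ennreal Q.D)\<^sup>2 * (\<integral>\<^sup>+t. (mass Q.h t)\<^sup>2 \<partial>lborel) \<le> 4 * (ennreal D)\<^sup>2 * ennreal (16 / (\<mu> / 2) * \<epsilon>\<^sup>2)"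
        unfolding QD by (intro mult_left_mono) auto
      also have "\<dots> = ennreal (4 * D\<^sup>2 * (16 / (\<mu> / 2) * \<epsilon>\<^sup>2))"
      proof -
        have "ennreal (4 * D\<^sup>2 * (16 / (\<mu> / 2) * \<epsilon>\<^sup>2)) = ennreal 4 * ennreal (D\<^sup>2) * ennreal (16 / (\<mu> / 2) * \<epsilon>\<^sup>2)"
          using D \<mu> by (subst ennreal_mult[symmetric] | simp)+
        then show ?thesis using D by (simp add: ennreal_power)
      qed
      finally show ?thesis unfolding \<epsilon>2 .
    qed
    have small': "32 * (C * Q.D)\<^sup>2 * a \<le> \<mu>" using small by (simp only: QD)
    have energy: "(\<integral>\<^sup>+t. (mass (weighted norm ?N) t)\<^sup>2 \<partial>lborel) < \<infinity>"
      by (rule le_less_trans[OF Q.weighted_energy_bound[OF a small' H]]) simp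
    define K where "K = 2 * D * B"
    have K: "K \<ge> 0" using B D by (simp add: K_def)
    have "AE t in lborel. AE \<xi> in lborel. weighted norm ?N (t, \<xi>) \<le> ennreal (2 * Q.D * B)"
      by (rule Q.weighted_pointwise_bound[OF a small' H B(1)]) (use B(2) in \<open>auto elim!: eventually_mono intro: ennreal_leI\<close>)
    then have "AE t in lborel. AE \<xi> in lborel. exp (2 * sqrt t * norm \<xi>) * norm (v (t, \<xi>)) \<le> K"
      using K by (auto elim!: eventually_mono simp: weighted_def QD K_def[symmetric] ennreal_mult[symmetric])
    then interpret small_mild_solution \<theta> \<mu> u0 u g0 v K
      using assms mild g0 v energy K by unfold_locales auto
    show "((\<lambda>t. ennreal (t powr (real CARD('n) / 2 * (1 - enn2real (1 / p)) + (s + 1) / 2)) *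
          hatL_norm p (riesz s (asymptotic_remainder \<mu> M0 u t))) \<longlongrightarrow> 0) at_top"
      by (rule remainder_tendsto_0[OF p s \<alpha> A])
  qed
qed

end
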